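(* Let $d$ be a fixed constant and $\textsf{minPts}\geq 1$ an integer. Given a set $\mathcal{P}$ of $n$ points in $\mathbb{R}^d$, a minimum spanning tree of the mutual reachability graph of $\mathcal{P}$ can be computed in $O(n^2)$ work, $O(\log^2 n)$ depth, and $O(n\cdot\textsf{minPts})$ space.
   Context: $d(p,q)$ is the Euclidean distance. The core distance $\textsf{cd}(p)$ of $p\in\mathcal{P}$ is the distance from $p$ to its $\textsf{minPts}$-nearest neighbor in $\mathcal{P}$ (counting $p$ itself). The mutual reachability distance is $d_m(p,q)=\max\{\textsf{cd}(p),\textsf{cd}(q),d(p,q)\}$, and the mutual reachability graph is the complete undirected graph on $\mathcal{P}$ with edge weights $d_m$. Costs are measured in the work-depth model for parallel shared-memory algorithms (work = total number of operations, depth = length of the longest chain of sequential dependencies), with priority concurrent writes taking $O(1)$ work and depth. *)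

theory Defs
  imports "HOL-Analysis.Analysis" "HOL-Library.Multiset"
begin

section \<open>Minimum spanning trees of finite simple graphs\<close>

text \<open>An undirected edge is a two-element set of vertices.\<close>

definition complete_edges :: "'a set \<Rightarrow> 'a set set" where
  "complete_edges V = {{p, q} | p q. p \<in> V \<and> q \<in> V \<and> p \<noteq> q}"

definition connects :: "'a set \<Rightarrow> 'a set set \<Rightarrow> bool" where
  "connects V T \<longleftrightarrow> (\<forall>p\<in>V. \<forall>q\<in>V. (p, q) \<in> {(x, y). {x, y} \<in> T}\<^sup>*)"

definition is_cycle :: "'a set set \<Rightarrow> 'a list \<Rightarrow> bool" where
  "is_cycle T vs \<longleftrightarrow> 3 \<le> length vs \<and> distinct vs \<and>
     (\<forall>i<length vs. {vs ! i, vs ! (Suc i mod length vs)} \<in> T)"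

definition spanning_tree :: "'a set \<Rightarrow> 'a set set \<Rightarrow> 'a set set \<Rightarrow> bool" where
  "spanning_tree V E T \<longleftrightarrow> T \<subseteq> E \<and> connects V T \<and> (\<nexists>vs. is_cycle T vs)"

definition minimum_spanning_tree ::
    "'a set \<Rightarrow> 'a set set \<Rightarrow> ('a set \<Rightarrow> real) \<Rightarrow> 'a set set \<Rightarrow> bool" where
  "minimum_spanning_tree V E w T \<longleftrightarrow> spanning_tree V E T \<and>
     (\<forall>T'. spanning_tree V E T' \<longrightarrow> sum w T \<le> sum w T')"


section \<open>The mutual reachability graph\<close>

text \<open>The distances from \<open>p\<close> to all points of \<open>P\<close> (\<open>p\<close> included) are sorted with
  multiplicity; list positions count from 0.\<close>

definition core_dist :: "'a::metric_space set \<Rightarrow> nat \<Rightarrow> 'a \<Rightarrow> real" where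
  "core_dist P minPts p =
     sorted_list_of_multiset (image_mset (dist p) (mset_set P)) ! (minPts - 1)"

definition mutual_reach_dist :: "'a::metric_space set \<Rightarrow> nat \<Rightarrow> 'a \<Rightarrow> 'a \<Rightarrow> real" where
  "mutual_reach_dist P minPts p q =
     Max {core_dist P minPts p, core_dist P minPts q, dist p q}"

definition mutual_reach_weight :: "'a::metric_space set \<Rightarrow> nat \<Rightarrow> 'a set \<Rightarrow> real" where
  "mutual_reach_weight P minPts e =
     (THE w. \<exists>p q. e = {p, q} \<and> w = mutual_reach_dist P minPts p q)"

lemma mutual_reach_dist_commute:
  "mutual_reach_dist P minPts p q = mutual_reach_dist P minPts q p"
  by (simp add: mutual_reach_dist_def dist_commute insert_commute)

lemma mutual_reach_weight_insert [simp]: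
  "mutual_reach_weight P minPts {p, q} = mutual_reach_dist P minPts p q"
  unfolding mutual_reach_weight_def
  by (rule the_equality) (auto simp: doubleton_eq_iff mutual_reach_dist_commute)

abbreviation mutual_reach_mst :: "'a::metric_space set \<Rightarrow> nat \<Rightarrow> 'a set set \<Rightarrow> bool" where
  "mutual_reach_mst P minPts \<equiv>
     minimum_spanning_tree P (complete_edges P) (mutual_reach_weight P minPts)"


section \<open>A work-depth model with priority concurrent writes\<close>

text \<open>
  A nested-parallel language over a shared-memory real RAM.  The shared memory consists of
  integer words and of real numbers.  Every thread has the registers named in the program text,
  hence a number of registers that is independent of the input.

  Two restrictions keep the unit-cost measure honest.  An integer result must be smaller than
  the word bound \<open>W\<close> (otherwise execution is stuck), and reals are accessible only through
  field operations, square roots and comparisons: there is no rounding and no conversion from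
  reals to integers, and constants are rational.
\<close>

type_synonym reg = nat

datatype loc = ICell nat | RCell nat

datatype iop = IAdd | ISub | IMul | IDiv | IMod

datatype rop = RAdd | RSub | RMul | RDiv

text \<open>The destination comes first, except that \<open>IStore a x\<close> and \<open>IWriteMin a x\<close> (and their
  real counterparts) write register \<open>x\<close> to the cell whose address is in the integer register
  \<open>a\<close>.  The destination of a comparison is an integer register.\<close>

datatype instr =
    IConst reg nat | IOp iop reg reg reg | ILe reg reg reg
  | ILoad reg reg | IStore reg reg | IWriteMin reg reg
  | RConst reg rat | ROp rop reg reg reg | RSqrt reg reg | RLe reg reg reg
  | RLoad reg reg | RStore reg reg | RWriteMin reg reg

text \<open>\<open>ParFor x y c\<close> runs one thread of \<open>c\<close> for every value of \<open>x\<close> below the content of \<open>y\<close>.\<close>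

datatype com =
    Do instr
  | Seq com com
  | Cond reg com com
  | While reg com
  | ParFor reg reg com

record state =
  ireg :: "reg \<Rightarrow> nat"
  rreg :: "reg \<Rightarrow> real"
  imem :: "nat \<Rightarrow> nat"
  rmem :: "nat \<Rightarrow> real"

fun iop_val :: "iop \<Rightarrow> nat \<Rightarrow> nat \<Rightarrow> nat" where
  "iop_val IAdd = (+)" | "iop_val ISub = (-)" | "iop_val IMul = (*)"
| "iop_val IDiv = (div)" | "iop_val IMod = (mod)"

fun rop_val :: "rop \<Rightarrow> real \<Rightarrow> real \<Rightarrow> real" where
  "rop_val RAdd = (+)" | "rop_val RSub = (-)" | "rop_val RMul = (*)" | "rop_val RDiv = (/)"

definition set_ireg :: "reg \<Rightarrow> nat \<Rightarrow> state \<Rightarrow> state" where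
  "set_ireg x v s = s\<lparr>ireg := (ireg s)(x := v)\<rparr>"

definition set_rreg :: "reg \<Rightarrow> real \<Rightarrow> state \<Rightarrow> state" where
  "set_rreg x v s = s\<lparr>rreg := (rreg s)(x := v)\<rparr>"

definition set_imem :: "nat \<Rightarrow> nat \<Rightarrow> state \<Rightarrow> state" where
  "set_imem a v s = s\<lparr>imem := (imem s)(a := v)\<rparr>"

definition set_rmem :: "nat \<Rightarrow> real \<Rightarrow> state \<Rightarrow> state" where
  "set_rmem a v s = s\<lparr>rmem := (rmem s)(a := v)\<rparr>"

fun instr_ok :: "nat \<Rightarrow> instr \<Rightarrow> state \<Rightarrow> bool" where
  "instr_ok W (IConst x k) s \<longleftrightarrow> k < W"
| "instr_ok W (IOp f x y z) s \<longleftrightarrow> iop_val f (ireg s y) (ireg s z) < W"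
| "instr_ok W _ s \<longleftrightarrow> True"

fun instr_next :: "instr \<Rightarrow> state \<Rightarrow> state" where
  "instr_next (IConst x k) s = set_ireg x k s"
| "instr_next (IOp f x y z) s = set_ireg x (iop_val f (ireg s y) (ireg s z)) s"
| "instr_next (ILe x y z) s = set_ireg x (of_bool (ireg s y \<le> ireg s z)) s"
| "instr_next (ILoad x a) s = set_ireg x (imem s (ireg s a)) s"
| "instr_next (IStore a x) s = set_imem (ireg s a) (ireg s x) s"
| "instr_next (IWriteMin a x) s =
     set_imem (ireg s a) (min (imem s (ireg s a)) (ireg s x)) s"
| "instr_next (RConst x k) s = set_rreg x (of_rat k) s"
| "instr_next (ROp f x y z) s = set_rreg x (rop_val f (rreg s y) (rreg s z)) s"
| "instr_next (RSqrt x y) s = set_rreg x (sqrt (rreg s y)) s"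
| "instr_next (RLe x y z) s = set_ireg x (of_bool (rreg s y \<le> rreg s z)) s"
| "instr_next (RLoad x a) s = set_rreg x (rmem s (ireg s a)) s"
| "instr_next (RStore a x) s = set_rmem (ireg s a) (rreg s x) s"
| "instr_next (RWriteMin a x) s =
     set_rmem (ireg s a) (min (rmem s (ireg s a)) (rreg s x)) s"

text \<open>Resource usage, together with the shared cells that are read, written by ordinary stores,
  and written by priority writes.\<close>

record usage =
  work :: nat
  depth :: nat
  reads :: "loc set"
  stores :: "loc set"
  pwrites :: "loc set"

definition tick :: usage where
  "tick = \<lparr>work = 1, depth = 1, reads = {}, stores = {}, pwrites = {}\<rparr>"

fun instr_usage :: "instr \<Rightarrow> state \<Rightarrow> usage" where
  "instr_usage (ILoad x a) s = tick\<lparr>reads := {ICell (ireg s a)}\<rparr>"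
| "instr_usage (IStore a x) s = tick\<lparr>stores := {ICell (ireg s a)}\<rparr>"
| "instr_usage (IWriteMin a x) s = tick\<lparr>pwrites := {ICell (ireg s a)}\<rparr>"
| "instr_usage (RLoad x a) s = tick\<lparr>reads := {RCell (ireg s a)}\<rparr>"
| "instr_usage (RStore a x) s = tick\<lparr>stores := {RCell (ireg s a)}\<rparr>"
| "instr_usage (RWriteMin a x) s = tick\<lparr>pwrites := {RCell (ireg s a)}\<rparr>"
| "instr_usage _ s = tick"

definition seq_usage :: "usage \<Rightarrow> usage \<Rightarrow> usage" where
  "seq_usage u v =
     \<lparr>work = work u + work v, depth = depth u + depth v, reads = reads u \<union> reads v,
      stores = stores u \<union> stores v, pwrites = pwrites u \<union> pwrites v\<rparr>"

text \<open>Spawning \<open>m\<close> threads costs \<open>m + 1\<close> work and unit depth.\<close>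

definition par_usage :: "nat \<Rightarrow> (nat \<Rightarrow> usage) \<Rightarrow> usage" where
  "par_usage m u =
     \<lparr>work = 1 + m + (\<Sum>i<m. work (u i)),
      depth = 1 + Max (insert 0 ((\<lambda>i. depth (u i)) ` {..<m})),
      reads = (\<Union>i<m. reads (u i)),
      stores = (\<Union>i<m. stores (u i)),
      pwrites = (\<Union>i<m. pwrites (u i))\<rparr>"

text \<open>Threads of one parallel loop may share a cell only if all of them read it or all of them
  priority-write it.  All other conflicting accesses make execution stuck, so the outcome does
  not depend on the scheduling.\<close>

definition race_free :: "nat \<Rightarrow> (nat \<Rightarrow> usage) \<Rightarrow> bool" where
  "race_free m u \<longleftrightarrow> (\<forall>i<m. \<forall>j<m. i \<noteq> j \<longrightarrow>
     stores (u i) \<inter> (reads (u j) \<union> stores (u j) \<union> pwrites (u j)) = {} \<and>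
     pwrites (u i) \<inter> reads (u j) = {})"

text \<open>The shared memory after a parallel loop started with content \<open>v\<close>, where thread \<open>i\<close> on its
  own ends with content \<open>f i\<close>.  A stored cell belongs to a single thread; on any other
  cell the smallest priority write wins.\<close>

definition merge_mem ::
    "(nat \<Rightarrow> loc) \<Rightarrow> nat \<Rightarrow> (nat \<Rightarrow> usage) \<Rightarrow> (nat \<Rightarrow> 'v::linorder) \<Rightarrow> (nat \<Rightarrow> nat \<Rightarrow> 'v) \<Rightarrow> nat \<Rightarrow> 'v"
where
  "merge_mem cell m u v f a =
     (if \<exists>i<m. cell a \<in> stores (u i)
      then f (THE i. i < m \<and> cell a \<in> stores (u i)) a
      else Min (insert (v a) ((\<lambda>i. f i a) ` {..<m})))"

definition join :: "nat \<Rightarrow> (nat \<Rightarrow> usage) \<Rightarrow> state \<Rightarrow> (nat \<Rightarrow> state) \<Rightarrow> state" where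
  "join m u s t =
     s\<lparr>imem := merge_mem ICell m u (imem s) (\<lambda>i. imem (t i)),
       rmem := merge_mem RCell m u (rmem s) (\<lambda>i. rmem (t i))\<rparr>"

inductive exec :: "nat \<Rightarrow> com \<Rightarrow> state \<Rightarrow> state \<Rightarrow> usage \<Rightarrow> bool" for W :: nat where
  Do: "instr_ok W ins s \<Longrightarrow> exec W (Do ins) s (instr_next ins s) (instr_usage ins s)"
| Seq: "exec W c\<^sub>1 s s' u \<Longrightarrow> exec W c\<^sub>2 s' s'' v \<Longrightarrow> exec W (Seq c\<^sub>1 c\<^sub>2) s s'' (seq_usage u v)"
| Cond: "exec W (if ireg s x \<noteq> 0 then c\<^sub>1 else c\<^sub>2) s s' u \<Longrightarrow>
    exec W (Cond x c\<^sub>1 c\<^sub>2) s s' (seq_usage tick u)"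
| While_done: "ireg s x = 0 \<Longrightarrow> exec W (While x c) s s tick"
| While_step: "ireg s x \<noteq> 0 \<Longrightarrow> exec W c s s' u \<Longrightarrow> exec W (While x c) s' s'' v \<Longrightarrow>
    exec W (While x c) s s'' (seq_usage tick (seq_usage u v))"
| ParFor: "m = ireg s y \<Longrightarrow> (\<And>i. i < m \<Longrightarrow> exec W c (set_ireg x i s) (t i) (u i)) \<Longrightarrow>
    race_free m u \<Longrightarrow> exec W (ParFor x y c) s (join m u s t) (par_usage m u)"

lemma merge_mem_cong:
  assumes rf: "race_free m u"
    and eq: "\<And>i. i < m \<Longrightarrow> u' i = u i" "\<And>i. i < m \<Longrightarrow> f' i = f i"
  shows "merge_mem cell m u' v f' = merge_mem cell m u v f"
proof
  fix a
  have st: "(\<exists>i<m. cell a \<in> stores (u' i)) = (\<exists>i<m. cell a \<in> stores (u i))"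
    "(THE i. i < m \<and> cell a \<in> stores (u' i)) = (THE i. i < m \<and> cell a \<in> stores (u i))"
    using eq by (auto intro!: arg_cong[where f = The] simp: fun_eq_iff)
  have img: "(\<lambda>i. f' i a) ` {..<m} = (\<lambda>i. f i a) ` {..<m}"
    using eq by (intro image_cong) auto
  have th: "f' (THE i. i < m \<and> cell a \<in> stores (u i)) a =
      f (THE i. i < m \<and> cell a \<in> stores (u i)) a"
    if ex: "\<exists>i<m. cell a \<in> stores (u i)"
  proof -
    from ex obtain i where i: "i < m" "cell a \<in> stores (u i)" by blast
    have "(THE i. i < m \<and> cell a \<in> stores (u i)) = i"
      using i rf unfolding race_free_def by (intro the_equality) blast+
    then show ?thesis using eq i by simp
  qed
  show "merge_mem cell m u' v f' a = merge_mem cell m u v f a"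
    unfolding merge_mem_def st img by (rule if_cong[OF refl th refl])
qed

lemma exec_deterministic:
  "exec W c s t u \<Longrightarrow> exec W c s t' u' \<Longrightarrow> t' = t \<and> u' = u"
proof (induction arbitrary: t' u' rule: exec.induct)
  case (Do ins s)
  from Do.prems show ?case by cases auto
next
  case (Seq c\<^sub>1 s s' u c\<^sub>2 s'' v)
  from Seq.prems show ?case by cases (use Seq.IH in blast)
next
  case (Cond s x c\<^sub>1 c\<^sub>2 s' u)
  from Cond.prems show ?case by cases (use Cond.IH in blast)
next
  case (While_done s x c)
  from While_done.prems show ?case by cases (use While_done in auto)
next
  case (While_step s x c s' u s'' v)
  from While_step.prems show ?case
    by cases (use While_step.hyps While_step.IH in blast)+
next
  case (ParFor m s y c x t u)
  from ParFor.prems show ?case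
  proof cases
    case (ParFor m2 t2 u2)
    then have eq: "t2 i = t i \<and> u2 i = u i" if "i < m" for i
      using ParFor.IH that \<open>m = ireg s y\<close> by blast
    have "par_usage m u2 = par_usage m u"
    proof -
      have "(\<lambda>i. f (u2 i)) ` {..<m} = (\<lambda>i. f (u i)) ` {..<m}" for f :: "usage \<Rightarrow> nat"
        using eq by (intro image_cong) auto
      moreover have "(\<lambda>i. f (u2 i)) ` {..<m} = (\<lambda>i. f (u i)) ` {..<m}" for f :: "usage \<Rightarrow> loc set"
        using eq by (intro image_cong) auto
      moreover have "(\<Sum>i<m. work (u2 i)) = (\<Sum>i<m. work (u i))"
        using eq by (intro sum.cong) auto
      ultimately show ?thesis
        unfolding par_usage_def by (simp only:)
    qed
    moreover have "join m u2 s t2 = join m u s t"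
      unfolding join_def 
      using merge_mem_cong[OF \<open>race_free m u\<close>, of u2 "\<lambda>i. imem (t2 i)" "\<lambda>i. imem (t i)" ICell]
        merge_mem_cong[OF \<open>race_free m u\<close>, of u2 "\<lambda>i. rmem (t2 i)" "\<lambda>i. rmem (t i)" RCell] eq
      by simp
    ultimately show ?thesis using ParFor \<open>m = ireg s y\<close> by simp
  qed
qed

text \<open>Space is the size of the initial segment of shared memory that contains all cells accessed,
  counted in both memories.  Input and output reside in shared memory, too.  Thread
  registers are not counted: they are private, vanish at the end of the thread, and, as loop nesting
  is bounded by the program text, a depth-first sequential schedule needs only a constant number
  of them at any time.\<close>

definition shared_space :: "usage \<Rightarrow> nat" where
  "shared_space u = (LEAST k. reads u \<union> stores u \<union> pwrites u \<subseteq> ICell ` {..<k} \<union> RCell ` {..<k})"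


section \<open>Input and output\<close>

text \<open>\<open>pt\<close> enumerates the \<open>n\<close> input points and \<open>coord\<close> enumerates the coordinate axes; the points
  are stored one after the other.  \<open>n\<close> and \<open>minPts\<close> are passed in integer registers 0 and 1.\<close>

definition init_state ::
    "(nat \<Rightarrow> 'd::finite) \<Rightarrow> (nat \<Rightarrow> real ^ 'd) \<Rightarrow> nat \<Rightarrow> nat \<Rightarrow> state" where
  "init_state coord pt n minPts =
     \<lparr>ireg = (\<lambda>_. 0)(0 := n, 1 := minPts),
      rreg = (\<lambda>_. 0),
      imem = (\<lambda>_. 0),
      rmem = (\<lambda>a. if a < n * CARD('d) then pt (a div CARD('d)) $ coord (a mod CARD('d)) else 0)\<rparr>"

text \<open>The output consists of \<open>n - 1\<close> pairs of point indices in the integer memory.\<close>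

definition output_edges :: "(nat \<Rightarrow> 'a) \<Rightarrow> nat \<Rightarrow> state \<Rightarrow> 'a set set" where
  "output_edges pt n s = (\<lambda>k. {pt (imem s (2 * k)), pt (imem s (2 * k + 1))}) ` {..<n - 1}"

definition valid_output :: "nat \<Rightarrow> state \<Rightarrow> bool" where
  "valid_output n s \<longleftrightarrow> (\<forall>k<2 * (n - 1). imem s k < n)"

end

theory Submission
  imports Defs
begin

text \<open>
  The core distance of each point is found by a deterministic selection.  The points are grouped into
  blocks of equal size; the minima of the blocks are sampled by repeatedly merging eight sorted buffers
  and keeping every fourth element, and the sample yields a pivot that discards a constant
  fraction of the blocks without losing the \<open>k\<close>-th smallest distance.  As soon as few blocks remain,
  their size is halved.  The work per point is a geometric series, the space is \<open>O(k)\<close> since at most \<open>64 k\<close>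
  blocks are alive at any time.

  For each point \<open>p\<close> and each of a constant number of cones with apex \<open>p\<close>, keep the edge to a
  nearest point in the cone whose core distance does not exceed that of \<open>p\<close>.  Two points of one cone are
  closer to each other than the farther one is to \<open>p\<close>; hence, for every threshold, these \<open>O(n)\<close> edges
  connect the same points as the complete mutual reachability graph.

  Boruvka's algorithm runs on the \<open>O(n)\<close> edges.  Each of the \<open>O(log n)\<close> phases hooks every component
  along its minimum edge, found by priority writes, and contracts by pointer jumping.  The resulting
  \<open>n - 1\<close> edges connect whatever the lighter edges of the complete graph connect, which
  characterises minimum spanning trees.
\<close>

section \<open>Expressions and their compilation\<close>

text \<open>Space shapes the selection: the distances of one point cannot all be stored, so every
  round recomputes them from the coordinates and keeps block minima only. A minimum bounds its block
  from below; hence blocks above a pivot may go at any block size, blocks below it only at size one.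
  Merging eight buffers and keeping every fourth element doubles the length of a buffer and divides
  their number by eight, so that even a merge by all comparisons within a group, which has constant
  depth, falls geometrically in cost. Ties are broken by index throughout: ranks of samples and
  choices of edges have to be unique. The machine cannot round reals, so a cone is found by
  comparing the coordinates of a unit vector with rational grid points; the grid is fine enough to
  keep angles in a cone below 60 degrees. Word size is treated once: stored integers stay below a
  polynomial \<beta>, intermediate values below a power of \<open>\<beta> + 2\<close> whose exponent
  is the size of the expression. The size of a program is also the constant factor in its work and
  depth.\<close>

datatype iexp = Num nat | Var nat | Bin iop iexp iexp | Leq iexp iexp | Ld iexp | RLeq rexp rexp
 and rexp = RNum rat | RVar nat | RBin rop rexp rexp | RSq rexp | RLd iexp

abbreviation setv :: "state => nat => nat => state" where
 "setv s x v \<equiv> s\<lparr>ireg := (ireg s)(x := v)\<rparr>"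

primrec ival :: "iexp => state => nat" and rval :: "rexp => state => real" where
 "ival (Num k) s = k"
| "ival (Var x) s = ireg s x"
| "ival (Bin f a b) s = iop_val f (ival a s) (ival b s)"
| "ival (Leq a b) s = of_bool (ival a s \<le> ival b s)"
| "ival (Ld a) s = imem s (ival a s)"
| "ival (RLeq a b) s = of_bool (rval a s \<le> rval b s)"
| "rval (RNum q) s = of_rat q"
| "rval (RVar x) s = rreg s x"
| "rval (RBin f a b) s = rop_val f (rval a s) (rval b s)"
| "rval (RSq a) s = sqrt (rval a s)"
| "rval (RLd a) s = rmem s (ival a s)"

primrec ird :: "iexp => state => loc set" and rrd :: "rexp => state => loc set" where
 "ird (Num k) s = {}"
| "ird (Var x) s = {}"
| "ird (Bin f a b) s = ird a s \<union> ird b s"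
| "ird (Leq a b) s = ird a s \<union> ird b s"
| "ird (Ld a) s = insert (ICell (ival a s)) (ird a s)"
| "ird (RLeq a b) s = rrd a s \<union> rrd b s"
| "rrd (RNum q) s = {}"
| "rrd (RVar x) s = {}"
| "rrd (RBin f a b) s = rrd a s \<union> rrd b s"
| "rrd (RSq a) s = rrd a s"
| "rrd (RLd a) s = insert (RCell (ival a s)) (ird a s)"

text \<open>The size bounds the running time of the compiled expression and is at the same time the
  exponent in the bound \<open>(\<beta> + 2) ^ isz a\<close> on its value. A literal
  \<open>k\<close> therefore counts \<open>k + 2\<close>, which suffices because
  \<open>k < 2 ^ k\<close>.\<close>

primrec isz :: "iexp => nat" and rsz :: "rexp => nat" where
 "isz (Num k) = k + 2"
| "isz (Var x) = 3"
| "isz (Bin f a b) = isz a + isz b + 1"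
| "isz (Leq a b) = isz a + isz b + 1"
| "isz (Ld a) = isz a + 1"
| "isz (RLeq a b) = rsz a + rsz b + 1"
| "rsz (RNum q) = 1"
| "rsz (RVar x) = 3"
| "rsz (RBin f a b) = rsz a + rsz b + 1"
| "rsz (RSq a) = rsz a + 1"
| "rsz (RLd a) = isz a + 1"

text \<open>Register layout of compiled code: program variable \<open>x\<close> lives in machine
  register \<open>2 * x\<close>, while the odd registers \<open>tp j\<close> form an evaluation
  stack. Scratch values thus never clash with variables.\<close>

definition tp :: "nat => reg" where "tp j = 2 * j + 1"

lemma tp_simps [simp]: "tp i = tp j \<longleftrightarrow> i = j" "tp i \<noteq> 2 * x" "2 * x \<noteq> tp i"
 unfolding tp_def by presburger+

primrec ci :: "iexp => nat => com" and cr :: "rexp => nat => com" where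
 "ci (Num k) j = Do (IConst (tp j) k)"
| "ci (Var x) j = Seq (Do (IConst (tp j) 0)) (Do (IOp IAdd (tp j) (tp j) (2 * x)))"
| "ci (Bin f a b) j = Seq (ci a j) (Seq (ci b (Suc j)) (Do (IOp f (tp j) (tp j) (tp (Suc j)))))"
| "ci (Leq a b) j = Seq (ci a j) (Seq (ci b (Suc j)) (Do (ILe (tp j) (tp j) (tp (Suc j)))))"
| "ci (Ld a) j = Seq (ci a j) (Do (ILoad (tp j) (tp j)))"
| "ci (RLeq a b) j = Seq (cr a j) (Seq (cr b (Suc j)) (Do (RLe (tp j) (tp j) (tp (Suc j)))))"
| "cr (RNum q) j = Do (RConst (tp j) q)"
| "cr (RVar x) j = Seq (Do (RConst (tp j) 0)) (Do (ROp RAdd (tp j) (tp j) (2 * x)))"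
| "cr (RBin f a b) j = Seq (cr a j) (Seq (cr b (Suc j)) (Do (ROp f (tp j) (tp j) (tp (Suc j)))))"
| "cr (RSq a) j = Seq (cr a j) (Do (RSqrt (tp j) (tp j)))"
| "cr (RLd a) j = Seq (ci a j) (Do (RLoad (tp j) (tp j)))"

definition rel :: "state => state => bool" where
 "rel s' s \<longleftrightarrow> (\<forall>x. ireg s' (2 * x) = ireg s x) & (\<forall>x. rreg s' (2 * x) = rreg s x) &
   imem s' = imem s & rmem s' = rmem s"

definition bnd :: "nat => state => bool" where
 "bnd \<beta> s \<longleftrightarrow> (\<forall>x. ireg s x \<le> \<beta>) & (\<forall>a. imem s a \<le> \<beta>)"

definition tkeep :: "nat => state => state => bool" where
 "tkeep j s t \<longleftrightarrow> (\<forall>i<j. ireg t (tp i) = ireg s (tp i) & rreg t (tp i) = rreg s (tp i))"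

definition cheap :: "nat => loc set => usage => bool" where
 "cheap k R u \<longleftrightarrow> work u \<le> k & depth u \<le> k & reads u = R & stores u = {} & pwrites u = {}"

lemma cheap_seq: "cheap k R u ==> cheap k' R' v ==> cheap (k + k') (R \<union> R') (seq_usage u v)"
 by (auto simp: cheap_def seq_usage_def)

lemma rel_set_ireg_tp [simp]: "rel (set_ireg (tp j) v s') s \<longleftrightarrow> rel s' s"
 by (auto simp: rel_def set_ireg_def)

lemma rel_set_rreg_tp [simp]: "rel (set_rreg (tp j) v s') s \<longleftrightarrow> rel s' s"
 by (auto simp: rel_def set_rreg_def)

lemma tkeep_refl [simp]: "tkeep j s s" by (simp add: tkeep_def)

lemma tkeep_trans: "tkeep j s t ==> tkeep j t r ==> tkeep j s r" by (simp add: tkeep_def)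

lemma tkeep_mono: "tkeep (Suc j) s t ==> tkeep j s t" by (simp add: tkeep_def)

lemma tkeep_set [simp]:
 "tkeep j s (set_ireg (tp j) v t) \<longleftrightarrow> tkeep j s t" "tkeep j s (set_rreg (tp j) r t) \<longleftrightarrow> tkeep j s t"
 by (auto simp: tkeep_def set_ireg_def set_rreg_def)

lemma seq_usage_sel [simp]:
 "work (seq_usage u v) = work u + work v" "depth (seq_usage u v) = depth u + depth v"
 "reads (seq_usage u v) = reads u \<union> reads v" "stores (seq_usage u v) = stores u \<union> stores v"
 "pwrites (seq_usage u v) = pwrites u \<union> pwrites v"
 by (simp_all add: seq_usage_def)

lemma tick_sel [simp]:
 "work tick = 1" "depth tick = 1" "reads tick = {}" "stores tick = {}" "pwrites tick = {}"
 by (simp_all add: tick_def)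

lemma set_reg_sel [simp]:
 "ireg (set_ireg x v s) = (ireg s)(x := v)" "rreg (set_ireg x v s) = rreg s"
 "imem (set_ireg x v s) = imem s" "rmem (set_ireg x v s) = rmem s"
 "ireg (set_rreg x r s) = ireg s" "rreg (set_rreg x r s) = (rreg s)(x := r)"
 "imem (set_rreg x r s) = imem s" "rmem (set_rreg x r s) = rmem s"
 by (simp_all add: set_ireg_def set_rreg_def)

text \<open>One product bounds all five operations: difference, quotient and remainder do not exceed
  \<open>x\<close>, and a sum is dominated because both factors are at least 2. Multiplying bounds
  is what lets sizes of subexpressions add up in the exponent.\<close>

lemma iop_val_less:
 assumes "x < A" "y < B" "2 \<le> A" "2 \<le> (B::nat)"
 shows "iop_val f x y < A * B"
proof -
 obtain a where a: "A = a + 2" using assms by (metis add.commute le_Suc_ex)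
 obtain b where b: "B = b + 2" using assms by (metis add.commute le_Suc_ex)
 have le: "x < A * B" using assms a b by (simp add: algebra_simps)
 have "x div y < A * B" using le by (rule order.strict_trans1[OF div_le_dividend])
 moreover have "x mod y \<le> x" "x - y \<le> x" by auto
 moreover have "x + y < A * B" using assms a b by (simp add: algebra_simps)
 moreover have "x * y < A * B" using assms by (intro mult_strict_mono) auto
 ultimately show ?thesis using le by (cases f) (auto simp del: mod_less_eq_dividend)
qed

lemma isz_ge: "2 \<le> isz a" "1 \<le> rsz b"
 by (induction a and b) auto

lemma pow_ge2: "1 \<le> k ==> 2 \<le> ((\<beta>::nat) + 2) ^ k"
 by (metis le_add2 order_trans power_increasing power_one_right one_le_numeral)

definition ires where
 "ires W \<beta> s a \<longleftrightarrow> (\<forall>j s'. rel s' s \<longrightarrow> bnd \<beta> s \<longrightarrow> (\<beta> + 2) ^ isz a \<le> W \<longrightarrow>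
   ival a s < (\<beta> + 2) ^ isz a &
   (\<exists>t u. exec W (ci a j) s' t u & rel t s & tkeep j s' t & ireg t (tp j) = ival a s &
    cheap (isz a) (ird a s) u))"

definition rres where
 "rres W \<beta> s b \<longleftrightarrow> (\<forall>j s'. rel s' s \<longrightarrow> bnd \<beta> s \<longrightarrow> (\<beta> + 2) ^ rsz b \<le> W \<longrightarrow>
   (\<exists>t u. exec W (cr b j) s' t u & rel t s & tkeep j s' t & rreg t (tp j) = rval b s &
    cheap (rsz b) (rrd b s) u))"

lemma pow_le_W:
 assumes "((\<beta>::nat) + 2) ^ k \<le> W" "i \<le> k"
 shows "(\<beta> + 2) ^ i \<le> W"
proof -
 have "(\<beta> + 2) ^ i \<le> (\<beta> + 2) ^ k" using assms(2) by (intro power_increasing) auto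
 with assms(1) show ?thesis by linarith
qed

lemma compile_exp: "ires W \<beta> s a" "rres W \<beta> s b"
proof (induction a and b)
 case (Num k)
 show ?case unfolding ires_def
 proof (intro allI impI)
  fix j s' assume H: "rel s' s" "bnd \<beta> s" "(\<beta> + 2) ^ isz (Num k) \<le> W"
  have "k < (\<beta> + 2) ^ isz (Num k)"
  proof -
   have "k < 2 ^ k" by simp
   also have "(2::nat) ^ k \<le> (\<beta> + 2) ^ k" by (intro power_mono) auto
   also have "\<dots> \<le> (\<beta> + 2) ^ (k + 2)" by (intro power_increasing) auto
   finally show ?thesis by simp
  qed
  with H show "ival (Num k) s < (\<beta> + 2) ^ isz (Num k) &
   (\<exists>t u. exec W (ci (Num k) j) s' t u & rel t s & tkeep j s' t & ireg t (tp j) = ival (Num k) s &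
    cheap (isz (Num k)) (ird (Num k) s) u)"
   by (auto intro!: exI exec.Do simp: cheap_def)
 qed
next
 case (Var x)
 show ?case unfolding ires_def
 proof (intro allI impI)
  fix j s' assume H: "rel s' s" "bnd \<beta> s" "(\<beta> + 2) ^ isz (Var x) \<le> W"
  have v: "ireg s x < (\<beta> + 2) ^ isz (Var x)"
  proof -
   have "ireg s x \<le> \<beta>" using H by (simp add: bnd_def)
   also have "\<beta> < (\<beta> + 2) ^ 1" by simp
   also have "\<dots> \<le> (\<beta> + 2) ^ isz (Var x)" by (intro power_increasing) auto
   finally show ?thesis .
  qed
  moreover have e: "ireg s' (2 * x) = ireg s x" using H by (simp add: rel_def)
  moreover have W: "0 < W" "ireg s x < W" using v H by auto
  have "exec W (ci (Var x) j) s'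
    (instr_next (IOp IAdd (tp j) (tp j) (2 * x)) (instr_next (IConst (tp j) 0) s'))
    (seq_usage tick tick)"
   unfolding ci.simps
   by (rule exec.Seq[OF exec.Do[where ins = "IConst (tp j) 0", simplified instr_usage.simps]
      exec.Do[where ins = "IOp IAdd (tp j) (tp j) (2 * x)", simplified instr_usage.simps]])
    (use W e in auto)
  ultimately show "ival (Var x) s < (\<beta> + 2) ^ isz (Var x) &
   (\<exists>t u. exec W (ci (Var x) j) s' t u & rel t s & tkeep j s' t & ireg t (tp j) = ival (Var x) s &
    cheap (isz (Var x)) (ird (Var x) s) u)"
   using H by (auto intro!: exI simp: cheap_def simp del: ci.simps)
 qed
next
 case (Bin f a b)
 show ?case unfolding ires_def
 proof (intro allI impI)
  fix j s' assume H: "rel s' s" "bnd \<beta> s" "(\<beta> + 2) ^ isz (Bin f a b) \<le> W"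
  have wa: "(\<beta> + 2) ^ isz a \<le> W" and wb: "(\<beta> + 2) ^ isz b \<le> W"
   by (rule pow_le_W[OF H(3)], simp)+
  from Bin.IH(1) H wa obtain t u where 1: "ival a s < (\<beta> + 2) ^ isz a"
   "exec W (ci a j) s' t u" "rel t s" "tkeep j s' t" "ireg t (tp j) = ival a s" "cheap (isz a) (ird a s) u"
   unfolding ires_def by blast
  from Bin.IH(2) 1(3) H wb obtain t2 v where 2: "ival b s < (\<beta> + 2) ^ isz b"
   "exec W (ci b (Suc j)) t t2 v" "rel t2 s" "tkeep (Suc j) t t2" "ireg t2 (tp (Suc j)) = ival b s"
   "cheap (isz b) (ird b s) v"
   unfolding ires_def by blast
  have e: "ireg t2 (tp j) = ival a s" using 1 2 by (simp add: tkeep_def)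
  have tk: "tkeep j s' t2" using 1 2 by (blast intro: tkeep_trans tkeep_mono)
  have "iop_val f (ival a s) (ival b s) < (\<beta> + 2) ^ isz a * (\<beta> + 2) ^ isz b"
   using 1 2 isz_ge(1)[of a] isz_ge(1)[of b] by (intro iop_val_less pow_ge2) simp_all
  also have "\<dots> \<le> (\<beta> + 2) ^ isz (Bin f a b)"
   by (simp flip: power_add)
  finally have v: "ival (Bin f a b) s < (\<beta> + 2) ^ isz (Bin f a b)" by simp
  then have "instr_ok W (IOp f (tp j) (tp j) (tp (Suc j))) t2" using H(3) e 2 by simp
  from exec.Seq[OF 1(2) exec.Seq[OF 2(2) exec.Do[OF this]]] v
  show "ival (Bin f a b) s < (\<beta> + 2) ^ isz (Bin f a b) &
   (\<exists>t u. exec W (ci (Bin f a b) j) s' t u & rel t s & tkeep j s' t & ireg t (tp j) = ival (Bin f a b) s &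
    cheap (isz (Bin f a b)) (ird (Bin f a b) s) u)"
   using 1 2 e tk by (auto intro!: exI simp: cheap_def)
 qed
next
 case (Leq a b)
 show ?case unfolding ires_def
 proof (intro allI impI)
  fix j s' assume H: "rel s' s" "bnd \<beta> s" "(\<beta> + 2) ^ isz (Leq a b) \<le> W"
  have wa: "(\<beta> + 2) ^ isz a \<le> W" and wb: "(\<beta> + 2) ^ isz b \<le> W"
   by (rule pow_le_W[OF H(3)], simp)+
  from Leq.IH(1) H wa obtain t u where 1: "ival a s < (\<beta> + 2) ^ isz a"
   "exec W (ci a j) s' t u" "rel t s" "tkeep j s' t" "ireg t (tp j) = ival a s" "cheap (isz a) (ird a s) u"
   unfolding ires_def by blast
  from Leq.IH(2) 1(3) H wb obtain t2 v where 2: "ival b s < (\<beta> + 2) ^ isz b"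
   "exec W (ci b (Suc j)) t t2 v" "rel t2 s" "tkeep (Suc j) t t2" "ireg t2 (tp (Suc j)) = ival b s"
   "cheap (isz b) (ird b s) v"
   unfolding ires_def by blast
  have e: "ireg t2 (tp j) = ival a s" using 1 2 by (simp add: tkeep_def)
  have tk: "tkeep j s' t2" using 1 2 by (blast intro: tkeep_trans tkeep_mono)
  have "2 \<le> (\<beta> + 2) ^ isz (Leq a b)" using isz_ge(1)[of "Leq a b"] by (intro pow_ge2) simp
  then have v: "ival (Leq a b) s < (\<beta> + 2) ^ isz (Leq a b)" by (simp del: isz.simps)
  have "instr_ok W (ILe (tp j) (tp j) (tp (Suc j))) t2" by simp
  from exec.Seq[OF 1(2) exec.Seq[OF 2(2) exec.Do[OF this]]] v
  show "ival (Leq a b) s < (\<beta> + 2) ^ isz (Leq a b) &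
   (\<exists>t u. exec W (ci (Leq a b) j) s' t u & rel t s & tkeep j s' t & ireg t (tp j) = ival (Leq a b) s &
    cheap (isz (Leq a b)) (ird (Leq a b) s) u)"
   using 1 2 e tk by (auto intro!: exI simp: cheap_def)
 qed
next
 case (Ld a)
 show ?case unfolding ires_def
 proof (intro allI impI)
  fix j s' assume H: "rel s' s" "bnd \<beta> s" "(\<beta> + 2) ^ isz (Ld a) \<le> W"
  have wa: "(\<beta> + 2) ^ isz a \<le> W" by (rule pow_le_W[OF H(3)], simp)+
  from Ld.IH H wa obtain t u where 1: "ival a s < (\<beta> + 2) ^ isz a"
   "exec W (ci a j) s' t u" "rel t s" "tkeep j s' t" "ireg t (tp j) = ival a s" "cheap (isz a) (ird a s) u"
   unfolding ires_def by blast
  have "imem s (ival a s) \<le> \<beta>" using H by (simp add: bnd_def)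
  also have "\<beta> < (\<beta> + 2) ^ 1" by simp
  also have "\<dots> \<le> (\<beta> + 2) ^ isz (Ld a)" by (intro power_increasing) auto
  finally have v: "ival (Ld a) s < (\<beta> + 2) ^ isz (Ld a)" by simp
  have m: "imem t = imem s" using 1 by (simp add: rel_def)
  have "instr_ok W (ILoad (tp j) (tp j)) t" by simp
  from exec.Seq[OF 1(2) exec.Do[OF this]] v
  show "ival (Ld a) s < (\<beta> + 2) ^ isz (Ld a) &
   (\<exists>t u. exec W (ci (Ld a) j) s' t u & rel t s & tkeep j s' t & ireg t (tp j) = ival (Ld a) s &
    cheap (isz (Ld a)) (ird (Ld a) s) u)"
   using 1 m by (auto intro!: exI simp: cheap_def)
 qed
next
 case (RLeq a b)
 show ?case unfolding ires_def
 proof (intro allI impI)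
  fix j s' assume H: "rel s' s" "bnd \<beta> s" "(\<beta> + 2) ^ isz (RLeq a b) \<le> W"
  have wa: "(\<beta> + 2) ^ rsz a \<le> W" and wb: "(\<beta> + 2) ^ rsz b \<le> W"
   by (rule pow_le_W[OF H(3)], simp)+
  from RLeq.IH(1) H wa obtain t u where 1:
   "exec W (cr a j) s' t u" "rel t s" "tkeep j s' t" "rreg t (tp j) = rval a s" "cheap (rsz a) (rrd a s) u"
   unfolding rres_def by blast
  from RLeq.IH(2) 1(2) H wb obtain t2 v where 2:
   "exec W (cr b (Suc j)) t t2 v" "rel t2 s" "tkeep (Suc j) t t2" "rreg t2 (tp (Suc j)) = rval b s"
   "cheap (rsz b) (rrd b s) v"
   unfolding rres_def by blast
  have e: "rreg t2 (tp j) = rval a s" using 1 2 by (simp add: tkeep_def)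
  have tk: "tkeep j s' t2" using 1 2 by (blast intro: tkeep_trans tkeep_mono)
  have "2 \<le> (\<beta> + 2) ^ isz (RLeq a b)" using isz_ge(1)[of "RLeq a b"] by (intro pow_ge2) simp
  then have v: "ival (RLeq a b) s < (\<beta> + 2) ^ isz (RLeq a b)" by (simp del: isz.simps)
  have "instr_ok W (RLe (tp j) (tp j) (tp (Suc j))) t2" by simp
  from exec.Seq[OF 1(1) exec.Seq[OF 2(1) exec.Do[OF this]]] v
  show "ival (RLeq a b) s < (\<beta> + 2) ^ isz (RLeq a b) &
   (\<exists>t u. exec W (ci (RLeq a b) j) s' t u & rel t s & tkeep j s' t & ireg t (tp j) = ival (RLeq a b) s &
    cheap (isz (RLeq a b)) (ird (RLeq a b) s) u)"
   using 1 2 e tk by (auto intro!: exI simp: cheap_def)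
 qed
next
 case (RNum q)
 show ?case unfolding rres_def by (auto intro!: exI exec.Do simp: cheap_def)
next
 case (RVar x)
 show ?case unfolding rres_def
 proof (intro allI impI)
  fix j s' assume H: "rel s' s" "bnd \<beta> s" "(\<beta> + 2) ^ rsz (RVar x) \<le> W"
  have "exec W (cr (RVar x) j) s'
    (instr_next (ROp RAdd (tp j) (tp j) (2 * x)) (instr_next (RConst (tp j) 0) s'))
    (seq_usage tick tick)"
   unfolding cr.simps
   by (rule exec.Seq[OF exec.Do[where ins = "RConst (tp j) 0", simplified instr_usage.simps]
      exec.Do[where ins = "ROp RAdd (tp j) (tp j) (2 * x)", simplified instr_usage.simps]])
    auto
  moreover have "rreg s' (2 * x) = rreg s x" using H by (simp add: rel_def)
  ultimately show "\<exists>t u. exec W (cr (RVar x) j) s' t u & rel t s & tkeep j s' t & rreg t (tp j) = rval (RVar x) s &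
    cheap (rsz (RVar x)) (rrd (RVar x) s) u"
   using H by (auto intro!: exI simp: cheap_def simp del: cr.simps)
 qed
next
 case (RBin f a b)
 show ?case unfolding rres_def
 proof (intro allI impI)
  fix j s' assume H: "rel s' s" "bnd \<beta> s" "(\<beta> + 2) ^ rsz (RBin f a b) \<le> W"
  have wa: "(\<beta> + 2) ^ rsz a \<le> W" and wb: "(\<beta> + 2) ^ rsz b \<le> W"
   by (rule pow_le_W[OF H(3)], simp)+
  from RBin.IH(1) H wa obtain t u where 1:
   "exec W (cr a j) s' t u" "rel t s" "tkeep j s' t" "rreg t (tp j) = rval a s" "cheap (rsz a) (rrd a s) u"
   unfolding rres_def by blast
  from RBin.IH(2) 1(2) H wb obtain t2 v where 2:
   "exec W (cr b (Suc j)) t t2 v" "rel t2 s" "tkeep (Suc j) t t2" "rreg t2 (tp (Suc j)) = rval b s"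
   "cheap (rsz b) (rrd b s) v"
   unfolding rres_def by blast
  have e: "rreg t2 (tp j) = rval a s" using 1 2 by (simp add: tkeep_def)
  have tk: "tkeep j s' t2" using 1 2 by (blast intro: tkeep_trans tkeep_mono)
  have "instr_ok W (ROp f (tp j) (tp j) (tp (Suc j))) t2" by simp
  from exec.Seq[OF 1(1) exec.Seq[OF 2(1) exec.Do[OF this]]]
  show "\<exists>t u. exec W (cr (RBin f a b) j) s' t u & rel t s & tkeep j s' t & rreg t (tp j) = rval (RBin f a b) s &
    cheap (rsz (RBin f a b)) (rrd (RBin f a b) s) u"
   using 1 2 e tk by (auto intro!: exI simp: cheap_def)
 qed
next
 case (RSq a)
 show ?case unfolding rres_def
 proof (intro allI impI)
  fix j s' assume H: "rel s' s" "bnd \<beta> s" "(\<beta> + 2) ^ rsz (RSq a) \<le> W"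
  have wa: "(\<beta> + 2) ^ rsz a \<le> W" by (rule pow_le_W[OF H(3)], simp)+
  from RSq.IH H wa obtain t u where 1:
   "exec W (cr a j) s' t u" "rel t s" "tkeep j s' t" "rreg t (tp j) = rval a s" "cheap (rsz a) (rrd a s) u"
   unfolding rres_def by blast
  have "instr_ok W (RSqrt (tp j) (tp j)) t" by simp
  from exec.Seq[OF 1(1) exec.Do[OF this]]
  show "\<exists>t u. exec W (cr (RSq a) j) s' t u & rel t s & tkeep j s' t & rreg t (tp j) = rval (RSq a) s &
    cheap (rsz (RSq a)) (rrd (RSq a) s) u"
   using 1 by (auto intro!: exI simp: cheap_def)
 qed
next
 case (RLd a)
 show ?case unfolding rres_def
 proof (intro allI impI)
  fix j s' assume H: "rel s' s" "bnd \<beta> s" "(\<beta> + 2) ^ rsz (RLd a) \<le> W"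
  have wa: "(\<beta> + 2) ^ isz a \<le> W" by (rule pow_le_W[OF H(3)], simp)+
  from RLd.IH H wa obtain t u where 1:
   "exec W (ci a j) s' t u" "rel t s" "tkeep j s' t" "ireg t (tp j) = ival a s" "cheap (isz a) (ird a s) u"
   unfolding ires_def by blast
  have m: "rmem t = rmem s" using 1 by (simp add: rel_def)
  have "instr_ok W (RLoad (tp j) (tp j)) t" by simp
  from exec.Seq[OF 1(1) exec.Do[OF this]]
  show "\<exists>t u. exec W (cr (RLd a) j) s' t u & rel t s & tkeep j s' t & rreg t (tp j) = rval (RLd a) s &
    cheap (rsz (RLd a)) (rrd (RLd a) s) u"
   using 1 m by (auto intro!: exI simp: cheap_def)
 qed
qed

lemma ci_exec:
 assumes "rel s' s" "bnd \<beta> s" "(\<beta> + 2) ^ isz a \<le> W"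
 obtains t u where "exec W (ci a j) s' t u" "rel t s" "tkeep j s' t" "ireg t (tp j) = ival a s"
  "cheap (isz a) (ird a s) u" "ival a s < W"
 using compile_exp(1)[of W \<beta> s a] assms unfolding ires_def by (meson order_less_le_trans)

lemma cr_exec:
 assumes "rel s' s" "bnd \<beta> s" "(\<beta> + 2) ^ rsz a \<le> W"
 obtains t u where "exec W (cr a j) s' t u" "rel t s" "tkeep j s' t" "rreg t (tp j) = rval a s"
  "cheap (rsz a) (rrd a s) u"
 using compile_exp(2)[of W \<beta> s a] assms unfolding rres_def by meson

text \<open>A priority write can only lower a cell, so a cell outside \<open>stores\<close> never
  grows. When thread memories are merged by taking minima, this makes the value of the single thread
  that touched a cell win over the initial content.\<close>

lemma exec_frame:
 assumes "exec W c s t u"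
 shows "(\<forall>a. ICell a \<notin> stores u \<longrightarrow> imem t a \<le> imem s a) &
  (\<forall>a. RCell a \<notin> stores u \<longrightarrow> rmem t a \<le> rmem s a) &
  (\<forall>a. ICell a \<notin> stores u \<union> pwrites u \<longrightarrow> imem t a = imem s a) &
  (\<forall>a. RCell a \<notin> stores u \<union> pwrites u \<longrightarrow> rmem t a = rmem s a)"
 using assms
proof induction
 case (Do ins s)
 then show ?case
  by (cases ins) (auto simp: set_imem_def set_rmem_def)
next
 case (Seq c1 s s' u c2 s'' v)
 then show ?case by (auto intro: order_trans)
next
 case (While_step s x c s' u s'' v)
 then show ?case by (auto intro: order_trans)
next
 case (ParFor m s y c x t u)
 have A: "merge_mem cell m u v f a \<le> v a"
  if "cell a \<notin> (\<Union>i<m. stores (u i))" for cell :: "nat => loc" and v :: "nat => 'v::linorder" and f a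
  using that by (auto simp: merge_mem_def intro!: Min_le)
 have B: "merge_mem cell m u v f a = v a"
  if "cell a \<notin> (\<Union>i<m. stores (u i))" "!!i. i < m ==> f i a = v a"
  for cell :: "nat => loc" and v :: "nat => 'v::linorder" and f a
 proof -
  have "insert (v a) ((\<lambda>i. f i a) ` {..<m}) = {v a}" using that by auto
  moreover have "\<not> (\<exists>i<m. cell a \<in> stores (u i))" using that by auto
  ultimately show ?thesis unfolding merge_mem_def by (simp only: if_False Min_singleton)
 qed
 show ?case
  using ParFor.IH by (auto simp: join_def par_usage_def intro!: A B)
qed auto

section \<open>Structured programs\<close>

datatype act = IS iexp iexp | IM iexp iexp | RS iexp rexp | RM iexp rexp

text \<open>\<open>Pf\<close> is a flat loop made of a list of guards and one memory action, so the
  cells touched by a thread are determined by the start state and freedom from races becomes a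
  statement about addresses. \<open>Par\<close> takes an arbitrary body and serves for threads with
  private workspaces.\<close>

datatype hc = Asg nat iexp | RAsg nat rexp | HSeq hc hc (infixr ";;" 60) | If iexp hc hc
 | Whl iexp hc | Par nat iexp hc | Pf nat iexp "iexp list" act

fun cact :: "act => com" where
 "cact (IS a v) = Seq (ci a 0) (Seq (ci v 1) (Do (IStore (tp 0) (tp 1))))"
| "cact (IM a v) = Seq (ci a 0) (Seq (ci v 1) (Do (IWriteMin (tp 0) (tp 1))))"
| "cact (RS a v) = Seq (ci a 0) (Seq (cr v 1) (Do (RStore (tp 0) (tp 1))))"
| "cact (RM a v) = Seq (ci a 0) (Seq (cr v 1) (Do (RWriteMin (tp 0) (tp 1))))"

fun asz :: "act => nat" where
 "asz (IS a v) = isz a + isz v + 1"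
| "asz (IM a v) = isz a + isz v + 1"
| "asz (RS a v) = isz a + rsz v + 1"
| "asz (RM a v) = isz a + rsz v + 1"

fun ard :: "act => state => loc set" where
 "ard (IS a v) s = ird a s \<union> ird v s"
| "ard (IM a v) s = ird a s \<union> ird v s"
| "ard (RS a v) s = ird a s \<union> rrd v s"
| "ard (RM a v) s = ird a s \<union> rrd v s"

fun aupd :: "act => state => state" where
 "aupd (IS a v) s = s\<lparr>imem := (imem s)(ival a s := ival v s)\<rparr>"
| "aupd (IM a v) s = s\<lparr>imem := (imem s)(ival a s := min (imem s (ival a s)) (ival v s))\<rparr>"
| "aupd (RS a v) s = s\<lparr>rmem := (rmem s)(ival a s := rval v s)\<rparr>"
| "aupd (RM a v) s = s\<lparr>rmem := (rmem s)(ival a s := min (rmem s (ival a s)) (rval v s))\<rparr>"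

fun ast :: "act => state => loc set" where
 "ast (IS a v) s = {ICell (ival a s)}"
| "ast (RS a v) s = {RCell (ival a s)}"
| "ast _ s = {}"

fun apw :: "act => state => loc set" where
 "apw (IM a v) s = {ICell (ival a s)}"
| "apw (RM a v) s = {RCell (ival a s)}"
| "apw _ s = {}"

text \<open>A failing guard ends the thread at once. Later guards and the action may therefore
  contain addresses that stay in the permitted area only when the earlier guards hold.\<close>

primrec cbody :: "iexp list => act => com" where
 "cbody [] ac = cact ac"
| "cbody (g # gs) ac = Seq (ci g 0) (Cond (tp 0) (cbody gs ac) (Do (IConst (tp 0) 0)))"

primrec bsz :: "iexp list => act => nat" where
 "bsz [] ac = asz ac"
| "bsz (g # gs) ac = isz g + 2 + bsz gs ac"

primrec gev :: "iexp list => state => bool" where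
 "gev [] s = True"
| "gev (g # gs) s = (ival g s \<noteq> 0 & gev gs s)"

primrec grd :: "iexp list => act => state => loc set" where
 "grd [] ac s = ard ac s"
| "grd (g # gs) ac s = ird g s \<union> (if ival g s \<noteq> 0 then grd gs ac s else {})"

primrec hcom :: "hc => com" where
 "hcom (Asg x e) = Seq (ci e 0) (Seq (Do (IConst (tp 1) 0)) (Do (IOp IAdd (2 * x) (tp 0) (tp 1))))"
| "hcom (RAsg x e) = Seq (cr e 0) (Seq (Do (RConst (tp 1) 0)) (Do (ROp RAdd (2 * x) (tp 0) (tp 1))))"
| "hcom (a ;; b) = Seq (hcom a) (hcom b)"
| "hcom (If e a b) = Seq (ci e 0) (Cond (tp 0) (hcom a) (hcom b))"
| "hcom (Whl e c) = Seq (ci e 0) (While (tp 0) (Seq (hcom c) (ci e 0)))"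
| "hcom (Par x e c) = Seq (ci e 0) (ParFor (2 * x) (tp 0) (hcom c))"
| "hcom (Pf x e gs ac) = Seq (ci e 0) (ParFor (2 * x) (tp 0) (cbody gs ac))"

primrec hsz :: "hc => nat" where
 "hsz (Asg x e) = isz e + 2"
| "hsz (RAsg x e) = rsz e + 2"
| "hsz (a ;; b) = hsz a + hsz b"
| "hsz (If e a b) = isz e + 1 + hsz a + hsz b"
| "hsz (Whl e c) = 2 * isz e + 2 + hsz c"
| "hsz (Par x e c) = isz e + 2 + hsz c"
| "hsz (Pf x e gs ac) = isz e + 2 + bsz gs ac"

text \<open>A total-correctness triple with costs. The budgets \<open>X\<close> and \<open>D\<close>
  are granted per unit of program text: the actual cost may be \<open>hsz c\<close> times as large.
  Since sizes add under \<open>;;\<close>, both parts of a sequence get the same budgets and no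
  constant factor has to be tracked. The size is also the exponent in the requirement on the word
  bound.\<close>

definition ok :: "nat => hc => state => nat => nat => loc set => loc set => (state => bool) => bool" where
 "ok \<beta> c s X D Rd Wr Q \<longleftrightarrow> (\<forall>W s'. (\<beta> + 2) ^ hsz c \<le> W \<longrightarrow> rel s' s \<longrightarrow> bnd \<beta> s \<longrightarrow>
   (\<exists>t' u t. exec W (hcom c) s' t' u & rel t' t & bnd \<beta> t &
    work u \<le> hsz c * X & depth u \<le> hsz c * D &
    reads u \<subseteq> Rd \<union> Wr & stores u \<union> pwrites u \<subseteq> Wr & Q t))"

lemma ok_mono:
 assumes "ok \<beta> c s X D Rd Wr Q" "X \<le> X'" "D \<le> D'" "Rd \<subseteq> Rd'" "Wr \<subseteq> Wr'"
  "!!t. bnd \<beta> t ==> Q t ==> Q' t"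
 shows "ok \<beta> c s X' D' Rd' Wr' Q'"
 unfolding ok_def
proof (intro allI impI)
 fix W s' assume "(\<beta> + 2) ^ hsz c \<le> W" "rel s' s" "bnd \<beta> s"
 with assms(1) obtain t' u t where *: "exec W (hcom c) s' t' u" "rel t' t" "bnd \<beta> t"
  "work u \<le> hsz c * X" "depth u \<le> hsz c * D" "reads u \<subseteq> Rd \<union> Wr" "stores u \<union> pwrites u \<subseteq> Wr" "Q t"
  unfolding ok_def by blast
 have "hsz c * X \<le> hsz c * X'" "hsz c * D \<le> hsz c * D'" using assms by auto
 with * assms show "\<exists>t' u t. exec W (hcom c) s' t' u & rel t' t & bnd \<beta> t &
    work u \<le> hsz c * X' & depth u \<le> hsz c * D' &
    reads u \<subseteq> Rd' \<union> Wr' & stores u \<union> pwrites u \<subseteq> Wr' & Q' t"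
  by (intro exI[of _ t'] exI[of _ u] exI[of _ t]) (auto intro: order_trans)
qed

lemma ok_seq:
 assumes "ok \<beta> c1 s X D Rd Wr (\<lambda>t. ok \<beta> c2 t X D Rd Wr Q)"
 shows "ok \<beta> (c1 ;; c2) s X D Rd Wr Q"
 unfolding ok_def
proof (intro allI impI)
 fix W s' assume s': "(\<beta> + 2) ^ hsz (c1 ;; c2) \<le> W" "rel s' s" "bnd \<beta> s"
 have W: "(\<beta> + 2) ^ hsz c1 \<le> W" "(\<beta> + 2) ^ hsz c2 \<le> W" by (rule pow_le_W[OF s'(1)], simp)+
 from assms W s' obtain t' u t where 1: "exec W (hcom c1) s' t' u" "rel t' t" "bnd \<beta> t"
  "work u \<le> hsz c1 * X" "depth u \<le> hsz c1 * D" "reads u \<subseteq> Rd \<union> Wr" "stores u \<union> pwrites u \<subseteq> Wr"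
  "ok \<beta> c2 t X D Rd Wr Q"
  unfolding ok_def[of _ c1] by blast
 from 1 W obtain t2' u2 t2 where 2: "exec W (hcom c2) t' t2' u2" "rel t2' t2" "bnd \<beta> t2"
  "work u2 \<le> hsz c2 * X" "depth u2 \<le> hsz c2 * D" "reads u2 \<subseteq> Rd \<union> Wr" "stores u2 \<union> pwrites u2 \<subseteq> Wr"
  "Q t2"
  unfolding ok_def[of _ c2] by blast
 show "\<exists>t' u t. exec W (hcom (c1 ;; c2)) s' t' u & rel t' t & bnd \<beta> t &
    work u \<le> hsz (c1 ;; c2) * X & depth u \<le> hsz (c1 ;; c2) * D &
    reads u \<subseteq> Rd \<union> Wr & stores u \<union> pwrites u \<subseteq> Wr & Q t"
  using exec.Seq[OF 1(1) 2(1)] 1 2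
  by (intro exI[of _ t2'] exI[of _ "seq_usage u u2"] exI[of _ t2]) (auto simp: algebra_simps)
qed

lemma le_mult1: "1 \<le> Y ==> k \<le> k * (Y::nat)"
 by (cases Y) auto

lemma ok_asg:
 assumes "1 \<le> X" "1 \<le> D" "bnd \<beta> s ==> ival e s \<le> \<beta>" "ird e s \<subseteq> Rd \<union> Wr"
  "Q (s\<lparr>ireg := (ireg s)(x := ival e s)\<rparr>)"
 shows "ok \<beta> (Asg x e) s X D Rd Wr Q"
 unfolding ok_def
proof (intro allI impI)
 fix W s' assume s': "(\<beta> + 2) ^ hsz (Asg x e) \<le> W" "rel s' s" "bnd \<beta> s"
 have "(\<beta> + 2) ^ isz e \<le> W" by (rule pow_le_W[OF s'(1)], simp)+
 from ci_exec[OF s'(2,3) this, of 0] obtain t u where 1: "exec W (ci e 0) s' t u" "rel t s"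
  "ireg t (tp 0) = ival e s" "cheap (isz e) (ird e s) u" "ival e s < W" by metis
 let ?t1 = "instr_next (IConst (tp 1) 0) t"
 let ?t2 = "instr_next (IOp IAdd (2 * x) (tp 0) (tp 1)) ?t1"
 have "exec W (hcom (Asg x e)) s' ?t2 (seq_usage u (seq_usage tick tick))"
  unfolding hcom.simps
  by (rule exec.Seq[OF 1(1) exec.Seq[OF
     exec.Do[where ins = "IConst (tp 1) 0", simplified instr_usage.simps]
     exec.Do[where ins = "IOp IAdd (2 * x) (tp 0) (tp 1)", simplified instr_usage.simps]]])
   (use 1 in auto)
 moreover have "rel ?t2 (s\<lparr>ireg := (ireg s)(x := ival e s)\<rparr>)"
  using 1 by (auto simp: rel_def)
 moreover have "bnd \<beta> (s\<lparr>ireg := (ireg s)(x := ival e s)\<rparr>)"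
  using s' assms by (auto simp: bnd_def)
 moreover have "isz e + 2 \<le> hsz (Asg x e) * X" "isz e + 2 \<le> hsz (Asg x e) * D"
  using le_mult1[OF assms(1), of "isz e + 2"] le_mult1[OF assms(2), of "isz e + 2"] by auto
 ultimately show "\<exists>t' u t. exec W (hcom (Asg x e)) s' t' u & rel t' t & bnd \<beta> t &
    work u \<le> hsz (Asg x e) * X & depth u \<le> hsz (Asg x e) * D &
    reads u \<subseteq> Rd \<union> Wr & stores u \<union> pwrites u \<subseteq> Wr & Q t"
  using 1(4) assms(4,5)
  by (intro exI[of _ ?t2] exI[of _ "seq_usage u (seq_usage tick tick)"] exI[of _ "s\<lparr>ireg := (ireg s)(x := ival e s)\<rparr>"])
   (auto simp: cheap_def simp del: instr_next.simps hcom.simps hsz.simps)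
qed

lemma ok_rasg:
 assumes "1 \<le> X" "1 \<le> D" "rrd e s \<subseteq> Rd \<union> Wr"
  "Q (s\<lparr>rreg := (rreg s)(x := rval e s)\<rparr>)"
 shows "ok \<beta> (RAsg x e) s X D Rd Wr Q"
 unfolding ok_def
proof (intro allI impI)
 fix W s' assume s': "(\<beta> + 2) ^ hsz (RAsg x e) \<le> W" "rel s' s" "bnd \<beta> s"
 have "(\<beta> + 2) ^ rsz e \<le> W" by (rule pow_le_W[OF s'(1)], simp)+
 from cr_exec[OF s'(2,3) this, of 0] obtain t u where 1: "exec W (cr e 0) s' t u" "rel t s"
  "rreg t (tp 0) = rval e s" "cheap (rsz e) (rrd e s) u" by metis
 let ?t1 = "instr_next (RConst (tp 1) 0) t"
 let ?t2 = "instr_next (ROp RAdd (2 * x) (tp 0) (tp 1)) ?t1"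
 have "exec W (hcom (RAsg x e)) s' ?t2 (seq_usage u (seq_usage tick tick))"
  unfolding hcom.simps
  by (rule exec.Seq[OF 1(1) exec.Seq[OF
     exec.Do[where ins = "RConst (tp 1) 0", simplified instr_usage.simps]
     exec.Do[where ins = "ROp RAdd (2 * x) (tp 0) (tp 1)", simplified instr_usage.simps]]])
   auto
 moreover have "rel ?t2 (s\<lparr>rreg := (rreg s)(x := rval e s)\<rparr>)"
  using 1 by (auto simp: rel_def)
 moreover have "bnd \<beta> (s\<lparr>rreg := (rreg s)(x := rval e s)\<rparr>)"
  using s' assms by (auto simp: bnd_def)
 moreover have "rsz e + 2 \<le> hsz (RAsg x e) * X" "rsz e + 2 \<le> hsz (RAsg x e) * D"
  using le_mult1[OF assms(1), of "rsz e + 2"] le_mult1[OF assms(2), of "rsz e + 2"] by auto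
 ultimately show "\<exists>t' u t. exec W (hcom (RAsg x e)) s' t' u & rel t' t & bnd \<beta> t &
    work u \<le> hsz (RAsg x e) * X & depth u \<le> hsz (RAsg x e) * D &
    reads u \<subseteq> Rd \<union> Wr & stores u \<union> pwrites u \<subseteq> Wr & Q t"
  using 1(4) assms(3,4)
  by (intro exI[of _ ?t2] exI[of _ "seq_usage u (seq_usage tick tick)"] exI[of _ "s\<lparr>rreg := (rreg s)(x := rval e s)\<rparr>"])
   (auto simp: cheap_def simp del: instr_next.simps hcom.simps hsz.simps)
qed

lemma ok_if:
 assumes "1 \<le> X" "1 \<le> D" "ird e s \<subseteq> Rd \<union> Wr"
  and "ival e s \<noteq> 0 ==> ok \<beta> a s X D Rd Wr Q"
  and "ival e s = 0 ==> ok \<beta> b s X D Rd Wr Q"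
 shows "ok \<beta> (If e a b) s X D Rd Wr Q"
 unfolding ok_def
proof (intro allI impI)
 fix W s' assume s': "(\<beta> + 2) ^ hsz (If e a b) \<le> W" "rel s' s" "bnd \<beta> s"
 have W: "(\<beta> + 2) ^ isz e \<le> W" "(\<beta> + 2) ^ hsz a \<le> W" "(\<beta> + 2) ^ hsz b \<le> W"
  by (rule pow_le_W[OF s'(1)], simp)+
 from ci_exec[OF s'(2,3) W(1), of 0] obtain t u where 1: "exec W (ci e 0) s' t u" "rel t s"
  "ireg t (tp 0) = ival e s" "cheap (isz e) (ird e s) u" by metis
 define c where "c = (if ival e s \<noteq> 0 then a else b)"
 have "ok \<beta> c s X D Rd Wr Q" "(\<beta> + 2) ^ hsz c \<le> W" using assms W by (auto simp: c_def)
 with 1 s' obtain t2' u2 t2 where 2: "exec W (hcom c) t t2' u2" "rel t2' t2" "bnd \<beta> t2"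
  "work u2 \<le> hsz c * X" "depth u2 \<le> hsz c * D" "reads u2 \<subseteq> Rd \<union> Wr" "stores u2 \<union> pwrites u2 \<subseteq> Wr"
  "Q t2"
  unfolding ok_def by blast
 have "exec W (if ireg t (tp 0) \<noteq> 0 then hcom a else hcom b) t t2' u2"
  using 2(1) 1(3) by (auto simp: c_def split: if_splits)
 from exec.Seq[OF 1(1) exec.Cond[OF this]]
 have ex: "exec W (hcom (If e a b)) s' t2' (seq_usage u (seq_usage tick u2))" by simp
 have k: "isz e + 1 + hsz c * Y \<le> hsz (If e a b) * Y" if "1 \<le> Y" for Y
 proof -
  have "isz e + 1 + hsz c * Y \<le> (isz e + 1) * Y + (hsz a + hsz b) * Y"
   using le_mult1[OF that, of "isz e + 1"] by (intro add_mono mult_le_mono) (auto simp: c_def)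
  then show ?thesis by (simp add: algebra_simps)
 qed
 show "\<exists>t' u t. exec W (hcom (If e a b)) s' t' u & rel t' t & bnd \<beta> t &
    work u \<le> hsz (If e a b) * X & depth u \<le> hsz (If e a b) * D &
    reads u \<subseteq> Rd \<union> Wr & stores u \<union> pwrites u \<subseteq> Wr & Q t"
  using ex 1(4) 2 k[OF assms(1)] k[OF assms(2)] assms(3)
  by (intro exI[of _ t2'] exI[of _ "seq_usage u (seq_usage tick u2)"] exI[of _ t2])
   (auto simp: cheap_def)
qed

text \<open>Amortised analysis: \<open>g\<close> is a ghost value, \<open>\<Phi>\<close> and
  \<open>\<Delta>\<close> are potentials paying for work and depth. Each round may choose budgets
  \<open>X1\<close> and \<open>D1\<close> of its own if the potentials fall by as much, so a loop
  with geometrically shrinking rounds costs no more than a constant times its first round.\<close>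

lemma ok_while:
 assumes step: "!!g s. I g s ==> bnd \<beta> s ==> ival e s \<noteq> 0 ==>
   \<exists>X1 D1. 1 \<le> X1 & 1 \<le> D1 &
    ok \<beta> c s X1 D1 Rd Wr (\<lambda>t. \<exists>g'. I g' t & \<Phi> g' + X1 \<le> \<Phi> g & \<Delta> g' + D1 \<le> (\<Delta> g :: nat))"
  and rd: "!!g s. I g s ==> ird e s \<subseteq> Rd \<union> Wr"
  and pos: "!!g s. I g s ==> 1 \<le> \<Phi> g & 1 \<le> \<Delta> g"
  and ex: "!!g s. I g s ==> bnd \<beta> s ==> ival e s = 0 ==> Q s"
  and init: "I g s" "\<Phi> g \<le> X" "\<Delta> g \<le> D"
 shows "ok \<beta> (Whl e c) s X D Rd Wr Q"
 unfolding ok_def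
proof (intro allI impI)
 fix W s' assume s': "(\<beta> + 2) ^ hsz (Whl e c) \<le> W" "rel s' s" "bnd \<beta> s"
 have W: "(\<beta> + 2) ^ isz e \<le> W" "(\<beta> + 2) ^ hsz c \<le> W"
  by (rule pow_le_W[OF s'(1)], simp)+
 let ?H = "hsz c + 1 + isz e"
 have loop: "\<exists>t' u t. exec W (While (tp 0) (Seq (hcom c) (ci e 0))) s' t' u & rel t' t & bnd \<beta> t &
   work u \<le> ?H * \<Phi> g & depth u \<le> ?H * \<Delta> g &
   reads u \<subseteq> Rd \<union> Wr & stores u \<union> pwrites u \<subseteq> Wr & Q t"
  if "I g s" "rel s' s" "bnd \<beta> s" "ireg s' (tp 0) = ival e s" for g s s'
  using that
 proof (induction "\<Delta> g" arbitrary: g s s' rule: less_induct)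
  case less
  note p = pos[OF less.prems(1)]
  show ?case
  proof (cases "ival e s = 0")
   case True
   have "1 \<le> ?H * \<Phi> g" "1 \<le> ?H * \<Delta> g" using p by auto
   then show ?thesis using exec.While_done[of s' "tp 0" W] less.prems ex[OF less.prems(1,3) True] True
    by (intro exI[of _ s'] exI[of _ tick] exI[of _ s]) auto
  next
   case False
   from step[OF less.prems(1,3) False] obtain X1 D1 where X1: "1 \<le> X1" "1 \<le> D1" and
    "ok \<beta> c s X1 D1 Rd Wr (\<lambda>t. \<exists>g'. I g' t & \<Phi> g' + X1 \<le> \<Phi> g & \<Delta> g' + D1 \<le> \<Delta> g)" by blast
   with W less.prems obtain t' u t g' where 1: "exec W (hcom c) s' t' u" "rel t' t" "bnd \<beta> t"
    "work u \<le> hsz c * X1" "depth u \<le> hsz c * D1" "reads u \<subseteq> Rd \<union> Wr" "stores u \<union> pwrites u \<subseteq> Wr"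
    "I g' t" "\<Phi> g' + X1 \<le> \<Phi> g" "\<Delta> g' + D1 \<le> \<Delta> g"
    unfolding ok_def by blast
   from ci_exec[OF 1(2,3) W(1), of 0] obtain t2 u2 where 2: "exec W (ci e 0) t' t2 u2" "rel t2 t"
    "ireg t2 (tp 0) = ival e t" "cheap (isz e) (ird e t) u2" by metis
   have "\<Delta> g' < \<Delta> g" using 1 X1 by linarith
   from less.hyps[OF this 1(8) 2(2) 1(3) 2(3)] obtain t3' u3 t3 where 3:
    "exec W (While (tp 0) (Seq (hcom c) (ci e 0))) t2 t3' u3" "rel t3' t3" "bnd \<beta> t3"
    "work u3 \<le> ?H * \<Phi> g'" "depth u3 \<le> ?H * \<Delta> g'"
    "reads u3 \<subseteq> Rd \<union> Wr" "stores u3 \<union> pwrites u3 \<subseteq> Wr" "Q t3" by blast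
   have "ireg s' (tp 0) \<noteq> 0" using False less.prems by simp
   note E = exec.While_step[OF this exec.Seq[OF 1(1) 2(1)] 3(1)]
   \<comment> \<open>The \<open>while\<close> tick and the test of the condition are charged to the
     budget \<open>Y\<close> of the body, which is at least 1; the rest telescopes.\<close>
   have k: "1 + (hsz c * Y + isz e) + ?H * Z' \<le> ?H * Z" if "1 \<le> Y" "Z' + Y \<le> Z" for Y Z Z'
   proof -
    have "1 + (hsz c * Y + isz e) \<le> Y + (hsz c * Y + isz e * Y)"
     using that(1) by (intro add_mono) auto
    also have "\<dots> = ?H * Y" by (simp add: algebra_simps)
    finally have "1 + (hsz c * Y + isz e) + ?H * Z' \<le> ?H * (Z' + Y)" by (simp add: algebra_simps)
    also have "\<dots> \<le> ?H * Z" using that(2) by (rule mult_le_mono2)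
    finally show ?thesis .
   qed
   show ?thesis
    using E 1 2(4) 3 k[OF X1(1) 1(9)] k[OF X1(2) 1(10)] rd[OF 1(8)]
    by (intro exI[of _ t3'] exI[of _ "seq_usage tick (seq_usage (seq_usage u u2) u3)"] exI[of _ t3])
     (auto simp: cheap_def)
  qed
 qed
 from ci_exec[OF s'(2,3) W(1), of 0] obtain t u where 1: "exec W (ci e 0) s' t u" "rel t s"
  "ireg t (tp 0) = ival e s" "cheap (isz e) (ird e s) u" by metis
 from loop[OF init(1) 1(2) s'(3) 1(3)] obtain t3' u3 t3 where 3:
    "exec W (While (tp 0) (Seq (hcom c) (ci e 0))) t t3' u3" "rel t3' t3" "bnd \<beta> t3"
    "work u3 \<le> ?H * \<Phi> g" "depth u3 \<le> ?H * \<Delta> g"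
    "reads u3 \<subseteq> Rd \<union> Wr" "stores u3 \<union> pwrites u3 \<subseteq> Wr" "Q t3" by blast
 have k: "isz e + ?H * Y \<le> hsz (Whl e c) * Z" if "1 \<le> Y" "Y \<le> Z" for Y Z
 proof -
  have "isz e + ?H * Y \<le> isz e * Y + ?H * Y" using that by auto
  also have "\<dots> \<le> hsz (Whl e c) * Y" by (simp add: algebra_simps)
  also have "\<dots> \<le> hsz (Whl e c) * Z" using that(2) by (rule mult_le_mono2)
  finally show ?thesis .
 qed
 show "\<exists>t' u t. exec W (hcom (Whl e c)) s' t' u & rel t' t & bnd \<beta> t &
    work u \<le> hsz (Whl e c) * X & depth u \<le> hsz (Whl e c) * D &
    reads u \<subseteq> Rd \<union> Wr & stores u \<union> pwrites u \<subseteq> Wr & Q t"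
  using exec.Seq[OF 1(1) 3(1)] 3 1(4) rd[OF init(1)] pos[OF init(1)]
   k[of "\<Phi> g" X, OF _ init(2)] k[of "\<Delta> g" D, OF _ init(3)]
  by (intro exI[of _ t3'] exI[of _ "seq_usage u u3"] exI[of _ t3]) (auto simp: cheap_def)
qed

lemma body_exec:
 assumes "rel s' s" "bnd \<beta> s" "(\<beta> + 2) ^ bsz gs ac \<le> W"
 shows "\<exists>t u. exec W (cbody gs ac) s' t u & rel t (if gev gs s then aupd ac s else s) &
  work u \<le> bsz gs ac & depth u \<le> bsz gs ac & reads u = grd gs ac s &
  stores u = (if gev gs s then ast ac s else {}) & pwrites u = (if gev gs s then apw ac s else {})"
 using assms
proof (induction gs arbitrary: s')
 case Nil
 note H = Nil
 have act: "\<exists>t u. exec W (cact ac) s' t u & rel t (aupd ac s) &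
  work u \<le> asz ac & depth u \<le> asz ac & reads u = ard ac s & stores u = ast ac s & pwrites u = apw ac s"
 proof -
  have I: "\<exists>t u. exec W (Seq (ci a 0) (Seq (ci v 1) (Do ins))) s' (instr_next ins t) (seq_usage u (instr_usage ins t)) &
    rel t s & ireg t (tp 0) = ival a s & ireg t (tp 1) = ival v s & cheap (isz a + isz v) (ird a s \<union> ird v s) u"
   if w: "(\<beta> + 2) ^ (isz a + isz v) \<le> W" and ins: "!!t. instr_ok W ins t" for a v ins
  proof -
   have wa: "(\<beta> + 2) ^ isz a \<le> W" "(\<beta> + 2) ^ isz v \<le> W" by (rule pow_le_W[OF w], simp)+
   from ci_exec[OF H(1,2) wa(1), of 0] obtain t u where 1: "exec W (ci a 0) s' t u" "rel t s"
    "ireg t (tp 0) = ival a s" "cheap (isz a) (ird a s) u" by metis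
   from ci_exec[OF 1(2) H(2) wa(2), of 1] obtain t2 u2 where 2: "exec W (ci v 1) t t2 u2" "rel t2 s"
    "tkeep 1 t t2" "ireg t2 (tp 1) = ival v s" "cheap (isz v) (ird v s) u2" by metis
   from exec.Seq[OF 1(1) exec.Seq[OF 2(1) exec.Do[OF ins]]]
   have "exec W (Seq (ci a 0) (Seq (ci v 1) (Do ins))) s' (instr_next ins t2)
     (seq_usage (seq_usage u u2) (instr_usage ins t2))"
    by (simp add: seq_usage_def add.assoc Un_assoc)
   then show ?thesis using 1 2 by (auto simp: tkeep_def dest: cheap_seq)
  qed
  have R: "\<exists>t u. exec W (Seq (ci a 0) (Seq (cr v 1) (Do ins))) s' (instr_next ins t) (seq_usage u (instr_usage ins t)) &
    rel t s & ireg t (tp 0) = ival a s & rreg t (tp 1) = rval v s & cheap (isz a + rsz v) (ird a s \<union> rrd v s) u"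
   if w: "(\<beta> + 2) ^ (isz a + rsz v) \<le> W" and ins: "!!t. instr_ok W ins t" for a v ins
  proof -
   have wa: "(\<beta> + 2) ^ isz a \<le> W" "(\<beta> + 2) ^ rsz v \<le> W" by (rule pow_le_W[OF w], simp)+
   from ci_exec[OF H(1,2) wa(1), of 0] obtain t u where 1: "exec W (ci a 0) s' t u" "rel t s"
    "ireg t (tp 0) = ival a s" "cheap (isz a) (ird a s) u" by metis
   from cr_exec[OF 1(2) H(2) wa(2), of 1] obtain t2 u2 where 2: "exec W (cr v 1) t t2 u2" "rel t2 s"
    "tkeep 1 t t2" "rreg t2 (tp 1) = rval v s" "cheap (rsz v) (rrd v s) u2" by metis
   from exec.Seq[OF 1(1) exec.Seq[OF 2(1) exec.Do[OF ins]]]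
   have "exec W (Seq (ci a 0) (Seq (cr v 1) (Do ins))) s' (instr_next ins t2)
     (seq_usage (seq_usage u u2) (instr_usage ins t2))"
    by (simp add: seq_usage_def add.assoc Un_assoc)
   then show ?thesis using 1 2 by (auto simp: tkeep_def dest: cheap_seq)
  qed
  have w: "!!k. k \<le> asz ac ==> (\<beta> + 2) ^ k \<le> W" by (rule pow_le_W[OF H(3)], simp)+
  show ?thesis
  proof (cases ac)
   case (IS a v)
   let ?ins = "IStore (tp 0) (tp 1)"
   from I[of a v ?ins] w[of "isz a + isz v"] IS obtain t u where
    "exec W (cact ac) s' (instr_next ?ins t) (seq_usage u (instr_usage ?ins t))"
    "rel t s" "ireg t (tp 0) = ival a s" "ireg t (tp 1) = ival v s"
    "cheap (isz a + isz v) (ird a s \<union> ird v s) u" by auto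
   then show ?thesis using IS
    by (intro exI[of _ "instr_next ?ins t"] exI[of _ "seq_usage u (instr_usage ?ins t)"])
     (auto simp: cheap_def rel_def set_imem_def simp del: cact.simps)
  next
   case (IM a v)
   let ?ins = "IWriteMin (tp 0) (tp 1)"
   from I[of a v ?ins] w[of "isz a + isz v"] IM obtain t u where
    "exec W (cact ac) s' (instr_next ?ins t) (seq_usage u (instr_usage ?ins t))"
    "rel t s" "ireg t (tp 0) = ival a s" "ireg t (tp 1) = ival v s"
    "cheap (isz a + isz v) (ird a s \<union> ird v s) u" by auto
   then show ?thesis using IM
    by (intro exI[of _ "instr_next ?ins t"] exI[of _ "seq_usage u (instr_usage ?ins t)"])
     (auto simp: cheap_def rel_def set_imem_def simp del: cact.simps)
  next
   case (RS a v)
   let ?ins = "RStore (tp 0) (tp 1)"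
   from R[of a v ?ins] w[of "isz a + rsz v"] RS obtain t u where
    "exec W (cact ac) s' (instr_next ?ins t) (seq_usage u (instr_usage ?ins t))"
    "rel t s" "ireg t (tp 0) = ival a s" "rreg t (tp 1) = rval v s"
    "cheap (isz a + rsz v) (ird a s \<union> rrd v s) u" by auto
   then show ?thesis using RS
    by (intro exI[of _ "instr_next ?ins t"] exI[of _ "seq_usage u (instr_usage ?ins t)"])
     (auto simp: cheap_def rel_def set_rmem_def simp del: cact.simps)
  next
   case (RM a v)
   let ?ins = "RWriteMin (tp 0) (tp 1)"
   from R[of a v ?ins] w[of "isz a + rsz v"] RM obtain t u where
    "exec W (cact ac) s' (instr_next ?ins t) (seq_usage u (instr_usage ?ins t))"
    "rel t s" "ireg t (tp 0) = ival a s" "rreg t (tp 1) = rval v s"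
    "cheap (isz a + rsz v) (ird a s \<union> rrd v s) u" by auto
   then show ?thesis using RM
    by (intro exI[of _ "instr_next ?ins t"] exI[of _ "seq_usage u (instr_usage ?ins t)"])
     (auto simp: cheap_def rel_def set_rmem_def simp del: cact.simps)
  qed
 qed
 then show ?case by simp
next
 case (Cons g gs)
 have W: "(\<beta> + 2) ^ isz g \<le> W" "(\<beta> + 2) ^ bsz gs ac \<le> W"
  by (rule pow_le_W[OF Cons.prems(3)], simp)+
 have "0 < W" using W(1) by (metis add_gr_0 gr_zeroI le_zero_eq not_gr_zero power_eq_0_iff zero_neq_numeral)
 from ci_exec[OF Cons.prems(1,2) W(1), of 0] obtain t u where 1: "exec W (ci g 0) s' t u" "rel t s"
  "ireg t (tp 0) = ival g s" "cheap (isz g) (ird g s) u" by metis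
 show ?case
 proof (cases "ival g s = 0")
  case True
  have "exec W (if ireg t (tp 0) \<noteq> 0 then cbody gs ac else Do (IConst (tp 0) 0)) t (set_ireg (tp 0) 0 t) tick"
   using True 1 exec.Do[of W "IConst (tp 0) 0" t] \<open>0 < W\<close> by simp
  from exec.Seq[OF 1(1) exec.Cond[OF this]] 1 True show ?thesis
   by (intro exI[of _ "set_ireg (tp 0) 0 t"] exI[of _ "seq_usage u (seq_usage tick tick)"])
    (auto simp: cheap_def)
 next
  case False
  from Cons.IH[OF 1(2) Cons.prems(2) W(2)] obtain t2 v where 2: "exec W (cbody gs ac) t t2 v"
   "rel t2 (if gev gs s then aupd ac s else s)" "work v \<le> bsz gs ac" "depth v \<le> bsz gs ac"
   "reads v = grd gs ac s" "stores v = (if gev gs s then ast ac s else {})"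
   "pwrites v = (if gev gs s then apw ac s else {})" by blast
  have "exec W (if ireg t (tp 0) \<noteq> 0 then cbody gs ac else Do (IConst (tp 0) 0)) t t2 v"
   using False 1 2 by simp
  from exec.Seq[OF 1(1) exec.Cond[OF this]] 1 2 False show ?thesis
   by (intro exI[of _ t2] exI[of _ "seq_usage u (seq_usage tick v)"])
    (auto simp: cheap_def)
 qed
qed

section \<open>Parallel loops\<close>

lemma merge_other:
 fixes v :: "nat => 'v::linorder"
 assumes "!!i. i < m ==> cell a \<notin> stores (u i)" "!!i. i < m ==> f i a = v a"
 shows "merge_mem cell m u v f a = v a"
proof -
 have "insert (v a) ((\<lambda>i. f i a) ` {..<m}) = {v a}" using assms by auto
 moreover have "\<not> (\<exists>i<m. cell a \<in> stores (u i))" using assms by auto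
 ultimately show ?thesis unfolding merge_mem_def by (simp only: if_False Min_singleton)
qed

text \<open>Covers a stored cell and a priority-written cell alike: with one writer, the minimum
  over all threads is the value of this writer, provided that it did not raise the cell.\<close>

lemma merge_own:
 fixes v :: "nat => 'v::linorder"
 assumes "i < m" "!!j. j < m ==> j \<noteq> i ==> cell a \<notin> stores (u j)"
  "!!j. j < m ==> j \<noteq> i ==> f j a = v a" "cell a \<notin> stores (u i) ==> f i a \<le> v a"
 shows "merge_mem cell m u v f a = f i a"
proof (cases "cell a \<in> stores (u i)")
 case True
 then have "(THE i. i < m & cell a \<in> stores (u i)) = i"
  using assms(1,2) by (intro the_equality) auto
 with True assms(1) show ?thesis unfolding merge_mem_def by auto
next
 case False
 then have no: "\<not> (\<exists>i<m. cell a \<in> stores (u i))" using assms by auto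
 have "Min (insert (v a) ((\<lambda>i. f i a) ` {..<m})) = f i a"
 proof (rule Min_eqI)
  fix y assume "y \<in> insert (v a) ((\<lambda>i. f i a) ` {..<m})"
  then show "f i a \<le> y" using assms(3,4) False by (metis imageE insertE lessThan_iff order_refl)
 qed (use assms(1) in auto)
 then show ?thesis unfolding merge_mem_def if_not_P[OF no] .
qed

lemma merge_min:
 fixes v :: "nat => 'v::linorder"
 assumes "!!i. i < m ==> cell a \<notin> stores (u i)"
  "!!i. i < m ==> f i a = (if G i & ad i = a then min (v a) (vl i) else v a)"
 shows "merge_mem cell m u v f a = Min (insert (v a) (vl ` {i. i < m & G i & ad i = a}))"
proof -
 have no: "\<not> (\<exists>i<m. cell a \<in> stores (u i))" using assms by auto
 have "Min (insert (v a) ((\<lambda>i. f i a) ` {..<m})) = Min (insert (v a) (vl ` {i. i < m & G i & ad i = a}))"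
  (is "Min ?A = Min ?B")
 proof (rule antisym)
  show "Min ?A \<le> Min ?B"
  proof (rule Min.boundedI)
   fix y assume "y \<in> ?B"
   then consider "y = v a" | i where "i < m" "G i" "ad i = a" "y = vl i" by auto
   then show "Min ?A \<le> y"
   proof cases
    case 2
    have "Min ?A \<le> f i a" using 2 by (intro Min_le) auto
    also have "\<dots> \<le> y" using 2 assms(2) by auto
    finally show ?thesis .
   qed auto
  qed auto
  show "Min ?B \<le> Min ?A"
  proof (rule Min.boundedI)
   fix y assume "y \<in> ?A"
   then consider "y = v a" | i where "i < m" "y = f i a" by auto
   then show "Min ?B \<le> y"
   proof cases
    case 2
    show ?thesis
    proof (cases "G i & ad i = a")
     case True
     then have "Min ?B \<le> vl i" "Min ?B \<le> v a" using 2 by (auto intro!: Min_le)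
     then show ?thesis using 2 True assms(2) by auto
    next
     case False
     then have "y = v a" using 2 assms(2) by metis
     then show ?thesis by (auto intro!: Min_le)
    qed
   qed auto
  qed auto
 qed
 then show ?thesis unfolding merge_mem_def if_not_P[OF no] .
qed

text \<open>\<open>post\<close> is stated for arbitrary usages and thread states, because they come
  out of \<open>exec\<close> existentially and only their effect on memory is known. Priority writes
  of different threads may hit the same cell, so disjointness of targets is required for
  \<open>ast\<close> alone.\<close>

lemma ok_pf:
 assumes m: "ival e s = m" "m \<le> \<beta>" "1 + m \<le> X" "1 \<le> D" "ird e s \<subseteq> Rd \<union> Wr"
  and S: "S = (\<lambda>i. (setv s x i))"
  and rd: "!!i. i < m ==> grd gs ac (S i) \<subseteq> Rd \<union> Wr"
  and wr: "!!i. i < m ==> gev gs (S i) ==> ast ac (S i) \<union> apw ac (S i) \<subseteq> Wr"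
  and race: "!!i j. i < m ==> j < m ==> i \<noteq> j ==> gev gs (S j) ==>
   grd gs ac (S i) \<inter> (ast ac (S j) \<union> apw ac (S j)) = {}"
  and race2: "!!i j. i < m ==> j < m ==> i \<noteq> j ==> gev gs (S i) ==> gev gs (S j) ==>
   ast ac (S i) \<inter> ast ac (S j) = {}"
  and post: "!!(u :: nat => usage) (tt :: nat => state). bnd \<beta> s ==>
   (!!i. i < m ==> stores (u i) = (if gev gs (S i) then ast ac (S i) else {})) ==>
   (!!i. i < m ==> imem (tt i) = imem (if gev gs (S i) then aupd ac (S i) else S i)) ==>
   (!!i. i < m ==> rmem (tt i) = rmem (if gev gs (S i) then aupd ac (S i) else S i)) ==>
   (let T = s\<lparr>imem := merge_mem ICell m u (imem s) (\<lambda>i. imem (tt i)),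
         rmem := merge_mem RCell m u (rmem s) (\<lambda>i. rmem (tt i))\<rparr>
    in bnd \<beta> T & Q T)"
 shows "ok \<beta> (Pf x e gs ac) s X D Rd Wr Q"
 unfolding ok_def
proof (intro allI impI)
 fix W s' assume s': "(\<beta> + 2) ^ hsz (Pf x e gs ac) \<le> W" "rel s' s" "bnd \<beta> s"
 have W: "(\<beta> + 2) ^ isz e \<le> W" "(\<beta> + 2) ^ bsz gs ac \<le> W"
  by (rule pow_le_W[OF s'(1)], simp)+
 from ci_exec[OF s'(2,3) W(1), of 0] obtain s1 u0 where 1: "exec W (ci e 0) s' s1 u0" "rel s1 s"
  "ireg s1 (tp 0) = ival e s" "cheap (isz e) (ird e s) u0" by metis
 have thr: "\<exists>t u. exec W (cbody gs ac) (set_ireg (2 * x) i s1) t u &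
   rel t (if gev gs (S i) then aupd ac (S i) else S i) &
   work u \<le> bsz gs ac & depth u \<le> bsz gs ac & reads u = grd gs ac (S i) &
   stores u = (if gev gs (S i) then ast ac (S i) else {}) &
   pwrites u = (if gev gs (S i) then apw ac (S i) else {})" if "i < m" for i
 proof (rule body_exec[OF _ _ W(2)])
  show "rel (set_ireg (2 * x) i s1) (S i)" using 1(2) by (auto simp: S rel_def)
  show "bnd \<beta> (S i)" using s'(3) that m(2) by (auto simp: S bnd_def)
 qed
 define PP where "PP = (\<lambda>i t u. exec W (cbody gs ac) (set_ireg (2 * x) i s1) t u &
   rel t (if gev gs (S i) then aupd ac (S i) else S i) &
   work u \<le> bsz gs ac & depth u \<le> bsz gs ac & reads u = grd gs ac (S i) &
   stores u = (if gev gs (S i) then ast ac (S i) else {}) &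
   pwrites u = (if gev gs (S i) then apw ac (S i) else {}))"
 from thr have "\<forall>i. \<exists>t u. i < m \<longrightarrow> PP i t u" unfolding PP_def by blast
 then obtain tt uu where "\<forall>i. i < m \<longrightarrow> PP i (tt i) (uu i)" by metis
 then have th: "!!i. i < m ==> exec W (cbody gs ac) (set_ireg (2 * x) i s1) (tt i) (uu i)"
  "!!i. i < m ==> rel (tt i) (if gev gs (S i) then aupd ac (S i) else S i)"
  "!!i. i < m ==> work (uu i) \<le> bsz gs ac" "!!i. i < m ==> depth (uu i) \<le> bsz gs ac"
  "!!i. i < m ==> reads (uu i) = grd gs ac (S i)"
  "!!i. i < m ==> stores (uu i) = (if gev gs (S i) then ast ac (S i) else {})"
  "!!i. i < m ==> pwrites (uu i) = (if gev gs (S i) then apw ac (S i) else {})"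
  unfolding PP_def by blast+
 have rf: "race_free m uu"
  unfolding race_free_def
 proof (intro allI impI)
  fix i j assume ij: "i < m" "j < m" "i \<noteq> j"
  \<comment> \<open>All threads execute the same action, which is either a store or a priority
    write; a store can thus never meet a priority write.\<close>
  have sp: "ast ac t = {} \<or> apw ac t' = {}" for t t' by (cases ac) auto
  show "stores (uu i) \<inter> (reads (uu j) \<union> stores (uu j) \<union> pwrites (uu j)) = {} &
   pwrites (uu i) \<inter> reads (uu j) = {}"
   using ij race[of j i] race2[of i j] sp[of "S i" "S j"]
   by (simp add: th(5-7)) blast
 qed
 let ?T = "s\<lparr>imem := merge_mem ICell m uu (imem s) (\<lambda>i. imem (tt i)),
         rmem := merge_mem RCell m uu (rmem s) (\<lambda>i. rmem (tt i))\<rparr>"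
 have T: "bnd \<beta> ?T & Q ?T"
 proof -
  have "imem (tt i) = imem (if gev gs (S i) then aupd ac (S i) else S i)"
   "rmem (tt i) = rmem (if gev gs (S i) then aupd ac (S i) else S i)" if "i < m" for i
   using th(2)[OF that] unfolding rel_def by simp_all
  from post[OF s'(3) th(6) this] show ?thesis unfolding Let_def .
 qed
 have "exec W (hcom (Pf x e gs ac)) s' (join m uu s1 tt) (seq_usage u0 (par_usage m uu))"
  unfolding hcom.simps
  by (rule exec.Seq[OF 1(1) exec.ParFor[OF _ th(1) rf]]) (use 1 m in auto)
 moreover have "rel (join m uu s1 tt) ?T"
  using 1(2) by (auto simp: rel_def join_def)
 moreover have "work (seq_usage u0 (par_usage m uu)) \<le> hsz (Pf x e gs ac) * X"
 proof -
  have "(\<Sum>i<m. work (uu i)) \<le> m * bsz gs ac"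
   using sum_bounded_above[of "{..<m}" "\<lambda>i. work (uu i)" "bsz gs ac"] th(3) by auto
  then have "work (seq_usage u0 (par_usage m uu)) \<le> isz e + 1 + m + m * bsz gs ac"
   using 1(4) by (auto simp: par_usage_def cheap_def)
  also have "\<dots> \<le> hsz (Pf x e gs ac) * (1 + m)" by (simp add: algebra_simps)
  also have "\<dots> \<le> hsz (Pf x e gs ac) * X" using m(3) by (rule mult_le_mono2)
  finally show ?thesis .
 qed
 moreover have "depth (seq_usage u0 (par_usage m uu)) \<le> hsz (Pf x e gs ac) * D"
 proof -
  have "Max (insert 0 ((\<lambda>i. depth (uu i)) ` {..<m})) \<le> bsz gs ac"
   using th(4) by (intro Max.boundedI) auto
  moreover have "depth (seq_usage u0 (par_usage m uu)) =
    depth u0 + (1 + Max (insert 0 ((\<lambda>i. depth (uu i)) ` {..<m})))"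
   by (simp add: par_usage_def)
  moreover have "depth u0 \<le> isz e" using 1(4) by (simp add: cheap_def)
  ultimately have "depth (seq_usage u0 (par_usage m uu)) \<le> hsz (Pf x e gs ac) * 1"
   unfolding hsz.simps mult_1_right by linarith
  also have "\<dots> \<le> hsz (Pf x e gs ac) * D" using m(4) by (rule mult_le_mono2)
  finally show ?thesis .
 qed
 moreover have "reads (seq_usage u0 (par_usage m uu)) \<subseteq> Rd \<union> Wr"
 proof -
  have "(\<Union>i<m. reads (uu i)) \<subseteq> Rd \<union> Wr" by (rule UN_least) (use th(5) rd in auto)
  then show ?thesis using 1(4) m(5) by (simp add: par_usage_def cheap_def)
 qed
 moreover have "stores (seq_usage u0 (par_usage m uu)) \<union> pwrites (seq_usage u0 (par_usage m uu)) \<subseteq> Wr"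
 proof -
  have "stores (uu i) \<union> pwrites (uu i) \<subseteq> Wr" if "i < m" for i
   using th(6,7)[OF that] wr[OF that] by auto
  then show ?thesis using 1(4) by (auto simp: par_usage_def cheap_def)
 qed
 ultimately show "\<exists>t' u t. exec W (hcom (Pf x e gs ac)) s' t' u & rel t' t & bnd \<beta> t &
    work u \<le> hsz (Pf x e gs ac) * X & depth u \<le> hsz (Pf x e gs ac) * D &
    reads u \<subseteq> Rd \<union> Wr & stores u \<union> pwrites u \<subseteq> Wr & Q t"
  using T by (intro exI[of _ "join m uu s1 tt"] exI[of _ "seq_usage u0 (par_usage m uu)"] exI[of _ ?T]) blast
qed

text \<open>\<open>rc\<close> allows a thread to read the very cell that it stores to afterwards.
  This permits updates in place, such as replacing every label by the label it points to.\<close>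

lemma ok_pf_IS:
 assumes m: "ival e s = m" "m \<le> \<beta>" "1 + m \<le> X" "1 \<le> D" "ird e s \<subseteq> Rd \<union> Wr"
  and G: "!!i. i < m ==> gev gs (setv s x i) = G i"
  and ad: "!!i. i < m ==> G i ==> ival a (setv s x i) = ad i"
  and vl: "!!i. i < m ==> G i ==> ival v (setv s x i) = vl i"
  and rd: "!!i l. i < m ==> l \<in> grd gs (IS a v) (setv s x i) ==> l \<in> Rd \<union> Wr"
  and rc: "!!i j. i < m ==> j < m ==> G j ==>
   ICell (ad j) \<in> grd gs (IS a v) (setv s x i) ==> i = j"
  and wr: "!!i. i < m ==> G i ==> ICell (ad i) \<in> Wr"
  and inj: "!!i j. i < m ==> j < m ==> G i ==> G j ==> ad i = ad j ==> i = j"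
  and vb: "!!i. i < m ==> G i ==> bnd \<beta> s ==> vl i \<le> \<beta>"
  and post: "!!f. (!!i. i < m ==> G i ==> f (ad i) = vl i) ==>
   (!!a. (!!i. i < m ==> G i ==> ad i \<noteq> a) ==> f a = imem s a) ==> Q (s\<lparr>imem := f\<rparr>)"
 shows "ok \<beta> (Pf x e gs (IS a v)) s X D Rd Wr Q"
proof (rule ok_pf[OF m refl])
 fix u :: "nat => usage" and tt :: "nat => state"
 assume b: "bnd \<beta> s" and st: "!!i. i < m ==> stores (u i) =
   (if gev gs (setv s x i) then ast (IS a v) (setv s x i) else {})"
  and im: "!!i. i < m ==> imem (tt i) = imem (if gev gs (setv s x i)
   then aupd (IS a v) (setv s x i) else (setv s x i))"
  and rm: "!!i. i < m ==> rmem (tt i) = rmem (if gev gs (setv s x i)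
   then aupd (IS a v) (setv s x i) else (setv s x i))"
 have st': "stores (u i) = (if G i then {ICell (ad i)} else {})" if "i < m" for i
  using st[OF that] G[OF that] ad[OF that] by simp
 have im': "imem (tt i) = (if G i then (imem s)(ad i := vl i) else imem s)" if "i < m" for i
  using im[OF that] G[OF that] ad[OF that] vl[OF that] by simp
 have rm': "rmem (tt i) = rmem s" if "i < m" for i using rm[OF that] by simp
 let ?f = "merge_mem ICell m u (imem s) (\<lambda>i. imem (tt i))"
 have R: "merge_mem RCell m u (rmem s) (\<lambda>i. rmem (tt i)) = rmem s"
  by (rule ext, rule merge_other) (auto simp: st' rm')
 have f1: "?f (ad i) = vl i" if "i < m" "G i" for i
 proof -
  have "?f (ad i) = imem (tt i) (ad i)"
   by (rule merge_own) (use that inj in \<open>auto simp: st' im' dest: inj\<close>)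
  then show ?thesis using im'[OF that(1)] that(2) by simp
 qed
 have f2: "?f a = imem s a" if "!!i. i < m ==> G i ==> ad i \<noteq> a" for a
  by (rule merge_other) (use that in \<open>auto simp: st' im'\<close>)
 have "bnd \<beta> (s\<lparr>imem := ?f\<rparr>)"
  unfolding bnd_def
 proof (intro conjI allI)
  fix a show "imem (s\<lparr>imem := ?f\<rparr>) a \<le> \<beta>"
   using f1 f2[of a] vb b by (cases "\<exists>i<m. G i & ad i = a") (auto simp: bnd_def)
 qed (use b in \<open>auto simp: bnd_def\<close>)
 moreover have "Q (s\<lparr>imem := ?f\<rparr>)" by (rule post) (use f1 f2 in auto)
 moreover have "s\<lparr>imem := ?f, rmem := rmem s\<rparr> = s\<lparr>imem := ?f\<rparr>" by simp
 ultimately show "let T = s\<lparr>imem := ?f, rmem := merge_mem RCell m u (rmem s) (\<lambda>i. rmem (tt i))\<rparr>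
    in bnd \<beta> T & Q T" by (simp add: R Let_def)
next
 show "!!i. i < m ==> grd gs (IS a v) (setv s x i) \<subseteq> Rd \<union> Wr" using rd by blast
next
 show "!!i. i < m ==> gev gs (setv s x i) ==>
   ast (IS a v) (setv s x i) \<union> apw (IS a v) (setv s x i) \<subseteq> Wr"
  using wr ad G by auto
next
 fix i j assume ij: "i < m" "j < m" "i \<noteq> j" "gev gs (setv s x j)"
 then have "G j" using G by auto
 then show "grd gs (IS a v) (setv s x i) \<inter>
   (ast (IS a v) (setv s x j) \<union> apw (IS a v) (setv s x j)) = {}"
  using rc[of i j] ij ad[of j] by auto
next
 fix i j assume ij: "i < m" "j < m" "i \<noteq> j" "gev gs (setv s x i)"
  "gev gs (setv s x j)"
 then have "G i" "G j" using G by auto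
 then show "ast (IS a v) (setv s x i) \<inter> ast (IS a v) (setv s x j) = {}"
  using inj[of i j] ij ad[of j] ad[of i] by auto
qed

lemma ok_pf_RS:
 assumes m: "ival e s = m" "m \<le> \<beta>" "1 + m \<le> X" "1 \<le> D" "ird e s \<subseteq> Rd \<union> Wr"
  and G: "!!i. i < m ==> gev gs (setv s x i) = G i"
  and ad: "!!i. i < m ==> G i ==> ival a (setv s x i) = ad i"
  and vl: "!!i. i < m ==> G i ==> rval v (setv s x i) = vl i"
  and rd: "!!i l. i < m ==> l \<in> grd gs (RS a v) (setv s x i) ==> l \<in> Rd \<union> Wr"
  and rc: "!!i j. i < m ==> j < m ==> G j ==>
   RCell (ad j) \<in> grd gs (RS a v) (setv s x i) ==> i = j"
  and wr: "!!i. i < m ==> G i ==> RCell (ad i) \<in> Wr"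
  and inj: "!!i j. i < m ==> j < m ==> G i ==> G j ==> ad i = ad j ==> i = j"
  and post: "!!f. (!!i. i < m ==> G i ==> f (ad i) = vl i) ==>
   (!!a. (!!i. i < m ==> G i ==> ad i \<noteq> a) ==> f a = rmem s a) ==> Q (s\<lparr>rmem := f\<rparr>)"
 shows "ok \<beta> (Pf x e gs (RS a v)) s X D Rd Wr Q"
proof (rule ok_pf[OF m refl])
 fix u :: "nat => usage" and tt :: "nat => state"
 assume b: "bnd \<beta> s" and st: "!!i. i < m ==> stores (u i) =
   (if gev gs (setv s x i) then ast (RS a v) (setv s x i) else {})"
  and im: "!!i. i < m ==> imem (tt i) = imem (if gev gs (setv s x i)
   then aupd (RS a v) (setv s x i) else (setv s x i))"
  and rm: "!!i. i < m ==> rmem (tt i) = rmem (if gev gs (setv s x i)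
   then aupd (RS a v) (setv s x i) else (setv s x i))"
 have st': "stores (u i) = (if G i then {RCell (ad i)} else {})" if "i < m" for i
  using st[OF that] G[OF that] ad[OF that] by simp
 have rm': "rmem (tt i) = (if G i then (rmem s)(ad i := vl i) else rmem s)" if "i < m" for i
  using rm[OF that] G[OF that] ad[OF that] vl[OF that] by simp
 have im': "imem (tt i) = imem s" if "i < m" for i using im[OF that] by simp
 let ?f = "merge_mem RCell m u (rmem s) (\<lambda>i. rmem (tt i))"
 have R: "merge_mem ICell m u (imem s) (\<lambda>i. imem (tt i)) = imem s"
  by (rule ext, rule merge_other) (auto simp: st' im')
 have f1: "?f (ad i) = vl i" if "i < m" "G i" for i
 proof -
  have "?f (ad i) = rmem (tt i) (ad i)"
   by (rule merge_own) (use that inj in \<open>auto simp: st' rm' dest: inj\<close>)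
  then show ?thesis using rm'[OF that(1)] that(2) by simp
 qed
 have f2: "?f a = rmem s a" if "!!i. i < m ==> G i ==> ad i \<noteq> a" for a
  by (rule merge_other) (use that in \<open>auto simp: st' rm'\<close>)
 have "bnd \<beta> (s\<lparr>rmem := ?f\<rparr>)" using b by (auto simp: bnd_def)
 moreover have "Q (s\<lparr>rmem := ?f\<rparr>)" by (rule post) (use f1 f2 in auto)
 moreover have "s\<lparr>imem := imem s, rmem := ?f\<rparr> = s\<lparr>rmem := ?f\<rparr>" by simp
 ultimately show "let T = s\<lparr>imem := merge_mem ICell m u (imem s) (\<lambda>i. imem (tt i)), rmem := ?f\<rparr>
    in bnd \<beta> T & Q T" by (simp add: R Let_def)
next
 show "!!i. i < m ==> grd gs (RS a v) (setv s x i) \<subseteq> Rd \<union> Wr" using rd by blast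
next
 show "!!i. i < m ==> gev gs (setv s x i) ==>
   ast (RS a v) (setv s x i) \<union> apw (RS a v) (setv s x i) \<subseteq> Wr"
  using wr ad G by auto
next
 fix i j assume ij: "i < m" "j < m" "i \<noteq> j" "gev gs (setv s x j)"
 then have "G j" using G by auto
 then show "grd gs (RS a v) (setv s x i) \<inter>
   (ast (RS a v) (setv s x j) \<union> apw (RS a v) (setv s x j)) = {}"
  using rc[of i j] ij ad[of j] by auto
next
 fix i j assume ij: "i < m" "j < m" "i \<noteq> j" "gev gs (setv s x i)"
  "gev gs (setv s x j)"
 then have "G i" "G j" using G by auto
 then show "ast (RS a v) (setv s x i) \<inter> ast (RS a v) (setv s x j) = {}"
  using inj[of i j] ij ad[of j] ad[of i] by auto
qed

lemma ok_pf_IM: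
 assumes m: "ival e s = m" "m \<le> \<beta>" "1 + m \<le> X" "1 \<le> D" "ird e s \<subseteq> Rd \<union> Wr"
  and G: "!!i. i < m ==> gev gs (setv s x i) = G i"
  and ad: "!!i. i < m ==> G i ==> ival a (setv s x i) = ad i"
  and vl: "!!i. i < m ==> G i ==> ival v (setv s x i) = vl i"
  and rd: "!!i l. i < m ==> l \<in> grd gs (IM a v) (setv s x i) ==> l \<in> Rd \<union> Wr"
  and rc: "!!i j. i < m ==> j < m ==> G j ==>
   ICell (ad j) \<in> grd gs (IM a v) (setv s x i) ==> i = j"
  and wr: "!!i. i < m ==> G i ==> ICell (ad i) \<in> Wr"
  and post: "!!f. (!!a. f a = Min (insert (imem s a) (vl ` {i. i < m & G i & ad i = a}))) ==>
   Q (s\<lparr>imem := f\<rparr>)"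
 shows "ok \<beta> (Pf x e gs (IM a v)) s X D Rd Wr Q"
proof (rule ok_pf[OF m refl])
 fix u :: "nat => usage" and tt :: "nat => state"
 assume b: "bnd \<beta> s" and st: "!!i. i < m ==> stores (u i) =
   (if gev gs (setv s x i) then ast (IM a v) (setv s x i) else {})"
  and im: "!!i. i < m ==> imem (tt i) = imem (if gev gs (setv s x i)
   then aupd (IM a v) (setv s x i) else (setv s x i))"
  and rm: "!!i. i < m ==> rmem (tt i) = rmem (if gev gs (setv s x i)
   then aupd (IM a v) (setv s x i) else (setv s x i))"
 have st': "stores (u i) = {}" if "i < m" for i using st[OF that] by simp
 have im': "imem (tt i) a = (if G i & ad i = a then min (imem s a) (vl i) else imem s a)" if "i < m" for i a
  using im[OF that] G[OF that] ad[OF that] vl[OF that] by simp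
 have rm': "rmem (tt i) = rmem s" if "i < m" for i using rm[OF that] by simp
 let ?f = "merge_mem ICell m u (imem s) (\<lambda>i. imem (tt i))"
 have R: "merge_mem RCell m u (rmem s) (\<lambda>i. rmem (tt i)) = rmem s"
  by (rule ext, rule merge_other) (auto simp: st' rm')
 have f: "?f a = Min (insert (imem s a) (vl ` {i. i < m & G i & ad i = a}))" for a
  by (rule merge_min) (auto simp: st' im')
 have "bnd \<beta> (s\<lparr>imem := ?f\<rparr>)"
  unfolding bnd_def
 proof (intro conjI allI)
  fix a
  have "?f a \<le> imem s a" unfolding f by (rule Min_le) auto
  then show "imem (s\<lparr>imem := ?f\<rparr>) a \<le> \<beta>" using b by (auto simp: bnd_def intro: order_trans)
 qed (use b in \<open>auto simp: bnd_def\<close>)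
 moreover have "Q (s\<lparr>imem := ?f\<rparr>)" by (rule post) (rule f)
 moreover have "s\<lparr>imem := ?f, rmem := rmem s\<rparr> = s\<lparr>imem := ?f\<rparr>" by simp
 ultimately show "let T = s\<lparr>imem := ?f, rmem := merge_mem RCell m u (rmem s) (\<lambda>i. rmem (tt i))\<rparr>
    in bnd \<beta> T & Q T" by (simp add: R Let_def)
next
 show "!!i. i < m ==> grd gs (IM a v) (setv s x i) \<subseteq> Rd \<union> Wr" using rd by blast
next
 show "!!i. i < m ==> gev gs (setv s x i) ==>
   ast (IM a v) (setv s x i) \<union> apw (IM a v) (setv s x i) \<subseteq> Wr"
  using wr ad G by auto
next
 fix i j assume ij: "i < m" "j < m" "i \<noteq> j" "gev gs (setv s x j)"
 then have "G j" using G by auto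
 then show "grd gs (IM a v) (setv s x i) \<inter>
   (ast (IM a v) (setv s x j) \<union> apw (IM a v) (setv s x j)) = {}"
  using rc[of i j] ij ad[of j] by auto
qed auto

lemma ok_pf_RM:
 assumes m: "ival e s = m" "m \<le> \<beta>" "1 + m \<le> X" "1 \<le> D" "ird e s \<subseteq> Rd \<union> Wr"
  and G: "!!i. i < m ==> gev gs (setv s x i) = G i"
  and ad: "!!i. i < m ==> G i ==> ival a (setv s x i) = ad i"
  and vl: "!!i. i < m ==> G i ==> rval v (setv s x i) = vl i"
  and rd: "!!i l. i < m ==> l \<in> grd gs (RM a v) (setv s x i) ==> l \<in> Rd \<union> Wr"
  and rc: "!!i j. i < m ==> j < m ==> G j ==>
   RCell (ad j) \<in> grd gs (RM a v) (setv s x i) ==> i = j"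
  and wr: "!!i. i < m ==> G i ==> RCell (ad i) \<in> Wr"
  and post: "!!f. (!!a. f a = Min (insert (rmem s a) (vl ` {i. i < m & G i & ad i = a}))) ==>
   Q (s\<lparr>rmem := f\<rparr>)"
 shows "ok \<beta> (Pf x e gs (RM a v)) s X D Rd Wr Q"
proof (rule ok_pf[OF m refl])
 fix u :: "nat => usage" and tt :: "nat => state"
 assume b: "bnd \<beta> s" and st: "!!i. i < m ==> stores (u i) =
   (if gev gs (setv s x i) then ast (RM a v) (setv s x i) else {})"
  and im: "!!i. i < m ==> imem (tt i) = imem (if gev gs (setv s x i)
   then aupd (RM a v) (setv s x i) else (setv s x i))"
  and rm: "!!i. i < m ==> rmem (tt i) = rmem (if gev gs (setv s x i)
   then aupd (RM a v) (setv s x i) else (setv s x i))"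
 have st': "stores (u i) = {}" if "i < m" for i using st[OF that] by simp
 have rm': "rmem (tt i) a = (if G i & ad i = a then min (rmem s a) (vl i) else rmem s a)" if "i < m" for i a
  using rm[OF that] G[OF that] ad[OF that] vl[OF that] by simp
 have im': "imem (tt i) = imem s" if "i < m" for i using im[OF that] by simp
 let ?f = "merge_mem RCell m u (rmem s) (\<lambda>i. rmem (tt i))"
 have R: "merge_mem ICell m u (imem s) (\<lambda>i. imem (tt i)) = imem s"
  by (rule ext, rule merge_other) (auto simp: st' im')
 have f: "?f a = Min (insert (rmem s a) (vl ` {i. i < m & G i & ad i = a}))" for a
  by (rule merge_min) (auto simp: st' rm')
 have "bnd \<beta> (s\<lparr>rmem := ?f\<rparr>)" using b by (auto simp: bnd_def)
 moreover have "Q (s\<lparr>rmem := ?f\<rparr>)" by (rule post) (rule f)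
 moreover have "s\<lparr>imem := imem s, rmem := ?f\<rparr> = s\<lparr>rmem := ?f\<rparr>" by simp
 ultimately show "let T = s\<lparr>imem := merge_mem ICell m u (imem s) (\<lambda>i. imem (tt i)), rmem := ?f\<rparr>
    in bnd \<beta> T & Q T" by (simp add: R Let_def)
next
 show "!!i. i < m ==> grd gs (RM a v) (setv s x i) \<subseteq> Rd \<union> Wr" using rd by blast
next
 show "!!i. i < m ==> gev gs (setv s x i) ==>
   ast (RM a v) (setv s x i) \<union> apw (RM a v) (setv s x i) \<subseteq> Wr"
  using wr ad G by auto
next
 fix i j assume ij: "i < m" "j < m" "i \<noteq> j" "gev gs (setv s x j)"
 then have "G j" using G by auto
 then show "grd gs (RM a v) (setv s x i) \<inter>
   (ast (RM a v) (setv s x j) \<union> apw (RM a v) (setv s x j)) = {}"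
  using rc[of i j] ij ad[of j] by auto
qed auto

text \<open>Races are excluded without looking into the body: the write sets \<open>Wi\<close> are
  pairwise disjoint and avoid the common read-only set \<open>Rd\<close>. Work is multiplied by the
  number of threads, depth is not.\<close>

lemma ok_par:
 assumes m: "ival e s = m" "m \<le> \<beta>" "ird e s \<subseteq> Rd \<union> Wr" "1 \<le> X1" "1 \<le> D"
  and body: "!!i. i < m ==> ok \<beta> c (setv s x i) X1 D Rd (Wi i) (Qi i)"
  and disj: "!!i j. i < m ==> j < m ==> i \<noteq> j ==> Wi i \<inter> Wi j = {}"
   "!!i. i < m ==> Wi i \<inter> Rd = {}" "!!i. i < m ==> Wi i \<subseteq> Wr"
  and X: "1 + m * X1 \<le> X"
  and post: "!!f g. (!!i. i < m ==> \<exists>t. Qi i t & (\<forall>a. ICell a \<in> Wi i \<longrightarrow> f a = imem t a) &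
    (\<forall>a. RCell a \<in> Wi i \<longrightarrow> g a = rmem t a)) ==>
   (!!a. (!!i. i < m ==> ICell a \<notin> Wi i) ==> f a = imem s a) ==>
   (!!a. (!!i. i < m ==> RCell a \<notin> Wi i) ==> g a = rmem s a) ==>
   Q (s\<lparr>imem := f, rmem := g\<rparr>)"
 shows "ok \<beta> (Par x e c) s X D Rd Wr Q"
 unfolding ok_def
proof (intro allI impI)
 fix W s' assume s': "(\<beta> + 2) ^ hsz (Par x e c) \<le> W" "rel s' s" "bnd \<beta> s"
 have W: "(\<beta> + 2) ^ isz e \<le> W" "(\<beta> + 2) ^ hsz c \<le> W"
  by (rule pow_le_W[OF s'(1)], simp)+
 let ?S = "\<lambda>i. (setv s x i)"
 from ci_exec[OF s'(2,3) W(1), of 0] obtain s1 u0 where 1: "exec W (ci e 0) s' s1 u0" "rel s1 s"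
  "ireg s1 (tp 0) = ival e s" "cheap (isz e) (ird e s) u0" by metis
 have thr: "\<exists>t' u t. exec W (hcom c) (set_ireg (2 * x) i s1) t' u & rel t' t & bnd \<beta> t &
    work u \<le> hsz c * X1 & depth u \<le> hsz c * D &
    reads u \<subseteq> Rd \<union> Wi i & stores u \<union> pwrites u \<subseteq> Wi i & Qi i t" if "i < m" for i
 proof -
  have "rel (set_ireg (2 * x) i s1) (?S i)" using 1(2) by (auto simp: rel_def)
  moreover have "bnd \<beta> (?S i)" using s'(3) that m(2) by (auto simp: bnd_def)
  ultimately show ?thesis using body[OF that] W(2) unfolding ok_def by blast
 qed
 define PP where "PP = (\<lambda>i t' u t. exec W (hcom c) (set_ireg (2 * x) i s1) t' u & rel t' t & bnd \<beta> t &
    work u \<le> hsz c * X1 & depth u \<le> hsz c * D &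
    reads u \<subseteq> Rd \<union> Wi i & stores u \<union> pwrites u \<subseteq> Wi i & Qi i t)"
 from thr have "\<forall>i. \<exists>t' u t. i < m \<longrightarrow> PP i t' u t" unfolding PP_def by blast
 then obtain tc uu tt where "\<forall>i. i < m \<longrightarrow> PP i (tc i) (uu i) (tt i)" by metis
 then have th: "!!i. i < m ==> exec W (hcom c) (set_ireg (2 * x) i s1) (tc i) (uu i)"
  "!!i. i < m ==> rel (tc i) (tt i)" "!!i. i < m ==> bnd \<beta> (tt i)"
  "!!i. i < m ==> work (uu i) \<le> hsz c * X1" "!!i. i < m ==> depth (uu i) \<le> hsz c * D"
  "!!i. i < m ==> reads (uu i) \<subseteq> Rd \<union> Wi i"
  "!!i. i < m ==> stores (uu i) \<union> pwrites (uu i) \<subseteq> Wi i" "!!i. i < m ==> Qi i (tt i)"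
  unfolding PP_def by blast+
 have rf: "race_free m uu"
  unfolding race_free_def
 proof (intro allI impI)
  fix i j assume ij: "i < m" "j < m" "i \<noteq> j"
  show "stores (uu i) \<inter> (reads (uu j) \<union> stores (uu j) \<union> pwrites (uu j)) = {} &
   pwrites (uu i) \<inter> reads (uu j) = {}"
   using disj(1)[OF ij] disj(2)[OF ij(1)] th(6)[OF ij(2)] th(7)[OF ij(2)] th(7)[OF ij(1)] by blast
 qed
 let ?f = "merge_mem ICell m uu (imem s1) (\<lambda>i. imem (tc i))"
 let ?g = "merge_mem RCell m uu (rmem s1) (\<lambda>i. rmem (tc i))"
 have mem: "imem s1 = imem s" "rmem s1 = rmem s" using 1(2) by (auto simp: rel_def)
 have frI: "imem (tc i) a = imem s a" if "i < m" "ICell a \<notin> Wi i" for i a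
  using exec_frame[OF th(1)[OF that(1)]] th(7)[OF that(1)] that mem by auto
 have frR: "rmem (tc i) a = rmem s a" if "i < m" "RCell a \<notin> Wi i" for i a
  using exec_frame[OF th(1)[OF that(1)]] th(7)[OF that(1)] that mem by auto
 have ownI: "?f a = imem (tt i) a" if "i < m" "ICell a \<in> Wi i" for i a
 proof -
  have "?f a = imem (tc i) a"
  proof (rule merge_own[OF that(1)])
   fix j assume j: "j < m" "j \<noteq> i"
   then have "ICell a \<notin> Wi j" using disj(1)[of i j] that by auto
   then show "ICell a \<notin> stores (uu j)" "imem (tc j) a = imem s1 a"
    using th(7)[of j] j frI[of j a] mem by auto
  next
   assume "ICell a \<notin> stores (uu i)"
   then show "imem (tc i) a \<le> imem s1 a" using exec_frame[OF th(1)[OF that(1)]] by simp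
  qed
  then show ?thesis using th(2)[OF that(1)] by (simp add: rel_def)
 qed
 have ownR: "?g a = rmem (tt i) a" if "i < m" "RCell a \<in> Wi i" for i a
 proof -
  have "?g a = rmem (tc i) a"
  proof (rule merge_own[OF that(1)])
   fix j assume j: "j < m" "j \<noteq> i"
   then have "RCell a \<notin> Wi j" using disj(1)[of i j] that by auto
   then show "RCell a \<notin> stores (uu j)" "rmem (tc j) a = rmem s1 a"
    using th(7)[of j] j frR[of j a] mem by auto
  next
   assume "RCell a \<notin> stores (uu i)"
   then show "rmem (tc i) a \<le> rmem s1 a" using exec_frame[OF th(1)[OF that(1)]] by simp
  qed
  then show ?thesis using th(2)[OF that(1)] by (simp add: rel_def)
 qed
 have othI: "?f a = imem s a" if "!!i. i < m ==> ICell a \<notin> Wi i" for a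
  unfolding mem by (rule merge_other) (use that th(7) frI in auto)
 have othR: "?g a = rmem s a" if "!!i. i < m ==> RCell a \<notin> Wi i" for a
  unfolding mem by (rule merge_other) (use that th(7) frR in auto)
 let ?T = "s\<lparr>imem := ?f, rmem := ?g\<rparr>"
 have Q: "Q ?T"
 proof (rule post)
  fix i assume "i < m"
  then show "\<exists>t. Qi i t & (\<forall>a. ICell a \<in> Wi i \<longrightarrow> ?f a = imem t a) &
    (\<forall>a. RCell a \<in> Wi i \<longrightarrow> ?g a = rmem t a)"
   using ownI[of i] ownR[of i] th(8)[of i] by (intro exI[of _ "tt i"]) simp
 qed (use othI othR in simp_all)
 have b: "bnd \<beta> ?T"
  unfolding bnd_def
 proof (intro conjI allI)
  fix a show "imem ?T a \<le> \<beta>"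
   using ownI[of _ a] othI[of a] th(3) s'(3)
   by (cases "\<exists>i<m. ICell a \<in> Wi i") (auto simp: bnd_def)
 qed (use s'(3) in \<open>auto simp: bnd_def\<close>)
 have "exec W (hcom (Par x e c)) s' (join m uu s1 tc) (seq_usage u0 (par_usage m uu))"
  unfolding hcom.simps
  by (rule exec.Seq[OF 1(1) exec.ParFor[OF _ th(1) rf]]) (use 1 m in auto)
 moreover have "rel (join m uu s1 tc) ?T"
  using 1(2) by (auto simp: rel_def join_def)
 moreover have "work (seq_usage u0 (par_usage m uu)) \<le> hsz (Par x e c) * X"
 proof -
  have "(\<Sum>i<m. work (uu i)) \<le> m * (hsz c * X1)"
   using sum_bounded_above[of "{..<m}" "\<lambda>i. work (uu i)" "hsz c * X1"] th(4) by auto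
  then have "work (seq_usage u0 (par_usage m uu)) \<le> isz e + 1 + m + m * (hsz c * X1)"
   using 1(4) by (auto simp: par_usage_def cheap_def)
  also have "\<dots> \<le> isz e + 1 + m * X1 + m * (hsz c * X1)" using le_mult1[OF m(4), of m] by simp
  also have "\<dots> \<le> hsz (Par x e c) * (1 + m * X1)" by (simp add: algebra_simps)
  also have "\<dots> \<le> hsz (Par x e c) * X" using X by (rule mult_le_mono2)
  finally show ?thesis .
 qed
 moreover have "depth (seq_usage u0 (par_usage m uu)) \<le> hsz (Par x e c) * D"
 proof -
  have "Max (insert 0 ((\<lambda>i. depth (uu i)) ` {..<m})) \<le> hsz c * D"
   using th(5) by (intro Max.boundedI) auto
  moreover have "depth (seq_usage u0 (par_usage m uu)) =
    depth u0 + (1 + Max (insert 0 ((\<lambda>i. depth (uu i)) ` {..<m})))"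
   by (simp add: par_usage_def)
  moreover have "depth u0 \<le> isz e" using 1(4) by (simp add: cheap_def)
  ultimately have "depth (seq_usage u0 (par_usage m uu)) \<le> (isz e + 1) + hsz c * D"
   unfolding hsz.simps mult_1_right by linarith
  also have "\<dots> \<le> (isz e + 1) * D + hsz c * D" using le_mult1[OF m(5), of "isz e + 1"] by (intro add_mono) auto
  also have "\<dots> \<le> hsz (Par x e c) * D" by (simp add: algebra_simps)
  finally show ?thesis .
 qed
 moreover have "reads (seq_usage u0 (par_usage m uu)) \<subseteq> Rd \<union> Wr"
 proof -
  have "(\<Union>i<m. reads (uu i)) \<subseteq> Rd \<union> Wr"
  proof (rule UN_least)
   fix i assume "i \<in> {..<m}"
   then show "reads (uu i) \<subseteq> Rd \<union> Wr" using th(6)[of i] disj(3)[of i] by auto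
  qed
  then show ?thesis using 1(4) m(3) by (simp add: par_usage_def cheap_def)
 qed
 moreover have "stores (seq_usage u0 (par_usage m uu)) \<union> pwrites (seq_usage u0 (par_usage m uu)) \<subseteq> Wr"
 proof -
  have "stores (uu i) \<union> pwrites (uu i) \<subseteq> Wr" if "i < m" for i
   using th(7)[OF that] disj(3)[OF that] by auto
  then show ?thesis using 1(4) by (auto simp: par_usage_def cheap_def)
 qed
 ultimately show "\<exists>t' u t. exec W (hcom (Par x e c)) s' t' u & rel t' t & bnd \<beta> t &
    work u \<le> hsz (Par x e c) * X & depth u \<le> hsz (Par x e c) * D &
    reads u \<subseteq> Rd \<union> Wr & stores u \<union> pwrites u \<subseteq> Wr & Q t"
  using Q b by (intro exI[of _ "join m uu s1 tc"] exI[of _ "seq_usage u0 (par_usage m uu)"] exI[of _ ?T]) blast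
qed

section \<open>Interleaved arrays\<close>

abbreviation iadd (infixl "[+]" 65) where "a [+] b \<equiv> Bin IAdd a b"
abbreviation isub (infixl "[-]" 65) where "a [-] b \<equiv> Bin ISub a b"
abbreviation imul (infixl "[*]" 70) where "a [*] b \<equiv> Bin IMul a b"
abbreviation idiv (infixl "['/]" 70) where "a [/] b \<equiv> Bin IDiv a b"
abbreviation imod (infixl "[%]" 70) where "a [%] b \<equiv> Bin IMod a b"
abbreviation ile (infix "[<=]" 50) where "a [<=] b \<equiv> Leq a b"
abbreviation iless (infix "[<]" 50) where "a [<] b \<equiv> Leq (a [+] Num 1) b"
abbreviation inot where "inot a \<equiv> Num 1 [-] a"
abbreviation ieq (infix "[=]" 50) where "a [=] b \<equiv> Leq a b [*] Leq b a"

text \<open>Sixteen arrays are interleaved from the base address \<open>q\<close> on.\<close>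

definition adr :: "nat => nat => nat => nat" where "adr q c i = q + 16 * i + c"

lemma adr_eq_iff [simp]: "c < 16 ==> c' < 16 ==> adr q c i = adr q c' i' \<longleftrightarrow> c = c' & i = i'"
proof
 assume c: "c < 16" "c' < 16" and "adr q c i = adr q c' i'"
 then have e: "16 * i + c = 16 * i' + c'" by (simp add: adr_def)
 then have "(16 * i + c) mod 16 = (16 * i' + c') mod 16" by simp
 then have "c = c'" using c by simp
 then show "c = c' & i = i'" using e by simp
qed simp

lemma adr_ge: "q \<le> adr q c i" by (simp add: adr_def)

definition Adr :: "iexp => nat => iexp => iexp" where
 "Adr q c e = q [+] Num 16 [*] e [+] Num c"

lemma Adr_simps [simp]:
 "ival (Adr q c e) s = adr (ival q s) c (ival e s)"
 "ird (Adr q c e) s = ird q s \<union> ird e s"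
 by (simp_all add: Adr_def adr_def)

abbreviation AI :: "state => nat => nat => nat" where "AI s c i \<equiv> imem s (adr (ireg s 2) c i)"
abbreviation AR :: "state => nat => nat => real" where "AR s c i \<equiv> rmem s (adr (ireg s 2) c i)"

abbreviation IA :: "nat => iexp => iexp" where "IA c e \<equiv> Ld (Adr (Var 2) c e)"
abbreviation RA :: "nat => iexp => rexp" where "RA c e \<equiv> RLd (Adr (Var 2) c e)"

definition region :: "nat => nat => loc set" where
 "region q z = ICell ` {q..<q + 16 * z} \<union> RCell ` {q..<q + 16 * z}"

lemma adr_in_region [simp]:
 "c < 16 ==> ICell (adr q c i) \<in> region q z \<longleftrightarrow> i < z"
 "c < 16 ==> RCell (adr q c i) \<in> region q z \<longleftrightarrow> i < z"
 unfolding region_def adr_def by auto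

text \<open>State \<open>t\<close> arises from \<open>s\<close> by changing only the variables \<open>R\<close>, the integer arrays \<open>C\<close> and
 the real arrays \<open>C'\<close> based at variable 2.\<close>

definition same :: "nat set => nat set => nat set => state => state => bool" where
 "same R C C' s t \<longleftrightarrow> (\<forall>x. x \<notin> R \<longrightarrow> ireg t x = ireg s x) & rreg t = rreg s & 2 \<notin> R &
   (\<forall>c i. c < 16 \<longrightarrow> c \<notin> C \<longrightarrow> imem t (adr (ireg s 2) c i) = imem s (adr (ireg s 2) c i)) &
   (\<forall>c i. c < 16 \<longrightarrow> c \<notin> C' \<longrightarrow> rmem t (adr (ireg s 2) c i) = rmem s (adr (ireg s 2) c i)) &
   (\<forall>a < ireg s 2. imem t a = imem s a & rmem t a = rmem s a)"

lemma same_refl [simp]: "2 \<notin> R ==> same R C C' s s" by (simp add: same_def)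

lemma same_trans:
 assumes "same R C C' s t" "same R' C1 C1' t u" "R \<subseteq> R2" "R' \<subseteq> R2" "C \<subseteq> C2" "C1 \<subseteq> C2" "C' \<subseteq> C2'" "C1' \<subseteq> C2'"
  "2 \<notin> R2"
 shows "same R2 C2 C2' s u"
proof -
 have q: "ireg t 2 = ireg s 2" using assms(1) by (simp add: same_def)
 show ?thesis using assms unfolding same_def q
  by (intro conjI allI impI) (metis subsetD)+
qed

lemma same_mono:
 assumes "same R C C' s t" "R \<subseteq> R2" "C \<subseteq> C2" "C' \<subseteq> C2'" "2 \<notin> R2"
 shows "same R2 C2 C2' s t"
 using assms unfolding same_def by blast

lemma same_reg: "same R C C' s t ==> x \<notin> R ==> ireg t x = ireg s x" by (simp add: same_def)
lemma same_Q: "same R C C' s t ==> ireg t 2 = ireg s 2" by (simp add: same_def)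
lemma same_AI: "same R C C' s t ==> c < 16 ==> c \<notin> C ==> AI t c i = AI s c i" by (simp add: same_def)
lemma same_AR: "same R C C' s t ==> c < 16 ==> c \<notin> C' ==> AR t c i = AR s c i" by (simp add: same_def)
lemma same_low: "same R C C' s t ==> a < ireg s 2 ==> imem t a = imem s a & rmem t a = rmem s a"
 by (simp add: same_def)

lemma pf_IA:
 assumes c: "c < 16" "x \<noteq> 2" and reg: "region (ireg s 2) z \<subseteq> Wr"
  and m: "ival e s = m" "m \<le> \<beta>" "1 + m \<le> X" "1 \<le> D" "ird e s \<subseteq> Rd \<union> Wr"
  and G: "!!i. i < m ==> gev gs (setv s x i) = G i"
  and ad: "!!i. i < m ==> G i ==> ival a (setv s x i) = ad i"
  and vl: "!!i. i < m ==> G i ==> ival v (setv s x i) = vl i"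
  and rd: "!!i l. i < m ==> l \<in> grd gs (IS (Adr (Var 2) c a) v) (setv s x i) ==> l \<in> Rd \<union> Wr"
  and rc: "!!i j. i < m ==> j < m ==> G j ==>
   ICell (adr (ireg s 2) c (ad j)) \<in> grd gs (IS (Adr (Var 2) c a) v) (setv s x i) ==> i = j"
  and wr: "!!i. i < m ==> G i ==> ad i < z"
  and inj: "!!i j. i < m ==> j < m ==> G i ==> G j ==> ad i = ad j ==> i = j"
  and vb: "!!i. i < m ==> G i ==> bnd \<beta> s ==> vl i \<le> \<beta>"
  and post: "!!t. same {} {c} {} s t ==> (!!i. i < m ==> G i ==> AI t c (ad i) = vl i) ==>
   (!!j. (!!i. i < m ==> G i ==> ad i \<noteq> j) ==> AI t c j = AI s c j) ==> ireg t = ireg s ==> Q t"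
 shows "ok \<beta> (Pf x e gs (IS (Adr (Var 2) c a) v)) s X D Rd Wr Q"
proof (rule ok_pf_IS[OF m, where G = G and ad = "\<lambda>i. adr (ireg s 2) c (ad i)" and vl = vl])
 fix f
 assume f: "!!i. i < m ==> G i ==> f (adr (ireg s 2) c (ad i)) = vl i"
  and f': "!!a. (!!i. i < m ==> G i ==> adr (ireg s 2) c (ad i) \<noteq> a) ==> f a = imem s a"
 have "f a = imem s a" if "a < ireg s 2" for a
  by (rule f') (use adr_ge[of "ireg s 2" c] that in \<open>metis not_le\<close>)
 moreover have "f (adr (ireg s 2) c' i) = imem s (adr (ireg s 2) c' i)" if "c' < 16" "c' \<noteq> c" for c' i
  by (rule f') (use that c in auto)
 ultimately have "same {} {c} {} s (s\<lparr>imem := f\<rparr>)" by (auto simp: same_def)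
 then show "Q (s\<lparr>imem := f\<rparr>)"
 proof (rule post)
  show "AI (s\<lparr>imem := f\<rparr>) c j = AI s c j" if "!!i. i < m ==> G i ==> ad i \<noteq> j" for j
   using f'[of "adr (ireg s 2) c j"] that c by auto
 qed (use f in auto)
next
 show "!!i. i < m ==> G i ==> ICell (adr (ireg s 2) c (ad i)) \<in> Wr" using reg wr c by auto
next
 show "!!i. i < m ==> G i ==> ival (Adr (Var 2) c a) (setv s x i) = adr (ireg s 2) c (ad i)"
  using ad c by simp
qed (use G vl rd rc inj vb c in \<open>simp_all\<close>)

lemma pf_RA:
 assumes c: "c < 16" "x \<noteq> 2" and reg: "region (ireg s 2) z \<subseteq> Wr"
  and m: "ival e s = m" "m \<le> \<beta>" "1 + m \<le> X" "1 \<le> D" "ird e s \<subseteq> Rd \<union> Wr"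
  and G: "!!i. i < m ==> gev gs (setv s x i) = G i"
  and ad: "!!i. i < m ==> G i ==> ival a (setv s x i) = ad i"
  and vl: "!!i. i < m ==> G i ==> rval v (setv s x i) = vl i"
  and rd: "!!i l. i < m ==> l \<in> grd gs (RS (Adr (Var 2) c a) v) (setv s x i) ==> l \<in> Rd \<union> Wr"
  and rc: "!!i j. i < m ==> j < m ==> G j ==>
   RCell (adr (ireg s 2) c (ad j)) \<in> grd gs (RS (Adr (Var 2) c a) v) (setv s x i) ==> i = j"
  and wr: "!!i. i < m ==> G i ==> ad i < z"
  and inj: "!!i j. i < m ==> j < m ==> G i ==> G j ==> ad i = ad j ==> i = j"
  and post: "!!t. same {} {} {c} s t ==> (!!i. i < m ==> G i ==> AR t c (ad i) = vl i) ==>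
   (!!j. (!!i. i < m ==> G i ==> ad i \<noteq> j) ==> AR t c j = AR s c j) ==> ireg t = ireg s ==> imem t = imem s ==> Q t"
 shows "ok \<beta> (Pf x e gs (RS (Adr (Var 2) c a) v)) s X D Rd Wr Q"
proof (rule ok_pf_RS[OF m, where G = G and ad = "\<lambda>i. adr (ireg s 2) c (ad i)" and vl = vl])
 fix f
 assume f: "!!i. i < m ==> G i ==> f (adr (ireg s 2) c (ad i)) = vl i"
  and f': "!!a. (!!i. i < m ==> G i ==> adr (ireg s 2) c (ad i) \<noteq> a) ==> f a = rmem s a"
 have "f a = rmem s a" if "a < ireg s 2" for a
  by (rule f') (use adr_ge[of "ireg s 2" c] that in \<open>metis not_le\<close>)
 moreover have "f (adr (ireg s 2) c' i) = rmem s (adr (ireg s 2) c' i)" if "c' < 16" "c' \<noteq> c" for c' i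
  by (rule f') (use that c in auto)
 ultimately have "same {} {} {c} s (s\<lparr>rmem := f\<rparr>)" by (auto simp: same_def)
 then show "Q (s\<lparr>rmem := f\<rparr>)"
 proof (rule post)
  show "AR (s\<lparr>rmem := f\<rparr>) c j = AR s c j" if "!!i. i < m ==> G i ==> ad i \<noteq> j" for j
   using f'[of "adr (ireg s 2) c j"] that c by auto
 qed (use f in auto)
next
 show "!!i. i < m ==> G i ==> RCell (adr (ireg s 2) c (ad i)) \<in> Wr" using reg wr c by auto
next
 show "!!i. i < m ==> G i ==> ival (Adr (Var 2) c a) (setv s x i) = adr (ireg s 2) c (ad i)"
  using ad c by simp
qed (use G vl rd rc inj c in \<open>simp_all\<close>)

lemma pf_IMA:
 assumes c: "c < 16" "x \<noteq> 2" and reg: "region (ireg s 2) z \<subseteq> Wr"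
  and m: "ival e s = m" "m \<le> \<beta>" "1 + m \<le> X" "1 \<le> D" "ird e s \<subseteq> Rd \<union> Wr"
  and G: "!!i. i < m ==> gev gs (setv s x i) = G i"
  and ad: "!!i. i < m ==> G i ==> ival a (setv s x i) = ad i"
  and vl: "!!i. i < m ==> G i ==> ival v (setv s x i) = vl i"
  and rd: "!!i l. i < m ==> l \<in> grd gs (IM (Adr (Var 2) c a) v) (setv s x i) ==> l \<in> Rd \<union> Wr"
  and rc: "!!i j. i < m ==> j < m ==> G j ==>
   ICell (adr (ireg s 2) c (ad j)) \<in> grd gs (IM (Adr (Var 2) c a) v) (setv s x i) ==> i = j"
  and wr: "!!i. i < m ==> G i ==> ad i < z"
  and post: "!!t. same {} {c} {} s t ==>
   (!!j. AI t c j = Min (insert (AI s c j) (vl ` {i. i < m & G i & ad i = j}))) ==> ireg t = ireg s ==> rmem t = rmem s ==> Q t"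
 shows "ok \<beta> (Pf x e gs (IM (Adr (Var 2) c a) v)) s X D Rd Wr Q"
proof (rule ok_pf_IM[OF m, where G = G and ad = "\<lambda>i. adr (ireg s 2) c (ad i)" and vl = vl])
 fix f
 assume f: "!!a. f a = Min (insert (imem s a) (vl ` {i. i < m & G i & adr (ireg s 2) c (ad i) = a}))"
 have "f a = imem s a" if "a < ireg s 2" for a
 proof -
  have "adr (ireg s 2) c (ad i) \<noteq> a" for i using adr_ge[of "ireg s 2" c "ad i"] that by linarith
  then show ?thesis using f by simp
 qed
 moreover have "f (adr (ireg s 2) c' i) = imem s (adr (ireg s 2) c' i)" if "c' < 16" "c' \<noteq> c" for c' i
  using f that c by simp
 ultimately have "same {} {c} {} s (s\<lparr>imem := f\<rparr>)" by (auto simp: same_def)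
 then show "Q (s\<lparr>imem := f\<rparr>)"
  by (rule post) (use f c in auto)
next
 show "!!i. i < m ==> G i ==> ICell (adr (ireg s 2) c (ad i)) \<in> Wr" using reg wr c by auto
next
 show "!!i. i < m ==> G i ==> ival (Adr (Var 2) c a) (setv s x i) = adr (ireg s 2) c (ad i)"
  using ad c by simp
qed (use G vl rd rc c in \<open>simp_all\<close>)

lemma pf_RMA:
 assumes c: "c < 16" "x \<noteq> 2" and reg: "region (ireg s 2) z \<subseteq> Wr"
  and m: "ival e s = m" "m \<le> \<beta>" "1 + m \<le> X" "1 \<le> D" "ird e s \<subseteq> Rd \<union> Wr"
  and G: "!!i. i < m ==> gev gs (setv s x i) = G i"
  and ad: "!!i. i < m ==> G i ==> ival a (setv s x i) = ad i"
  and vl: "!!i. i < m ==> G i ==> rval v (setv s x i) = vl i"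
  and rd: "!!i l. i < m ==> l \<in> grd gs (RM (Adr (Var 2) c a) v) (setv s x i) ==> l \<in> Rd \<union> Wr"
  and rc: "!!i j. i < m ==> j < m ==> G j ==>
   RCell (adr (ireg s 2) c (ad j)) \<in> grd gs (RM (Adr (Var 2) c a) v) (setv s x i) ==> i = j"
  and wr: "!!i. i < m ==> G i ==> ad i < z"
  and post: "!!t. same {} {} {c} s t ==>
   (!!j. AR t c j = Min (insert (AR s c j) (vl ` {i. i < m & G i & ad i = j}))) ==> ireg t = ireg s ==> imem t = imem s ==> Q t"
 shows "ok \<beta> (Pf x e gs (RM (Adr (Var 2) c a) v)) s X D Rd Wr Q"
proof (rule ok_pf_RM[OF m, where G = G and ad = "\<lambda>i. adr (ireg s 2) c (ad i)" and vl = vl])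
 fix f
 assume f: "!!a. f a = Min (insert (rmem s a) (vl ` {i. i < m & G i & adr (ireg s 2) c (ad i) = a}))"
 have "f a = rmem s a" if "a < ireg s 2" for a
 proof -
  have "adr (ireg s 2) c (ad i) \<noteq> a" for i using adr_ge[of "ireg s 2" c "ad i"] that by linarith
  then show ?thesis using f by simp
 qed
 moreover have "f (adr (ireg s 2) c' i) = rmem s (adr (ireg s 2) c' i)" if "c' < 16" "c' \<noteq> c" for c' i
  using f that c by simp
 ultimately have "same {} {} {c} s (s\<lparr>rmem := f\<rparr>)" by (auto simp: same_def)
 then show "Q (s\<lparr>rmem := f\<rparr>)"
  by (rule post) (use f c in auto)
next
 show "!!i. i < m ==> G i ==> RCell (adr (ireg s 2) c (ad i)) \<in> Wr" using reg wr c by auto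
next
 show "!!i. i < m ==> G i ==> ival (Adr (Var 2) c a) (setv s x i) = adr (ireg s 2) c (ad i)"
  using ad c by simp
qed (use G vl rd rc c in \<open>simp_all\<close>)

lemma asg_same:
 assumes "x \<noteq> 2" "1 \<le> X" "1 \<le> D" "bnd \<beta> s ==> ival e s \<le> \<beta>" "ird e s \<subseteq> Rd \<union> Wr"
  "!!t. same {x} {} {} s t ==> ireg t = (ireg s)(x := ival e s) ==> imem t = imem s ==> rmem t = rmem s ==> Q t"
 shows "ok \<beta> (Asg x e) s X D Rd Wr Q"
proof (rule ok_asg[where e = e])
 show "Q (s\<lparr>ireg := (ireg s)(x := ival e s)\<rparr>)"
  by (rule assms(6)) (use assms(1) in \<open>auto simp: same_def\<close>)
qed (use assms in auto)

lemma ok_weaken: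
 assumes "ok \<beta> c s X D Rd Wr Q" "!!t. bnd \<beta> t ==> Q t ==> Q' t"
 shows "ok \<beta> c s X D Rd Wr Q'"
 by (rule ok_mono[OF assms(1)]) (use assms(2) in auto)

section \<open>Order statistics from sorted samples\<close>

text \<open>With ties the rank of a value is an interval; \<open>v\<close> is the
  \<open>k\<close>-th smallest, counted from 1 with multiplicity, when \<open>k\<close> lies in
  it.\<close>

definition is_kth :: "(nat => real) => nat set => nat => real => bool" where
 "is_kth f S k v \<longleftrightarrow> card {i\<in>S. f i < v} < k & k \<le> card {i\<in>S. f i \<le> v}"

lemma sorted_nth_is_kth:
 fixes xs :: "real list"
 assumes "sorted xs" "k < length xs" "length (filter (\<lambda>x. x < v) xs) \<le> k" "k < length (filter (\<lambda>x. x \<le> v) xs)"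
 shows "xs ! k = v"
proof (rule antisym)
 show "xs ! k \<le> v"
 proof (rule ccontr)
  assume "\<not> xs ! k \<le> v"
  then have "xs ! j > v" if "k \<le> j" "j < length xs" for j
   using sorted_nth_mono[OF assms(1) that] by simp
  then have "{j. j < length xs & xs ! j \<le> v} \<subseteq> {..<k}" by (force simp: not_le[symmetric])
  then have "card {j. j < length xs & xs ! j \<le> v} \<le> k" using card_mono[of "{..<k}"] by fastforce
  then show False using assms(4) by (simp add: length_filter_conv_card)
 qed
 show "v \<le> xs ! k"
 proof (rule ccontr)
  assume "\<not> v \<le> xs ! k"
  then have "xs ! j < v" if "j \<le> k" for j
   using sorted_nth_mono[OF assms(1) that assms(2)] by simp
  then have "{..k} \<subseteq> {j. j < length xs & xs ! j < v}" using assms(2) by auto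
  then have "card {..k} \<le> card {j. j < length xs & xs ! j < v}" by (intro card_mono) auto
  then show False using assms(3) by (simp add: length_filter_conv_card)
 qed
qed

text \<open>Bridge to the definition by a sorted list; afterwards only rank counts matter.\<close>

lemma core_dist_eqI:
 fixes pt :: "nat => 'a::metric_space"
 assumes bij: "bij_betw pt {..<n} P" and k: "1 \<le> k" "k \<le> n"
  and v: "is_kth (\<lambda>j. dist p (pt j)) {..<n} k v"
 shows "core_dist P k p = v"
proof -
 have fin: "finite P" using bij bij_betw_finite by blast
 have P: "mset_set P = image_mset pt (mset_set {..<n})"
  using bij image_mset_mset_set[of pt "{..<n}"] unfolding bij_betw_def by auto
 let ?M = "image_mset (dist p) (mset_set P)"
 let ?xs = "sorted_list_of_multiset ?M"
 have M: "?M = image_mset (\<lambda>j. dist p (pt j)) (mset_set {..<n})"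
  unfolding P by (simp add: multiset.map_comp o_def)
 have len: "length (filter R ?xs) = card {j \<in> {..<n}. R (dist p (pt j))}" for R
 proof -
  have "length (filter R ?xs) = size (filter_mset R (mset ?xs))"
   by (metis mset_filter size_mset)
  also have "mset ?xs = ?M" by simp
  also have "size (filter_mset R ?M) = size (filter_mset (\<lambda>j. R (dist p (pt j))) (mset_set {..<n}))"
   unfolding M by (simp add: filter_mset_image_mset)
  finally show ?thesis by simp
 qed
 have l: "length ?xs = n" using len[of "\<lambda>_. True"] by simp
 show ?thesis
  unfolding core_dist_def
  by (rule sorted_nth_is_kth) (use v k l in \<open>auto simp: is_kth_def len\<close>)
qed

section \<open>Sorted samples with bounded rank error\<close>

definition vlt :: "(nat => real) => nat => nat => bool" where
 "vlt V i j \<longleftrightarrow> V i < V j \<or> V i = V j & i < j"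

lemma vlt_irrefl [simp]: "\<not> vlt V i i" by (simp add: vlt_def)
lemma vlt_trans: "vlt V i j ==> vlt V j k ==> vlt V i k" by (auto simp: vlt_def)
lemma vlt_total: "i \<noteq> j ==> vlt V i j \<or> vlt V j i" by (auto simp: vlt_def)
lemma vlt_asym: "vlt V i j ==> \<not> vlt V j i" by (auto simp: vlt_def)
lemma vlt_nle: "\<not> vlt V i j ==> vlt V k j ==> vlt V k i" using vlt_total vlt_trans by metis

text \<open>\<open>X\<close> consists of \<open>nb\<close> sorted buffers of length \<open>t\<close>.  Buffer \<open>b\<close> is a sample of
 the items \<open>bN, \<dots>, (b+1)N-1\<close> in which every element has weight \<open>w\<close>, with rank error \<open>E\<close>.\<close>

definition buffers :: "(nat => real) => (nat => nat) => nat => nat => nat => nat => nat => bool" where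
 "buffers V X t N nb w E \<longleftrightarrow>
   (\<forall>b<nb. \<forall>j j'. j < j' \<longrightarrow> j' < t \<longrightarrow> vlt V (X (b * t + j)) (X (b * t + j'))) &
   (\<forall>b<nb. \<forall>j<t. b * N \<le> X (b * t + j) & X (b * t + j) < (b + 1) * N) &
   (\<forall>b<nb. \<forall>x. w * card {j. j < t & vlt V (X (b * t + j)) x} \<le> card {i. b * N \<le> i & i < (b + 1) * N & vlt V i x} &
    card {i. b * N \<le> i & i < (b + 1) * N & vlt V i x} \<le> w * card {j. j < t & vlt V (X (b * t + j)) x} + E)"

definition grank :: "(nat => real) => (nat => nat) => nat => nat => nat" where
 "grank V Z n q = card {q'. q' < n & vlt V (Z q') (Z q)}"

text \<open>The elements below any \<open>x\<close> form an initial segment in the order of ranks.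
  The second claim expresses this as a comparison of a rank with a count, which is how kept elements
  are counted later.\<close>

lemma grank_bij:
 assumes "inj_on Z {..<n}"
 shows "bij_betw (grank V Z n) {..<n} {..<n}"
  and "!!q x. q < n ==> vlt V (Z q) x \<longleftrightarrow> grank V Z n q < card {q'. q' < n & vlt V (Z q') x}"
proof -
 show *: "vlt V (Z q) x \<longleftrightarrow> grank V Z n q < card {q'. q' < n & vlt V (Z q') x}" if "q < n" for q x
 proof
  assume "vlt V (Z q) x"
  then have "{q'. q' < n & vlt V (Z q') (Z q)} \<subseteq> {q'. q' < n & vlt V (Z q') x}"
   using vlt_trans by blast
  moreover have "q \<in> {q'. q' < n & vlt V (Z q') x}" using \<open>vlt V (Z q) x\<close> that by simp
  moreover have "q \<notin> {q'. q' < n & vlt V (Z q') (Z q)}" by simp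
  ultimately have "{q'. q' < n & vlt V (Z q') (Z q)} \<subset> {q'. q' < n & vlt V (Z q') x}" by blast
  then show "grank V Z n q < card {q'. q' < n & vlt V (Z q') x}"
   unfolding grank_def by (intro psubset_card_mono) simp_all
 next
  assume l: "grank V Z n q < card {q'. q' < n & vlt V (Z q') x}"
  show "vlt V (Z q) x"
  proof (rule ccontr)
   assume "\<not> vlt V (Z q) x"
   then have "card {q'. q' < n & vlt V (Z q') x} \<le> grank V Z n q"
    unfolding grank_def using vlt_nle[of V "Z q" x] by (intro card_mono) auto
   with l show False by simp
  qed
 qed
 have "inj_on (grank V Z n) {..<n}"
 proof (rule inj_onI)
  fix q q' assume q: "q \<in> {..<n}" "q' \<in> {..<n}" "grank V Z n q = grank V Z n q'"
  then have "\<not> vlt V (Z q) (Z q')" "\<not> vlt V (Z q') (Z q)"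
   using *[of q "Z q'"] *[of q' "Z q"] by (simp_all add: grank_def)
  then have "Z q = Z q'" using vlt_total by blast
  then show "q = q'" using assms q by (auto dest: inj_onD)
 qed
 moreover have "grank V Z n ` {..<n} \<subseteq> {..<n}"
 proof
  fix r assume "r \<in> grank V Z n ` {..<n}"
  then obtain q where q: "q < n" "r = grank V Z n q" by auto
  have "{q'. q' < n & vlt V (Z q') (Z q)} \<subseteq> {..<n}" by auto
  moreover have "q \<in> {..<n}" "q \<notin> {q'. q' < n & vlt V (Z q') (Z q)}" using q by simp_all
  ultimately have "{q'. q' < n & vlt V (Z q') (Z q)} \<subset> {..<n}" by blast
  then have "card {q'. q' < n & vlt V (Z q') (Z q)} < card {..<n}" by (intro psubset_card_mono) simp_all
  then show "r \<in> {..<n}" using q unfolding grank_def by simp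
 qed
 ultimately show "bij_betw (grank V Z n) {..<n} {..<n}"
  unfolding bij_betw_def using endo_inj_surj[of "{..<n}" "grank V Z n"] by blast
qed

lemma card_block_split:
 fixes t k :: nat
 shows "card {q. q < k * t & R q} = (\<Sum>b<k. card {j. j < t & R (b * t + j)})"
proof (induction k)
 case (Suc k)
 have "{q. q < Suc k * t & R q} = {q. q < k * t & R q} \<union> (\<lambda>j. k * t + j) ` {j. j < t & R (k * t + j)}"
 proof (intro equalityI subsetI)
  fix q assume q: "q \<in> {q. q < Suc k * t & R q}"
  show "q \<in> {q. q < k * t & R q} \<union> (\<lambda>j. k * t + j) ` {j. j < t & R (k * t + j)}"
  proof (cases "q < k * t")
   case False
   then have "q = k * t + (q - k * t)" "q - k * t < t" using q by auto
   then show ?thesis using q by (intro UnI2 image_eqI[of _ _ "q - k * t"]) auto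
  qed (use q in auto)
 qed auto
 moreover have "card ((\<lambda>j. k * t + j) ` {j. j < t & R (k * t + j)}) = card {j. j < t & R (k * t + j)}"
  by (intro card_image) (auto intro: inj_onI)
 moreover have "{q. q < k * t & R q} \<inter> (\<lambda>j. k * t + j) ` {j. j < t & R (k * t + j)} = {}" by auto
 ultimately show ?case using Suc by (simp add: card_Un_disjoint)
qed simp

lemma card_range_split:
 fixes N k c :: nat
 shows "card {i. c * (k * N) \<le> i & i < (c + 1) * (k * N) & R i} =
  (\<Sum>b<k. card {i. (c * k + b) * N \<le> i & i < (c * k + b + 1) * N & R i})"
proof -
 have sh: "card {i. a \<le> i & i < a + d & R i} = card {j. j < d & R (a + j)}" for a d :: nat
 proof -
  have "{i. a \<le> i & i < a + d & R i} = (\<lambda>j. a + j) ` {j. j < d & R (a + j)}"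
  proof (intro equalityI subsetI)
   fix i assume i: "i \<in> {i. a \<le> i & i < a + d & R i}"
   then have "i = a + (i - a)" "i - a < d" by auto
   then show "i \<in> (\<lambda>j. a + j) ` {j. j < d & R (a + j)}" using i by (intro image_eqI[of _ _ "i - a"]) auto
  qed auto
  then show ?thesis by (simp add: card_image inj_on_def)
 qed
 have "card {i. c * (k * N) \<le> i & i < (c + 1) * (k * N) & R i} = card {q. q < k * N & R (c * (k * N) + q)}"
  using sh[of "c * (k * N)" "k * N"] by (simp add: algebra_simps)
 also have "\<dots> = (\<Sum>b<k. card {j. j < N & R (c * (k * N) + (b * N + j))})"
  by (rule card_block_split)
 also have "\<dots> = (\<Sum>b<k. card {i. (c * k + b) * N \<le> i & i < (c * k + b + 1) * N & R i})"
  using sh[of "(c * k + b) * N" N for b] by (intro sum.cong) (auto simp: algebra_simps)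
 finally show ?thesis .
qed

text \<open>Counts how many of the kept elements, namely those of rank
  \<open>\<sigma> * r + (\<sigma> - 1)\<close>, are among the \<open>cc\<close> smallest of the
  merged group.\<close>

lemma card_residue:
 fixes \<sigma> t' cc :: nat
 assumes "0 < \<sigma>" "cc \<le> \<sigma> * t'"
 shows "card {r. r < t' & \<sigma> * r + (\<sigma> - 1) < cc} = cc div \<sigma>"
proof -
 have "{r. r < t' & \<sigma> * r + (\<sigma> - 1) < cc} = {..<cc div \<sigma>}"
 proof (intro set_eqI)
  fix r
  have "\<sigma> * r + (\<sigma> - 1) < cc \<longleftrightarrow> (r + 1) * \<sigma> \<le> cc"
   using assms(1) by (auto simp: algebra_simps)
  also have "\<dots> \<longleftrightarrow> r + 1 \<le> cc div \<sigma>" using assms(1) by (simp add: less_eq_div_iff_mult_less_eq)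
  finally have 1: "\<sigma> * r + (\<sigma> - 1) < cc \<longleftrightarrow> r < cc div \<sigma>" by auto
  have "cc div \<sigma> \<le> t'" using assms by (metis div_le_mono nonzero_mult_div_cancel_left not_gr_zero)
  then show "r \<in> {r. r < t' & \<sigma> * r + (\<sigma> - 1) < cc} \<longleftrightarrow> r \<in> {..<cc div \<sigma>}" using 1 by auto
 qed
 then show ?thesis by simp
qed

text \<open>Different buffers sample disjoint ranges of items and each buffer is strictly sorted, so
  no item occurs twice in a group of eight. Hence ranks within the group are distinct.\<close>

lemma buffers_inj:
 assumes B: "buffers V X t N (8 * nb) w E" and g: "g < nb"
 shows "inj_on (\<lambda>q. X (g * (8 * t) + q)) {..<8 * t}"
proof (rule inj_onI)
 fix q q' assume q: "q \<in> {..<8 * t}" "q' \<in> {..<8 * t}" and eq: "X (g * (8 * t) + q) = X (g * (8 * t) + q')"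
 have t: "0 < t" using q by (cases t) auto
 have dec: "g * (8 * t) + q = (g * 8 + q div t) * t + q mod t & g * 8 + q div t < 8 * nb & q mod t < t"
  if "q < 8 * t" for q
 proof -
  have "q div t < 8" using that t by (simp add: div_less_iff_less_mult)
  then have "g * 8 + q div t < 8 * nb" using g by linarith
  then show ?thesis using t by (simp add: algebra_simps)
 qed
 note d = dec[of q] dec[of q']
 let ?b = "g * 8 + q div t" and ?b' = "g * 8 + q' div t"
 have rng: "?b * N \<le> X (?b * t + q mod t)" "X (?b * t + q mod t) < (?b + 1) * N"
  "?b' * N \<le> X (?b' * t + q' mod t)" "X (?b' * t + q' mod t) < (?b' + 1) * N"
  using B d q unfolding buffers_def by auto
 have e: "X (?b * t + q mod t) = X (?b' * t + q' mod t)" using eq d q by auto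
 have bb: "?b = ?b'"
 proof (rule ccontr)
  assume "?b \<noteq> ?b'"
  then have "?b + 1 \<le> ?b' \<or> ?b' + 1 \<le> ?b" by linarith
  then have "(?b + 1) * N \<le> ?b' * N \<or> (?b' + 1) * N \<le> ?b * N" by (meson mult_le_mono1)
  then show False using rng e by linarith
 qed
 have "q mod t = q' mod t"
 proof (rule ccontr)
  assume "q mod t \<noteq> q' mod t"
  then have "vlt V (X (?b * t + q mod t)) (X (?b * t + q' mod t)) \<or> vlt V (X (?b * t + q' mod t)) (X (?b * t + q mod t))"
   using B d q unfolding buffers_def by (metis lessThan_iff linorder_neqE_nat)
  then show False using e bb by auto
 qed
 then show "q = q'" using bb by (metis add_left_cancel div_mod_decomp)
qed

text \<open>The errors of the eight merged buffers add up to \<open>8 * E\<close>; rounding the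
  merged count down to a multiple of \<open>\<sigma>\<close> loses at most
  \<open>\<sigma> - 1\<close> elements of weight \<open>w\<close>. Keeping the last of every
  \<open>\<sigma>\<close> consecutive elements preserves the lower estimate without error.\<close>

lemma buffers_merge:
 assumes B: "buffers V X t N (8 * nb) w E" and t: "0 < t" and \<sigma>: "0 < \<sigma>" "8 * t = \<sigma> * t'"
  and Y: "!!g q. g < nb ==> q < 8 * t ==>
   grank V (\<lambda>q. X (g * (8 * t) + q)) (8 * t) q mod \<sigma> = \<sigma> - 1 ==>
   Y (g * t' + grank V (\<lambda>q. X (g * (8 * t) + q)) (8 * t) q div \<sigma>) = X (g * (8 * t) + q)"
 shows "buffers V Y t' (8 * N) nb (\<sigma> * w) (8 * E + (\<sigma> - 1) * w)"
proof -
 have main: "(\<forall>j j'. j < j' \<longrightarrow> j' < t' \<longrightarrow> vlt V (Y (g * t' + j)) (Y (g * t' + j'))) & (\<forall>j<t'. g * (8 * N) \<le> Y (g * t' + j) & Y (g * t' + j) <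
  (g + 1) * (8 * N)) & (\<forall>x. \<sigma> * w * card {j. j < t' & vlt V (Y (g * t' + j)) x} \<le> card {i. g * (8 * N) \<le> i & i < (g + 1) * (8 * N) & vlt V
  i x} & card {i. g * (8 * N) \<le> i & i < (g + 1) * (8 * N) & vlt V i x} \<le> \<sigma> * w * card {j. j < t' & vlt V (Y (g * t' + j)) x} + (8 * E + (\<sigma>
  - 1) * w))"
  if g: "g < nb" for g
 proof -
  define Z where "Z = (\<lambda>q. X (g * (8 * t) + q))"
  define \<rho> where "\<rho> = grank V Z (8 * t)"
  have inj: "inj_on Z {..<8 * t}" unfolding Z_def by (rule buffers_inj[OF B g])
  note bij = grank_bij(1)[OF inj, of V, folded \<rho>_def] and rkx = grank_bij(2)[OF inj, of _ V, folded \<rho>_def]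
  \<comment> \<open>\<open>\<pi> r\<close> is the place in the group of the element of rank
    \<open>r\<close>.\<close>
  define \<pi> where "\<pi> = inv_into {..<8 * t} \<rho>"
  have pi: "\<pi> r < 8 * t" "\<rho> (\<pi> r) = r" if "r < 8 * t" for r
   using bij that bij_betw_inv_into_right[OF bij] bij_betwE[OF bij_betw_inv_into[OF bij]] unfolding \<pi>_def by auto
  have idx: "\<sigma> * j + (\<sigma> - 1) < 8 * t" if "j < t'" for j
  proof -
   have "\<sigma> * j + (\<sigma> - 1) < \<sigma> * (j + 1)" using \<sigma>(1) by (simp add: algebra_simps)
   also have "\<dots> \<le> \<sigma> * t'" using that by (intro mult_le_mono2) simp
   finally show ?thesis using \<sigma>(2) by simp
  qed
  have YZ: "Y (g * t' + j) = Z (\<pi> (\<sigma> * j + (\<sigma> - 1)))" if j: "j < t'" for j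
  proof -
   let ?r = "\<sigma> * j + (\<sigma> - 1)"
   have "\<sigma> - 1 < \<sigma>" "\<sigma> \<noteq> 0" using \<sigma>(1) by auto
   then have "?r mod \<sigma> = \<sigma> - 1" by (simp only: mod_mult_self4 mod_less)
   moreover have "?r div \<sigma> = j" using \<sigma>(1) by (intro div_nat_eqI) (auto simp: algebra_simps)
   ultimately show ?thesis
    using Y[OF g pi(1)[OF idx[OF j]]] pi(2)[OF idx[OF j]] unfolding \<rho>_def Z_def by simp
  qed
  have Yx: "vlt V (Y (g * t' + j)) x \<longleftrightarrow> \<sigma> * j + (\<sigma> - 1) < card {q. q < 8 * t & vlt V (Z q) x}" if "j < t'" for j x
   using YZ[OF that] rkx[OF pi(1)[OF idx[OF that]]] pi(2)[OF idx[OF that]] by simp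
  have srt: "vlt V (Y (g * t' + j)) (Y (g * t' + j'))" if "j < j'" "j' < t'" for j j'
  proof -
   have jj: "j < t'" using that by simp
   have "card {q. q < 8 * t & vlt V (Z q) (Y (g * t' + j'))} = \<rho> (\<pi> (\<sigma> * j' + (\<sigma> - 1)))"
    unfolding YZ[OF that(2)] \<rho>_def grank_def ..
   also have "\<dots> = \<sigma> * j' + (\<sigma> - 1)" using pi(2)[OF idx[OF that(2)]] .
   finally have "card {q. q < 8 * t & vlt V (Z q) (Y (g * t' + j'))} = \<sigma> * j' + (\<sigma> - 1)" .
   moreover have "\<sigma> * j < \<sigma> * j'" using that \<sigma>(1) by simp
   ultimately show ?thesis unfolding Yx[OF jj] by linarith
  qed
  have rng: "g * (8 * N) \<le> Y (g * t' + j) & Y (g * t' + j) < (g + 1) * (8 * N)" if j: "j < t'" for j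
  proof -
   let ?q = "\<pi> (\<sigma> * j + (\<sigma> - 1))"
   have q: "?q < 8 * t" by (rule pi(1)[OF idx[OF j]])
   have qb: "?q div t < 8" using q t by (simp add: div_less_iff_less_mult)
   let ?b = "g * 8 + ?q div t"
   have b: "?b < 8 * nb" using g qb by linarith
   have eq: "g * (8 * t) + ?q = ?b * t + ?q mod t" by (simp add: algebra_simps)
   have zz: "?b * N \<le> Z ?q & Z ?q < (?b + 1) * N"
    unfolding Z_def eq using B b t unfolding buffers_def by auto
   have "g * 8 \<le> ?b" "?b + 1 \<le> (g + 1) * 8" using qb by auto
   then have "g * (8 * N) \<le> ?b * N" "(?b + 1) * N \<le> (g + 1) * (8 * N)"
    using mult_le_mono1[of "g * 8" ?b N] mult_le_mono1[of "?b + 1" "(g + 1) * 8" N]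
    unfolding mult.assoc by blast+
   with zz show ?thesis unfolding YZ[OF j] by linarith
  qed
  have cnt: "\<sigma> * w * card {j. j < t' & vlt V (Y (g * t' + j)) x} \<le> card {i. g * (8 * N) \<le> i & i < (g + 1) * (8 * N) & vlt V i x} & card
   {i. g * (8 * N) \<le> i & i < (g + 1) * (8 * N) & vlt V i x} \<le> \<sigma> * w * card {j. j < t' & vlt V (Y (g * t' + j)) x} + (8 * E + (\<sigma> - 1) * w)" for x
  proof -
   let ?cc = "card {q. q < 8 * t & vlt V (Z q) x}"
   let ?tru = "\<lambda>b. card {i. (g * 8 + b) * N \<le> i & i < (g * 8 + b + 1) * N & vlt V i x}"
   let ?cb = "\<lambda>b. card {j. j < t & vlt V (X ((g * 8 + b) * t + j)) x}"
   have "?cc \<le> card {..<8 * t}" by (rule card_mono) auto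
   then have le: "?cc \<le> \<sigma> * t'" using \<sigma> by simp
   have "{j. j < t' & vlt V (Y (g * t' + j)) x} = {j. j < t' & \<sigma> * j + (\<sigma> - 1) < ?cc}" using Yx by auto
   then have c1: "card {j. j < t' & vlt V (Y (g * t' + j)) x} = ?cc div \<sigma>"
    using card_residue[OF \<sigma>(1) le] by simp
   have c2: "?cc = (\<Sum>b<8. ?cb b)"
    using card_block_split[of 8 t "\<lambda>q. vlt V (Z q) x"] by (simp add: Z_def algebra_simps)
   have c3: "card {i. g * (8 * N) \<le> i & i < (g + 1) * (8 * N) & vlt V i x} = (\<Sum>b<8. ?tru b)"
    by (rule card_range_split)
   have tb: "w * ?cb b \<le> ?tru b & ?tru b \<le> w * ?cb b + E" if "b < 8" for b
    using B that g unfolding buffers_def by auto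
   have s1: "w * ?cc \<le> (\<Sum>b<8. ?tru b)" unfolding c2 sum_distrib_left using tb by (intro sum_mono) auto
   have "(\<Sum>b<8. ?tru b) \<le> (\<Sum>b<8. w * ?cb b + E)" using tb by (intro sum_mono) auto
   also have "\<dots> = w * ?cc + 8 * E" unfolding c2 by (simp add: sum.distrib sum_distrib_left)
   finally have s2: "(\<Sum>b<8. ?tru b) \<le> w * ?cc + 8 * E" .
   have dm: "?cc = \<sigma> * (?cc div \<sigma>) + ?cc mod \<sigma>" by simp
   have "w * ?cc = \<sigma> * w * (?cc div \<sigma>) + w * (?cc mod \<sigma>)"
    by (subst dm) (simp only: distrib_left mult.assoc mult.left_commute)
   moreover have "?cc mod \<sigma> < \<sigma>" using \<sigma>(1) by simp
   then have "?cc mod \<sigma> \<le> \<sigma> - 1" by linarith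
   then have "w * (?cc mod \<sigma>) \<le> (\<sigma> - 1) * w" by (simp add: mult.commute)
   ultimately show ?thesis unfolding c1 c3 using s1 s2 by linarith
  qed
  show ?thesis using srt rng cnt by blast
 qed
 then show ?thesis unfolding buffers_def by blast
qed

lemma buffers_init: "buffers V (\<lambda>i. i) 1 1 M 1 0"
proof -
 have "{j. j < Suc 0 & R j} = (if R 0 then {0} else {})" for R by auto
 moreover have "{i. b \<le> i & i < Suc b & vlt V i x} = (if vlt V b x then {b} else {})" for b x
  by (auto simp: le_less_Suc_eq)
 ultimately show ?thesis by (auto simp: buffers_def)
qed

text \<open>In a sorted buffer the number of elements below \<open>x\<close> equals the first index
  whose element is not below \<open>x\<close>, or \<open>t\<close> if there is none. In this form
  the rank is a minimum and can be found by priority writes into a cell that starts with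
  \<open>t\<close>.\<close>

lemma Min_rank:
 assumes srt: "!!j j'. j < j' ==> j' < t ==> vlt V (Z j) (Z j')"
 shows "Min (insert t {j. j < t & \<not> vlt V (Z j) x}) = card {j. j < t & vlt V (Z j) x}"
proof -
 define m where "m = Min (insert t {j. j < t & \<not> vlt V (Z j) x})"
 have fin: "finite (insert t {j. j < t & \<not> vlt V (Z j) x})" by simp
 have "m \<in> insert t {j. j < t & \<not> vlt V (Z j) x}" unfolding m_def by (rule Min_in) auto
 then have m: "m = t \<or> m < t & \<not> vlt V (Z m) x" by blast
 have below: "vlt V (Z j) x" if "j < m" "j < t" for j
  using Min_le[OF fin, of j] that unfolding m_def[symmetric] by force
 have "{j. j < t & vlt V (Z j) x} = {..<m}"
 proof (intro set_eqI iffI)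
  fix j assume j: "j \<in> {j. j < t & vlt V (Z j) x}"
  show "j \<in> {..<m}"
  proof (rule ccontr)
   assume "j \<notin> {..<m}"
   then have mj: "m \<le> j" "m < t" using j by auto
   then have nm: "\<not> vlt V (Z m) x" using m by auto
   then have "m \<noteq> j" using j by auto
   then have "vlt V (Z m) (Z j)" using mj j by (intro srt) auto
   then show False using nm j vlt_trans by blast
  qed
 next
  fix j assume j: "j \<in> {..<m}"
  have "m \<le> t" unfolding m_def by (rule Min_le) auto
  then show "j \<in> {j. j < t & vlt V (Z j) x}" using below[of j] j by auto
 qed
 then show ?thesis unfolding m_def[symmetric] by simp
qed

text \<open>Once a single buffer is left, exactly \<open>q\<close> of its elements lie below the one
  at place \<open>q\<close>, so the true rank of that element is known up to
  \<open>E\<close>.\<close>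

lemma pivot_rank:
 assumes B: "buffers V X t N 1 w E" and q: "q < t"
 shows "w * q \<le> card {i. i < N & vlt V i (X q)}" "card {i. i < N & vlt V i (X q)} \<le> w * q + E" "X q < N"
proof -
 have srt: "vlt V (X j) (X j')" if "j < j'" "j' < t" for j j'
  using B that by (auto simp: buffers_def)
 have "{j. j < t & vlt V (X j) (X q)} = {..<q}"
 proof (intro set_eqI iffI)
  fix j assume j: "j \<in> {j. j < t & vlt V (X j) (X q)}"
  show "j \<in> {..<q}"
  proof (rule ccontr)
   assume "j \<notin> {..<q}"
   then have "j = q \<or> q < j" by auto
   then show False using j srt[of q j] vlt_asym[of V "X q" "X j"] by auto
  qed
 qed (use srt q in auto)
 then have c: "card {j. j < t & vlt V (X j) (X q)} = q" by simp
 have "w * card {j. j < t & vlt V (X j) (X q)} \<le> card {i. i < N & vlt V i (X q)} & card {i. i < N & vlt V i (X q)} \<le> w * card {j. j < t &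
  vlt V (X j) (X q)} + E"
  using B by (simp add: buffers_def)
 then show "w * q \<le> card {i. i < N & vlt V i (X q)}" "card {i. i < N & vlt V i (X q)} \<le> w * q + E"
  unfolding c by auto
 show "X q < N" using B q by (simp add: buffers_def)
qed

section \<open>Discarding blocks by a pivot\<close>

definition cov :: "nat => nat => nat set => nat set" where
 "cov n bs S = {j. j < n & j div bs \<in> S}"

lemma finite_cov [simp]: "finite (cov n bs S)" by (simp add: cov_def)

text \<open>\<open>A\<close> lists the alive blocks and \<open>V\<close> their minima. A block may
  lie beyond \<open>n\<close>, partly or completely; \<open>BIG\<close>, larger than all distances,
  is the minimum of a block without positions.\<close>

locale filter_step =
 fixes n bs B K :: nat and D :: "nat => real" and BIG :: real and A :: "nat => nat" and V :: "nat => real"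
 assumes big: "!!j. j < n ==> D j < BIG"
  and inj: "inj_on A {..<B}"
  and V: "!!i. i < B ==> V i = Min (insert BIG (D ` {j. j < n & j div bs = A i}))"
  and K: "1 \<le> K" "K \<le> card (cov n bs (A ` {..<B}))"
begin

definition kept :: "nat => nat set" where
 "kept \<pi> = {i. i < B & (vlt V i \<pi> \<or> i = \<pi>)}"

lemma finite_kept [simp]: "finite (kept \<pi>)" by (simp add: kept_def)

lemma V_le: "i < B ==> j < n ==> j div bs = A i ==> V i \<le> D j"
 using V by (auto intro: Min_le)

lemma V_rep:
 assumes "i < B" "V i < BIG"
 shows "\<exists>j. j < n & j div bs = A i & D j = V i"
proof -
 have "V i \<in> insert BIG (D ` {j. j < n & j div bs = A i})"
  unfolding V[OF assms(1)] by (rule Min_in) auto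
 then show ?thesis using assms(2) by auto
qed

lemma V_big: "i < B ==> V i \<le> BIG" using V by (auto intro: Min_le)

lemma not_kept_ge: "i < B ==> i \<notin> kept \<pi> ==> V \<pi> \<le> V i"
 using vlt_total[of i \<pi> V] by (auto simp: kept_def vlt_def)

lemma kept_le: "i \<in> kept \<pi> ==> V i \<le> V \<pi>" by (auto simp: kept_def vlt_def)

text \<open>Different blocks are disjoint, so positions attaining the minima of the kept blocks are
  distinct.\<close>

lemma kept_reps:
 assumes lt: "V \<pi> < BIG" and R: "!!i j. i \<in> kept \<pi> ==> j < n ==> j div bs = A i ==> D j = V i ==> j \<in> R"
  and fin: "finite R"
 shows "card (kept \<pi>) \<le> card R"
proof -
 have "\<forall>i\<in>kept \<pi>. \<exists>j. j < n & j div bs = A i & D j = V i"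
  using V_rep kept_le lt by (fastforce simp: kept_def)
 then obtain f where f: "\<forall>i\<in>kept \<pi>. f i < n & f i div bs = A i & D (f i) = V i" by metis
 have "inj_on f (kept \<pi>)"
 proof (rule inj_onI)
  fix x y assume xy: "x \<in> kept \<pi>" "y \<in> kept \<pi>" "f x = f y"
  then have "A x = A y" using f by metis
  then show "x = y" using xy inj by (auto simp: kept_def dest: inj_onD)
 qed
 moreover have "f ` kept \<pi> \<subseteq> R" using f R by auto
 ultimately show ?thesis using fin by (rule card_inj_on_le)
qed

lemma dropped_ge:
 assumes "j \<in> cov n bs (A ` {..<B}) - cov n bs (A ` kept \<pi>)"
 shows "V \<pi> \<le> D j" "j < n"
proof -
 from assms obtain i where i: "i < B" "j < n" "j div bs = A i" by (auto simp: cov_def)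
 then have "i \<notin> kept \<pi>" using assms by (auto simp: cov_def)
 then show "V \<pi> \<le> D j" "j < n" using i V_le[OF i] not_kept_ge[of i \<pi>] by auto
qed

lemma cov_mono: "cov n bs (A ` kept \<pi>) \<subseteq> cov n bs (A ` {..<B})" by (auto simp: cov_def kept_def)

text \<open>Every discarded distance is at least \<open>V \<pi>\<close>, while the kept blocks alone
  provide at least \<open>K\<close> distances up to \<open>V \<pi>\<close>. This works for every
  block size.\<close>

lemma filter_low:
 assumes r: "K \<le> card (kept \<pi>)"
 shows "K \<le> card (cov n bs (A ` kept \<pi>))"
  and "is_kth D (cov n bs (A ` kept \<pi>)) K v ==> is_kth D (cov n bs (A ` {..<B})) K v"
proof -
 show "K \<le> card (cov n bs (A ` kept \<pi>))"
 proof (cases "V \<pi> < BIG")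
  case True
  have "card (kept \<pi>) \<le> card (cov n bs (A ` kept \<pi>))"
   by (rule kept_reps[OF True]) (auto simp: cov_def)
  then show ?thesis using r by simp
 next
  case False
  have "cov n bs (A ` {..<B}) - cov n bs (A ` kept \<pi>) = {}"
   using dropped_ge[of _ \<pi>] big False by fastforce
  then have "cov n bs (A ` kept \<pi>) = cov n bs (A ` {..<B})" using cov_mono by blast
  then show ?thesis using K by simp
 qed
next
 assume k: "is_kth D (cov n bs (A ` kept \<pi>)) K v"
 have "card {i \<in> cov n bs (A ` kept \<pi>). D i \<le> v} \<le> card {i \<in> cov n bs (A ` {..<B}). D i \<le> v}"
  using cov_mono[of \<pi>] by (intro card_mono) auto
 then have "K \<le> card {i \<in> cov n bs (A ` {..<B}). D i \<le> v}"
  using k unfolding is_kth_def by linarith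
 moreover have "card {i \<in> cov n bs (A ` {..<B}). D i < v} < K"
 \<comment> \<open>A discarded distance below \<open>v\<close> would force
   \<open>V \<pi> < v\<close>; then the kept blocks alone would contain \<open>K\<close> distances
   below \<open>v\<close>, contrary to the choice of \<open>v\<close>.\<close>
 proof (cases "\<exists>j \<in> cov n bs (A ` {..<B}) - cov n bs (A ` kept \<pi>). D j < v")
  case True
  then obtain j where j: "j \<in> cov n bs (A ` {..<B}) - cov n bs (A ` kept \<pi>)" "D j < v" by blast
  have lt: "V \<pi> < BIG" "V \<pi> < v" using dropped_ge[OF j(1)] big[of j] j(2) by auto
  have "card (kept \<pi>) \<le> card {i \<in> cov n bs (A ` kept \<pi>). D i < v}"
  proof (rule kept_reps[OF lt(1)])
   fix i j assume "i \<in> kept \<pi>" "j < n" "j div bs = A i" "D j = V i"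
   then show "j \<in> {i \<in> cov n bs (A ` kept \<pi>). D i < v}"
    using kept_le[of i \<pi>] lt(2) by (auto simp: cov_def)
  qed simp
  then show ?thesis using r k by (simp add: is_kth_def)
 next
  case False
  then have "{i \<in> cov n bs (A ` {..<B}). D i < v} = {i \<in> cov n bs (A ` kept \<pi>). D i < v}"
   using cov_mono[of \<pi>] by blast
  then show ?thesis using k by (simp add: is_kth_def)
 qed
 ultimately show "is_kth D (cov n bs (A ` {..<B})) K v" by (simp add: is_kth_def)
qed

lemma V_single: "bs = 1 ==> i < B ==> V i = (if A i < n then D (A i) else BIG)"
proof -
 assume bs: "bs = 1" and i: "i < B"
 have "{j. j < n & j div bs = A i} = (if A i < n then {A i} else {})" using bs by auto
 then show ?thesis unfolding V[OF i] using big[of "A i"] by simp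
qed

text \<open>Removing the low side is sound only if all distances in the removed blocks are at most
  the pivot, and minima ensure this just for blocks of size one. The sought rank drops by the number
  of removed distances.\<close>

lemma filter_high:
 assumes bs: "bs = 1" and r: "card (kept \<pi>) < K"
 shows "K - card (kept \<pi>) \<le> card (cov n bs (A ` ({..<B} - kept \<pi>)))"
  and "is_kth D (cov n bs (A ` ({..<B} - kept \<pi>))) (K - card (kept \<pi>)) v ==> is_kth D (cov n bs (A ` {..<B})) K v"
proof -
 let ?k = "kept \<pi>"
 let ?C = "cov n bs (A ` {..<B})" and ?C' = "cov n bs (A ` ({..<B} - ?k))"
 have Ak: "card (A ` ?k) = card ?k"
  by (intro card_image inj_on_subset[OF inj]) (auto simp: kept_def)
 have lt: "V \<pi> < BIG"
 proof (rule ccontr)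
  assume n: "\<not> V \<pi> < BIG"
  have "?C \<subseteq> A ` ?k"
  proof
   fix j assume "j \<in> ?C"
   then obtain i where i: "i < B" "j = A i" "j < n" using bs by (auto simp: cov_def)
   have "V i < BIG" using V_single[OF bs i(1)] i big by auto
   then have "i \<in> ?k" using not_kept_ge[OF i(1), of \<pi>] n by auto
   then show "j \<in> A ` ?k" using i by auto
  qed
  then have "card ?C \<le> card ?k" using card_mono[of "A ` ?k" ?C] Ak by simp
  then show False using r K by simp
 qed
 have kn: "A i < n & D (A i) = V i" if "i \<in> ?k" for i
  using V_single[OF bs, of i] kept_le[OF that] lt that by (auto simp: kept_def split: if_splits)
 have un: "?C = A ` ?k \<union> ?C'" using kn bs by (auto simp: cov_def kept_def)
 have dj: "A ` ?k \<inter> ?C' = {}" using inj bs by (auto simp: cov_def kept_def dest: inj_onD)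
 have "card ?C = card ?k + card ?C'" unfolding un using dj Ak by (subst card_Un_disjoint) auto
 then show "K - card ?k \<le> card ?C'" using K by simp
 assume k: "is_kth D ?C' (K - card ?k) v"
 have "0 < card {i \<in> ?C'. D i \<le> v}" using k r by (simp add: is_kth_def)
 then obtain j where j: "j \<in> ?C'" "D j \<le> v" by (metis (no_types, lifting) card_gt_0_iff ex_in_conv mem_Collect_eq)
 then obtain i where i: "i < B" "i \<notin> ?k" "j = A i" "j < n" using bs by (auto simp: cov_def)
 have "V \<pi> \<le> v" using not_kept_ge[OF i(1,2)] V_single[OF bs i(1)] i j by auto
 then have all: "D (A i) \<le> v" if "i \<in> ?k" for i using kn[OF that] kept_le[OF that] by auto
 have "{i \<in> ?C. D i \<le> v} = A ` ?k \<union> {i \<in> ?C'. D i \<le> v}" unfolding un using all by auto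
 then have "card {i \<in> ?C. D i \<le> v} = card ?k + card {i \<in> ?C'. D i \<le> v}"
  using dj Ak by (subst (asm) (2) arg_cong[where f = card]) (auto intro!: card_Un_disjoint[THEN trans])
 moreover have "card {i \<in> ?C. D i < v} \<le> card (A ` ?k \<union> {i \<in> ?C'. D i < v})"
  unfolding un by (intro card_mono) auto
 then have "card {i \<in> ?C. D i < v} \<le> card ?k + card {i \<in> ?C'. D i < v}"
  using card_Un_le[of "A ` ?k" "{i \<in> ?C'. D i < v}"] Ak by linarith
 ultimately show "is_kth D ?C K v" using k r by (auto simp: is_kth_def)
qed

text \<open>Slots from \<open>B\<close> to \<open>M\<close> are padding with value
  \<open>BIG\<close>. At least \<open>K\<close> positions have distances below \<open>BIG\<close>,
  so the slot with \<open>K - 1\<close> predecessors is neither padding nor an empty block.\<close>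

lemma final_select:
 assumes bs: "bs = 1" and M: "B \<le> M" "!!i. B \<le> i ==> i < M ==> V i = BIG"
  and x: "x < M" "card {i. i < M & vlt V i x} = K - 1"
 shows "is_kth D (cov n bs (A ` {..<B})) K (V x)"
proof -
 let ?C = "cov n bs (A ` {..<B})"
 have Vb: "V i \<le> BIG" if "i < M" for i using V_big M(2)[of i] that by (cases "i < B") auto
 let ?R = "{i. i < B & A i < n}"
 have CR: "?C = A ` ?R" using bs by (auto simp: cov_def)
 have injR: "inj_on A ?R" by (rule inj_on_subset[OF inj]) auto
 have Vx: "V x < BIG"
 proof (rule ccontr)
  assume n: "\<not> V x < BIG"
  have "?R \<subseteq> {i. i < M & vlt V i x}"
  proof
   fix i assume "i \<in> ?R"
   then have i: "i < B" "A i < n" by auto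
   then have "V i < BIG" using V_single[OF bs i(1)] big by auto
   then show "i \<in> {i. i < M & vlt V i x}" using i M(1) n by (auto simp: vlt_def)
  qed
  then have "card ?R \<le> K - 1" using card_mono[of "{i. i < M & vlt V i x}" ?R] x(2) by simp
  moreover have "card ?C = card ?R" unfolding CR by (rule card_image[OF injR])
  ultimately show False using K by simp
 qed
 have real: "i < B & A i < n & D (A i) = V i" if "i < M" "V i < BIG" for i
  using that M(2)[of i] V_single[OF bs, of i] by (cases "i < B") (auto split: if_splits)
 have lt: "card {j \<in> ?C. D j < V x} \<le> K - 1"
 proof -
  have "{j \<in> ?C. D j < V x} \<subseteq> A ` {i. i < M & vlt V i x}"
  proof
   fix j assume "j \<in> {j \<in> ?C. D j < V x}"
   then obtain i where i: "i < B" "A i < n" "j = A i" "D j < V x" unfolding CR by auto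
   then have "vlt V i x" using V_single[OF bs i(1)] by (simp add: vlt_def)
   then show "j \<in> A ` {i. i < M & vlt V i x}" using i M(1) by auto
  qed
  then have "card {j \<in> ?C. D j < V x} \<le> card (A ` {i. i < M & vlt V i x})" by (intro card_mono) auto
  also have "\<dots> \<le> card {i. i < M & vlt V i x}" by (rule card_image_le) simp
  finally show ?thesis using x(2) by simp
 qed
 let ?T = "insert x {i. i < M & vlt V i x}"
 have T: "i < B & A i < n & D (A i) = V i & V i \<le> V x" if "i \<in> ?T" for i
 proof -
  have "i < M" "V i \<le> V x" using that x(1) by (auto simp: vlt_def)
  then show ?thesis using real[of i] Vx by auto
 qed
 have "card ?T = K" using x K by simp
 moreover have "card (A ` ?T) = card ?T" by (intro card_image inj_on_subset[OF inj]) (use T in auto)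
 moreover have "A ` ?T \<subseteq> {j \<in> ?C. D j \<le> V x}" using T unfolding CR by fastforce
 then have "card (A ` ?T) \<le> card {j \<in> ?C. D j \<le> V x}" by (intro card_mono) auto
 ultimately show ?thesis using lt K by (simp add: is_kth_def)
qed

end

lemma cov_split:
 assumes "0 < c"
 shows "cov n (2 * c) S = cov n c ((\<lambda>a. 2 * a) ` S \<union> (\<lambda>a. 2 * a + 1) ` S)"
proof -
 have "j div (2 * c) \<in> S \<longleftrightarrow> j div c \<in> (\<lambda>a. 2 * a) ` S \<union> (\<lambda>a. 2 * a + 1) ` S" for j
 proof -
  have e: "j div (2 * c) = (j div c) div 2" by (simp add: div_mult2_eq mult.commute)
  show ?thesis
  proof
   assume "j div (2 * c) \<in> S"
   moreover have "j div c = 2 * (j div c div 2) \<or> j div c = 2 * (j div c div 2) + 1" by linarith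
   ultimately show "j div c \<in> (\<lambda>a. 2 * a) ` S \<union> (\<lambda>a. 2 * a + 1) ` S" unfolding e by blast
  qed (auto simp: e)
 qed
 then show ?thesis by (simp add: cov_def)
qed

lemma cov_all: "n \<le> bs ==> cov n bs {0} = {..<n}"
 by (auto simp: cov_def)

section \<open>A criterion for minimum spanning trees\<close>

definition conn :: "'a set set => 'a => 'a => bool" where
 "conn T p q \<longleftrightarrow> (p, q) \<in> {(x, y). {x, y} \<in> T}\<^sup>*"

lemma conn_refl [simp]: "conn T p p" by (simp add: conn_def)

lemma conn_trans: "conn T p q ==> conn T q r ==> conn T p r" by (simp add: conn_def)

lemma conn_edge: "{p, q} \<in> T ==> conn T p q" by (auto simp: conn_def)

lemma conn_step: "conn T p q ==> {q, r} \<in> T ==> conn T p r"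
 using conn_trans conn_edge by metis

lemma conn_induct [consumes 1, case_names refl step]:
 assumes "conn T p q" "Q p" "!!x y. conn T p x ==> {x, y} \<in> T ==> Q x ==> Q y"
 shows "Q q"
 using assms(1) unfolding conn_def
proof (induction rule: rtrancl_induct)
 case (step y z)
 then show ?case using assms(3) unfolding conn_def by auto
qed (rule assms(2))

lemma conn_sym: "conn T p q ==> conn T q p"
proof (induction rule: conn_induct)
 case (step x y)
 have "{y, x} \<in> T" using step.hyps(2) by (simp only: insert_commute)
 from conn_trans[OF conn_edge[OF this] step.IH] show ?case .
qed simp

lemma conn_mono:
 assumes "conn T p q" "T \<subseteq> T'"
 shows "conn T' p q"
proof -
 have "{(x, y). {x, y} \<in> T} \<subseteq> {(x, y). {x, y} \<in> T'}" using assms(2) by auto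
 then show ?thesis using assms(1) rtrancl_mono unfolding conn_def by blast
qed

lemma conn_subst:
 assumes "conn T p q" "!!x y. {x, y} \<in> T ==> conn T' x y"
 shows "conn T' p q"
 using assms(1)
proof (induction rule: conn_induct)
 case (step x y)
 then show ?case using assms(2)[of x y] conn_trans[of T' p x y] by simp
qed simp

lemma connects_iff: "connects V T \<longleftrightarrow> (\<forall>p\<in>V. \<forall>q\<in>V. conn T p q)"
 by (simp add: connects_def conn_def)

lemma conn_insert:
 "conn (insert {a, b} T) x y \<longleftrightarrow>
   conn T x y \<or> conn T x a & conn T b y \<or> conn T x b & conn T a y" (is "?L \<longleftrightarrow> ?R")
proof
 assume ?L
 then show ?R
 proof (induction rule: conn_induct)
  case (step y z)
  then consider "{y, z} = {a, b}" | "{y, z} \<in> T" by blast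
  then show ?case
  proof cases
   case 1
   then have "y = a & z = b \<or> y = b & z = a" by (auto simp: doubleton_eq_iff)
   then show ?thesis using step.IH by auto
  next
   case 2
   then show ?thesis using step.IH conn_step[of T _ y z] by blast
  qed
 qed simp
next
 have m: "conn (insert {a, b} T) u v" if "conn T u v" for u v
  using that by (rule conn_mono) auto
 have e: "conn (insert {a, b} T) a b" "conn (insert {a, b} T) b a"
  by (auto intro!: conn_edge simp: insert_commute)
 assume ?R
 then consider "conn T x y" | "conn T x a" "conn T b y" | "conn T x b" "conn T a y" by blast
 then show ?L
 proof cases
  case 1
  then show ?thesis by (rule m)
 next
  case 2
  from conn_trans[OF conn_trans[OF m[OF 2(1)] e(1)] m[OF 2(2)]] show ?thesis .
 next
  case 3
  from conn_trans[OF conn_trans[OF m[OF 3(1)] e(2)] m[OF 3(2)]] show ?thesis .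
 qed
qed

section \<open>Counting components of edge sets\<close>

definition cls :: "'a set => 'a set set => 'a => 'a set" where
 "cls V T v = {u \<in> V. conn T v u}"

definition ncomp :: "'a set => 'a set set => nat" where
 "ncomp V T = card (cls V T ` V)"

lemma cls_eq_iff:
 assumes "v \<in> V"
 shows "cls V T u = cls V T v \<longleftrightarrow> conn T u v"
proof
 assume "cls V T u = cls V T v"
 then have "v \<in> cls V T u" using assms by (simp add: cls_def)
 then show "conn T u v" by (simp add: cls_def)
next
 assume "conn T u v"
 then have "conn T u w \<longleftrightarrow> conn T v w" for w using conn_sym conn_trans by metis
 then show "cls V T u = cls V T v" by (simp add: cls_def)
qed

lemma ncomp_insert:
 assumes V: "finite V" and ab: "a \<in> V" "b \<in> V"
 shows "conn T a b ==> ncomp V (insert {a, b} T) = ncomp V T"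
  and "\<not> conn T a b ==> ncomp V (insert {a, b} T) + 1 = ncomp V T"
proof -
 assume c: "conn T a b"
 have "conn (insert {a, b} T) x y \<longleftrightarrow> conn T x y" for x y
  unfolding conn_insert using c conn_sym[of T] conn_trans[of T] by blast
 then show "ncomp V (insert {a, b} T) = ncomp V T" by (simp add: ncomp_def cls_def)
next
 assume c: "\<not> conn T a b"
 let ?C = "cls V T" and ?C' = "cls V (insert {a, b} T)"
 let ?U = "?C a \<union> ?C b"
 have C': "?C' v = (if conn T a v \<or> conn T b v then ?U else ?C v)" for v
 proof -
  have "conn (insert {a, b} T) v w \<longleftrightarrow> conn T a w \<or> conn T b w" if "conn T a v \<or> conn T b v" for w
   unfolding conn_insert using that conn_sym[of T] conn_trans[of T] by blast
  moreover have "conn (insert {a, b} T) v w \<longleftrightarrow> conn T v w" if "\<not> (conn T a v \<or> conn T b v)" for w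
   unfolding conn_insert using that conn_sym[of T] by blast
  ultimately show ?thesis unfolding cls_def by auto
 qed
 \<comment> \<open>The new edge replaces the classes of its two ends by their union and leaves all
   others alone.\<close>
 have img: "?C' ` V = insert ?U (?C ` V - {?C a, ?C b})"
 proof (intro equalityI subsetI)
  fix X assume "X \<in> ?C' ` V"
  then obtain v where v: "v \<in> V" "X = ?C' v" by auto
  show "X \<in> insert ?U (?C ` V - {?C a, ?C b})"
  proof (cases "conn T a v \<or> conn T b v")
   case False
   then have "?C v \<noteq> ?C a" "?C v \<noteq> ?C b" using v ab cls_eq_iff conn_sym by metis+
   then show ?thesis using v C'[of v] False by auto
  qed (use v C'[of v] in auto)
 next
  fix X assume "X \<in> insert ?U (?C ` V - {?C a, ?C b})"
  then consider "X = ?U" | v where "v \<in> V" "X = ?C v" "?C v \<noteq> ?C a" "?C v \<noteq> ?C b" by auto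
  then show "X \<in> ?C' ` V"
  proof cases
   case 1
   then show ?thesis using C'[of a] ab by (intro image_eqI[of _ _ a]) auto
  next
   case 2
   then have "\<not> conn T a v" "\<not> conn T b v" using ab cls_eq_iff conn_sym by metis+
   then show ?thesis using C'[of v] 2 by (intro image_eqI[of _ _ v]) auto
  qed
 qed
 have ne: "?C a \<noteq> ?C b" using c ab cls_eq_iff by metis
 have aU: "a \<in> ?U" "b \<in> ?U" using ab by (auto simp: cls_def)
 have nin: "?U \<notin> ?C ` V"
 proof
  assume "?U \<in> ?C ` V"
  then obtain v where v: "v \<in> V" "?U = ?C v" by auto
  then have "conn T v a" "conn T v b" using aU by (auto simp: cls_def)
  then show False using c conn_sym conn_trans by metis
 qed
 have 2: "card (?C ` V - {?C a, ?C b}) = card (?C ` V) - 2"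
  using ne ab by (subst card_Diff_subset) auto
 have "card {?C a, ?C b} \<le> card (?C ` V)" using V ab by (intro card_mono) auto
 then have "2 \<le> card (?C ` V)" using ne by simp
 then show "ncomp V (insert {a, b} T) + 1 = ncomp V T"
  unfolding ncomp_def img using V nin 2 by simp
qed

lemma ncomp_empty: "finite V ==> ncomp V {} = card V"
proof -
 have "conn {} x y \<longleftrightarrow> x = y" for x y :: 'a by (auto simp: conn_def)
 then have "inj_on (cls V {}) V" by (auto intro!: inj_onI simp: cls_def)
 then show ?thesis by (simp add: ncomp_def card_image)
qed

lemma complete_edgesE:
 assumes "e \<in> complete_edges V"
 obtains a b where "e = {a, b}" "a \<in> V" "b \<in> V" "a \<noteq> b"
 using assms by (auto simp: complete_edges_def)

lemma finite_complete_edges: "finite V ==> finite (complete_edges V)"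
 by (rule finite_subset[of _ "Pow V"]) (auto simp: complete_edges_def)

lemma ncomp_ge:
 assumes V: "finite V" and T: "T \<subseteq> complete_edges V"
 shows "card V \<le> ncomp V T + card T"
proof -
 have "finite T" using assms finite_complete_edges finite_subset by blast
 then show ?thesis using T
 proof (induction T rule: finite_induct)
  case empty
  then show ?case using ncomp_empty[OF V] by simp
 next
  case (insert e T)
  then obtain a b where e: "e = {a, b}" "a \<in> V" "b \<in> V" by (auto elim: complete_edgesE)
  then have "ncomp V T \<le> ncomp V (insert e T) + 1"
   using ncomp_insert[OF V e(2,3), of T] by (cases "conn T a b") auto
  then show ?case using insert by simp
 qed
qed

lemma conn_path:
 assumes "conn T a b"
 shows "\<exists>vs. vs \<noteq> [] & hd vs = a & last vs = b & distinct vs &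
  (\<forall>i. Suc i < length vs \<longrightarrow> {vs ! i, vs ! Suc i} \<in> T)"
 using assms
proof (induction rule: conn_induct)
 case refl
 then show ?case by (intro exI[of _ "[a]"]) auto
next
 case (step x y)
 then obtain vs where vs: "vs \<noteq> []" "hd vs = a" "last vs = x" "distinct vs"
  "!!i. Suc i < length vs ==> {vs ! i, vs ! Suc i} \<in> T" by blast
 show ?case
 proof (cases "y \<in> set vs")
  case True
  then obtain k where k: "k < length vs" "vs ! k = y" by (metis in_set_conv_nth)
  let ?w = "take (Suc k) vs"
  have "last ?w = y" using k by (simp add: take_Suc_conv_app_nth)
  moreover have "hd ?w = a" using vs by (cases vs) auto
  ultimately show ?thesis using vs k by (intro exI[of _ ?w]) auto
 next
  case False
  let ?w = "vs @ [y]"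
  have "{?w ! i, ?w ! Suc i} \<in> T" if "Suc i < length ?w" for i
  proof (cases "Suc i < length vs")
   case True
   then show ?thesis using vs(5) by (simp add: nth_append)
  next
   case False
   then have i: "i = length vs - 1" "i < length vs" using that vs(1) by (auto simp: Suc_lessI)
   then have "?w ! i = x" "?w ! Suc i = y" using vs by (auto simp: nth_append last_conv_nth)
   then show ?thesis using step.hyps by simp
  qed
  then show ?thesis using vs False by (intro exI[of _ ?w]) auto
 qed
qed

text \<open>A simple path from \<open>a\<close> to \<open>b\<close> that avoids the edge
  \<open>{a, b}\<close> has at least three vertices, so the edge closes it to a cycle.\<close>

lemma acyclic_insert_not_conn:
 assumes "\<nexists>vs. is_cycle (insert {a, b} T) vs" "{a, b} \<notin> T" "a \<noteq> b"
 shows "\<not> conn T a b"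
proof
 assume "conn T a b"
 from conn_path[OF this] obtain vs where vs: "vs \<noteq> []" "hd vs = a" "last vs = b" "distinct vs"
  "!!i. Suc i < length vs ==> {vs ! i, vs ! Suc i} \<in> T" by blast
 have ab: "vs ! 0 = a" "vs ! (length vs - 1) = b" using vs by (auto simp: hd_conv_nth last_conv_nth)
 have "3 \<le> length vs"
 proof (rule ccontr)
  assume "\<not> 3 \<le> length vs"
  moreover have "length vs \<noteq> 1" using ab assms(3) by auto
  moreover have "length vs \<noteq> 0" using vs(1) by simp
  ultimately have "length vs = 2" by arith
  then show False using vs(5)[of 0] ab assms(2) by simp
 qed
 moreover have "{vs ! i, vs ! (Suc i mod length vs)} \<in> insert {a, b} T" if "i < length vs" for i
 proof (cases "Suc i = length vs")
  case True
  then have "i = length vs - 1" by arith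
  with True have "vs ! i = b" "Suc i mod length vs = 0" using ab by (simp_all only: mod_self)
  then show ?thesis using ab by (simp add: insert_commute)
 next
  case False
  then show ?thesis using that vs(5)[of i] by simp
 qed
 ultimately have "is_cycle (insert {a, b} T) vs" using vs by (simp add: is_cycle_def)
 with assms show False by blast
qed

lemma is_cycle_mono: "is_cycle T vs ==> T \<subseteq> T' ==> is_cycle T' vs"
 by (auto simp: is_cycle_def)

lemma ncomp_acyclic:
 assumes V: "finite V" and T: "T \<subseteq> complete_edges V" and ac: "\<nexists>vs. is_cycle T vs"
 shows "ncomp V T + card T = card V"
proof -
 have "finite T" using assms finite_complete_edges finite_subset by blast
 then show ?thesis using T ac
 proof (induction T rule: finite_induct)
  case empty
  then show ?case using ncomp_empty[OF V] by simp
 next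
  case (insert e T)
  then obtain a b where e: "e = {a, b}" "a \<in> V" "b \<in> V" "a \<noteq> b" by (auto elim: complete_edgesE)
  have "\<not> conn T a b" using insert e by (intro acyclic_insert_not_conn) auto
  then have "ncomp V (insert e T) + 1 = ncomp V T"
   using ncomp_insert[OF V e(2,3), of T] e by auto
  moreover have "\<nexists>vs. is_cycle T vs"
   using insert.prems(2) is_cycle_mono[OF _ subset_insertI[of T e]] by blast
  ultimately show ?case using insert by simp
 qed
qed

lemma ncomp_mono:
 assumes V: "finite V" and "!!x y. {x, y} \<in> A ==> conn B x y"
 shows "ncomp V B \<le> ncomp V A"
proof -
 have "cls V B u = cls V B v" if "u \<in> V" "v \<in> V" "cls V A u = cls V A v" for u v
 proof -
  have "conn A u v" using that cls_eq_iff by metis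
  then have "conn B u v" using assms(2) by (rule conn_subst)
  then show ?thesis using that cls_eq_iff by metis
 qed
 then have "\<forall>X\<in>cls V A ` V. \<exists>Y. \<forall>v\<in>V. cls V A v = X \<longrightarrow> cls V B v = Y" by blast
 then obtain f where f: "\<forall>X\<in>cls V A ` V. \<forall>v\<in>V. cls V A v = X \<longrightarrow> cls V B v = f X"
  by (rule bchoice[THEN exE])
 have "cls V B ` V \<subseteq> f ` (cls V A ` V)" using f by auto
 then show ?thesis unfolding ncomp_def using V by (intro surj_card_le) auto
qed

text \<open>A forest has exactly \<open>card V\<close> minus the number of its components many
  edges, and no edge set has fewer; \<open>B\<close> has at most as many components as
  \<open>A\<close>.\<close>

lemma forest_card_le:
 assumes V: "finite V" and A: "A \<subseteq> complete_edges V" "\<nexists>vs. is_cycle A vs"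
  and B: "B \<subseteq> complete_edges V" and AB: "!!x y. {x, y} \<in> A ==> conn B x y"
 shows "card A \<le> card B"
proof -
 have "ncomp V B \<le> ncomp V A" by (rule ncomp_mono[OF V AB])
 then show ?thesis using ncomp_acyclic[OF V A] ncomp_ge[OF V B] by linarith
qed

lemma connected_card:
 assumes V: "finite V" and T: "T \<subseteq> complete_edges V" "connects V T"
 shows "card V \<le> card T + 1"
proof (cases "V = {}")
 case False
 then obtain v where v: "v \<in> V" by auto
 have "cls V T ` V = {V}" using v T(2) by (auto simp: cls_def connects_iff)
 then show ?thesis using ncomp_ge[OF V T(1)] by (simp add: ncomp_def)
qed simp

text \<open>Lets acyclicity be derived by counting: an edge on a cycle could be dropped, which would
  leave a connected set with too few edges.\<close>

lemma cycle_remove: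
 assumes cyc: "is_cycle T vs" and T: "connects V T"
 shows "\<exists>e\<in>T. connects V (T - {e})"
proof -
 let ?n = "length vs"
 from cyc have n: "3 \<le> ?n" "distinct vs" "!!i. i < ?n ==> {vs ! i, vs ! (Suc i mod ?n)} \<in> T"
  by (auto simp: is_cycle_def)
 let ?a = "vs ! (?n - 1)" and ?b = "vs ! 0"
 let ?e = "{?a, ?b}"
 have "Suc (?n - 1) mod ?n = 0" using n(1) by (cases ?n) auto
 then have e: "?e \<in> T" using n(3)[of "?n - 1"] n(1) by simp
 have "conn (T - {?e}) ?b (vs ! i)" if "i < ?n" for i
  using that
 proof (induction i)
  case (Suc i)
  have "{vs ! i, vs ! Suc i} \<in> T" using n(3)[of i] Suc.prems by simp
  moreover have "{vs ! i, vs ! Suc i} \<noteq> ?e"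
  proof
   assume "{vs ! i, vs ! Suc i} = ?e"
   then have "vs ! i = ?a & vs ! Suc i = ?b \<or> vs ! i = ?b & vs ! Suc i = ?a"
    by (auto simp: doubleton_eq_iff)
   then have "Suc i = 0 \<or> i = 0 & Suc i = ?n - 1"
    using nth_eq_iff_index_eq[OF n(2)] Suc.prems n(1) by (metis Suc_lessD diff_less
      less_le_trans less_numeral_extra(1) zero_less_numeral)
   then show False using n(1) by auto
  qed
  ultimately have "{vs ! i, vs ! Suc i} \<in> T - {?e}" by simp
  then show ?case using Suc conn_step by fastforce
 qed simp
 then have ab: "conn (T - {?e}) ?b ?a" using n(1) by simp
 have "conn (T - {?e}) x y" if "conn T x y" for x y
  using that
 proof (rule conn_subst)
  fix x y assume xy: "{x, y} \<in> T"
  show "conn (T - {?e}) x y"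
  proof (cases "{x, y} = ?e")
   case True
   then have "x = ?a & y = ?b \<or> x = ?b & y = ?a" by (auto simp: doubleton_eq_iff)
   then show ?thesis using ab conn_sym by metis
  qed (use xy in \<open>auto intro: conn_edge\<close>)
 qed
 then show ?thesis using T e by (intro bexI[of _ ?e]) (auto simp: connects_iff)
qed

text \<open>The hypothesis on thresholds says that the \<open>i\<close>-th smallest value on
  \<open>A\<close> is at most the \<open>i\<close>-th smallest on \<open>B\<close>. The induction
  compares two maxima and removes them.\<close>

lemma sum_le_of_counts:
 fixes f :: "'a => real"
 assumes "finite A" "finite B" "card A = card B"
  "!!r. card {b \<in> B. f b \<le> r} \<le> card {a \<in> A. f a \<le> r}"
 shows "sum f A \<le> sum f B"
 using assms
proof (induction "card A" arbitrary: A B)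
 case 0
 then show ?case by simp
next
 case (Suc k)
 then have ne: "A \<noteq> {}" "B \<noteq> {}" by auto
 have "Max (f ` A) \<in> f ` A" using Suc.prems(1) ne by (intro Max_in) auto
 then obtain a where "a \<in> A" "f a = Max (f ` A)" by auto
 then have a: "a \<in> A" "!!x. x \<in> A ==> f x \<le> f a"
  using Suc.prems(1) by auto
 have "Max (f ` B) \<in> f ` B" using Suc.prems(2) ne by (intro Max_in) auto
 then obtain b where "b \<in> B" "f b = Max (f ` B)" by auto
 then have b: "b \<in> B" "!!x. x \<in> B ==> f x \<le> f b"
  using Suc.prems(2) by auto
 \<comment> \<open>Otherwise at the threshold \<open>f b\<close> all of \<open>B\<close> but not all
   of \<open>A\<close> would be counted.\<close>
 have ab: "f a \<le> f b"
 proof (rule ccontr)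
  assume "\<not> f a \<le> f b"
  then have "{x \<in> A. f x \<le> f b} \<subset> A" using a(1) by auto
  then have "card {x \<in> A. f x \<le> f b} < card A" using Suc.prems(1) psubset_card_mono by blast
  moreover have "{x \<in> B. f x \<le> f b} = B" using b by auto
  ultimately show False using Suc.prems(3) Suc.prems(4)[of "f b"] by simp
 qed
 have "sum f (A - {a}) \<le> sum f (B - {b})"
 proof (rule Suc.hyps(1))
  show "k = card (A - {a})" using Suc a by simp
  show "card (A - {a}) = card (B - {b})" using Suc.prems a b by simp
  fix r show "card {x \<in> B - {b}. f x \<le> r} \<le> card {x \<in> A - {a}. f x \<le> r}"
  proof (cases "f a \<le> r")
   case True
   then have "{x \<in> A - {a}. f x \<le> r} = A - {a}" using a by force
   moreover have "card {x \<in> B - {b}. f x \<le> r} \<le> card (B - {b})"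
    using Suc.prems(2) by (intro card_mono) auto
   ultimately show ?thesis using Suc.prems a b by simp
  next
   case False
   then have "{x \<in> A - {a}. f x \<le> r} = {x \<in> A. f x \<le> r}" "{x \<in> B - {b}. f x \<le> r} = {x \<in> B. f x \<le> r}"
    using ab by auto
   then show ?thesis using Suc.prems(4) by simp
  qed
 qed (use Suc.prems in auto)
 then show ?case using ab a b Suc.prems by (simp add: sum.remove)
qed

text \<open>By \<open>thr\<close>, the edges of \<open>T\<close> up to a threshold connect whatever
  the complete graph connects up to it. The edges of a competing tree up to this threshold form a
  forest, hence are at most as many; counting over all thresholds compares the two sums without
  exchanging edges.\<close>

lemma mst_criterion:
 fixes w :: "'a set => real"
 assumes V: "finite V" and T: "T \<subseteq> complete_edges V" "card T < card V" "connects V T"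
  and thr: "!!p q. p \<in> V ==> q \<in> V ==> p \<noteq> q ==> conn {e \<in> T. w e \<le> w {p, q}} p q"
 shows "minimum_spanning_tree V (complete_edges V) w T"
 unfolding minimum_spanning_tree_def
proof (intro conjI allI impI)
 have fT: "finite T" using V T finite_complete_edges finite_subset by blast
 show "spanning_tree V (complete_edges V) T"
  unfolding spanning_tree_def
 proof (intro conjI notI)
  assume "\<exists>vs. is_cycle T vs"
  then obtain e where e: "e \<in> T" "connects V (T - {e})" using cycle_remove T(3) by blast
  then have "card V \<le> card (T - {e}) + 1" using T by (intro connected_card[OF V]) auto
  moreover have "card T > 0" using e(1) fT card_gt_0_iff by blast
  ultimately show False using e T fT by simp
 qed (use T in auto)
 fix T' assume "spanning_tree V (complete_edges V) T'"
 then have T': "T' \<subseteq> complete_edges V" "connects V T'" "\<nexists>vs. is_cycle T' vs"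
  by (auto simp: spanning_tree_def)
 have fT': "finite T'" using V T' finite_complete_edges finite_subset by blast
 have cnt: "card {e \<in> T'. w e \<le> r} \<le> card {e \<in> T. w e \<le> r}" for r
 proof (rule forest_card_le[OF V])
  show "\<nexists>vs. is_cycle {e \<in> T'. w e \<le> r} vs" using T'(3) is_cycle_mono by (metis (no_types, lifting) mem_Collect_eq subsetI)
  fix x y assume xy: "{x, y} \<in> {e \<in> T'. w e \<le> r}"
  then have "{x, y} \<in> complete_edges V" using T'(1) by auto
  then have "x \<in> V" "y \<in> V" "x \<noteq> y" by (auto simp: complete_edges_def doubleton_eq_iff)
  from thr[OF this] show "conn {e \<in> T. w e \<le> r} x y" by (rule conn_mono) (use xy in auto)
 qed (use T T' in auto)
 have "card T' \<le> card T"
 proof (rule forest_card_le[OF V T'(1,3) T(1)])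
  fix x y assume "{x, y} \<in> T'"
  then have "{x, y} \<in> complete_edges V" using T'(1) by auto
  then have "x \<in> V" "y \<in> V" by (auto simp: complete_edges_def doubleton_eq_iff)
  then show "conn T x y" using T(3) by (simp add: connects_iff)
 qed
 moreover have "card V \<le> card T' + 1" using connected_card[OF V T'(1,2)] .
 ultimately have "card T = card T'" using T(2) by linarith
 then show "sum w T \<le> sum w T'" by (rule sum_le_of_counts[OF fT fT' _ cnt])
qed

section \<open>Cones of directions\<close>

text \<open>Index of the cell of \<open>x\<close> in the subdivision of the interval from -1 to 1
  into cells of width \<open>2 / G\<close>. It is a number of successful comparisons because the
  machine cannot convert a real into an integer.\<close>

definition dig :: "nat => real => nat" where
 "dig G x = (\<Sum>m<G. of_bool (2 * real m / real G - 1 \<le> x))"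

lemma dig_le: "dig G x \<le> G"
 unfolding dig_def using sum_bounded_above[of "{..<G}" "\<lambda>m. of_bool (2 * real m / real G - 1 \<le> x)" "1::nat"] by auto

lemma dig_close_aux:
 assumes G: "0 < G" and x: "-1 \<le> x" and y: "y \<le> 1" and far: "2 / real G < y - x"
 shows "dig G x < dig G y"
proof -
 \<comment> \<open>The first grid point above \<open>x\<close>; it lies at most one cell width
   further, hence below \<open>y\<close>.\<close>
 define m where "m = nat \<lfloor>(x + 1) * G / 2\<rfloor> + 1"
 have nn: "0 \<le> (x + 1) * G / 2" using x by simp
 have m1: "(x + 1) * G / 2 < real m" "real m \<le> (x + 1) * G / 2 + 1"
  unfolding m_def using nn by linarith+
 have "x < 2 * real m / real G - 1" using m1(1) G by (simp add: field_simps)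
 moreover have "2 * real m / real G - 1 \<le> x + 2 / real G"
 proof -
  have "2 * real m / real G \<le> ((x + 1) * G + 2) / real G"
   using m1(2) by (intro divide_right_mono) auto
  also have "\<dots> = x + 1 + 2 / real G" using G by (simp add: field_simps)
  finally show ?thesis by simp
 qed
 ultimately have t: "x < 2 * real m / real G - 1" "2 * real m / real G - 1 < y" using far by auto
 have "2 * real m / real G < 2" using t(2) y by linarith
 then have "real m < real G" using G by (simp add: field_simps)
 then have "m < G" by simp
 have le: "of_bool (2 * real i / real G - 1 \<le> x) \<le> (of_bool (2 * real i / real G - 1 \<le> y) :: nat)" for i
 proof -
  have "0 < 2 / real G" using G by simp
  then have "x \<le> y" using far by linarith
  then show ?thesis by auto
 qed
 show ?thesis
  unfolding dig_def
  by (rule sum_strict_mono_ex1) (use \<open>m < G\<close> t le in \<open>auto intro!: bexI[of _ m]\<close>)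
qed

lemma dig_close:
 assumes G: "0 < G" and x: "\<bar>x\<bar> \<le> 1" and y: "\<bar>y\<bar> \<le> 1" and eq: "dig G x = dig G y"
 shows "\<bar>x - y\<bar> \<le> 2 / real G"
 using dig_close_aux[OF G, of x y] dig_close_aux[OF G, of y x] assms by linarith

text \<open>The direction from \<open>p\<close> to \<open>q\<close> is encoded by the grid cell of the unit vector.\<close>

primrec cone_idx :: "nat => (nat => real) => nat => nat" where
 "cone_idx G f 0 = 0"
| "cone_idx G f (Suc i) = cone_idx G f i * (G + 1) + dig G (f i)"

lemma cone_less: "cone_idx G f d < (G + 1) ^ d"
proof (induction d)
 case (Suc d)
 have "cone_idx G f (Suc d) < (cone_idx G f d + 1) * (G + 1)" using dig_le[of G "f d"] by simp
 also have "\<dots> \<le> (G + 1) ^ d * (G + 1)" using Suc by (intro mult_le_mono1) simp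
 finally show ?case by (simp add: mult.commute)
qed simp

lemma cone_eqD: "cone_idx G f d = cone_idx G g d ==> i < d ==> dig G (f i) = dig G (g i)"
proof (induction d)
 case (Suc d)
 have l: "dig G (f d) < G + 1" "dig G (g d) < G + 1" using dig_le[of G] by (simp_all add: le_imp_less_Suc)
 have eq: "cone_idx G f d * (G + 1) + dig G (f d) = cone_idx G g d * (G + 1) + dig G (g d)" using Suc.prems by simp
 have "dig G (f d) = dig G (g d)"
  using arg_cong[OF eq, of "\<lambda>k. k mod (G + 1)"] l by (simp only: mod_mult_self3 mod_less)
 moreover then have "cone_idx G f d * (G + 1) = cone_idx G g d * (G + 1)" using eq by simp
 then have "cone_idx G f d = cone_idx G g d" by (simp only: mult_cancel2) simp
 ultimately show ?case using Suc by (cases "i = d") auto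
qed simp

text \<open>Equal cone numbers force the unit vectors \<open>u\<close> and \<open>v\<close> to agree
  up to \<open>2 / G\<close> in every coordinate. The choice of \<open>G\<close> then gives
  \<open>norm (u - v) < 1\<close>, an angle below 60 degrees, and the law of cosines yields the
  claim.\<close>

lemma same_direction_closer:
 fixes p q r :: "real ^ 'd::finite"
 assumes coord: "bij_betw coord {..<CARD('d)} UNIV"
  and G: "G = 2 * CARD('d) + 1"
  and ne: "q \<noteq> p" "r \<noteq> p" and le: "dist p r \<le> dist p q"
  and eq: "cone_idx G (\<lambda>i. (q $ coord i - p $ coord i) / dist p q) CARD('d) =
       cone_idx G (\<lambda>i. (r $ coord i - p $ coord i) / dist p r) CARD('d)"
 shows "dist r q < dist p q"
proof -
 define a where "a = dist p q"
 define b where "b = dist p r"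
 have ab: "0 < a" "0 < b" "b \<le> a" using ne le by (auto simp: a_def b_def)
 define u where "u = (q - p) /\<^sub>R a"
 define v where "v = (r - p) /\<^sub>R b"
 have nu: "norm u = 1" "norm v = 1"
  using ab by (auto simp: u_def v_def a_def b_def dist_norm norm_minus_commute)
 have hcom: "\<bar>u $ c - v $ c\<bar> \<le> 2 / real G" for c
 proof -
  obtain i where i: "i < CARD('d)" "c = coord i" using coord unfolding bij_betw_def by (metis UNIV_I imageE lessThan_iff)
  have "\<bar>u $ c\<bar> \<le> 1" "\<bar>v $ c\<bar> \<le> 1" using component_le_norm_cart[of u c] component_le_norm_cart[of v c] nu by auto
  moreover have "dig G (u $ c) = dig G (v $ c)"
   using cone_eqD[OF eq i(1)] i by (simp add: u_def v_def a_def b_def divide_inverse mult.commute)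
  ultimately show ?thesis using G by (intro dig_close) auto
 qed
 have "(norm (u - v))\<^sup>2 = (\<Sum>c\<in>UNIV. (u $ c - v $ c)\<^sup>2)"
  by (simp add: norm_vec_def L2_set_def sum_nonneg)
 also have "\<dots> \<le> (\<Sum>c\<in>(UNIV :: 'd set). (2 / real G)\<^sup>2)"
  by (intro sum_mono) (metis hcom abs_ge_zero power2_abs power_mono)
 also have "\<dots> = CARD('d) * (2 / real G)\<^sup>2" by simp
 also have "\<dots> < 1"
 proof -
  \<comment> \<open>This inequality dictates \<open>G\<close>: with
    \<open>G = 2 * CARD('d) + 1\<close>, the square of \<open>G\<close> exceeds
    \<open>4 * CARD('d)\<close>.\<close>
  have "4 * real CARD('d) < (real G)\<^sup>2" using G by (simp add: power2_eq_square algebra_simps add_pos_nonneg)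
  then show ?thesis using G by (simp add: power2_eq_square field_simps)
 qed
 finally have uv: "(norm (u - v))\<^sup>2 < 1" .
 have "(norm (u - v))\<^sup>2 = 2 - 2 * (u \<bullet> v)"
  using nu by (simp add: power2_norm_eq_inner inner_diff inner_commute norm_eq_1)
 then have i: "1 / 2 < u \<bullet> v" using uv by simp
 have "(dist r q)\<^sup>2 = (norm (b *\<^sub>R v - a *\<^sub>R u))\<^sup>2"
  using ab by (simp add: dist_norm u_def v_def)
 also have "\<dots> = b\<^sup>2 - 2 * (a * b * (u \<bullet> v)) + a\<^sup>2"
  using nu unfolding power2_norm_eq_inner norm_eq_1
  by (simp add: inner_diff inner_commute power2_eq_square algebra_simps)
 also have "\<dots> < b\<^sup>2 - 2 * (a * b * (1 / 2)) + a\<^sup>2"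
  using ab i by (simp add: mult_less_cancel_left_pos)
 also have "\<dots> \<le> a\<^sup>2" using ab by (simp add: power2_eq_square)
 finally have "(dist r q)\<^sup>2 < a\<^sup>2" .
 then show ?thesis using ab by (simp add: a_def power2_less_imp_less)
qed

section \<open>Sparse spanners and Boruvka phases\<close>

definition pairs :: "nat set => (nat => nat) => (nat => nat) => nat set set" where
 "pairs H a b = (\<lambda>h. {a h, b h}) ` H"

lemma pairs_mono: "H \<subseteq> H' ==> pairs H a b \<subseteq> pairs H' a b"
 by (auto simp: pairs_def)

lemma conn_cut:
 assumes "conn T x y" "x \<in> S" "y \<notin> S"
 shows "\<exists>u v. {u, v} \<in> T & u \<in> S & v \<notin> S"
proof (rule ccontr)
 assume no: "\<not> ?thesis"
 have "y \<in> S" using assms(1)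
 proof (induction rule: conn_induct)
  case (step u v)
  then show ?case using no by blast
 qed (rule assms(2))
 with assms(3) show False by blast
qed

text \<open>Induction on the number of pairs closer than \<open>p\<close> and \<open>q\<close>. The
  edge selected from the end with the larger core distance is no heavier than \<open>w p q\<close>.
  It leads to a point strictly closer to the other end and of no larger core distance, so the
  remaining path stays below the same threshold.\<close>

lemma sparse_spanner:
 fixes n :: nat and cd :: "nat => real" and D :: "nat => nat => real" and C :: "nat => nat => nat"
 assumes sym: "!!p q. D p q = D q p"
  and closer: "!!p q r. p < n ==> q < n ==> r < n ==> p \<noteq> q ==> p \<noteq> r ==> C p q = C p r ==>
   D p r \<le> D p q ==> D r q < D p q"
  and sel: "!!p q. p < n ==> q < n ==> p \<noteq> q ==> cd q \<le> cd p ==>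
   \<exists>h\<in>H. a h = p & b h < n & b h \<noteq> p & cd (b h) \<le> cd p & C p q = C p (b h) & D p (b h) \<le> D p q"
  and w: "!!p q. w p q = max (cd p) (max (cd q) (D p q))"
  and pq: "p < n" "q < n"
 shows "conn (pairs {h\<in>H. w (a h) (b h) \<le> w p q} a b) p q"
 using pq
proof (induction "card {(x, y). x < n & y < n & D x y < D p q}" arbitrary: p q rule: less_induct)
 case less
 have fin: "finite {(x, y). x < n & y < n & D x y < d}" for d
  by (rule finite_subset[of _ "{..<n} \<times> {..<n}"]) auto
 have main: "conn (pairs {h\<in>H. w (a h) (b h) \<le> w x y} a b) x y"
  if xy: "x < n" "y < n" "x \<noteq> y" "cd y \<le> cd x" "D x y = D p q" for x y
 proof -
  from sel[OF xy(1-4)] obtain h where h: "h \<in> H" "a h = x" "b h < n" "b h \<noteq> x" "cd (b h) \<le> cd x"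
   "C x y = C x (b h)" "D x (b h) \<le> D x y" by blast
  let ?r = "b h"
  let ?E = "pairs {h\<in>H. w (a h) (b h) \<le> w x y} a b"
  have "w (a h) (b h) \<le> w x y" using h xy unfolding w by auto
  then have "{a h, b h} \<in> ?E" using h(1) unfolding pairs_def by blast
  then have xr: "conn ?E x ?r" using h(2) conn_edge by metis
  show ?thesis
  proof (cases "?r = y")
   case True
   with xr show ?thesis by simp
  next
   case False
   have lt: "D ?r y < D x y" using closer[OF xy(1,2) h(3)] xy h by auto
   have "{(u, v). u < n & v < n & D u v < D ?r y} \<subset> {(u, v). u < n & v < n & D u v < D p q}"
    using lt xy h(3) by force
   then have "card {(u, v). u < n & v < n & D u v < D ?r y} <
     card {(u, v). u < n & v < n & D u v < D p q}" by (rule psubset_card_mono[OF fin])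
   from less.hyps[OF this h(3) xy(2)]
   have "conn (pairs {h\<in>H. w (a h) (b h) \<le> w ?r y} a b) ?r y" .
   moreover have "w ?r y \<le> w x y" using h xy lt unfolding w by auto
   ultimately have "conn ?E ?r y" by (elim conn_mono) (force simp: pairs_def)
   with xr show ?thesis by (rule conn_trans)
  qed
 qed
 show ?case
 proof (cases "p = q")
  case False
  show ?thesis
  proof (cases "cd q \<le> cd p")
   case True
   then show ?thesis using main[of p q] less.prems False by auto
  next
   case nle: False
   have "w q p = w p q" using sym by (auto simp: w)
   then show ?thesis using main[of q p] less.prems False nle sym[of p q] conn_sym by auto
  qed
 qed simp
qed

text \<open>Edges are numbers rather than sets, since parallel edges can occur: two points of equal
  core distance may select each other.\<close>

locale boruvka =
 fixes n m :: nat and ve :: "nat => bool" and ea eb :: "nat => nat" and ew :: "nat => real"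
 assumes ends: "!!e. e < m ==> ve e ==> ea e < n & eb e < n"
  and conn_all: "!!u v. u < n ==> v < n ==> conn (pairs {e. e < m & ve e} ea eb) u v"
begin

text \<open>Ties are broken by number, which makes the lightest edge leaving a component unique;
  otherwise hooking along lightest edges could close cycles through several components.\<close>

definition elt :: "nat => nat => bool" where
 "elt e f \<longleftrightarrow> ew e < ew f \<or> ew e = ew f & e < f"

definition rk :: "nat => nat" where
 "rk e = card {f. f < m & elt f e}"

lemma rk_less: "f < m ==> elt f e ==> rk f < rk e"
 unfolding rk_def by (rule psubset_card_mono) (auto simp: elt_def)

lemma elt_total: "e \<noteq> f ==> elt e f \<or> elt f e"
 by (auto simp: elt_def)

lemma rk_less_iff: "e < m ==> f < m ==> rk e < rk f \<longleftrightarrow> elt e f"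
 using rk_less elt_total by (metis less_asym less_irrefl)

lemma rk_inj: "e < m ==> f < m ==> rk e = rk f ==> e = f"
 using rk_less elt_total by (metis less_irrefl)

lemma rk_le_m: "rk e \<le> m"
 unfolding rk_def by (rule order_trans[OF card_mono[of "{..<m}"]]) auto

lemma rk_le_ew: "e < m ==> f < m ==> rk e \<le> rk f ==> ew e \<le> ew f"
 using rk_less[of f e] unfolding elt_def by (meson leD leI)

text \<open>The edge would be accepted by Kruskal's algorithm in the order
  \<open>elt\<close>.\<close>

definition gd :: "nat => bool" where
 "gd h \<longleftrightarrow> h < m & ve h & \<not> conn (pairs {e. e < m & ve e & rk e < rk h} ea eb) (ea h) (eb h)"

text \<open>Exchange argument at the least rank \<open>k\<close> at which \<open>H\<close> connects
  the ends of \<open>e\<close>. If \<open>k\<close> exceeded the rank of \<open>e\<close>, the ends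
  of the edge of rank \<open>k\<close> would be connected through \<open>e\<close> and lighter edges
  of \<open>H\<close>, so this edge would not satisfy \<open>gd\<close>.\<close>

lemma good_threshold:
 assumes H: "!!h. h \<in> H ==> gd h" and con: "!!u v. u < n ==> v < n ==> conn (pairs H ea eb) u v"
  and e: "e < m" "ve e"
 shows "conn (pairs {h\<in>H. rk h \<le> rk e} ea eb) (ea e) (eb e)"
proof (rule ccontr)
 assume no: "\<not> ?thesis"
 let ?P = "\<lambda>k. conn (pairs {h\<in>H. rk h \<le> k} ea eb) (ea e) (eb e)"
 have "{h\<in>H. rk h \<le> m} = H" using rk_le_m by auto
 then have "?P m" using con ends[OF e] by auto
 define k where "k = (LEAST k. ?P k)"
 have k: "?P k" unfolding k_def by (rule LeastI) fact
 have kmin: "\<not> ?P i" if "i < k" for i using not_less_Least that unfolding k_def by blast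
 have ek: "rk e < k"
 proof (rule ccontr)
  assume "\<not> rk e < k"
  then have "?P (rk e)" using k by (elim conn_mono) (auto simp: pairs_def)
  then show False using no by blast
 qed
 let ?A = "pairs {h\<in>H. rk h < k} ea eb"
 have "{h\<in>H. rk h < k} = {h\<in>H. rk h \<le> k - 1}" using ek by auto
 then have nA: "\<not> conn ?A (ea e) (eb e)" using kmin[of "k - 1"] ek by simp
 have "\<exists>g\<in>H. rk g = k"
 proof (rule ccontr)
  assume "\<not> ?thesis"
  then have "{h\<in>H. rk h \<le> k} = {h\<in>H. rk h < k}" by (auto simp: le_less)
  with k nA show False by simp
 qed
 then obtain g where g: "g \<in> H" "rk g = k" by blast
 have gm: "h < m" if "h \<in> H" for h using H[OF that] by (simp add: gd_def)
 have "{h\<in>H. rk h \<le> k} = insert g {h\<in>H. rk h < k}"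
  using g gm rk_inj by (auto simp: le_less)
 then have "pairs {h\<in>H. rk h \<le> k} ea eb = insert {ea g, eb g} ?A" by (simp add: pairs_def)
 with k nA have c: "conn ?A (ea e) (ea g) & conn ?A (eb g) (eb e) \<or> conn ?A (ea e) (eb g) & conn ?A (ea g) (eb e)"
  by (simp add: conn_insert)
 let ?B = "pairs {f. f < m & ve f & rk f < rk g} ea eb"
 have AB: "conn ?B x y" if "conn ?A x y" for x y
  using that by (rule conn_mono) (use g H in \<open>auto simp: pairs_def gd_def\<close>)
 have "{ea e, eb e} \<in> ?B" using e ek g by (auto simp: pairs_def)
 then have eB: "conn ?B (ea e) (eb e)" by (rule conn_edge)
 have "conn ?B (ea g) (eb g)"
  using c
 proof (elim disjE conjE)
  assume c1: "conn ?A (ea e) (ea g)" and c2: "conn ?A (eb g) (eb e)"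
  from conn_trans[OF conn_trans[OF conn_sym[OF AB[OF c1]] eB] conn_sym[OF AB[OF c2]]]
  show ?thesis .
 next
  assume c1: "conn ?A (ea e) (eb g)" and c2: "conn ?A (ea g) (eb e)"
  from conn_trans[OF conn_trans[OF AB[OF c2] conn_sym[OF eB]] AB[OF c1]]
  show ?thesis .
 qed
 then show False using H[OF g(1)] by (simp add: gd_def)
qed

text \<open>A component label is a root, and the slot of every vertex that is no longer a root holds the
 edge through which it was hooked.\<close>

definition bor_inv :: "(nat => nat) => (nat => nat) => bool" where
 "bor_inv L sl \<longleftrightarrow> (\<forall>v<n. L v < n & L (L v) = L v) &
   (\<forall>c<n. L c \<noteq> c \<longrightarrow> gd (sl c)) &
   (\<forall>u<n. \<forall>v<n. L u = L v \<longrightarrow> conn (pairs (sl ` {c. c < n & L c \<noteq> c}) ea eb) u v)"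

definition roots :: "(nat => nat) => nat set" where
 "roots L = {c. c < n & L c = c}"

definition outs :: "(nat => nat) => nat => nat set" where
 "outs L c = {e. e < m & ve e & L (ea e) \<noteq> L (eb e) & (L (ea e) = c \<or> L (eb e) = c)}"

text \<open>\<open>BE c\<close> is the lightest edge leaving component \<open>c\<close>. One of its
  two labels is \<open>c\<close>, so the sum minus \<open>c\<close> in \<open>PR\<close> is the
  component at the other end. Two components that choose each other form the only possible cycle of
  \<open>PR\<close>; \<open>PR2\<close> opens it by making the smaller one a root.\<close>

lemma boruvka_step:
 assumes inv: "bor_inv L sl"
  and BE: "!!c. c < n ==> outs L c = {} ==> \<not> BE c < m"
   "!!c. c < n ==> outs L c \<noteq> {} ==> BE c \<in> outs L c & (\<forall>e\<in>outs L c. rk (BE c) \<le> rk e)"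
  and PR: "!!c. c < n ==> PR c = (if BE c < m then L (ea (BE c)) + L (eb (BE c)) - c else c)"
  and PR2: "!!c. c < n ==> PR2 c = (if PR (PR c) = c & c < PR c then c else PR c)"
  and N: "m + 2 \<le> N"
  and L': "!!v. v < n ==> L' v = (PR2 ^^ N) (L v)"
  and sl': "!!c. c < n ==> sl' c = (if PR2 c \<noteq> c then BE c else sl c)"
 shows "bor_inv L' sl'" and "card (roots L') \<le> 1 \<or> 2 * card (roots L') \<le> card (roots L)"
  and "!!c. c < n ==> PR c < n" and "!!c. c < n ==> PR2 c < n"
  and "!!c. c < n ==> PR2 c \<noteq> c ==> BE c < m & ve (BE c)"
proof -
 from inv have L: "!!v. v < n ==> L v < n" "!!v. v < n ==> L (L v) = L v"
  "!!c. c < n ==> L c \<noteq> c ==> gd (sl c)"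
  "!!u v. u < n ==> v < n ==> L u = L v ==> conn (pairs (sl ` {c. c < n & L c \<noteq> c}) ea eb) u v"
  by (auto simp: bor_inv_def)
 have BEm: "BE c \<in> outs L c" "!!e. e \<in> outs L c ==> rk (BE c) \<le> rk e" if "c < n" "BE c < m" for c
  using BE[OF that(1)] that(2) by blast+
 have hook: "PR c < n & PR c \<noteq> c & L c = c & L (PR c) = PR c & BE c \<in> outs L (PR c) & (L (ea (BE c)) = c & L (eb (BE c)) = PR c \<or> L (eb (BE
  c)) = c & L (ea (BE c)) = PR c)"
  if c: "c < n" "BE c < m" for c
 proof -
  from BEm[OF c] have o: "BE c < m" "ve (BE c)" "L (ea (BE c)) \<noteq> L (eb (BE c))"
   "L (ea (BE c)) = c \<or> L (eb (BE c)) = c" by (auto simp: outs_def)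
  have e: "ea (BE c) < n" "eb (BE c) < n" using ends o by auto
  have "L (ea (BE c)) = c & L (eb (BE c)) = PR c \<or> L (eb (BE c)) = c & L (ea (BE c)) = PR c"
   using PR[OF c(1)] c(2) o(4) by auto
  then show ?thesis using o L(1)[OF e(1)] L(1)[OF e(2)] L(2)[OF e(1)] L(2)[OF e(2)] by (auto simp: outs_def)
 qed
 show PRn: "PR c < n" if "c < n" for c
  using hook[OF that] PR[OF that] that by (cases "BE c < m") auto
 have PRs: "PR c = c" if "c < n" "\<not> BE c < m" for c using PR that by simp
 show P2n: "PR2 c < n" if "c < n" for c using PR2[OF that] PRn[OF that] that by auto
 have P2ne: "BE c < m & PR2 c = PR c" if "c < n" "PR2 c \<noteq> c" for c
  using PR2[OF that(1)] that PRs[OF that(1)] by (auto split: if_splits)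
 show "BE c < m & ve (BE c)" if "c < n" "PR2 c \<noteq> c" for c
  using P2ne[OF that] BEm[OF that(1)] by (auto simp: outs_def)
 have P2root: "L (PR2 c) = PR2 c" if "c < n" "L c = c" for c
  using P2ne[OF that(1)] hook[OF that(1)] that by (cases "PR2 c = c") auto
 \<comment> \<open>An upper bound for the distance of \<open>c\<close> from its root in the hooking
   forest. It is at most \<open>m + 1\<close>, so \<open>N\<close> steps of \<open>PR2\<close> reach
   the root.\<close>
 define ht where "ht c = (if PR2 c = c then 0 else 1 + rk (BE c))" for c
 have dec: "ht (PR2 c) < ht c" if c: "c < n" "PR2 c \<noteq> c" for c
 proof (cases "PR2 (PR2 c) = PR2 c")
  case True
  then show ?thesis using c by (simp add: ht_def)
 next
  case False
  let ?c = "PR c"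
  have p: "PR2 c = ?c" "BE c < m" using P2ne[OF c] by auto
  note hc = hook[OF c(1) p(2)]
  have cn: "?c < n" using hc by simp
  have bc: "BE ?c < m" "PR2 ?c = PR ?c" using P2ne[OF cn] False p by auto
  have "BE c \<in> outs L ?c" using hc by simp
  then have le: "rk (BE ?c) \<le> rk (BE c)" using BEm(2)[OF cn bc(1)] by blast
  \<comment> \<open>Equal lightest edges mean that the two components chose each other; then
    \<open>PR2\<close> would have made one of them a root.\<close>
  have "rk (BE ?c) \<noteq> rk (BE c)"
  proof
   assume "rk (BE ?c) = rk (BE c)"
   then have eq: "BE ?c = BE c" using rk_inj bc p by blast
   have "PR ?c = c" using hook[OF cn bc(1)] hc unfolding eq by auto
   then have "\<not> c < ?c" "\<not> ?c < c" using PR2[OF c(1)] PR2[OF cn] c p bc False by auto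
   then show False using hc by simp
  qed
  with le show ?thesis using False c p by (simp add: ht_def)
 qed
 have it_n: "(PR2 ^^ i) c < n" if "c < n" for i c
  using that by (induction i) (auto intro: P2n)
 have fix_ht: "PR2 ((PR2 ^^ i) c) = (PR2 ^^ i) c" if "c < n" "ht c \<le> i" for i c
  using that
 proof (induction i arbitrary: c)
  case 0
  then show ?case by (auto simp: ht_def split: if_splits)
 next
  case (Suc i)
  show ?case
  proof (cases "PR2 c = c")
   case True
   then have "(PR2 ^^ j) c = c" for j by (induction j) auto
   then show ?thesis using True by metis
  next
   case False
   then have "ht (PR2 c) \<le> i" using dec[OF Suc.prems(1)] Suc.prems(2) by simp
   from Suc.IH[OF P2n[OF Suc.prems(1)] this] show ?thesis
    by (simp only: funpow_Suc_right comp_apply)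
  qed
 qed
 have fixN: "PR2 ((PR2 ^^ N) c) = (PR2 ^^ N) c" if "c < n" for c
  by (rule fix_ht[OF that]) (use rk_le_m[of "BE c"] N in \<open>auto simp: ht_def\<close>)
 have it_root: "L ((PR2 ^^ i) c) = (PR2 ^^ i) c" if "c < n" "L c = c" for i c
  using that by (induction i) (auto intro: P2root it_n)
 have it_fix: "(PR2 ^^ i) c = c" if "PR2 c = c" for i c using that by (induction i) auto
 have L'r: "L' c = c \<longleftrightarrow> L c = c & PR2 c = c" if c: "c < n" for c
 proof
  assume "L' c = c"
  then have e: "(PR2 ^^ N) (L c) = c" using L'[OF c] by simp
  then show "L c = c & PR2 c = c" using it_root[of "L c" N] fixN[of "L c"] L c by auto
 next
  assume "L c = c & PR2 c = c"
  then show "L' c = c" using L'[OF c] it_fix by simp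
 qed
 let ?F = "pairs (sl ` {c. c < n & L c \<noteq> c}) ea eb"
 let ?F' = "pairs (sl' ` {c. c < n & L' c \<noteq> c}) ea eb"
 have slk: "sl' c = sl c" if "c < n" "L c \<noteq> c" for c
  using sl'[OF that(1)] P2ne[OF that(1)] hook[OF that(1)] that(2) by auto
 have FF: "?F \<subseteq> ?F'"
 proof (rule pairs_mono, safe)
  fix c assume c: "c < n" "L c \<noteq> c"
  then have "sl c = sl' c" "L' c \<noteq> c" using slk L'r by auto
  then show "sl c \<in> sl' ` {c. c < n & L' c \<noteq> c}" using c by blast
 qed
 have gdBE: "gd (BE c)" if c: "c < n" "BE c < m" for c
 proof -
  let ?h = "BE c"
  note h = hook[OF c]
  have v: "ve ?h" using BEm(1)[OF c] by (auto simp: outs_def)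
  let ?S = "{v. L v = c}"
  \<comment> \<open>Cut property: a path of edges lighter than \<open>BE c\<close> cannot leave the
    component \<open>c\<close>, because its first edge across would be a lighter outgoing
    edge.\<close>
  have no: False if cc: "conn (pairs {e. e < m & ve e & rk e < rk ?h} ea eb) x y" "x \<in> ?S" "y \<notin> ?S" for x y
  proof -
   from conn_cut[OF cc] obtain u w where uw: "{u, w} \<in> pairs {e. e < m & ve e & rk e < rk ?h} ea eb"
    "L u = c" "L w \<noteq> c" by blast
   then obtain e where e: "e < m" "ve e" "rk e < rk ?h" "{u, w} = {ea e, eb e}" by (auto simp: pairs_def)
   then have "e \<in> outs L c" using uw by (auto simp: outs_def doubleton_eq_iff)
   then show False using BEm(2)[OF c] e(3) by (meson not_less)
  qed
  have "\<not> conn (pairs {e. e < m & ve e & rk e < rk ?h} ea eb) (ea ?h) (eb ?h)"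
  proof
   assume cn: "conn (pairs {e. e < m & ve e & rk e < rk ?h} ea eb) (ea ?h) (eb ?h)"
   show False
    using no[OF cn] no[OF conn_sym[OF cn]] h by auto
  qed
  then show ?thesis using c v by (simp add: gd_def)
 qed
 have gd': "gd (sl' c)" if c: "c < n" "L' c \<noteq> c" for c
 proof (cases "PR2 c = c")
  case True
  then show ?thesis using L'r[OF c(1)] c L(3) sl'[OF c(1)] by auto
 next
  case False
  then show ?thesis using gdBE[OF c(1)] P2ne[OF c(1) False] sl'[OF c(1)] by auto
 qed
 have step: "conn ?F' c (PR2 c)" if c: "c < n" "L c = c" for c
 proof (cases "PR2 c = c")
  case False
  have p: "BE c < m" "PR2 c = PR c" using P2ne[OF c(1) False] by auto
  note h = hook[OF c(1) p(1)]
  have v: "ea (BE c) < n" "eb (BE c) < n" using BEm(1)[OF c(1) p(1)] ends by (auto simp: outs_def)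
  have "L' c \<noteq> c" using L'r[OF c(1)] False by simp
  moreover have "sl' c = BE c" using sl'[OF c(1)] False by simp
  ultimately have "{ea (BE c), eb (BE c)} \<in> ?F'" using c(1) unfolding pairs_def by force
  then have ed: "conn ?F' (ea (BE c)) (eb (BE c))" by (rule conn_edge)
  have cF: "conn ?F' x y" if "x < n" "y < n" "L x = L y" for x y
   using conn_mono[OF L(4)[OF that] FF] .
  from h show ?thesis
  proof (elim conjE disjE)
   assume a: "L (ea (BE c)) = c" "L (eb (BE c)) = PR c"
   have c1: "conn ?F' c (ea (BE c))" using cF[of c "ea (BE c)"] c v a by simp
   have c2: "conn ?F' (eb (BE c)) (PR c)" using cF[of "eb (BE c)" "PR c"] h v a by simp
   from conn_trans[OF conn_trans[OF c1 ed] c2] show ?thesis unfolding p(2) .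
  next
   assume a: "L (eb (BE c)) = c" "L (ea (BE c)) = PR c"
   have c1: "conn ?F' c (eb (BE c))" using cF[of c "eb (BE c)"] c v a by simp
   have c2: "conn ?F' (ea (BE c)) (PR c)" using cF[of "ea (BE c)" "PR c"] h v a by simp
   from conn_trans[OF conn_trans[OF c1 conn_sym[OF ed]] c2] show ?thesis unfolding p(2) .
  qed
 qed simp
 have steps: "conn ?F' c ((PR2 ^^ i) c)" if c: "c < n" "L c = c" for c i
 proof (induction i)
  case (Suc i)
  have "conn ?F' ((PR2 ^^ i) c) (PR2 ((PR2 ^^ i) c))" using step it_n it_root c by simp
  from conn_trans[OF Suc this] show ?case by simp
 qed simp
 have toL': "conn ?F' u (L' u)" if u: "u < n" for u
 proof -
  have "conn ?F' u (L u)" using conn_mono[OF L(4)[OF u L(1)[OF u]] FF] L(2)[OF u] by simp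
  moreover have "conn ?F' (L u) (L' u)" using steps[of "L u" N] L u L'[OF u] by simp
  ultimately show ?thesis by (rule conn_trans)
 qed
 show "bor_inv L' sl'"
  unfolding bor_inv_def
 proof (intro conjI allI impI)
  fix v assume v: "v < n"
  show l: "L' v < n" using L'[OF v] it_n L(1)[OF v] by simp
  show "L' (L' v) = L' v"
   using L'r[OF l] it_root[of "L v" N] fixN[of "L v"] L v L'[OF v] by auto
 next
  fix u v assume "u < n" "v < n" "L' u = L' v"
  then show "conn ?F' u v"
   using conn_trans[OF toL'[of u] conn_sym[OF toL'[of v, folded \<open>L' u = L' v\<close>]]] by simp
 qed (use gd' in auto)
 have R': "roots L' = {c \<in> roots L. PR2 c = c}" unfolding roots_def using L'r by blast
 have finR: "finite (roots L)" by (simp add: roots_def)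
 show "card (roots L') \<le> 1 \<or> 2 * card (roots L') \<le> card (roots L)"
 proof (cases "card (roots L) \<le> 1")
  case True
  have "card (roots L') \<le> card (roots L)" unfolding R' by (rule card_mono[OF finR]) auto
  then show ?thesis using True by simp
 next
  case False
  \<comment> \<open>While two components remain, connectivity of the edge set gives each of them an
    outgoing edge.\<close>
  have BEr: "BE c < m" if c: "c \<in> roots L" for c
  proof (rule ccontr)
   assume nb: "\<not> BE c < m"
   have cn: "c < n" "L c = c" using c by (auto simp: roots_def)
   obtain d where d: "d \<in> roots L" "d \<noteq> c"
   proof -
    have "roots L \<noteq> {c}" using False by auto
    then show ?thesis using that c by blast
   qed
   then have dn: "d < n" "L d = d" by (auto simp: roots_def)
   from conn_cut[OF conn_all[OF cn(1) dn(1)], of "{v. L v = c}"] cn dn d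
   obtain u w where uw: "{u, w} \<in> pairs {e. e < m & ve e} ea eb" "L u = c" "L w \<noteq> c" by auto
   then obtain e where "e < m" "ve e" "{u, w} = {ea e, eb e}" by (auto simp: pairs_def)
   then have "e \<in> outs L c" using uw by (auto simp: outs_def doubleton_eq_iff)
   then show False using BE(2)[OF cn(1)] nb by (auto simp: outs_def)
  qed
  \<comment> \<open>A surviving root owes its survival to a mutual choice, so its partner is a root
    that has just disappeared. Different survivors have different partners, which yields the
    halving.\<close>
  have mate: "PR c \<in> roots L - roots L' & PR (PR c) = c" if c: "c \<in> roots L'" for c
  proof -
   have cn: "c < n" "L c = c" "PR2 c = c" "c \<in> roots L" using c unfolding R' by (auto simp: roots_def)
   note h = hook[OF cn(1) BEr[OF cn(4)]]
   have pp: "PR (PR c) = c" "c < PR c" using PR2[OF cn(1)] cn(3) h by (auto split: if_splits)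
   have "PR2 (PR c) \<noteq> PR c" using PR2[of "PR c"] pp h by auto
   then show ?thesis using pp h unfolding R' by (auto simp: roots_def)
  qed
  have "inj_on PR (roots L')" using mate by (metis inj_onI)
  then have "card (roots L') \<le> card (roots L - roots L')"
   using mate finR by (intro card_inj_on_le) auto
  also have "\<dots> = card (roots L) - card (roots L')"
   by (rule card_Diff_subset) (use R' finR in \<open>auto intro: finite_subset[OF _ finR]\<close>)
  finally show ?thesis by linarith
 qed
qed

lemma boruvka_final:
 assumes inv: "bor_inv L sl" and one: "card (roots L) \<le> 1" and n: "0 < n"
 shows "roots L = {L 0}" "L 0 < n"
  and "!!u v. u < n ==> v < n ==> conn (pairs (sl ` ({..<n} - {L 0})) ea eb) u v"
  and "!!c. c < n ==> c \<noteq> L 0 ==> sl c < m & ve (sl c)"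
  and "!!e. e < m ==> ve e ==> conn (pairs {h \<in> sl ` ({..<n} - {L 0}). ew h \<le> ew e} ea eb) (ea e) (eb e)"
proof -
 from inv have L: "!!v. v < n ==> L v < n" "!!v. v < n ==> L (L v) = L v"
  "!!c. c < n ==> L c \<noteq> c ==> gd (sl c)"
  "!!u v. u < n ==> v < n ==> L u = L v ==> conn (pairs (sl ` {c. c < n & L c \<noteq> c}) ea eb) u v"
  by (auto simp: bor_inv_def)
 have z: "L v \<in> roots L" if "v < n" for v using L that by (auto simp: roots_def)
 have fin: "finite (roots L)" by (simp add: roots_def)
 show R: "roots L = {L 0}"
 proof -
  have "c = L 0" if "c \<in> roots L" for c
   using one z[OF n] card_le_Suc0_iff_eq[OF fin] that by (metis One_nat_def)
  then show ?thesis using z[OF n] by blast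
 qed
 show "L 0 < n" using L n by auto
 have all: "L v = L 0" if "v < n" for v using z[OF that] unfolding R by simp
 have S: "{c. c < n & L c \<noteq> c} = {..<n} - {L 0}"
 proof (rule set_eqI)
  fix c show "c \<in> {c. c < n & L c \<noteq> c} \<longleftrightarrow> c \<in> {..<n} - {L 0}" using all[of c] by auto
 qed
 show con: "conn (pairs (sl ` ({..<n} - {L 0})) ea eb) u v" if "u < n" "v < n" for u v
  using L(4)[OF that] all[OF that(1)] all[OF that(2)] unfolding S by simp
 have gd: "gd h" if "h \<in> sl ` ({..<n} - {L 0})" for h using that L(3) unfolding S[symmetric] by auto
 show "sl c < m & ve (sl c)" if "c < n" "c \<noteq> L 0" for c
 proof -
  have "gd (sl c)" using gd that by blast
  then show ?thesis by (simp add: gd_def)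
 qed
 show "conn (pairs {h \<in> sl ` ({..<n} - {L 0}). ew h \<le> ew e} ea eb) (ea e) (eb e)" if e: "e < m" "ve e" for e
 proof -
 from good_threshold[OF gd con e]
 have "conn (pairs {h \<in> sl ` ({..<n} - {L 0}). rk h \<le> rk e} ea eb) (ea e) (eb e)" by blast
 then show ?thesis
 proof (rule conn_mono)
  show "pairs {h \<in> sl ` ({..<n} - {L 0}). rk h \<le> rk e} ea eb \<subseteq> pairs {h \<in> sl ` ({..<n} - {L 0}). ew h \<le> ew e} ea eb"
  proof (rule pairs_mono, rule subsetI)
   fix h assume "h \<in> {h \<in> sl ` ({..<n} - {L 0}). rk h \<le> rk e}"
   then have h: "h \<in> sl ` ({..<n} - {L 0})" "rk h \<le> rk e" by auto
   have "h < m" using gd[OF h(1)] by (simp add: gd_def)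
   from rk_le_ew[OF this e(1) h(2)] h(1) show "h \<in> {h \<in> sl ` ({..<n} - {L 0}). ew h \<le> ew e}" by simp
  qed
 qed
 qed
qed

end

section \<open>The selection program\<close>

text \<open>The sum over the coordinates is unrolled into one expression, whose size is constant
  because the dimension is fixed.\<close>

primrec dsq :: "nat => nat => iexp => iexp => rexp" where
 "dsq d 0 a b = RNum 0"
| "dsq d (Suc l) a b = (let x = RBin RSub (RLd (a [*] Num d [+] Num l)) (RLd (b [*] Num d [+] Num l))
   in RBin RAdd (dsq d l a b) (RBin RMul x x))"

definition dexp :: "nat => iexp => iexp => rexp" where "dexp d a b = RSq (dsq d d a b)"

lemma rval_dexp: "rval (dexp d a b) s =
  sqrt (\<Sum>l<d. (rmem s (ival a s * d + l) - rmem s (ival b s * d + l))\<^sup>2)"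
proof -
 have "rval (dsq d m a b) s = (\<Sum>l<m. (rmem s (ival a s * d + l) - rmem s (ival b s * d + l))\<^sup>2)" for m
  by (induction m) (simp_all add: Let_def power2_eq_square)
 then show ?thesis by (simp add: dexp_def)
qed

lemma rrd_dexp:
 assumes "l \<in> rrd (dexp d a b) s" "ival a s < n" "ival b s < n"
 shows "l \<in> ird a s \<or> l \<in> ird b s \<or> (\<exists>q < n * d. l = RCell q)"
proof -
 have lt: "x * d + i < n * d" if "x < n" "i < d" for x i
 proof -
  have "x * d + i < (x + 1) * d" using that by simp
  also have "\<dots> \<le> n * d" using that by (intro mult_le_mono1) simp
  finally show ?thesis .
 qed
 have *: "m \<le> d ==> l \<in> rrd (dsq d m a b) s ==> ?thesis" for m
  by (induction m) (use assms(2,3) lt in \<open>auto simp: Let_def\<close>)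
 show ?thesis using *[of d] assms(1) by (simp add: dexp_def)
qed

text \<open>Non-zero means true, a product is a conjunction and a sum a disjunction.\<close>

definition vltE :: "iexp => iexp => iexp" where
 "vltE a b = RLeq (RA 0 a) (RA 0 b) [*] (inot (RLeq (RA 0 b) (RA 0 a)) [+] (a [<] b))"

lemma ival_vltE [simp]:
 "ival (vltE a b) s = 0 \<longleftrightarrow> \<not> vlt (AR s 0) (ival a s) (ival b s)"
 "ird (vltE a b) s = {RCell (adr (ireg s 2) 0 (ival a s)), RCell (adr (ireg s 2) 0 (ival b s))} \<union> ird a s \<union> ird b s"
 by (auto simp: vltE_def vlt_def)

lemma ival_inot_vltE: "ival (inot (vltE a b)) s = of_bool (\<not> vlt (AR s 0) (ival a s) (ival b s))"
proof (cases "vlt (AR s 0) (ival a s) (ival b s)")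
 case True
 then have "ival (vltE a b) s \<noteq> 0" by simp
 then obtain v where "ival (vltE a b) s = Suc v" by (cases "ival (vltE a b) s") blast+
 then show ?thesis using True by simp
next
 case False
 then have z: "ival (vltE a b) s = 0" by simp
 show ?thesis using False by (simp only: ival.simps iop_val.simps z) simp
qed

lemma ival_vltE_ge [simp]: "Suc 0 \<le> ival (vltE a b) s \<longleftrightarrow> vlt (AR s 0) (ival a s) (ival b s)"
 using ival_vltE(1)[of a b s] by linarith

text \<open>Variables of the selection: 0 number of points, 1 \<open>minPts\<close>, 2 base address,
  4 the point, 5 rank still sought, 6 number of alive blocks, 7 block size, 8 number of slots
  including padding, 9 buffer length, 10 total length of all buffers, 11 width of a tree level, 12
  number of kept blocks, 13 pivot, 14 thread number. Integer array 0 lists the alive blocks, 1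
  receives compacted lists, 2 holds the buffers, 3 and 4 serve merging, 5 and 6 prefix counts. Real
  array 0 holds the block minima.\<close>

definition MINIMA :: "nat => hc" where
 "MINIMA d = (let j = IA 0 (Var 14 [/] Var 7) [*] Var 7 [+] Var 14 [%] Var 7 in
   Pf 14 (Var 8) [] (RS (Adr (Var 2) 0 (Var 14)) (RVar 0)) ;;
   Pf 14 (Var 6 [*] Var 7) [j [<] Var 0] (RM (Adr (Var 2) 0 (Var 14 [/] Var 7)) (dexp d (Var 4) j)))"

primrec rks :: "nat => iexp" where
 "rks 0 = Num 0"
| "rks (Suc b) = rks b [+] IA 4 (Num 8 [*] Var 14 [+] Num b)"

lemma ival_rks [simp]: "ival (rks b) s = (\<Sum>j<b. AI s 4 (8 * ireg s 14 + j))"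
 by (induction b) auto

lemma ird_rks [simp]: "ird (rks b) s = (\<lambda>j. ICell (adr (ireg s 2) 4 (8 * ireg s 14 + j))) ` {..<b}"
 by (induction b) (auto simp: lessThan_Suc)

text \<open>Each element is compared with all elements of its group of eight buffers. Cell
  \<open>8 * e + b\<close> of array 4 receives the first place in buffer \<open>b\<close> that is
  not below element \<open>e\<close>, which is the rank of \<open>e\<close> there;
  \<open>rks 8\<close> adds the eight ranks. Work is proportional to total length times buffer
  length, depth is constant.\<close>

definition SUPER :: "nat => hc" where
 "SUPER \<sigma> = (let t8 = Num 8 [*] Var 9; e = Var 14 [/] t8 in
   Pf 14 (Num 8 [*] Var 10) [] (IS (Adr (Var 2) 4 (Var 14)) (Var 9)) ;;
   Pf 14 (Num 8 [*] Var 10 [*] Var 9)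
    [inot (vltE (IA 2 (e [/] t8 [*] t8 [+] Var 14 [%] t8)) (IA 2 e))]
    (IM (Adr (Var 2) 4 (Var 14 [/] Var 9)) (Var 14 [%] Var 9)) ;;
   Pf 14 (Var 10) [rks 8 [%] Num \<sigma> [=] Num (\<sigma> - 1)]
    (IS (Adr (Var 2) 3 (e [*] (t8 [/] Num \<sigma>) [+] rks 8 [/] Num \<sigma>)) (IA 2 (Var 14))) ;;
   Asg 10 (Var 10 [/] Num \<sigma>) ;; Asg 9 (t8 [/] Num \<sigma>) ;;
   Pf 14 (Var 10) [] (IS (Adr (Var 2) 2 (Var 14)) (IA 3 (Var 14))))"

lemma div_mod_less: "i < a * (b::nat) ==> 0 < b ==> i div b < a & i mod b < b"
 by (simp add: less_mult_imp_div_less)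

lemma buffers_cong:
 assumes "!!i. i < nb * t ==> X i = Y i" "buffers V X t N nb w E"
 shows "buffers V Y t N nb w E"
proof -
 have lt: "b * t + j < nb * t" if "b < nb" "j < t" for b j
 proof -
  have "b * t + j < (b + 1) * t" using that by simp
  also have "\<dots> \<le> nb * t" using that by (intro mult_le_mono1) simp
  finally show ?thesis .
 qed
 have e: "Y (b * t + j) = X (b * t + j)" if "b < nb" "j < t" for b j using assms(1) lt[OF that] by simp
 have c: "{j. j < t & vlt V (Y (b * t + j)) x} = {j. j < t & vlt V (X (b * t + j)) x}" if "b < nb" for b x
  using e[OF that] by auto
 note B = assms(2)[unfolded buffers_def]
 show ?thesis
  unfolding buffers_def
 proof (intro conjI allI impI)
  fix b j j' assume a: "b < nb" "j < j'" "j' < t"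
  then have "j < t" by simp
  then show "vlt V (Y (b * t + j)) (Y (b * t + j'))" using B a e[OF a(1)] by simp
 qed (use B e c in \<open>simp_all\<close>)
qed

locale core =
 fixes n k d \<beta> Q SZ p :: nat and Rd Wr :: "loc set" and Dm :: "nat => real" and inp :: "nat => real" and BIG :: real
 assumes reg: "region Q SZ \<subseteq> Wr" and Rd: "RCell ` {..<n * d} \<subseteq> Rd" and ndQ: "n * d \<le> Q"
  and Dm: "!!j. j < n ==> Dm j = sqrt (\<Sum>l<d. (inp (p * d + l) - inp (j * d + l))\<^sup>2)"
  and BIG: "!!j. j < n ==> Dm j < BIG"
  and p: "p < n"
begin

lemma inRW [simp]: "c < 16 ==> i < SZ ==> ICell (adr Q c i) \<in> Wr" "c < 16 ==> i < SZ ==> RCell (adr Q c i) \<in> Wr"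
 using reg by auto

definition env :: "state => bool" where
 "env s \<longleftrightarrow> ireg s 0 = n & ireg s 2 = Q & ireg s 4 = p & rreg s 0 = BIG & (\<forall>a < n * d. rmem s a = inp a)"

lemma env_same: "env s ==> same R C C' s t ==> 0 \<notin> R ==> 4 \<notin> R ==> env t"
 using ndQ unfolding env_def same_def by auto

lemma env_dexp: "env s ==> ival a s = p ==> ival b s < n ==> rval (dexp d a b) s = Dm (ival b s)"
proof -
 assume e: "env s" "ival a s = p" "ival b s < n"
 have lt: "x * d + l < n * d" if "x < n" "l < d" for x l
 proof -
  have "x * d + l < (x + 1) * d" using that by simp
  also have "\<dots> \<le> n * d" using that by (intro mult_le_mono1) simp
  finally show ?thesis .
 qed
 show ?thesis unfolding rval_dexp Dm[OF e(3)]
  using e lt p by (intro arg_cong[where f = sqrt] sum.cong) (auto simp: env_def)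
qed

lemma MINIMA_ok:
 assumes s: "env s" "ireg s 6 = B" "ireg s 7 = bs" "ireg s 8 = M"
  and sz: "B \<le> M" "M \<le> SZ" "0 < bs" "B * bs \<le> \<beta>" "M \<le> \<beta>" "1 + M \<le> X" "1 + B * bs \<le> X" "1 \<le> D"
  and post: "!!t. same {} {} {0} s t ==> (!!i. i < M ==> AR t 0 i =
   (if i < B then Min (insert BIG (Dm ` {j. j < n & j div bs = AI s 0 i})) else BIG)) ==> ireg t = ireg s ==>
    imem t = imem s ==> PP t"
 shows "ok \<beta> (MINIMA d) s X D Rd Wr PP"
 unfolding MINIMA_def Let_def
proof (rule ok_seq, rule pf_RA[where z = SZ and m = M and G = "\<lambda>i. True" and ad = "\<lambda>i. i" and vl = "\<lambda>i. BIG"])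
 show "region (ireg s 2) SZ \<subseteq> Wr" using reg s by (simp add: env_def)
next
 fix t assume t: "same {} {} {0} s t" "!!i. i < M ==> True ==> AR t 0 i = BIG" "ireg t = ireg s" "imem t = imem s"
 have et: "env t" by (rule env_same[OF s(1) t(1)]) auto
 have Qt: "ireg t 2 = Q" using et by (simp add: env_def)
 \<comment> \<open>The position examined by thread \<open>i\<close>: offset \<open>i mod bs\<close>
   in the alive block stored at place \<open>i div bs\<close>.\<close>
 let ?j = "\<lambda>i. imem s (adr Q 0 (i div bs)) * bs + i mod bs"
 have dv: "i div bs < B & i mod bs < bs" if "i < B * bs" for i using that div_mod_less sz(3) by blast
 have dvS: "i div bs < SZ" if "i < B * bs" for i using dv[OF that] sz by simp
 have red: "l = ICell (adr Q 0 (i div bs)) \<or> (\<exists>q < n * d. l = RCell q)"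
  if l: "l \<in> grd [IA 0 (Var 14 [/] Var 7) [*] Var 7 [+] Var 14 [%] Var 7 [<] Var 0]
    (RM (Adr (Var 2) 0 (Var 14 [/] Var 7)) (dexp d (Var 4) (IA 0 (Var 14 [/] Var 7) [*] Var 7 [+] Var 14 [%] Var 7)))
    (setv t 14 i)" for i l
 proof -
  let ?S = "(setv t 14 i)" and ?jE = "IA 0 (Var 14 [/] Var 7) [*] Var 7 [+] Var 14 [%] Var 7"
  have r: "ireg t 7 = bs" "ireg t 0 = n" "ireg t 4 = p" using s t(3) by (simp_all add: env_def)
  have e: "ival ?jE ?S = ?j i" "ird ?jE ?S = {ICell (adr Q 0 (i div bs))}" using r Qt t(4) by simp_all
  have "l = ICell (adr Q 0 (i div bs)) \<or> ?j i < n & l \<in> rrd (dexp d (Var 4) ?jE) ?S"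
   using l r Qt t(4) by (auto split: if_splits)
  then show ?thesis
  proof (elim disjE conjE)
   assume "?j i < n" and l: "l \<in> rrd (dexp d (Var 4) ?jE) ?S"
   then have "ival (Var 4) ?S < n" "ival ?jE ?S < n" using e r p by auto
   from rrd_dexp[OF l this] show ?thesis unfolding e by auto
  qed simp
 qed
 show "ok \<beta> (Pf 14 (Var 6 [*] Var 7) [IA 0 (Var 14 [/] Var 7) [*] Var 7 [+] Var 14 [%] Var 7 [<] Var 0]
    (RM (Adr (Var 2) 0 (Var 14 [/] Var 7)) (dexp d (Var 4) (IA 0 (Var 14 [/] Var 7) [*] Var 7 [+] Var 14 [%] Var 7))))
   t X D Rd Wr PP"
 proof (rule pf_RMA[where z = SZ and m = "B * bs" and G = "\<lambda>i. ?j i < n" and ad = "\<lambda>i. i div bs" and vl = "\<lambda>i. Dm (?j i)"])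
  fix i assume i: "i < B * bs" "?j i < n"
  let ?S = "(setv t 14 i)"
  have "env ?S" using et by (simp add: env_def)
  from env_dexp[OF this] show "rval (dexp d (Var 4) (IA 0 (Var 14 [/] Var 7) [*] Var 7 [+] Var 14 [%] Var 7)) ?S = Dm (?j i)"
   using i et t s by (simp add: env_def)
 next
  fix i l assume i: "i < B * bs"
   and l: "l \<in> grd [IA 0 (Var 14 [/] Var 7) [*] Var 7 [+] Var 14 [%] Var 7 [<] Var 0]
    (RM (Adr (Var 2) 0 (Var 14 [/] Var 7)) (dexp d (Var 4) (IA 0 (Var 14 [/] Var 7) [*] Var 7 [+] Var 14 [%] Var 7)))
    (setv t 14 i)"
  have a: "i div bs < SZ" using dv[OF i] sz by simp
  from red[OF l] show "l \<in> Rd \<union> Wr" using a Rd by auto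
 next
  fix i j assume i: "i < B * bs" "j < B * bs"
   and l: "RCell (adr (ireg t 2) 0 (j div bs)) \<in> grd [IA 0 (Var 14 [/] Var 7) [*] Var 7 [+] Var 14 [%] Var 7 [<] Var 0]
    (RM (Adr (Var 2) 0 (Var 14 [/] Var 7)) (dexp d (Var 4) (IA 0 (Var 14 [/] Var 7) [*] Var 7 [+] Var 14 [%] Var 7)))
    (setv t 14 i)"
  have "\<not> adr Q 0 (j div bs) < n * d" using adr_ge[of Q 0 "j div bs"] ndQ by linarith
  then show "i = j" using red[OF l] Qt by auto
 next
  fix u assume u: "same {} {} {0} t u" "!!j. AR u 0 j = Min (insert (AR t 0 j)
    ((\<lambda>i. Dm (?j i)) ` {i. i < B * bs & ?j i < n & i div bs = j}))" "ireg u = ireg t" "imem u = imem t"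
  show "PP u"
  proof (rule post)
   show "same {} {} {0} s u" by (rule same_trans[OF t(1) u(1)]) auto
  next
   fix i assume i: "i < M"
   show "AR u 0 i = (if i < B then Min (insert BIG (Dm ` {j. j < n & j div bs = AI s 0 i})) else BIG)"
   proof (cases "i < B")
    case True
    have "(\<lambda>i. Dm (?j i)) ` {i'. i' < B * bs & ?j i' < n & i' div bs = i} = Dm ` {j. j < n & j div bs = AI s 0 i}"
    proof (intro equalityI subsetI)
     fix x assume "x \<in> (\<lambda>i. Dm (?j i)) ` {i'. i' < B * bs & ?j i' < n & i' div bs = i}"
     then obtain i' where i': "x = Dm (?j i')" "?j i' < n" "i' div bs = i" by auto
     have "?j i' div bs = AI s 0 i" using i'(3) sz(3) s by (simp add: env_def)
     then show "x \<in> Dm ` {j. j < n & j div bs = AI s 0 i}" using i' by blast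
    next
     fix x assume "x \<in> Dm ` {j. j < n & j div bs = AI s 0 i}"
     then obtain j where j: "x = Dm j" "j < n" "j div bs = AI s 0 i" by auto
     let ?i = "i * bs + j mod bs"
     have "?i < (i + 1) * bs" using sz(3) by simp
     also have "\<dots> \<le> B * bs" using True by (intro mult_le_mono1) simp
     finally have lt: "?i < B * bs" .
     have dm: "?i div bs = i" "?i mod bs = j mod bs" using sz(3) by simp_all
     have "?j ?i = j" unfolding dm using j(3) s by (simp add: env_def) (metis div_mult_mod_eq)
     then show "x \<in> (\<lambda>i. Dm (?j i)) ` {i'. i' < B * bs & ?j i' < n & i' div bs = i}"
      using j lt dm by (intro image_eqI[of _ _ ?i]) auto
    qed
    then show ?thesis using u(2)[of i] t(2)[OF i] u(3) True by simp
   next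
    case False
    then have "{i'. i' < B * bs & ?j i' < n & i' div bs = i} = {}" using dv by auto
    then show ?thesis using u(2)[of i] t(2)[OF i] u(3) False by (simp only: image_empty) simp
   qed
  qed (use u t in auto)
 qed (use s t sz et dv dvS Qt reg in \<open>auto simp: env_def Suc_le_eq dest: dv\<close>)
qed (use s sz in \<open>auto simp: env_def\<close>)

lemma SUPER_ok:
 assumes s: "env s" "ireg s 9 = t" "ireg s 10 = c" and c: "c = nb * (8 * t)"
  and B: "buffers (AR s 0) (AI s 2) t N (8 * nb) w E"
  and t: "0 < t" and \<sigma>: "0 < \<sigma>" "8 * t = \<sigma> * t'"
  and sz: "8 * nb * N \<le> SZ" "8 * c \<le> SZ" "8 * c * t \<le> \<beta>" "8 * t \<le> \<beta>" "1 + 8 * c * t \<le> X" "1 \<le> D"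
  and post: "!!u. same {9, 10} {2, 3, 4} {} s u ==> ireg u 9 = t' ==> ireg u 10 = nb * t' ==>
   buffers (AR u 0) (AI u 2) t' (8 * N) nb (\<sigma> * w) (8 * E + (\<sigma> - 1) * w) ==> PP u"
 shows "ok \<beta> (SUPER \<sigma>) s X D Rd Wr PP"
proof -
 let ?P1 = "IS (Adr (Var 2) 3 (Var 14 [/] (Num 8 [*] Var 9) [*] (Num 8 [*] Var 9 [/] Num \<sigma>) [+] rks 8 [/] Num \<sigma>)) (IA 2 (Var 14))"
 let ?P2 = "[inot (vltE (IA 2 (Var 14 [/] (Num 8 [*] Var 9) [/] (Num 8 [*] Var 9) [*] (Num 8 [*] Var 9) [+] Var 14 [%] (Num 8 [*] Var 9)))
  (IA 2 (Var 14 [/] (Num 8 [*] Var 9))))]"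
 let ?P3 = "Asg 9 (Num 8 [*] Var 9 [/] Num \<sigma>) ;; Pf 14 (Var 10) [] (IS (Adr (Var 2) 2 (Var 14)) (IA 3 (Var 14)))"
 let ?P4 = "[rks 8 [%] Num \<sigma> [=] Num (\<sigma> - 1)]"
 let ?P5 = "Asg 10 (Var 10 [/] Num \<sigma>) ;; ?P3"
 let ?P6 = "IM (Adr (Var 2) 4 (Var 14 [/] Var 9)) (Var 14 [%] Var 9)"
 define V where "V = AR s 0"
 define Y where "Y = AI s 2"
 have Q: "ireg s 2 = Q" using s by (simp add: env_def)
 have c8': "8 * c \<le> 8 * c * t" using t by simp
 have c8: "8 * c \<le> \<beta>" "Suc (8 * c) \<le> X" "c \<le> \<beta>" "Suc c \<le> X"
  using order_trans[OF c8' sz(3)] c8' sz(5) by linarith+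
 have Y_lt: "Y i < SZ" if "i < c" for i
 proof -
  have "i < 8 * nb * t" using that c by simp
  from div_mod_less[OF this t] have dm: "i div t < 8 * nb" "i mod t < t" by auto
  have "Y (i div t * t + i mod t) < (i div t + 1) * N"
   using B dm unfolding buffers_def Y_def by blast
  also have "\<dots> \<le> 8 * nb * N" using dm by (intro mult_le_mono1) simp
  finally show ?thesis using sz(1) by simp
 qed
 \<comment> \<open>Thread \<open>i\<close> compares element \<open>eo i\<close> with element
   \<open>src i\<close> of the same group.\<close>
 define eo where "eo i = i div (8 * t)" for i
 define src where "src i = eo i div (8 * t) * (8 * t) + i mod (8 * t)" for i
 have eo: "eo i < c" if "i < 8 * c * t" for i
  unfolding eo_def using that t by (intro less_mult_imp_div_less) (simp add: ac_simps)
 have src: "src i < c" if "i < 8 * c * t" for i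
 proof -
  have "eo i div (8 * t) < nb" using eo[OF that] c t by (intro less_mult_imp_div_less) simp
  moreover have "i mod (8 * t) < 8 * t" using t by simp
  ultimately have "src i < (eo i div (8 * t) + 1) * (8 * t)" "(eo i div (8 * t) + 1) * (8 * t) \<le> nb * (8 * t)"
   unfolding src_def by (simp, intro mult_le_mono1, simp)
  then show ?thesis using c by linarith
 qed
 \<comment> \<open>The rank of element \<open>e\<close> within its group, which decides whether and
   where it is copied.\<close>
 define RK where "RK e = card {q. q < 8 * t & vlt V (Y (e div (8 * t) * (8 * t) + q)) (Y e)}" for e
 have RKg: "RK (g * (8 * t) + q) = grank V (\<lambda>q. Y (g * (8 * t) + q)) (8 * t) q" if "q < 8 * t" for g q
  using that unfolding RK_def grank_def by simp
 have gb: "bij_betw (grank V (\<lambda>q. Y (g * (8 * t) + q)) (8 * t)) {..<8 * t} {..<8 * t}" if "g < nb" for g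
  by (rule grank_bij(1), rule buffers_inj[OF B[folded V_def Y_def] that])
 have dec: "e = e div (8 * t) * (8 * t) + e mod (8 * t) & e div (8 * t) < nb & e mod (8 * t) < 8 * t" if "e < c" for e
 proof -
  have "0 < 8 * t" using t by simp
  from div_mod_less[OF that[unfolded c] this] div_mult_mod_eq[of e "8 * t"] show ?thesis by metis
 qed
 have RK_lt: "RK e < 8 * t" if "e < c" for e
 proof -
  let ?g = "e div (8 * t)"
  have m: "e mod (8 * t) < 8 * t" and g: "?g < nb" using dec[OF that] by blast+
  have "?g * (8 * t) + e mod (8 * t) = e" by (rule div_mult_mod_eq)
  then have "RK e = grank V (\<lambda>q. Y (?g * (8 * t) + q)) (8 * t) (e mod (8 * t))" using RKg[OF m, of ?g] by metis
  then show ?thesis using bij_betwE[OF gb[OF g]] m by auto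
 qed
 have RK_inj: "e = e'" if "e < c" "e' < c" "e div (8 * t) = e' div (8 * t)" "RK e = RK e'" for e e'
 proof -
  let ?g = "e div (8 * t)"
  have m: "e mod (8 * t) < 8 * t" "e' mod (8 * t) < 8 * t" using t by simp_all
  have e: "?g * (8 * t) + e mod (8 * t) = e" "?g * (8 * t) + e' mod (8 * t) = e'"
   using div_mult_mod_eq[of e "8 * t"] div_mult_mod_eq[of e' "8 * t"] that(3) by metis+
  have "e mod (8 * t) = e' mod (8 * t)"
  proof (rule inj_onD[OF bij_betw_imp_inj_on[OF gb]])
   show "?g < nb" using dec[OF that(1)] by blast
   show "grank V (\<lambda>q. Y (?g * (8 * t) + q)) (8 * t) (e mod (8 * t)) = grank V (\<lambda>q. Y (?g * (8 * t) + q)) (8 * t) (e' mod (8 * t))"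
    using RKg[OF m(1), of ?g] RKg[OF m(2), of ?g] that(4) unfolding e by simp
  qed (use m in auto)
  then show ?thesis using e by metis
 qed
 have t': "8 * t div \<sigma> = t'" using \<sigma> by simp
 have "c = \<sigma> * (nb * t')" unfolding c \<sigma>(2) by (rule mult.left_commute)
 then have ct': "c div \<sigma> = nb * t'" using \<sigma>(1) by simp
 have RKt: "RK e div \<sigma> < t'" if "e < c" for e
  using RK_lt[OF that] \<sigma> by (simp add: less_mult_imp_div_less mult.commute)
 have ad_lt: "e div (8 * t) * t' + RK e div \<sigma> < nb * t'" if "e < c" for e
 proof -
  have "e div (8 * t) * t' + RK e div \<sigma> < (e div (8 * t) + 1) * t'" using RKt[OF that] by simp
  also have "\<dots> \<le> nb * t'" using dec[OF that] by (intro mult_le_mono1) simp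
  finally show ?thesis .
 qed
 have nbt: "nb * t' \<le> c" using ct' by (metis div_le_dividend)
 show ?thesis
  unfolding SUPER_def Let_def
 proof (rule ok_seq, rule pf_IA[where z = SZ and m = "8 * c" and G = "\<lambda>i. True" and ad = "\<lambda>i. i" and vl = "\<lambda>i. t"])
  show "region (ireg s 2) SZ \<subseteq> Wr" using reg Q by simp
 next
  fix t1 assume t1: "same {} {4} {} s t1" "!!i. i < 8 * c ==> True ==> AI t1 4 i = t" "ireg t1 = ireg s"
  have m1: "!!i. imem t1 (adr Q 2 i) = Y i" "!!i. rmem t1 (adr Q 0 i) = V i"
   using same_AI[OF t1(1), of 2] same_AR[OF t1(1), of 0] Q t1(3) by (auto simp: Y_def V_def)
  show "ok \<beta> (Pf 14 (Num 8 [*] Var 10 [*] Var 9) ?P2 ?P6 ;; Pf 14 (Var 10) ?P4 ?P1 ;; ?P5) t1 X D Rd Wr PP"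
  proof (rule ok_seq, rule pf_IMA[where z = SZ and m = "8 * c * t" and G = "\<lambda>i. \<not> vlt V (Y (src i)) (Y (eo i))"
     and ad = "\<lambda>i. i div t" and vl = "\<lambda>i. i mod t"])
   show "region (ireg t1 2) SZ \<subseteq> Wr" using reg Q t1(3) by simp
  next
   fix i assume i: "i < 8 * c * t"
   show "gev ?P2 (setv t1 14 i) = (\<not> vlt V (Y (src i)) (Y (eo i)))"
    using s(2) t1(3) Q m1 by (simp add: src_def eo_def)
  next
   fix i l assume i: "i < 8 * c * t" and l: "l \<in> grd ?P2 ?P6 (setv t1 14 i)"
   have b: "eo i < SZ" "src i < SZ" "Y (eo i) < SZ" "Y (src i) < SZ"
    using eo[OF i] src[OF i] Y_lt[of "eo i"] Y_lt[of "src i"] sz(2) by auto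
   have "l \<in> {ICell (adr Q 2 (src i)), ICell (adr Q 2 (eo i)), RCell (adr Q 0 (Y (src i))), RCell (adr Q 0 (Y (eo i)))}"
    using l s(2) t1(3) Q m1 by (auto simp: src_def eo_def split: if_splits)
   then show "l \<in> Rd \<union> Wr" using b by auto
  next
   fix i assume i: "i < 8 * c * t"
   have "i div t < 8 * c" using i t by (simp add: less_mult_imp_div_less)
   then show "i div t < SZ" using sz(2) by simp
  next
   fix t2 assume t2: "same {} {4} {} t1 t2" "!!j. AI t2 4 j = Min (insert (AI t1 4 j) ((\<lambda>i. i mod t) ` {i. i < 8 * c * t & \<not> vlt V (Y (src
    i)) (Y (eo i)) & i div t = j}))" "ireg t2 = ireg t1"
   have m2: "!!i. imem t2 (adr Q 2 i) = Y i" "!!i. rmem t2 (adr Q 0 i) = V i"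
    using same_AI[OF t2(1), of 2] same_AR[OF t2(1), of 0] Q t2(3) t1(3) m1 by auto
   have rk1: "imem t2 (adr Q 4 (8 * e + b)) = card {j. j < t & vlt V (Y (e div (8 * t) * (8 * t) + (b * t + j))) (Y e)}"
    if e: "e < c" and b: "b < 8" for e b
   proof -
    let ?r = "8 * e + b" and ?Z = "\<lambda>j. Y (e div (8 * t) * (8 * t) + (b * t + j))"
    have r: "?r < 8 * c" "?r div 8 = e" "?r mod 8 = b" using e b by auto
    have ii: "eo i = e & src i = e div (8 * t) * (8 * t) + (b * t + i mod t)" if "i div t = ?r" for i
    proof -
     have "eo i = e" unfolding eo_def using that r(2) by (metis div_mult2_eq mult.commute)
     moreover have "i mod (8 * t) = b * t + i mod t"
      using that r(3) mod_mult2_eq[of i t 8] by (simp only: mult.commute)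
     ultimately show ?thesis by (simp add: src_def)
    qed
    have img: "(\<lambda>i. i mod t) ` {i. i < 8 * c * t & \<not> vlt V (Y (src i)) (Y (eo i)) & i div t = ?r} = {j. j < t & \<not> vlt V (?Z j) (Y e)}"
    proof (intro equalityI subsetI)
     fix j assume "j \<in> (\<lambda>i. i mod t) ` {i. i < 8 * c * t & \<not> vlt V (Y (src i)) (Y (eo i)) & i div t = ?r}"
     then obtain i where i: "j = i mod t" "\<not> vlt V (Y (src i)) (Y (eo i))" "i div t = ?r" by auto
     then show "j \<in> {j. j < t & \<not> vlt V (?Z j) (Y e)}" using ii[OF i(3)] t by simp
    next
     fix j assume j: "j \<in> {j. j < t & \<not> vlt V (?Z j) (Y e)}"
     let ?i = "?r * t + j"
     have d: "?i div t = ?r" "?i mod t = j" using j t by auto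
     have "?i < (?r + 1) * t" using j by simp
     also have "\<dots> \<le> 8 * c * t" using r(1) by (intro mult_le_mono1) simp
     finally have "?i < 8 * c * t" .
     then show "j \<in> (\<lambda>i. i mod t) ` {i. i < 8 * c * t & \<not> vlt V (Y (src i)) (Y (eo i)) & i div t = ?r}"
      using d j ii[OF d(1)] by (intro image_eqI[of _ _ ?i]) auto
    qed
    have "imem t2 (adr Q 4 ?r) = Min (insert t {j. j < t & \<not> vlt V (?Z j) (Y e)})"
     using t2(2)[of ?r] t1(2)[OF r(1)] t2(3) t1(3) Q unfolding img by simp
    also have "\<dots> = card {j. j < t & vlt V (?Z j) (Y e)}"
    proof (rule Min_rank)
     fix j j' assume jj: "j < j'" "j' < t"
     have g: "e div (8 * t) * 8 + b < 8 * nb" using dec[OF e] b by linarith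
     have "vlt V (Y ((e div (8 * t) * 8 + b) * t + j)) (Y ((e div (8 * t) * 8 + b) * t + j'))"
      using B g jj unfolding buffers_def V_def Y_def by blast
     then show "vlt V (?Z j) (?Z j')" by (simp add: algebra_simps)
    qed
    finally show ?thesis .
   qed
   have rk: "(\<Sum>b<8. imem t2 (adr Q 4 (8 * e + b))) = RK e" if e: "e < c" for e
    using rk1[OF e] card_block_split[of 8 t "\<lambda>q. vlt V (Y (e div (8 * t) * (8 * t) + q)) (Y e)"]
    unfolding RK_def by (metis (mono_tags, lifting) lessThan_iff sum.cong)
   show "ok \<beta> (Pf 14 (Var 10) ?P4 ?P1 ;; ?P5) t2 X D Rd Wr PP"
   proof (rule ok_seq, rule pf_IA[where z = SZ and m = c and G = "\<lambda>e. RK e mod \<sigma> = \<sigma> - 1"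
      and ad = "\<lambda>e. e div (8 * t) * t' + RK e div \<sigma>" and vl = Y])
    show "region (ireg t2 2) SZ \<subseteq> Wr" using reg Q t1(3) t2(3) by simp
   next
    fix e assume e: "e < c"
    show "gev ?P4 (setv t2 14 e) = (RK e mod \<sigma> = \<sigma> - 1)"
     using rk[OF e] Q t1(3) t2(3) by auto
    show "ival (Var 14 [/] (Num 8 [*] Var 9) [*] (Num 8 [*] Var 9 [/] Num \<sigma>) [+] rks 8 [/] Num \<sigma>) (setv t2 14 e) = e div (8 * t) * t' +
     RK e div \<sigma>"
     using rk[OF e] Q t1(3) t2(3) s t' by simp
   next
    fix e l assume e: "e < c" and l: "l \<in> grd ?P4 ?P1 (setv t2 14 e)"
    have "8 * e + j < SZ" if "j < 8" for j using e that sz(2) by linarith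
    moreover have "e < SZ" using e sz(2) by linarith
    ultimately show "l \<in> Rd \<union> Wr" using l by (auto simp: Q t1(3) t2(3) split: if_splits)
   next
    fix e e' assume e: "e < c" "e' < c" "RK e mod \<sigma> = \<sigma> - 1" "RK e' mod \<sigma> = \<sigma> - 1"
     "e div (8 * t) * t' + RK e div \<sigma> = e' div (8 * t) * t' + RK e' div \<sigma>"
    have "(e div (8 * t) * t' + RK e div \<sigma>) div t' = e div (8 * t)" "(e div (8 * t) * t' + RK e div \<sigma>) mod t' = RK e div \<sigma>"
     "(e' div (8 * t) * t' + RK e' div \<sigma>) div t' = e' div (8 * t)" "(e' div (8 * t) * t' + RK e' div \<sigma>) mod t' = RK e' div \<sigma>"
     using RKt[OF e(1)] RKt[OF e(2)] by simp_all
    then have "e div (8 * t) = e' div (8 * t)" "RK e div \<sigma> = RK e' div \<sigma>" using e(5) by metis+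
    moreover have "RK e = RK e'" using calculation(2) e(3,4) by (metis div_mult_mod_eq)
    ultimately show "e = e'" using RK_inj e by blast
   next
    fix e e' assume e: "e < c" "e' < c" and l: "ICell (adr (ireg t2 2) 3 (e' div (8 * t) * t' + RK e' div \<sigma>)) \<in> grd ?P4 ?P1 (setv t2 14 e)"
    then show "e = e'" by (auto split: if_splits)
   next
    fix e assume e: "e < c"
    show "e div (8 * t) * t' + RK e div \<sigma> < SZ" using ad_lt[OF e] nbt sz(2) by linarith
    assume "bnd \<beta> t2"
    then show "Y e \<le> \<beta>" unfolding m2(1)[symmetric] by (simp add: bnd_def)
   next
    fix t3 assume t3: "same {} {3} {} t2 t3"
     "!!e. e < c ==> RK e mod \<sigma> = \<sigma> - 1 ==> AI t3 3 (e div (8 * t) * t' + RK e div \<sigma>) = Y e" "ireg t3 = ireg t2"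
    have rg: "ireg t3 = ireg s" using t1 t2 t3 by simp
    have bf: "buffers V (AI t3 3) t' (8 * N) nb (\<sigma> * w) (8 * E + (\<sigma> - 1) * w)"
    proof (rule buffers_merge[OF B[folded V_def Y_def] t \<sigma>])
     fix g q assume g: "g < nb" and q: "q < 8 * t" and r: "grank V (\<lambda>q. Y (g * (8 * t) + q)) (8 * t) q mod \<sigma> = \<sigma> - 1"
     let ?e = "g * (8 * t) + q"
     have "?e < (g + 1) * (8 * t)" using q by simp
     also have "\<dots> \<le> c" unfolding c using g by (intro mult_le_mono1) simp
     finally have e: "?e < c" .
     have "?e div (8 * t) = g" using q by simp
     then show "AI t3 3 (g * t' + grank V (\<lambda>q. Y (g * (8 * t) + q)) (8 * t) q div \<sigma>) = Y ?e"
      using t3(2)[OF e] RKg[OF q, of g] r by simp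
    qed
    have m3: "rmem t3 (adr Q 0 i) = V i" for i
     using same_AR[OF t3(1), of 0 i] m2(2)[of i] by (simp add: Q t1(3) t2(3) rg)
    show "ok \<beta> ?P5 t3 X D Rd Wr PP"
    proof (rule ok_seq, rule asg_same)
     fix t4 assume t4: "same {10} {} {} t3 t4" "ireg t4 = (ireg t3)(10 := ival (Var 10 [/] Num \<sigma>) t3)"
      "imem t4 = imem t3" "rmem t4 = rmem t3"
     show "ok \<beta> ?P3 t4 X D Rd Wr PP"
     proof (rule ok_seq, rule asg_same)
      fix t5 assume t5: "same {9} {} {} t4 t5" "ireg t5 = (ireg t4)(9 := ival (Num 8 [*] Var 9 [/] Num \<sigma>) t4)"
       "imem t5 = imem t4" "rmem t5 = rmem t4"
      have r5: "ireg t5 9 = t'" "ireg t5 10 = nb * t'" "ireg t5 2 = Q" using t5(2) t4(2) rg s t' ct' Q by auto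
      show "ok \<beta> (Pf 14 (Var 10) [] (IS (Adr (Var 2) 2 (Var 14)) (IA 3 (Var 14)))) t5 X D Rd Wr PP"
      proof (rule pf_IA[where z = SZ and m = "nb * t'" and G = "\<lambda>i. True" and ad = "\<lambda>i. i" and vl = "\<lambda>i. AI t5 3 i"])
       fix u assume u: "same {} {2} {} t5 u" "!!i. i < nb * t' ==> True ==> AI u 2 i = AI t5 3 i" "ireg u = ireg t5"
       have "buffers (AR u 0) (AI u 2) t' (8 * N) nb (\<sigma> * w) (8 * E + (\<sigma> - 1) * w)"
       proof (rule buffers_cong[where X = "AI t3 3"])
        have "AR u 0 = V" using same_AR[OF u(1), of 0] r5 u(3) m3 t5 t4 by (intro ext) auto
        then show "buffers (AR u 0) (AI t3 3) t' (8 * N) nb (\<sigma> * w) (8 * E + (\<sigma> - 1) * w)" using bf by simp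
        show "AI t3 3 i = AI u 2 i" if "i < nb * t'" for i
         using u(2)[OF that] u(3) t5 t4 rg r5 Q by simp
       qed
       moreover have "same {9, 10} {2, 3, 4} {} s u"
       proof -
        have a: "same {9, 10} {2, 3, 4} {} s t2" by (rule same_trans[OF t1(1) t2(1)]) auto
        have b: "same {9, 10} {2, 3, 4} {} s t3" by (rule same_trans[OF a t3(1)]) auto
        have c: "same {9, 10} {2, 3, 4} {} s t4" by (rule same_trans[OF b t4(1)]) auto
        have d: "same {9, 10} {2, 3, 4} {} s t5" by (rule same_trans[OF c t5(1)]) auto
        show ?thesis by (rule same_trans[OF d u(1)]) auto
       qed
       ultimately show "PP u" using post u(3) r5 by simp
      qed (use r5 reg nbt sz c8 in \<open>auto simp: bnd_def\<close>)
     qed (use sz t4(2) rg s t' in \<open>auto intro: order_trans[OF div_le_dividend]\<close>)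
    qed (use sz rg s c8 in \<open>auto intro: order_trans[OF div_le_dividend]\<close>)
   qed (use c8 sz in \<open>simp_all add: s Q t1(3) t2(3) m2\<close>)
  qed (use s t1 Q sz c8 m1 in \<open>auto split: if_splits\<close>)
 qed (use s sz c8 t in \<open>auto\<close>)
qed

end

text \<open>\<open>SUPER 1\<close> drops nothing, so two rounds starting from buffers of length 1
  sort groups of 64 items exactly, with weight 1 and no rank error.\<close>

definition SORT :: hc where
 "SORT = Pf 14 (Var 8) [] (IS (Adr (Var 2) 2 (Var 14)) (Var 14)) ;;
   Asg 9 (Num 1) ;; Asg 10 (Var 8) ;; SUPER 1 ;; SUPER 1"

text \<open>A round with \<open>SUPER 4\<close> doubles the buffer length and divides the total
  length by four, so their product, which governs the work, is halved. The loop ends with one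
  buffer, whose element at one sixteenth becomes the pivot.\<close>

definition PIVOT :: hc where
 "PIVOT = SORT ;; Whl (Var 9 [<] Var 10) (SUPER 4) ;; Asg 13 (IA 2 (Var 9 [/] Num 16))"

text \<open>Array 5 is a binary tree in heap order with its leaves from \<open>Var 8\<close> on and
  the children of node \<open>v\<close> at \<open>2 * v\<close> and \<open>2 * v + 1\<close>. The
  upward pass counts the flags below every node, the downward pass records in array 6 the flags to
  the left of its subtree.\<close>

definition SCAN :: hc where
 "SCAN = Pf 14 (Var 8) [] (IS (Adr (Var 2) 5 (Var 8 [+] Var 14)) (inot (vltE (Var 13) (Var 14)))) ;;
   Asg 11 (Var 8) ;;
   Whl (Num 2 [<=] Var 11)
    (Asg 11 (Var 11 [/] Num 2) ;;
    Pf 14 (Var 11) [] (IS (Adr (Var 2) 5 (Var 11 [+] Var 14))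
     (IA 5 (Num 2 [*] (Var 11 [+] Var 14)) [+] IA 5 (Num 2 [*] (Var 11 [+] Var 14) [+] Num 1)))) ;;
   Pf 14 (Num 1) [] (IS (Adr (Var 2) 6 (Num 1)) (Num 0)) ;;
   Asg 11 (Num 1) ;;
   Whl (Var 11 [<] Var 8)
    (Pf 14 (Num 2 [*] Var 11) [] (IS (Adr (Var 2) 6 (Num 2 [*] Var 11 [+] Var 14))
     (IA 6 ((Num 2 [*] Var 11 [+] Var 14) [/] Num 2) [+]
      (Num 2 [*] Var 11 [+] Var 14) [%] Num 2 [*] IA 5 (Num 2 [*] Var 11 [+] Var 14 [-] Num 1))) ;;
    Asg 11 (Num 2 [*] Var 11)) ;;
   Asg 12 (IA 5 (Num 1))"

lemma buffers_mono: "buffers V X t N nb w E ==> E \<le> E' ==> buffers V X t N nb w E'"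
 unfolding buffers_def by (meson add_left_mono order_trans)

definition cnt :: "(nat => bool) => nat => nat => nat" where
 "cnt P a b = card {i. a \<le> i & i < b & P i}"

lemma cnt_add: "a \<le> b ==> b \<le> c ==> cnt P a b + cnt P b c = cnt P a c"
proof -
 assume ab: "a \<le> b" "b \<le> c"
 have "{i. a \<le> i & i < c & P i} = {i. a \<le> i & i < b & P i} \<union> {i. b \<le> i & i < c & P i}" using ab by auto
 moreover have "{i. a \<le> i & i < b & P i} \<inter> {i. b \<le> i & i < c & P i} = {}" by auto
 ultimately show ?thesis unfolding cnt_def by (simp add: card_Un_disjoint)
qed

lemma cnt_Suc: "cnt P a (Suc a) = of_bool (P a)"
proof -
 have "{i. a \<le> i & i < Suc a & P i} = (if P a then {a} else {})" by (auto simp: le_less_Suc_eq)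
 then show ?thesis by (simp add: cnt_def)
qed

lemma cnt_le: "cnt P a b \<le> b"
proof -
 have "card {i. a \<le> i & i < b & P i} \<le> card {..<b}" by (intro card_mono) auto
 then show ?thesis by (simp add: cnt_def)
qed

section \<open>Correctness of sorting, pivot and prefix counts\<close>

context core begin

lemma SORT_ok:
 assumes s: "env s" "ireg s 8 = 64 * nb"
  and sz: "512 * nb \<le> SZ" "64 * (64 * nb) \<le> \<beta>" "64 \<le> \<beta>" "1 + 64 * (64 * nb) \<le> X" "1 \<le> D"
  and post: "!!u. same {9, 10} {2, 3, 4} {} s u ==> ireg u 9 = 64 ==> ireg u 10 = 64 * nb ==>
   buffers (AR u 0) (AI u 2) 64 64 nb 1 0 ==> PP u"
 shows "ok \<beta> SORT s X D Rd Wr PP"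
proof -
 have Q: "ireg s 2 = Q" using s by (simp add: env_def)
 show ?thesis
  unfolding SORT_def
 proof (rule ok_seq, rule pf_IA[where z = SZ and m = "64 * nb" and G = "\<lambda>i. True" and ad = "\<lambda>i. i" and vl = "\<lambda>i. i"])
  fix t1 assume t1: "same {} {2} {} s t1" "!!i. i < 64 * nb ==> True ==> AI t1 2 i = i" "ireg t1 = ireg s"
  show "ok \<beta> (Asg 9 (Num 1) ;; Asg 10 (Var 8) ;; SUPER 1 ;; SUPER 1) t1 X D Rd Wr PP"
  proof (rule ok_seq, rule asg_same)
   fix t2 assume t2: "same {9} {} {} t1 t2" "ireg t2 = (ireg t1)(9 := ival (Num 1) t1)" "imem t2 = imem t1" "rmem t2 = rmem t1"
   show "ok \<beta> (Asg 10 (Var 8) ;; SUPER 1 ;; SUPER 1) t2 X D Rd Wr PP"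
   proof (rule ok_seq, rule asg_same)
    fix t3 assume t3: "same {10} {} {} t2 t3" "ireg t3 = (ireg t2)(10 := ival (Var 8) t2)" "imem t3 = imem t2" "rmem t3 = rmem t2"
    have a: "same {9, 10} {2, 3, 4} {} s t2" by (rule same_trans[OF t1(1) t2(1)]) auto
    have b: "same {9, 10} {2, 3, 4} {} s t3" by (rule same_trans[OF a t3(1)]) auto
    have r3: "ireg t3 9 = 1" "ireg t3 10 = 64 * nb" "ireg t3 2 = Q" by (simp_all add: t3 t2 t1 s Q)
    have b3: "buffers (AR t3 0) (AI t3 2) 1 1 (8 * (8 * nb)) 1 0"
    proof (rule buffers_cong[OF _ buffers_init])
     fix i assume "i < 8 * (8 * nb) * 1"
     then show "i = AI t3 2 i" using t1(2)[of i] by (simp add: t3 t2 t1(3) Q)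
    qed
    show "ok \<beta> (SUPER 1 ;; SUPER 1) t3 X D Rd Wr PP"
    proof (rule ok_seq, rule SUPER_ok[where t = 1 and c = "64 * nb" and nb = "8 * nb" and N = 1 and w = 1 and E = 0 and t' = 8])
     show "env t3" by (rule env_same[OF s(1) b]) auto
    next
     fix t4 assume t4: "same {9, 10} {2, 3, 4} {} t3 t4" "ireg t4 9 = 8" "ireg t4 10 = 8 * nb * 8"
      "buffers (AR t4 0) (AI t4 2) 8 (8 * 1) (8 * nb) (1 * 1) (8 * 0 + (1 - 1) * 1)"
     have c: "same {9, 10} {2, 3, 4} {} s t4" by (rule same_trans[OF b t4(1)]) auto
     show "ok \<beta> (SUPER 1) t4 X D Rd Wr PP"
     proof (rule SUPER_ok[where t = 8 and c = "64 * nb" and nb = "nb" and N = 8 and w = 1 and E = 0 and t' = 64])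
      show "env t4" by (rule env_same[OF s(1) c]) auto
     next
      fix u assume u: "same {9, 10} {2, 3, 4} {} t4 u" "ireg u 9 = 64" "ireg u 10 = nb * 64"
       "buffers (AR u 0) (AI u 2) 64 (8 * 8) nb (1 * 1) (8 * 0 + (1 - 1) * 1)"
      have "same {9, 10} {2, 3, 4} {} s u" by (rule same_trans[OF c u(1)]) auto
      then show "PP u" using u by (intro post) simp_all
     qed (use t4 sz in simp_all)
    qed (use r3 b3 sz in simp_all)
   qed (use sz in \<open>simp_all add: t2 t1 s\<close>)
  qed (use sz in simp_all)
 qed (use sz reg in \<open>auto simp: s Q\<close>)
qed

text \<open>After \<open>j\<close> rounds the weight is \<open>4 ^ j\<close> and the error at most
  \<open>8 ^ j - 4 ^ j\<close>. In the last buffer, place \<open>4 * 2 ^ J\<close> therefore has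
  true rank at least \<open>4 * 8 ^ J\<close> and less than \<open>5 * 8 ^ J\<close> among
  \<open>64 * 8 ^ J\<close> slots.\<close>

lemma PIVOT_ok:
 assumes s: "env s" "ireg s 8 = 64 * 8 ^ J"
  and sz: "512 * 8 ^ J \<le> SZ" "512 * (64 * 8 ^ J) \<le> \<beta>" "2 + 1200 * (64 * 8 ^ J) \<le> X" "J + 1 \<le> D"
  and post: "!!u. same {9, 10, 13} {2, 3, 4} {} s u ==> ireg u 13 < 64 * 8 ^ J ==>
   4 * 8 ^ J \<le> card {i. i < 64 * 8 ^ J & vlt (AR u 0) i (ireg u 13)} ==>
   card {i. i < 64 * 8 ^ J & vlt (AR u 0) i (ireg u 13)} < 5 * 8 ^ J ==> PP u"
 shows "ok \<beta> PIVOT s X D Rd Wr PP"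
 unfolding PIVOT_def
proof (rule ok_seq, rule SORT_ok[where nb = "8 ^ J"])
 have one: "(1::nat) \<le> 8 ^ J" by simp
 show "1 + 64 * (64 * 8 ^ J) \<le> X" using sz(3) by linarith
 show "64 * (64 * 8 ^ J) \<le> \<beta>" "64 \<le> \<beta>" using sz(2) one by linarith+
 have Q: "ireg s 2 = Q" using s by (simp add: env_def)
 fix t1 assume t1: "same {9, 10} {2, 3, 4} {} s t1" "ireg t1 9 = 64" "ireg t1 10 = 64 * 8 ^ J"
  "buffers (AR t1 0) (AI t1 2) 64 64 (8 ^ J) 1 0"
 define I where "I j u \<longleftrightarrow> j \<le> J & same {9, 10} {2, 3, 4} {} s u & ireg u 9 = 64 * 2 ^ j &
  ireg u 10 = 64 * 2 ^ j * 8 ^ (J - j) &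
  buffers (AR u 0) (AI u 2) (64 * 2 ^ j) (64 * 8 ^ j) (8 ^ (J - j)) (4 ^ j) (8 ^ j - 4 ^ j)" for j u
 \<comment> \<open>Total length times buffer length after \<open>j\<close> rounds. It halves from
   round to round, so the potential \<open>18 * ct j\<close> covers \<open>1 + 8 * ct j\<close> and
   what remains.\<close>
 define ct where "ct j = 64 * 2 ^ j * 8 ^ (J - j) * (64 * 2 ^ j :: nat)" for j
 have ct0: "ct 0 = 64 * (64 * 8 ^ J)" by (simp add: ct_def)
 have ct_half: "ct j = 2 * ct (Suc j)" if "j < J" for j
 proof -
  have "J - j = Suc (J - Suc j)" using that by simp
  then have "(8::nat) ^ (J - j) = 8 * 8 ^ (J - Suc j)" by simp
  then show ?thesis by (simp add: ct_def)
 qed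
 have ct_le: "ct j \<le> ct 0" if "j \<le> J" for j
  using that by (induction j) (use ct_half in force)+
 have ct_pos: "1 \<le> ct j" for j by (simp add: ct_def Suc_le_eq)
 show "ok \<beta> (Whl (Var 9 [<] Var 10) (SUPER 4) ;; Asg 13 (IA 2 (Var 9 [/] Num 16))) t1 X D Rd Wr PP"
 proof (rule ok_seq, rule ok_while[where I = I and \<Phi> = "\<lambda>j. 1 + 18 * ct j" and \<Delta> = "\<lambda>j. J - j + 1" and g = 0])
  show "I 0 t1" using t1 by (simp add: I_def)
  show "1 + 18 * ct 0 \<le> X" using sz(3) unfolding ct0 by linarith
  show "J - 0 + 1 \<le> D" using sz by simp
 next
  fix j u assume I: "I j u" and nz: "ival (Var 9 [<] Var 10) u \<noteq> 0"
  have jJ: "j < J"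
  proof (rule ccontr)
   assume "\<not> j < J"
   then have "j = J" using I by (simp add: I_def)
   then show False using I nz by (simp add: I_def)
  qed
  then have e8: "(8::nat) ^ (J - j) = 8 * 8 ^ (J - Suc j)" by (metis Suc_diff_Suc power_Suc)
  have NN: "8 * 8 ^ (J - Suc j) * (64 * 8 ^ j) = (64 * 8 ^ J :: nat)"
  proof -
   have "(8::nat) ^ J = 8 ^ (J - j) * 8 ^ j" using jJ by (simp flip: power_add)
   then show ?thesis using e8 by simp
  qed
  have cM: "8 * (64 * 2 ^ j * 8 ^ (J - j)) \<le> (512 * 8 ^ J :: nat)"
  proof -
   have "(2::nat) ^ j * 8 ^ (J - j) \<le> 8 ^ j * 8 ^ (J - j)" by (intro mult_le_mono1 power_mono) auto
   also have "\<dots> = 8 ^ J" using jJ by (simp flip: power_add)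
   finally show ?thesis by simp
  qed
  have c8: "8 * (64 * 2 ^ j * 8 ^ (J - j)) * (64 * 2 ^ j) = 8 * ct j" by (simp add: ct_def)
  have cb: "8 * ct j \<le> \<beta>"
   using ct_le[of j] jJ sz(2) unfolding ct0 by simp
  have tb: "8 * (64 * 2 ^ j) \<le> \<beta>"
  proof -
   have "64 * 2 ^ j \<le> ct j" unfolding ct_def by simp
   then show ?thesis using cb by linarith
  qed
  \<comment> \<open>The merged error equals \<open>8 ^ Suc j - 5 * 4 ^ j\<close>, slightly better
    than the invariant demands.\<close>
  have EE: "8 * (8 ^ j - 4 ^ j) + (4 - 1) * 4 ^ j \<le> (8 ^ Suc j - 4 ^ Suc j :: nat)"
  proof -
   have "(4::nat) ^ j \<le> 8 ^ j" by (intro power_mono) auto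
   then show ?thesis by simp
  qed
  show "\<exists>X1 D1. 1 \<le> X1 & 1 \<le> D1 & ok \<beta> (SUPER 4) u X1 D1 Rd Wr
    (\<lambda>t. \<exists>g'. I g' t & 1 + 18 * ct g' + X1 \<le> 1 + 18 * ct j & J - g' + 1 + D1 \<le> J - j + 1)"
  proof (intro exI conjI)
   show "ok \<beta> (SUPER 4) u (1 + 8 * ct j) 1 Rd Wr
    (\<lambda>t. \<exists>g'. I g' t & 1 + 18 * ct g' + (1 + 8 * ct j) \<le> 1 + 18 * ct j & J - g' + 1 + 1 \<le> J - j + 1)"
   proof (rule SUPER_ok[where t = "64 * 2 ^ j" and c = "64 * 2 ^ j * 8 ^ (J - j)" and nb = "8 ^ (J - Suc j)"
      and N = "64 * 8 ^ j" and w = "4 ^ j" and E = "8 ^ j - 4 ^ j" and t' = "64 * 2 ^ Suc j"])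
    show "env u" using I by (intro env_same[OF s(1)]) (auto simp: I_def)
    show "8 * 8 ^ (J - Suc j) * (64 * 8 ^ j) \<le> SZ" unfolding NN using sz(1) by simp
    show "8 * (64 * 2 ^ j * 8 ^ (J - j)) \<le> SZ" using cM sz(1) by linarith
    show "8 * (64 * 2 ^ j * 8 ^ (J - j)) * (64 * 2 ^ j) \<le> \<beta>" unfolding c8 by (rule cb)
    show "1 + 8 * (64 * 2 ^ j * 8 ^ (J - j)) * (64 * 2 ^ j) \<le> 1 + 8 * ct j" unfolding c8 ..
   next
    fix v assume v: "same {9, 10} {2, 3, 4} {} u v" "ireg v 9 = 64 * 2 ^ Suc j" "ireg v 10 = 8 ^ (J - Suc j) * (64 * 2 ^ Suc j)"
     "buffers (AR v 0) (AI v 2) (64 * 2 ^ Suc j) (8 * (64 * 8 ^ j)) (8 ^ (J - Suc j)) (4 * 4 ^ j) (8 * (8 ^ j - 4 ^ j) + (4 - 1) * 4 ^ j)"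
    have "same {9, 10} {2, 3, 4} {} s u" using I by (simp add: I_def)
    then have sv: "same {9, 10} {2, 3, 4} {} s v" by (rule same_trans[OF _ v(1)]) auto
    have "buffers (AR v 0) (AI v 2) (64 * 2 ^ Suc j) (64 * 8 ^ Suc j) (8 ^ (J - Suc j)) (4 ^ Suc j) (8 ^ Suc j - 4 ^ Suc j)"
     using buffers_mono[OF v(4) EE] by (simp add: mult.left_commute)
    then have "I (Suc j) v" using sv v(2,3) jJ by (simp add: I_def mult.commute)
    moreover have "1 + 18 * ct (Suc j) + (1 + 8 * ct j) \<le> 1 + 18 * ct j"
     using ct_half[OF jJ] ct_pos[of "Suc j"] by linarith
    moreover have "J - Suc j + 1 + 1 \<le> J - j + 1" using jJ by simp
    ultimately show "\<exists>g'. I g' v & 1 + 18 * ct g' + (1 + 8 * ct j) \<le> 1 + 18 * ct j & J - g' + 1 + 1 \<le> J - j + 1"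
     by blast
   qed (use I tb e8 in \<open>simp_all add: I_def\<close>)
  qed simp_all
 next
  fix j u assume I: "I j u" and z: "ival (Var 9 [<] Var 10) u = 0"
  have jJ: "j = J"
  proof (rule ccontr)
   assume "j \<noteq> J"
   then have g1: "1 < (8::nat) ^ (J - j)" using I by (intro one_less_power) (auto simp: I_def)
   have p: "0 < 64 * (2::nat) ^ j" by simp
   from mult_less_mono2[OF g1 p] have "64 * 2 ^ j * 1 < 64 * 2 ^ j * (8::nat) ^ (J - j)" by blast
   moreover have "ireg u 9 = 64 * 2 ^ j" "ireg u 10 = 64 * 2 ^ j * 8 ^ (J - j)" using I by (simp_all add: I_def)
   ultimately have "ireg u 9 < ireg u 10" by linarith
   then show False using z by simp
  qed
  have su: "same {9, 10} {2, 3, 4} {} s u" and r: "ireg u 9 = 64 * 2 ^ J" and B: "buffers (AR u 0) (AI u 2) (64 * 2 ^ J) (64 * 8 ^ J) 1 (4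
   ^ J) (8 ^ J - 4 ^ J)"
   using I by (simp_all add: I_def jJ)
  have Qu: "ireg u 2 = Q" using same_Q[OF su] Q by simp
  have q: "4 * 2 ^ J < (64 * 2 ^ J :: nat)" by simp
  have iv: "ival (IA 2 (Var 9 [/] Num 16)) u = AI u 2 (4 * 2 ^ J)" using r by simp
  have p48: "(4::nat) ^ J * 2 ^ J = 8 ^ J" by (simp flip: power_mult_distrib)
  have p4: "(1::nat) \<le> 4 ^ J" "(4::nat) ^ J \<le> 8 ^ J" by (auto intro: power_mono)
  note pr = pivot_rank[OF B q]
  have lt: "4 * 2 ^ J < SZ"
  proof -
   have "(2::nat) ^ J \<le> 8 ^ J" by (intro power_mono) auto
   then show ?thesis using sz(1) one by linarith
  qed
  show "ok \<beta> (Asg 13 (IA 2 (Var 9 [/] Num 16))) u X D Rd Wr PP"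
  proof (rule asg_same)
   show "1 \<le> X" "1 \<le> D" using sz by simp_all
   show "ival (IA 2 (Var 9 [/] Num 16)) u \<le> \<beta>" using iv pr(3) sz(2) by simp
   show "ird (IA 2 (Var 9 [/] Num 16)) u \<subseteq> Rd \<union> Wr" using r lt Qu by simp
  next
   fix v assume v: "same {13} {} {} u v" "ireg v = (ireg u)(13 := ival (IA 2 (Var 9 [/] Num 16)) u)" "imem v = imem u" "rmem v = rmem u"
   have r13: "ireg v 13 = AI u 2 (4 * 2 ^ J)" using v(2) iv by simp
   have V: "AR v 0 = AR u 0" using v by simp
   have e: "4 ^ J * (4 * 2 ^ J) = (4 * 8 ^ J :: nat)" using p48 by (metis mult.left_commute)
   show "PP v"
   proof (rule post)
    show "same {9, 10, 13} {2, 3, 4} {} s v" by (rule same_trans[OF su v(1)]) auto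
   qed (use pr p4 in \<open>simp_all only: V r13 e\<close>, linarith?)
  qed simp
 next
  fix j u assume "I j u"
  show "ird (Var 9 [<] Var 10) u \<subseteq> Rd \<union> Wr" by simp
 qed simp_all
qed (use s sz in simp_all)

lemma SCAN_ok:
 assumes s: "env s" "ireg s 8 = 2 ^ L" "ireg s 13 = x" and x: "x < SZ"
  and sz: "4 * 2 ^ L \<le> SZ" "4 * 2 ^ L \<le> \<beta>" "8 + 8 * 2 ^ L \<le> X" "L + 1 \<le> D"
  and post: "!!u. same {11, 12} {5, 6} {} s u ==>
   (!!i. i < 2 ^ L ==> AI u 5 (2 ^ L + i) = of_bool (\<not> vlt (AR s 0) x i)) ==>
   (!!i. i < 2 ^ L ==> AI u 6 (2 ^ L + i) = cnt (\<lambda>i. \<not> vlt (AR s 0) x i) 0 i) ==>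
   ireg u 12 = cnt (\<lambda>i. \<not> vlt (AR s 0) x i) 0 (2 ^ L) ==> PP u"
 shows "ok \<beta> SCAN s X D Rd Wr PP"
proof -
 let ?P1 = "IS (Adr (Var 2) 6 (Num 2 [*] Var 11 [+] Var 14)) (IA 6 ((Num 2 [*] Var 11 [+] Var 14) [/] Num 2) [+] (Num 2 [*] Var 11 [+] Var
  14) [%] Num 2 [*] IA 5 (Num 2 [*] Var 11 [+] Var 14 [-] Num 1))"
 let ?P2 = "IS (Adr (Var 2) 5 (Var 11 [+] Var 14)) (IA 5 (Num 2 [*] (Var 11 [+] Var 14)) [+] IA 5 (Num 2 [*] (Var 11 [+] Var 14) [+] Num 1))"
 let ?P3 = "Whl (Var 11 [<] Var 8) (Pf 14 (Num 2 [*] Var 11) [] ?P1 ;; Asg 11 (Num 2 [*] Var 11)) ;; Asg 12 (IA 5 (Num 1))"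
 let ?P4 = "Whl (Num 2 [<=] Var 11) (Asg 11 (Var 11 [/] Num 2) ;; Pf 14 (Var 11) [] ?P2) ;; Pf 14 (Num 1) [] (IS (Adr (Var 2) 6 (Num 1))
  (Num 0)) ;; Asg 11 (Num 1) ;; ?P3"
 let ?P5 = "IA 6 ((Num 2 [*] Var 11 [+] Var 14) [/] Num 2) [+] (Num 2 [*] Var 11 [+] Var 14) [%] Num 2 [*] IA 5 (Num 2 [*] Var 11 [+] Var
  14 [-] Num 1)"
 let ?P6 = "Pf 14 (Num 2 [*] Var 11) [] ?P1 ;; Asg 11 (Num 2 [*] Var 11)"
 have Q: "ireg s 2 = Q" using s by (simp add: env_def)
 have "(1::nat) \<le> 2 ^ L" by simp
 then have b1: "1 \<le> \<beta>" using sz(2) by linarith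
 have X1: "1 \<le> X" "1 \<le> D" using sz by simp_all
 define P where "P i = (\<not> vlt (AR s 0) x i)" for i
 define M where "M = (2 ^ L :: nat)"
 have M1: "1 \<le> M" by (simp add: M_def)
 have S1: "Suc 0 < SZ" "2 \<le> X" using sz(1,3) M1 unfolding M_def by linarith+
 have pL: "2 ^ h * 2 ^ (L - h) = M" if "h \<le> L" for h using that by (simp add: M_def flip: power_add)
 have pLh: "(2::nat) ^ (L - h) = 2 * 2 ^ (L - Suc h)" if "h < L" for h
  using that by (metis Suc_diff_Suc power_Suc)
 have p2: "(2::nat) ^ h \<le> M" if "h \<le> L" for h unfolding M_def using that by (intro power_increasing) auto
 \<comment> \<open>Node \<open>v\<close> of level \<open>h\<close> stands for the
   \<open>2 ^ (L - h)\<close> leaves starting at \<open>v * 2 ^ (L - h)\<close>; the counts are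
   correct from level \<open>l\<close> down to the leaves.\<close>
 define T where "T l u \<longleftrightarrow> (\<forall>h. l \<le> h & h \<le> L \<longrightarrow> (\<forall>v < 2 ^ h. AI u 5 (2 ^ h + v) = cnt P (v * 2 ^ (L - h)) ((v + 1) * 2 ^ (L - h))))" for l u
 define I where "I l u \<longleftrightarrow> l \<le> L & same {11, 12} {5, 6} {} s u & ireg u 11 = 2 ^ l & T l u" for l u
 define I2 where "I2 l u \<longleftrightarrow> l \<le> L & same {11, 12} {5, 6} {} s u & ireg u 11 = 2 ^ l & T 0 u & (\<forall>v < 2 ^ l. AI u 6 (2 ^ l + v) = cnt P 0 (v *
  2 ^ (L - l)))" for l u
 show ?thesis
  unfolding SCAN_def
 proof (rule ok_seq, rule pf_IA[where z = SZ and m = M and G = "\<lambda>i. True" and ad = "\<lambda>i. M + i" and vl = "\<lambda>i. of_bool (P i)"])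
  show "M \<le> \<beta>" "1 + M \<le> X" using sz by (simp_all add: M_def)
  fix i assume i: "i < M"
  show "M + i < SZ" using i sz(1) by (simp add: M_def)
  show "ival (inot (vltE (Var 13) (Var 14))) (setv s 14 i) = of_bool (P i)"
   unfolding ival_inot_vltE by (simp add: s P_def)
  fix l assume "l \<in> grd [] (IS (Adr (Var 2) 5 (Var 8 [+] Var 14)) (inot (vltE (Var 13) (Var 14)))) (setv s 14 i)"
  then have "l = RCell (adr Q 0 x) \<or> l = RCell (adr Q 0 i)" by (auto simp: s Q)
  moreover have "i < SZ" using i sz(1) by (simp add: M_def)
  ultimately show "l \<in> Rd \<union> Wr" using x by auto
 next
  fix t1 assume t1: "same {} {5} {} s t1" "!!i. i < M ==> True ==> AI t1 5 (M + i) = of_bool (P i)" "ireg t1 = ireg s"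
  show "ok \<beta> (Asg 11 (Var 8) ;; ?P4) t1 X D Rd Wr PP"
  proof (rule ok_seq, rule asg_same)
   show "ival (Var 8) t1 \<le> \<beta>" using sz by (simp add: t1 s)
   fix t2 assume t2: "same {11} {} {} t1 t2" "ireg t2 = (ireg t1)(11 := ival (Var 8) t1)" "imem t2 = imem t1" "rmem t2 = rmem t1"
   have st2: "same {11, 12} {5, 6} {} s t2" by (rule same_trans[OF t1(1) t2(1)]) auto
   have T2: "T L t2" unfolding T_def
   proof (intro allI impI)
    fix h v assume h: "L \<le> h & h \<le> L" and v: "v < (2::nat) ^ h"
    then have hL: "h = L" by simp
    show "AI t2 5 (2 ^ h + v) = cnt P (v * 2 ^ (L - h)) ((v + 1) * 2 ^ (L - h))"
     using t1(2)[of v] v by (simp add: hL t2 cnt_Suc M_def)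
   qed
   show "ok \<beta> ?P4 t2 X D Rd Wr PP"
   proof (rule ok_seq, rule ok_while[where I = I and \<Phi> = "\<lambda>l. 4 * 2 ^ l" and \<Delta> = "\<lambda>l. l + 1" and g = L])
    show "I L t2" using st2 T2 by (simp add: I_def t2 t1 s)
    show "4 * 2 ^ L \<le> X" "L + 1 \<le> D" using sz by simp_all
    fix l u assume I: "I l u"
    show "ird (Num 2 [<=] Var 11) u \<subseteq> Rd \<union> Wr" by simp
    show "1 \<le> 4 * (2::nat) ^ l & 1 \<le> l + 1" by (simp add: Suc_le_eq)
    assume nz: "ival (Num 2 [<=] Var 11) u \<noteq> 0"
    then have "l \<noteq> 0" using I by (cases l) (auto simp: I_def)
    then obtain l' where l': "l = Suc l'" by (cases l) auto
    have lL: "l' < L" using I l' by (simp add: I_def)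
    have su: "same {11, 12} {5, 6} {} s u" and r11: "ireg u 11 = 2 * 2 ^ l'" and Tu: "T (Suc l') u" using I by (simp_all add: I_def l')
    have Qu: "ireg u 2 = Q" using same_Q[OF su] Q by simp
    note pl = p2[of l'] p2[of "Suc l'"]
    show "\<exists>X1 D1. 1 \<le> X1 & 1 \<le> D1 & ok \<beta> (Asg 11 (Var 11 [/] Num 2) ;; Pf 14 (Var 11) [] ?P2) u X1 D1 Rd Wr (\<lambda>t. \<exists>g'. I g' t & 4 * 2 ^
     g' + X1 \<le> 4 * 2 ^ l & g' + 1 + D1 \<le> l + 1)"
    proof (intro exI conjI)
     show "1 \<le> 1 + (2::nat) ^ l'" "(1::nat) \<le> 1" by simp_all
     show "ok \<beta> (Asg 11 (Var 11 [/] Num 2) ;; Pf 14 (Var 11) [] ?P2) u (1 + 2 ^ l') 1 Rd Wr (\<lambda>t. \<exists>g'. I g' t & 4 * 2 ^ g' + (1 + 2 ^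
      l') \<le> (4 * 2 ^ l :: nat) & g' + 1 + 1 \<le> l + 1)"
     proof (rule ok_seq, rule asg_same)
      show "ival (Var 11 [/] Num 2) u \<le> \<beta>" using pl lL sz by (simp add: r11 M_def)
      fix v assume v: "same {11} {} {} u v" "ireg v = (ireg u)(11 := ival (Var 11 [/] Num 2) u)" "imem v = imem u" "rmem v = rmem u"
      have rv: "ireg v 11 = 2 ^ l'" "ireg v 2 = Q" using v(2) r11 Qu by simp_all
      show "ok \<beta> (Pf 14 (Var 11) [] ?P2) v (1 + 2 ^ l') 1 Rd Wr (\<lambda>t. \<exists>g'. I g' t & 4 * 2 ^ g' + (1 + 2 ^ l') \<le> (4 * 2 ^ l :: nat) & g'
       + 1 + 1 \<le> l + 1)"
      proof (rule pf_IA[where z = SZ and m = "2 ^ l'" and G = "\<lambda>i. True" and ad = "\<lambda>i. 2 ^ l' + i"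
         and vl = "\<lambda>i. cnt P (i * 2 ^ (L - l')) ((i + 1) * 2 ^ (L - l'))"])
       fix i assume i: "i < (2::nat) ^ l'"
       have T1: "AI u 5 (2 ^ Suc l' + 2 * i) = cnt P (2 * i * 2 ^ (L - Suc l')) ((2 * i + 1) * 2 ^ (L - Suc l'))"
        "AI u 5 (2 ^ Suc l' + (2 * i + 1)) = cnt P ((2 * i + 1) * 2 ^ (L - Suc l')) ((2 * i + 1 + 1) * 2 ^ (L - Suc l'))"
        using Tu[unfolded T_def, rule_format, of "Suc l'" "2 * i"]
         Tu[unfolded T_def, rule_format, of "Suc l'" "2 * i + 1"] i lL by simp_all
       show "ival (IA 5 (Num 2 [*] (Var 11 [+] Var 14)) [+] IA 5 (Num 2 [*] (Var 11 [+] Var 14) [+] Num 1)) (setv v 14 i) = cnt P (i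
        * 2 ^ (L - l')) ((i + 1) * 2 ^ (L - l'))"
        using T1 cnt_add[of "2 * i * 2 ^ (L - Suc l')" "(2 * i + 1) * 2 ^ (L - Suc l')" "(2 * i + 1 + 1) * 2 ^ (L - Suc l')" P]
        by (simp add: rv v(3) Qu pLh[OF lL] algebra_simps)
       show "2 ^ l' + i < SZ" using i pl lL sz by (simp add: M_def)
       show "cnt P (i * 2 ^ (L - l')) ((i + 1) * 2 ^ (L - l')) \<le> \<beta>"
       proof (rule order_trans[OF cnt_le])
        have "(i + 1) * 2 ^ (L - l') \<le> 2 ^ l' * 2 ^ (L - l')" using i by (intro mult_le_mono1) simp
        also have "\<dots> = M" by (rule pL) (use lL in simp)
        also have "M \<le> \<beta>" using sz by (simp add: M_def)
        finally show "(i + 1) * 2 ^ (L - l') \<le> \<beta>" .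
       qed
       fix l assume "l \<in> grd [] ?P2 (setv v 14 i)"
       then have "l = ICell (adr Q 5 (2 * (2 ^ l' + i))) \<or> l = ICell (adr Q 5 (2 * (2 ^ l' + i) + 1))" by (auto simp: rv)
       moreover have "2 * (2 ^ l' + i) + 1 < SZ" using i pl lL sz by (simp add: M_def)
       ultimately show "l \<in> Rd \<union> Wr" by auto
      next
       fix w assume w: "same {} {5} {} v w" "!!i. i < 2 ^ l' ==> True ==> AI w 5 (2 ^ l' + i) = cnt P (i * 2 ^ (L - l')) ((i + 1) * 2 ^ (L - l'))"
        "!!j. (!!i. i < 2 ^ l' ==> True ==> 2 ^ l' + i \<noteq> j) ==> AI w 5 j = AI v 5 j" "ireg w = ireg v"
       have "same {11, 12} {5, 6} {} s v" by (rule same_trans[OF su v(1)]) auto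
       then have sw: "same {11, 12} {5, 6} {} s w" by (rule same_trans[OF _ w(1)]) auto
       have "T l' w" unfolding T_def
       proof (intro allI impI)
        fix h y assume h: "l' \<le> h & h \<le> L" and y: "y < (2::nat) ^ h"
        show "AI w 5 (2 ^ h + y) = cnt P (y * 2 ^ (L - h)) ((y + 1) * 2 ^ (L - h))"
        proof (cases "h = l'")
         case True
         then show ?thesis using w(2) y by simp
        next
         case False
         then have "(2::nat) ^ Suc l' \<le> 2 ^ h" using h by (intro power_increasing) auto
         then have "AI w 5 (2 ^ h + y) = AI v 5 (2 ^ h + y)" by (intro w(3)) auto
         also have "\<dots> = AI u 5 (2 ^ h + y)" by (simp add: rv v(3) Qu)
         also have "\<dots> = cnt P (y * 2 ^ (L - h)) ((y + 1) * 2 ^ (L - h))"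
          using Tu y h False unfolding T_def by simp
         finally show ?thesis .
        qed
       qed
       then have "I l' w" using sw lL rv w(4) by (simp add: I_def)
       moreover have "4 * 2 ^ l' + (1 + 2 ^ l') \<le> 4 * (2::nat) ^ l" using l' by simp
       ultimately show "\<exists>g'. I g' w & 4 * 2 ^ g' + (1 + 2 ^ l') \<le> (4 * 2 ^ l :: nat) & g' + 1 + 1 \<le> l + 1"
        using l' by (intro exI[of _ l']) simp
      qed (use reg pl lL sz in \<open>auto simp: rv M_def\<close>)
     qed simp_all
    qed
   next
    fix l u assume I: "I l u" and z: "ival (Num 2 [<=] Var 11) u = 0"
    have "(2::nat) ^ l < 2" using I z by (simp add: I_def)
    then have "l = 0" by (cases l) auto
    then have su: "same {11, 12} {5, 6} {} s u" and Tu: "T 0 u" using I by (simp_all add: I_def)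
    have Qu: "ireg u 2 = Q" using same_Q[OF su] Q by simp
    show "ok \<beta> (Pf 14 (Num 1) [] (IS (Adr (Var 2) 6 (Num 1)) (Num 0)) ;; Asg 11 (Num 1) ;; ?P3) u X D Rd Wr PP"
    proof (rule ok_seq, rule pf_IA[where z = SZ and m = 1 and G = "\<lambda>i. True" and ad = "\<lambda>i. 1" and vl = "\<lambda>i. 0"])
     fix v assume v: "same {} {6} {} u v" "!!i::nat. i < 1 ==> True ==> AI v 6 1 = 0" "ireg v = ireg u"
     have sv: "same {11, 12} {5, 6} {} s v" by (rule same_trans[OF su v(1)]) auto
     show "ok \<beta> (Asg 11 (Num 1) ;; ?P3) v X D Rd Wr PP"
     proof (rule ok_seq, rule asg_same)
      fix w assume w: "same {11} {} {} v w" "ireg w = (ireg v)(11 := ival (Num 1) v)" "imem w = imem v" "rmem w = rmem v"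
      have sw: "same {11, 12} {5, 6} {} s w" by (rule same_trans[OF sv w(1)]) auto
      have Tw: "T 0 w" using Tu same_AI[OF v(1), of 5] unfolding T_def by (simp add: w v(3))
      show "ok \<beta> ?P3 w X D Rd Wr PP"
      proof (rule ok_seq, rule ok_while[where I = I2 and \<Phi> = "\<lambda>l. 1 + 3 * (2 * M - 2 * 2 ^ l)" and \<Delta> = "\<lambda>l. L - l + 1" and g = 0])
       show "I2 0 w" using sw Tw v(2)[of 0] by (simp add: I2_def w v(3) cnt_def)
       show "1 + 3 * (2 * M - 2 * 2 ^ 0) \<le> X" using sz by (simp add: M_def)
       show "L - 0 + 1 \<le> D" using sz by simp
       fix l u assume I: "I2 l u"
       show "ird (Var 11 [<] Var 8) u \<subseteq> Rd \<union> Wr" by simp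
       show "1 \<le> 1 + 3 * (2 * M - 2 * 2 ^ l) & 1 \<le> L - l + 1" by simp
       assume nz: "ival (Var 11 [<] Var 8) u \<noteq> 0"
       have su: "same {11, 12} {5, 6} {} s u" and r11: "ireg u 11 = 2 ^ l" and Tu: "T 0 u" and lL': "l \<le> L"
        and O: "!!v. v < 2 ^ l ==> AI u 6 (2 ^ l + v) = cnt P 0 (v * 2 ^ (L - l))" using I by (simp_all add: I2_def)
       have r8: "ireg u 8 = M" using same_reg[OF su, of 8] s by (simp add: M_def)
       have lL: "l < L" using nz lL' by (cases "l = L") (auto simp: r11 r8 M_def)
       have Qu: "ireg u 2 = Q" using same_Q[OF su] Q by simp
       have pl: "2 * 2 ^ l \<le> M" using p2[of "Suc l"] lL by simp
       show "\<exists>X1 D1. 1 \<le> X1 & 1 \<le> D1 & ok \<beta> ?P6 u X1 D1 Rd Wr (\<lambda>t. \<exists>g'. I2 g' t & 1 + 3 * (2 * M - 2 * 2 ^ g') + X1 \<le> 1 + 3 * (2 * M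
        - 2 * 2 ^ l) & L - g' + 1 + D1 \<le> L - l + 1)"
       proof (intro exI conjI)
        show "1 \<le> 1 + 2 * (2::nat) ^ l" "(1::nat) \<le> 1" by simp_all
        show "ok \<beta> ?P6 u (1 + 2 * 2 ^ l) 1 Rd Wr (\<lambda>t. \<exists>g'. I2 g' t & 1 + 3 * (2 * M - 2 * 2 ^ g') + (1 + 2 * 2 ^ l) \<le> 1 + 3 * (2 * M
         - 2 * 2 ^ l) & L - g' + 1 + 1 \<le> L - l + 1)"
        proof (rule ok_seq, rule pf_IA[where z = SZ and m = "2 * 2 ^ l" and G = "\<lambda>i. True" and ad = "\<lambda>i. 2 * 2 ^ l + i"
           and vl = "\<lambda>i. cnt P 0 (i * 2 ^ (L - Suc l))"])
         fix i assume i: "i < 2 * (2::nat) ^ l"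
         show "2 * 2 ^ l + i < SZ" using i pl sz by (simp add: M_def)
         show "cnt P 0 (i * 2 ^ (L - Suc l)) \<le> \<beta>"
         proof (rule order_trans[OF cnt_le])
          have "i * 2 ^ (L - Suc l) \<le> 2 ^ Suc l * 2 ^ (L - Suc l)" using i by (intro mult_le_mono1) simp
          also have "\<dots> = M" by (rule pL) (use lL in simp)
          also have "M \<le> \<beta>" using sz by (simp add: M_def)
          finally show "i * 2 ^ (L - Suc l) \<le> \<beta>" .
         qed
         \<comment> \<open>A node inherits the count of its parent, and an odd node adds the count
           of its left sibling. For an even node the neighbouring count is read as well but
           multiplied by 0.\<close>
         have half: "(2 * 2 ^ l + i) div 2 = 2 ^ l + i div 2" by simp
         have m2: "(2 * 2 ^ l + i) mod 2 = i mod 2" by simp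
         have i2: "i div 2 < 2 ^ l" using i by simp
         have ev: "ival ?P5 (setv u 14 i) = AI u 6 (2 ^ l + i div 2) + i mod 2 * AI u 5 (2 * 2 ^ l + i - 1)" using half m2 by (simp
          add: r11 Qu)
         also have "\<dots> = cnt P 0 (i * 2 ^ (L - Suc l))"
         proof (cases "even i")
          case True
          then obtain y where y: "i = 2 * y" by (elim evenE)
          show ?thesis using O[OF i2] by (simp add: y pLh[OF lL] ac_simps)
         next
          case False
          then obtain y where y: "i = 2 * y + 1" by (elim oddE)
          have "2 * y < 2 ^ Suc l" using i y by simp
          then have "AI u 5 (2 ^ Suc l + 2 * y) = cnt P (2 * y * 2 ^ (L - Suc l)) ((2 * y + 1) * 2 ^ (L - Suc l))"
           using Tu lL unfolding T_def by (metis Suc_leI le0)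
          moreover have "AI u 6 (2 ^ l + y) = cnt P 0 (2 * y * 2 ^ (L - Suc l))"
           using O[of y] i2 y by (simp add: pLh[OF lL] ac_simps)
          ultimately show ?thesis
           using cnt_add[of 0 "2 * y * 2 ^ (L - Suc l)" "(2 * y + 1) * 2 ^ (L - Suc l)" P] y by simp
         qed
         finally show "ival ?P5 (setv u 14 i) = cnt P 0 (i * 2 ^ (L - Suc l))" .
         have gr: "y \<in> {ICell (adr Q 6 (2 ^ l + i div 2)), ICell (adr Q 5 (2 * 2 ^ l + i - 1))}"
          if "y \<in> grd [] ?P1 (setv u 14 i)" for y
          using that half by (auto simp: r11 Qu)
         have "2 ^ l + i div 2 < SZ" "2 * 2 ^ l + i - 1 < SZ" using i i2 pl sz unfolding M_def by linarith+
         then show "y \<in> Rd \<union> Wr" if "y \<in> grd [] ?P1 (setv u 14 i)" for y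
          using gr[OF that] by auto
         fix j assume "j < 2 * (2::nat) ^ l" "ICell (adr (ireg u 2) 6 (2 * 2 ^ l + j)) \<in> grd [] ?P1 (setv u 14 i)"
         from gr[OF this(2)] have "2 * 2 ^ l + j = 2 ^ l + i div 2" by (auto simp: Qu)
         then show "i = j" using i2 by linarith
        next
         fix v assume v: "same {} {6} {} u v" "!!i. i < 2 * 2 ^ l ==> True ==> AI v 6 (2 * 2 ^ l + i) = cnt P 0 (i * 2 ^ (L - Suc l))"
          "ireg v = ireg u"
         show "ok \<beta> (Asg 11 (Num 2 [*] Var 11)) v (1 + 2 * 2 ^ l) 1 Rd Wr (\<lambda>t. \<exists>g'. I2 g' t & 1 + 3 * (2 * M - 2 * 2 ^ g') + (1 + 2
          * 2 ^ l) \<le> 1 + 3 * (2 * M - 2 * 2 ^ l) & L - g' + 1 + 1 \<le> L - l + 1)"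
         proof (rule asg_same)
          show "ival (Num 2 [*] Var 11) v \<le> \<beta>" using pl sz by (simp add: v r11 M_def)
          fix w assume w: "same {11} {} {} v w" "ireg w = (ireg v)(11 := ival (Num 2 [*] Var 11) v)" "imem w = imem v" "rmem w = rmem v"
          have "same {11, 12} {5, 6} {} s v" by (rule same_trans[OF su v(1)]) auto
          then have sw: "same {11, 12} {5, 6} {} s w" by (rule same_trans[OF _ w(1)]) auto
          have Tw: "T 0 w" using Tu same_AI[OF v(1), of 5] unfolding T_def by (simp add: w v(3))
          have "I2 (Suc l) w" using sw Tw lL v(2) by (simp add: I2_def w v(3) r11)
          moreover have "1 + 3 * (2 * M - 2 * 2 ^ Suc l) + (1 + 2 * 2 ^ l) \<le> 1 + 3 * (2 * M - 2 * 2 ^ l)"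
          proof -
           have "1 + 3 * (2 * M - 2 * (2 * a)) + (1 + 2 * a) \<le> 1 + 3 * (2 * M - 2 * a)"
            if "2 * a \<le> M" "1 \<le> a" for a using that by linarith
           from this[OF pl] show ?thesis by simp
          qed
          ultimately show "\<exists>g'. I2 g' w & 1 + 3 * (2 * M - 2 * 2 ^ g') + (1 + 2 * 2 ^ l) \<le> 1 + 3 * (2 * M - 2 * 2 ^ l) & L - g' +
           1 + 1 \<le> L - l + 1"
           using lL by (intro exI[of _ "Suc l"]) simp
         qed simp_all
        qed (use reg pl sz in \<open>auto simp: r11 Qu M_def\<close>)
       qed
      next
       fix l u assume I: "I2 l u" and z: "ival (Var 11 [<] Var 8) u = 0"
       have su: "same {11, 12} {5, 6} {} s u" and r11: "ireg u 11 = 2 ^ l" and Tu: "T 0 u" and lL': "l \<le> L"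
        and O: "!!v. v < 2 ^ l ==> AI u 6 (2 ^ l + v) = cnt P 0 (v * 2 ^ (L - l))" using I by (simp_all add: I2_def)
       have r8: "ireg u 8 = M" using same_reg[OF su, of 8] s by (simp add: M_def)
       have "\<not> ireg u 11 < ireg u 8" using z by simp
       then have "\<not> (2::nat) ^ l < 2 ^ L" unfolding r11 r8 M_def .
       moreover have "(2::nat) ^ l < 2 ^ L" if "l < L" using that by (intro power_strict_increasing) auto
       ultimately have lL: "l = L" using lL' by linarith
       have Qu: "ireg u 2 = Q" using same_Q[OF su] Q by simp
       have T0: "AI u 5 (2 ^ 0 + 0) = cnt P (0 * 2 ^ (L - 0)) ((0 + 1) * 2 ^ (L - 0))"
        by (rule Tu[unfolded T_def, rule_format]) simp_all
       have c: "cnt P 0 M \<le> \<beta>" by (rule order_trans[OF cnt_le]) (use sz in \<open>simp add: M_def\<close>)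
       show "ok \<beta> (Asg 12 (IA 5 (Num 1))) u X D Rd Wr PP"
       proof (rule asg_same)
        fix v assume v: "same {12} {} {} u v" "ireg v = (ireg u)(12 := ival (IA 5 (Num 1)) u)" "imem v = imem u" "rmem v = rmem u"
        show "PP v"
        proof (rule post)
         show "same {11, 12} {5, 6} {} s v" by (rule same_trans[OF su v(1)]) auto
         show "AI v 5 (2 ^ L + i) = of_bool (\<not> vlt (AR s 0) x i)" if "i < 2 ^ L" for i
          using Tu[unfolded T_def, rule_format, of L i] that by (simp add: v cnt_Suc P_def)
         show "AI v 6 (2 ^ L + i) = cnt (\<lambda>i. \<not> vlt (AR s 0) x i) 0 i" if "i < 2 ^ L" for i
          using O[of i] that by (simp add: v lL P_def[abs_def])
         show "ireg v 12 = cnt (\<lambda>i. \<not> vlt (AR s 0) x i) 0 (2 ^ L)"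
          using T0 by (simp add: v P_def[abs_def])
        qed
       qed (use X1 S1 T0 c in \<open>simp_all add: Qu M_def\<close>)
      qed
     qed (use b1 X1 in simp_all)
    qed (use reg X1 b1 S1 in \<open>simp_all add: Qu\<close>)
   qed
  qed (use X1 in simp_all)
 qed (use X1 reg s Q b1 in \<open>auto simp: M_def\<close>)
qed

end

text \<open>In the second branch the target of slot \<open>i\<close> is \<open>i\<close> minus the
  number of kept slots before it, that is, the number of slots before it that are not kept; one
  prefix count serves both branches.\<close>

definition FILTER :: hc where
 "FILTER =
   If (Var 5 [<=] Var 12)
    (Pf 14 (Var 6) [IA 5 (Var 8 [+] Var 14)]
     (IS (Adr (Var 2) 1 (IA 6 (Var 8 [+] Var 14))) (IA 0 (Var 14))) ;;
    Asg 6 (Var 12))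
    (Pf 14 (Var 6) [inot (IA 5 (Var 8 [+] Var 14))]
     (IS (Adr (Var 2) 1 (Var 14 [-] IA 6 (Var 8 [+] Var 14))) (IA 0 (Var 14))) ;;
    Asg 6 (Var 6 [-] Var 12) ;; Asg 5 (Var 5 [-] Var 12)) ;;
   Pf 14 (Var 6) [] (IS (Adr (Var 2) 0 (Var 14)) (IA 1 (Var 14)))"

text \<open>The odd halves are written behind the list first, because the second loop overwrites the
  block numbers in place.\<close>

definition SPLIT :: hc where
 "SPLIT =
   Pf 14 (Var 6) [] (IS (Adr (Var 2) 0 (Var 6 [+] Var 14)) (Num 2 [*] IA 0 (Var 14) [+] Num 1)) ;;
   Pf 14 (Var 6) [] (IS (Adr (Var 2) 0 (Var 14)) (Num 2 [*] IA 0 (Var 14))) ;;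
   Asg 6 (Num 2 [*] Var 6) ;; Asg 7 (Var 7 [/] Num 2)"

text \<open>The number of slots is padded to 64 times a power of 8, so that sorted groups of 64 can
  be merged by eights down to a single buffer.\<close>

definition MSIZE :: hc where
 "MSIZE = Asg 8 (Num 64) ;; Whl (Var 8 [<] Var 6) (Asg 8 (Num 8 [*] Var 8))"

text \<open>Prefix counts enumerate the positions satisfying \<open>P\<close> without gaps, so
  compaction neither collides nor leaves holes.\<close>

lemma rank_bij:
 "bij_betw (cnt P 0) {i. i < B & P i} {..<cnt P 0 B}"
proof (induction B)
 case 0
 then show ?case by (simp add: cnt_def bij_betw_def)
next
 case (Suc B)
 have c: "cnt P 0 (Suc B) = cnt P 0 B + of_bool (P B)" using cnt_add[of 0 B "Suc B" P] by (simp add: cnt_Suc)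
 show ?case
 proof (cases "P B")
  case True
  have "bij_betw (cnt P 0) ({i. i < B & P i} \<union> {B}) ({..<cnt P 0 B} \<union> {cnt P 0 B})"
   by (rule bij_betw_combine[OF Suc]) (auto simp: bij_betw_def)
  moreover have "{i. i < B & P i} \<union> {B} = {i. i < Suc B & P i}" using True by (auto simp: less_Suc_eq)
  moreover have "{..<cnt P 0 B} \<union> {cnt P 0 B} = {..<cnt P 0 (Suc B)}" using True by (auto simp: c)
  ultimately show ?thesis by simp
 next
  case False
  then have "{i. i < Suc B & P i} = {i. i < B & P i}" by (auto simp: less_Suc_eq)
  then show ?thesis using Suc False by (simp add: c)
 qed
qed

lemma cnt_compl: "i - cnt P 0 i = cnt (\<lambda>j. \<not> P j) 0 i"
proof -
 have "{j. j < i & P j} \<union> {j. j < i & \<not> P j} = {..<i}" "{j. j < i & P j} \<inter> {j. j < i & \<not> P j} = {}" by auto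
 then have "card {j. j < i & P j} + card {j. j < i & \<not> P j} = i"
  by (metis card_Un_disjoint card_lessThan finite_lessThan finite_Un)
 then show ?thesis by (simp add: cnt_def)
qed

lemma compact_image:
 assumes A': "!!i. i < B ==> P i ==> A' (cnt P 0 i) = A i" and inj: "inj_on A {..<B}"
 shows "A' ` {..<cnt P 0 B} = A ` {i. i < B & P i}" "inj_on A' {..<cnt P 0 B}"
proof -
 have im: "cnt P 0 ` {i. i < B & P i} = {..<cnt P 0 B}" using rank_bij[of P B] by (simp add: bij_betw_def)
 show "A' ` {..<cnt P 0 B} = A ` {i. i < B & P i}"
  unfolding im[symmetric] image_image using A' by auto
 show "inj_on A' {..<cnt P 0 B}"
  unfolding im[symmetric]
 proof (rule inj_onI)
  fix x y assume "x \<in> cnt P 0 ` {i. i < B & P i}" "y \<in> cnt P 0 ` {i. i < B & P i}" and e: "A' x = A' y"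
  then obtain i j where ij: "i < B" "P i" "x = cnt P 0 i" "j < B" "P j" "y = cnt P 0 j" by auto
  then have "A i = A j" using e A' by metis
  then show "x = y" using inj ij by (auto dest: inj_onD)
 qed
qed

section \<open>Correctness of compaction, splitting and padding\<close>

context core begin

lemma FILTER_ok:
 assumes s: "env s" "ireg s 6 = B" "ireg s 8 = M" "ireg s 12 = r" "ireg s 5 = K"
  and P5: "!!i. i < B ==> AI s 5 (M + i) = of_bool (P i)" and P6: "!!i. i < B ==> AI s 6 (M + i) = cnt P 0 i"
  and r: "r = cnt P 0 B" and inj: "inj_on (AI s 0) {..<B}"
  and sz: "2 * M \<le> SZ" "B \<le> M" "B \<le> \<beta>" "K \<le> \<beta>" "1 + B \<le> X" "1 \<le> D"
  and post: "!!u. same {5, 6} {0, 1} {} s u ==>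
   (K \<le> r & ireg u 5 = K & ireg u 6 = r & AI u 0 ` {..<r} = AI s 0 ` {i. i < B & P i} & inj_on (AI u 0) {..<r} \<or>
    r < K & ireg u 5 = K - r & ireg u 6 = B - r & AI u 0 ` {..<B - r} = AI s 0 ` {i. i < B & \<not> P i} & inj_on (AI u 0) {..<B - r})
   ==> PP u"
 shows "ok \<beta> FILTER s X D Rd Wr PP"
proof -
 let ?P1 = "Pf 14 (Var 6) [] (IS (Adr (Var 2) 0 (Var 14)) (IA 1 (Var 14)))"
 let ?P2 = "IS (Adr (Var 2) 1 (Var 14 [-] IA 6 (Var 8 [+] Var 14))) (IA 0 (Var 14))"
 let ?P3 = "IS (Adr (Var 2) 1 (IA 6 (Var 8 [+] Var 14))) (IA 0 (Var 14))"
 let ?P4 = "[inot (IA 5 (Var 8 [+] Var 14))]"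
 have Q: "ireg s 2 = Q" using s by (simp add: env_def)
 have rB: "r \<le> B" unfolding r by (rule cnt_le)
 have copy: "ok \<beta> ?P1 t X D Rd Wr PP"
  if t: "same {5, 6} {0, 1} {} s t" "ireg t 6 = B'" "B' \<le> B"
   "K \<le> r & ireg t 5 = K & B' = r & AI t 1 ` {..<r} = AI s 0 ` {i. i < B & P i} & inj_on (AI t 1) {..<r} \<or> r < K & ireg t 5 = K - r & B'
    = B - r & AI t 1 ` {..<B - r} = AI s 0 ` {i. i < B & \<not> P i} & inj_on (AI t 1) {..<B - r}"
  for t B'
 proof -
  have Qt: "ireg t 2 = Q" using same_Q[OF t(1)] Q by simp
  show ?thesis
  proof (rule pf_IA[where z = SZ and m = B' and G = "\<lambda>i. True" and ad = "\<lambda>i. i" and vl = "\<lambda>i. AI t 1 i"])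
   fix u assume u: "same {} {0} {} t u" "!!i. i < B' ==> True ==> AI u 0 i = AI t 1 i" "ireg u = ireg t"
   have su: "same {5, 6} {0, 1} {} s u" by (rule same_trans[OF t(1) u(1)]) auto
   have im: "AI u 0 ` {..<B'} = AI t 1 ` {..<B'}" by (intro image_cong refl u(2)) auto
   have ij: "inj_on (AI u 0) {..<B'} = inj_on (AI t 1) {..<B'}" by (intro inj_on_cong u(2)) auto
   have u5: "ireg u 5 = ireg t 5" "ireg u 6 = B'" by (simp_all only: u(3) t(2))
   show "PP u"
   proof (rule post[OF su], use t(4) in \<open>elim disjE conjE\<close>)
    assume a: "K \<le> r" "ireg t 5 = K" "B' = r" "AI t 1 ` {..<r} = AI s 0 ` {i. i < B & P i}" "inj_on (AI t 1) {..<r}"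
    show "K \<le> r & ireg u 5 = K & ireg u 6 = r & AI u 0 ` {..<r} = AI s 0 ` {i. i < B & P i} & inj_on (AI u 0) {..<r} \<or> r < K & ireg u 5
     = K - r & ireg u 6 = B - r & AI u 0 ` {..<B - r} = AI s 0 ` {i. i < B & \<not> P i} & inj_on (AI u 0) {..<B - r}"
     using a(1,5) u5(1)[unfolded a(2)] u5(2)[unfolded a(3)] im[unfolded a(3,4)] ij[unfolded a(3)] by blast
   next
    assume a: "r < K" "ireg t 5 = K - r" "B' = B - r" "AI t 1 ` {..<B - r} = AI s 0 ` {i. i < B & \<not> P i}" "inj_on (AI t 1) {..<B - r}"
    show "K \<le> r & ireg u 5 = K & ireg u 6 = r & AI u 0 ` {..<r} = AI s 0 ` {i. i < B & P i} & inj_on (AI u 0) {..<r} \<or> r < K & ireg u 5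
     = K - r & ireg u 6 = B - r & AI u 0 ` {..<B - r} = AI s 0 ` {i. i < B & \<not> P i} & inj_on (AI u 0) {..<B - r}"
     using a(1,5) u5(1)[unfolded a(2)] u5(2)[unfolded a(3)] im[unfolded a(3,4)] ij[unfolded a(3)] by blast
   qed
  qed (use t(3) sz reg in \<open>auto simp: t(2) Qt bnd_def\<close>)
 qed
 show ?thesis
  unfolding FILTER_def
 proof (rule ok_seq, rule ok_if)
  assume "ival (Var 5 [<=] Var 12) s \<noteq> 0"
  then have Kr: "K \<le> r" by (simp add: s)
  show "ok \<beta> (Pf 14 (Var 6) [IA 5 (Var 8 [+] Var 14)] ?P3 ;; Asg 6 (Var 12)) s X D Rd Wr (\<lambda>t. ok \<beta> ?P1 t X D Rd Wr PP)"
  proof (rule ok_seq, rule pf_IA[where z = SZ and m = B and G = P and ad = "cnt P 0" and vl = "AI s 0"])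
   fix i l assume i: "i < B"
   show "gev [IA 5 (Var 8 [+] Var 14)] (setv s 14 i) = P i" using P5[OF i] by (simp add: s Q)
   show "ival (IA 6 (Var 8 [+] Var 14)) (setv s 14 i) = cnt P 0 i" using P6[OF i] by (simp add: s Q)
   show "cnt P 0 i < SZ" using cnt_le[of P 0 i] i sz by simp
   have b: "i < SZ" "M + i < SZ" using i sz by simp_all
   assume "l \<in> grd [IA 5 (Var 8 [+] Var 14)] ?P3 (setv s 14 i)"
   then show "l \<in> Rd \<union> Wr" using b by (auto simp: s Q split: if_splits)
  next
   fix i j assume "i < B" "j < B" "P i" "P j" "cnt P 0 i = cnt P 0 j"
   then show "i = j" using rank_bij[of P B] by (auto simp: bij_betw_def dest: inj_onD)
  next
   fix t assume t: "same {} {1} {} s t" "!!i. i < B ==> P i ==> AI t 1 (cnt P 0 i) = AI s 0 i" "ireg t = ireg s"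
   note ci = compact_image[of B P "AI t 1" "AI s 0", OF t(2) inj]
   show "ok \<beta> (Asg 6 (Var 12)) t X D Rd Wr (\<lambda>t. ok \<beta> ?P1 t X D Rd Wr PP)"
   proof (rule asg_same)
    fix v assume v: "same {6} {} {} t v" "ireg v = (ireg t)(6 := ival (Var 12) t)" "imem v = imem t" "rmem v = rmem t"
    have sv: "same {5, 6} {0, 1} {} s v" by (rule same_trans[OF t(1) v(1)]) auto
    show "ok \<beta> ?P1 v X D Rd Wr PP"
     by (rule copy[OF sv _ rB]) (use ci Kr in \<open>simp_all add: v t(3) s r\<close>)
   qed (use sz rB in \<open>simp_all add: t(3) s\<close>)
  qed (use sz reg in \<open>auto simp: s Q bnd_def split: if_splits\<close>)
 next
  assume "ival (Var 5 [<=] Var 12) s = 0"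
  then have Kr: "r < K" by (simp add: s)
  let ?N = "\<lambda>i. \<not> P i"
  have cB: "B - r = cnt ?N 0 B" unfolding r by (rule cnt_compl)
  show "ok \<beta> (Pf 14 (Var 6) ?P4 ?P2 ;; Asg 6 (Var 6 [-] Var 12) ;; Asg 5 (Var 5 [-] Var 12)) s X D Rd Wr (\<lambda>t. ok \<beta> ?P1 t X D Rd Wr PP)"
  proof (rule ok_seq, rule pf_IA[where z = SZ and m = B and G = ?N and ad = "cnt ?N 0" and vl = "AI s 0"])
   fix i l assume i: "i < B"
   show "gev ?P4 (setv s 14 i) = (\<not> P i)" using P5[OF i] by (simp add: s Q)
   show "ival (Var 14 [-] IA 6 (Var 8 [+] Var 14)) (setv s 14 i) = cnt ?N 0 i"
    using P6[OF i] cnt_compl[of i P] by (simp add: s Q)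
   show "cnt ?N 0 i < SZ" using cnt_le[of ?N 0 i] i sz by simp
   have b: "i < SZ" "M + i < SZ" using i sz by simp_all
   assume "l \<in> grd ?P4 ?P2 (setv s 14 i)"
   then show "l \<in> Rd \<union> Wr" using b by (auto simp: s Q split: if_splits)
  next
   fix i j assume "i < B" "j < B" "?N i" "?N j" "cnt ?N 0 i = cnt ?N 0 j"
   then show "i = j" using rank_bij[of ?N B] by (auto simp: bij_betw_def dest: inj_onD)
  next
   fix t assume t: "same {} {1} {} s t" "!!i. i < B ==> ?N i ==> AI t 1 (cnt ?N 0 i) = AI s 0 i" "ireg t = ireg s"
   note ci = compact_image[of B ?N "AI t 1" "AI s 0", OF t(2) inj]
   show "ok \<beta> (Asg 6 (Var 6 [-] Var 12) ;; Asg 5 (Var 5 [-] Var 12)) t X D Rd Wr (\<lambda>t. ok \<beta> ?P1 t X D Rd Wr PP)"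
   proof (rule ok_seq, rule asg_same)
    fix v assume v: "same {6} {} {} t v" "ireg v = (ireg t)(6 := ival (Var 6 [-] Var 12) t)" "imem v = imem t" "rmem v = rmem t"
    have sv: "same {5, 6} {0, 1} {} s v" by (rule same_trans[OF t(1) v(1)]) auto
    show "ok \<beta> (Asg 5 (Var 5 [-] Var 12)) v X D Rd Wr (\<lambda>t. ok \<beta> ?P1 t X D Rd Wr PP)"
    proof (rule asg_same)
     fix w assume w: "same {5} {} {} v w" "ireg w = (ireg v)(5 := ival (Var 5 [-] Var 12) v)" "imem w = imem v" "rmem w = rmem v"
     have sw: "same {5, 6} {0, 1} {} s w" by (rule same_trans[OF sv w(1)]) auto
     show "ok \<beta> ?P1 w X D Rd Wr PP"
      by (rule copy[OF sw, of "B - r"]) (use ci Kr cnt_le[of ?N 0 B] in \<open>simp_all add: w v t(3) s cB\<close>)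
    qed (use sz in \<open>simp_all add: v t(3) s\<close>)
   qed (use sz in \<open>simp_all add: t(3) s\<close>)
  qed (use sz reg in \<open>auto simp: s Q bnd_def split: if_splits\<close>)
 qed (use sz in simp_all)
qed

lemma SPLIT_ok:
 assumes s: "env s" "ireg s 6 = B" "ireg s 7 = 2 * c" and inj: "inj_on (AI s 0) {..<B}"
  and A: "!!i. i < B ==> 2 * AI s 0 i + 1 \<le> \<beta>"
  and sz: "2 * B \<le> SZ" "2 * B \<le> \<beta>" "c \<le> \<beta>" "1 + B \<le> X" "1 \<le> D"
  and post: "!!u. same {6, 7} {0} {} s u ==> ireg u 6 = 2 * B ==> ireg u 7 = c ==>
   AI u 0 ` {..<2 * B} = (\<lambda>a. 2 * a) ` AI s 0 ` {..<B} \<union> (\<lambda>a. 2 * a + 1) ` AI s 0 ` {..<B} ==>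
   inj_on (AI u 0) {..<2 * B} ==> PP u"
 shows "ok \<beta> SPLIT s X D Rd Wr PP"
proof -
 have Q: "ireg s 2 = Q" using s by (simp add: env_def)
 show ?thesis
  unfolding SPLIT_def
 proof (rule ok_seq, rule pf_IA[where z = SZ and m = B and G = "\<lambda>i. True" and ad = "\<lambda>i. B + i" and vl = "\<lambda>i. 2 * AI s 0 i + 1"])
  fix t assume t: "same {} {0} {} s t" "!!i. i < B ==> True ==> AI t 0 (B + i) = 2 * AI s 0 i + 1"
   "!!j. (!!i. i < B ==> True ==> B + i \<noteq> j) ==> AI t 0 j = AI s 0 j" "ireg t = ireg s"
  have t0: "AI t 0 i = AI s 0 i" if "i < B" for i by (rule t(3)) (use that in simp)
  show "ok \<beta> (Pf 14 (Var 6) [] (IS (Adr (Var 2) 0 (Var 14)) (Num 2 [*] IA 0 (Var 14))) ;; Asg 6 (Num 2 [*] Var 6) ;; Asg 7 (Var 7 [/] Num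
   2)) t X D Rd Wr PP"
  proof (rule ok_seq, rule pf_IA[where z = SZ and m = B and G = "\<lambda>i. True" and ad = "\<lambda>i. i" and vl = "\<lambda>i. 2 * AI s 0 i"])
   fix i assume i: "i < B"
   show "ival (Num 2 [*] IA 0 (Var 14)) (setv t 14 i) = 2 * AI s 0 i" using t0[OF i] by (simp add: t(4))
   show "2 * AI s 0 i \<le> \<beta>" using A[OF i] by simp
  next
   fix u assume u: "same {} {0} {} t u" "!!i. i < B ==> True ==> AI u 0 i = 2 * AI s 0 i"
    "!!j. (!!i. i < B ==> True ==> i \<noteq> j) ==> AI u 0 j = AI t 0 j" "ireg u = ireg t"
   have u1: "AI u 0 (B + i) = 2 * AI s 0 i + 1" if "i < B" for i using u(3)[of "B + i"] t(2)[OF that] by simp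
   show "ok \<beta> (Asg 6 (Num 2 [*] Var 6) ;; Asg 7 (Var 7 [/] Num 2)) u X D Rd Wr PP"
   proof (rule ok_seq, rule asg_same)
    fix v assume v: "same {6} {} {} u v" "ireg v = (ireg u)(6 := ival (Num 2 [*] Var 6) u)" "imem v = imem u" "rmem v = rmem u"
    show "ok \<beta> (Asg 7 (Var 7 [/] Num 2)) v X D Rd Wr PP"
    proof (rule asg_same)
     fix w assume w: "same {7} {} {} v w" "ireg w = (ireg v)(7 := ival (Var 7 [/] Num 2) v)" "imem w = imem v" "rmem w = rmem v"
     have a: "same {6, 7} {0} {} s u" by (rule same_trans[OF t(1) u(1)]) auto
     have b: "same {6, 7} {0} {} s v" by (rule same_trans[OF a v(1)]) auto
     have c: "same {6, 7} {0} {} s w" by (rule same_trans[OF b w(1)]) auto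
     have e: "AI w 0 = AI u 0" by (simp add: w v)
     have B2: "{..<2 * B} = {..<B} \<union> (\<lambda>i. B + i) ` {..<B}"
     proof (intro equalityI subsetI)
      fix i assume "i \<in> {..<2 * B}"
      then show "i \<in> {..<B} \<union> (\<lambda>i. B + i) ` {..<B}"
       by (cases "i < B") (auto intro!: image_eqI[of _ _ "i - B"])
     qed auto
     show "PP w"
     proof (rule post[OF c])
      show "ireg w 6 = 2 * B" "ireg w 7 = c" by (simp_all add: w v u(4) t(4) s)
      have "AI u 0 ` {..<B} = (\<lambda>a. 2 * a) ` AI s 0 ` {..<B}"
       unfolding image_image using u(2) by (intro image_cong) auto
      moreover have "AI u 0 ` (\<lambda>i. B + i) ` {..<B} = (\<lambda>a. 2 * a + 1) ` AI s 0 ` {..<B}"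
       unfolding image_image using u1 by (intro image_cong) auto
      ultimately show "AI w 0 ` {..<2 * B} = (\<lambda>a. 2 * a) ` AI s 0 ` {..<B} \<union> (\<lambda>a. 2 * a + 1) ` AI s 0 ` {..<B}"
       unfolding e B2 image_Un by simp
      show "inj_on (AI w 0) {..<2 * B}"
       unfolding e
      proof (rule inj_onI)
       fix x y assume xy: "x \<in> {..<2 * B}" "y \<in> {..<2 * B}" "AI u 0 x = AI u 0 y"
       have lo: "AI u 0 z = 2 * AI s 0 z" if "z < B" for z using u(2)[OF that] by simp
       have hi: "AI u 0 z = 2 * AI s 0 (z - B) + 1" "z - B < B" if "\<not> z < B" "z < 2 * B" for z
        using u1[of "z - B"] that by auto
       have xy2: "x < 2 * B" "y < 2 * B" using xy by auto
       consider "x < B" "y < B" | "\<not> x < B" "\<not> y < B" | "x < B" "\<not> y < B" | "\<not> x < B" "y < B" by blast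
       then show "x = y"
       proof cases
        case 1
        then have "AI s 0 x = AI s 0 y" using xy(3) lo[of x] lo[of y] by simp
        then show ?thesis using inj 1 by (auto dest: inj_onD)
       next
        case 2
        then have "AI s 0 (x - B) = AI s 0 (y - B)" using xy(3) hi(1)[OF 2(1) xy2(1)] hi(1)[OF 2(2) xy2(2)] by simp
        then have "x - B = y - B" using inj_onD[OF inj] hi(2)[OF 2(1) xy2(1)] hi(2)[OF 2(2) xy2(2)] by simp
        then show ?thesis using 2 by simp
       next
        case 3
        then show ?thesis using xy(3) lo[OF 3(1)] hi(1)[OF 3(2) xy2(2)] by presburger
       next
        case 4
        then show ?thesis using xy(3) lo[OF 4(2)] hi(1)[OF 4(1) xy2(1)] by presburger
       qed
      qed
     qed
    qed (use sz in \<open>simp_all add: v u(4) t(4) s\<close>)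
   qed (use sz in \<open>simp_all add: u(4) t(4) s\<close>)
  qed (use sz reg in \<open>auto simp: t(4) s Q\<close>)
 qed (use sz reg A in \<open>auto simp: s Q\<close>)
qed

text \<open>The conclusion \<open>8 * 8 ^ J < B\<close> says that padding costs less than a factor
  of 8.\<close>

lemma MSIZE_ok:
 assumes s: "env s" "ireg s 6 = B" and B: "8 < B" "B \<le> 2 ^ D0"
  and sz: "512 * B \<le> \<beta>" "2 + D0 \<le> X" "2 + D0 \<le> D"
  and post: "!!u J. same {8} {} {} s u ==> imem u = imem s ==> rmem u = rmem s ==> ireg u 8 = 64 * 8 ^ J ==> B \<le> 64 * 8 ^ J ==> 8 * 8 ^ J < B ==> J \<le> D0 ==> PP u"
 shows "ok \<beta> MSIZE s X D Rd Wr PP"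
 unfolding MSIZE_def
proof (rule ok_seq, rule asg_same)
 fix t assume t: "same {8} {} {} s t" "ireg t = (ireg s)(8 := ival (Num 64) s)" "imem t = imem s" "rmem t = rmem s"
 define I where "I J u \<longleftrightarrow> J \<le> D0 & same {8} {} {} s u & imem u = imem s & rmem u = rmem s & ireg u 8 = 64 * 8 ^ J & 8 * 8 ^ J < B" for J u
 show "ok \<beta> (Whl (Var 8 [<] Var 6) (Asg 8 (Num 8 [*] Var 8))) t X D Rd Wr PP"
 proof (rule ok_while[where I = I and g = 0 and \<Phi> = "\<lambda>J. D0 - J + 1" and \<Delta> = "\<lambda>J. D0 - J + 1"])
  show "I 0 t" using t B by (simp add: I_def)
  show "D0 - 0 + 1 \<le> X" "D0 - 0 + 1 \<le> D" using sz by simp_all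
  fix J u assume I: "I J u"
  have r: "ireg u 6 = B" "ireg u 8 = 64 * 8 ^ J" using I s same_reg[of "{8}" "{}" "{}" s u 6] by (simp_all add: I_def)
  show "PP u" if "ival (Var 8 [<] Var 6) u = 0" using I that by (intro post[of u J]) (simp_all add: I_def r)
  assume "ival (Var 8 [<] Var 6) u \<noteq> 0"
  then have lt: "64 * 8 ^ J < B" by (simp add: r)
  have JD: "J < D0"
  proof (rule ccontr)
   assume "\<not> J < D0"
   then have "(2::nat) ^ D0 \<le> 2 ^ J" by (intro power_increasing) auto
   also have "\<dots> \<le> 8 ^ J" by (intro power_mono) auto
   finally show False using lt B by linarith
  qed
  show "\<exists>X1 D1. 1 \<le> X1 & 1 \<le> D1 & ok \<beta> (Asg 8 (Num 8 [*] Var 8)) u X1 D1 Rd Wr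
    (\<lambda>t. \<exists>g'. I g' t & D0 - g' + 1 + X1 \<le> D0 - J + 1 & D0 - g' + 1 + D1 \<le> D0 - J + 1)"
  proof (intro exI conjI)
   show "ok \<beta> (Asg 8 (Num 8 [*] Var 8)) u 1 1 Rd Wr
    (\<lambda>t. \<exists>g'. I g' t & D0 - g' + 1 + 1 \<le> D0 - J + 1 & D0 - g' + 1 + 1 \<le> D0 - J + 1)"
   proof (rule asg_same)
    show "ival (Num 8 [*] Var 8) u \<le> \<beta>" using lt sz by (simp add: r)
    fix v assume v: "same {8} {} {} u v" "ireg v = (ireg u)(8 := ival (Num 8 [*] Var 8) u)" "imem v = imem u" "rmem v = rmem u"
    have "same {8} {} {} s u" using I by (simp add: I_def)
    then have "same {8} {} {} s v" by (rule same_trans[OF _ v(1)]) auto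
    then have "I (Suc J) v" using I JD lt by (simp add: I_def v r)
    then show "\<exists>g'. I g' v & D0 - g' + 1 + 1 \<le> D0 - J + 1 & D0 - g' + 1 + 1 \<le> D0 - J + 1"
     using JD by (intro exI[of _ "Suc J"]) simp
   qed simp_all
  qed simp_all
 qed simp_all
qed (use sz B in simp_all)

end

text \<open>For blocks of size at least 2 only the high side may be discarded, which requires at
  least \<open>K\<close> kept blocks. More than a sixteenth of the blocks are kept, so
  \<open>B > 32 * K\<close> is ample; otherwise the blocks are split first.\<close>

definition ITER :: "nat => hc" where
 "ITER d = If ((Num 2 [<=] Var 7) [*] (Var 6 [<=] Num 32 [*] Var 5)) SPLIT
   (MSIZE ;; MINIMA d ;; PIVOT ;; SCAN ;; FILTER)"

text \<open>Starts with one block of size \<open>Var 3\<close>, which covers all positions, and ends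
  with at most 64 single positions, which are sorted directly. Variable 15 holds the base of the
  global arrays, where the result is left.\<close>

definition SELECT :: "nat => hc" where
 "SELECT d = Asg 5 (Var 1) ;; Asg 6 (Num 1) ;; Asg 7 (Var 3) ;;
   Pf 14 (Num 1) [] (IS (Adr (Var 2) 0 (Num 0)) (Num 0)) ;;
   Whl ((Num 2 [<=] Var 7) [+] (Num 65 [<=] Var 6)) (ITER d) ;;
   Asg 8 (Num 64) ;; MINIMA d ;; SORT ;;
   Pf 14 (Num 1) [] (RS (Adr (Var 15) 0 (Var 4)) (RA 0 (IA 2 (Var 5 [-] Num 1))))"

section \<open>The selection loop and its potentials\<close>

context core begin

text \<open>Ghost values: \<open>B\<close> blocks of size \<open>2 ^ e\<close> are alive and
  \<open>i\<close> filterings have taken place. A filtering leaves at most 15/16 of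
  \<open>B * 2 ^ e\<close>, a split leaves it unchanged, hence the inequality between powers of 16
  and 15.\<close>

definition sel_inv :: "state => nat => nat \<times> nat \<times> nat => state => bool" where
 "sel_inv s0 lg = (\<lambda>(B, e, i) u. same {5..13} {0..6} {0} s0 u & ireg u 6 = B & ireg u 7 = 2 ^ e & e \<le> lg &
   inj_on (AI u 0) {..<B} & (\<forall>j<B. AI u 0 j < 2 ^ (lg - e)) & B \<le> 64 * k & 1 \<le> B &
   16 ^ i * (B * 2 ^ e) \<le> 2 ^ lg * 15 ^ i &
   1 \<le> ireg u 5 & ireg u 5 \<le> k & ireg u 5 \<le> card (cov n (2 ^ e) (AI u 0 ` {..<B})) &
   (\<forall>v. is_kth Dm (cov n (2 ^ e) (AI u 0 ` {..<B})) (ireg u 5) v \<longrightarrow> is_kth Dm {..<n} k v))"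

lemma sel_inv_B:
 assumes "sel_inv s0 lg (B, e, i) u"
 shows "B \<le> 2 ^ (lg - e)" "B * 2 ^ e \<le> 2 ^ lg" "i \<le> 11 * lg"
proof -
 note I = assms[unfolded sel_inv_def, simplified]
 have "AI u 0 ` {..<B} \<subseteq> {..<2 ^ (lg - e)}" using I by auto
 then have "card (AI u 0 ` {..<B}) \<le> card {..<2 ^ (lg - e) :: nat}" by (intro card_mono) auto
 then show B: "B \<le> 2 ^ (lg - e)" using I by (simp add: card_image)
 have "B * 2 ^ e \<le> 2 ^ (lg - e) * 2 ^ e" using B by (rule mult_le_mono1)
 also have "\<dots> = 2 ^ lg" using I by (simp flip: power_add)
 finally show "B * 2 ^ e \<le> 2 ^ lg" .
 show "i \<le> 11 * lg"
 proof (rule ccontr)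
  assume "\<not> i \<le> 11 * lg"
  then obtain r where r: "i = 11 * lg + Suc r" by (metis add_Suc_right less_natE not_less)
  have "1 \<le> B * 2 ^ e" using I by simp
  then have "16 ^ i \<le> 16 ^ i * (B * 2 ^ e)" by simp
  then have le: "(16::nat) ^ i \<le> 2 ^ lg * 15 ^ i" using I by linarith
  have "(2::nat) ^ lg * 15 ^ i = (2 * 15 ^ 11) ^ lg * 15 ^ Suc r"
   by (simp only: r power_add power_mult power_mult_distrib mult.assoc)
  \<comment> \<open>The origin of 11: eleven filterings at least halve \<open>B * 2 ^ e\<close>, as
    \<open>2 * 15 ^ 11 \<le> 16 ^ 11\<close>.\<close>
  also have "\<dots> \<le> (16 ^ 11) ^ lg * 15 ^ Suc r" by (intro mult_le_mono1 power_mono) auto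
  also have "\<dots> < (16 ^ 11) ^ lg * 16 ^ Suc r" by (intro mult_strict_left_mono power_strict_mono) auto
  also have "\<dots> = 16 ^ i" by (simp only: r power_add power_mult)
  finally show False using le by linarith
 qed
qed

text \<open>A filtering costs \<open>10000 * (B * 2 ^ e)\<close> and removes at least a sixteenth of
  \<open>B * 2 ^ e\<close>, so the factor 160000 releases just that amount. The second summand and
  \<open>e\<close> pay for splits, whose cost \<open>1 + 2 ^ (lg - e)\<close> grows
  geometrically.\<close>

definition sel_work :: "nat => nat \<times> nat \<times> nat => nat" where
 "sel_work lg = (\<lambda>(B, e, i). 160000 * (B * 2 ^ e) + 4 * (2 ^ lg - 2 ^ (lg - e)) + e + 1)"

text \<open>Every round has depth \<open>lg + 4\<close> at most, and there are at most
  \<open>11 * lg\<close> filterings and \<open>lg\<close> splits.\<close>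

definition sel_depth :: "nat => nat \<times> nat \<times> nat => nat" where
 "sel_depth lg = (\<lambda>(B, e, i). (lg + 4) * (11 * lg + 1 - i + e) + 1)"

lemma ITER_ok:
 assumes e0: "env s0" and I: "sel_inv s0 lg (B, e, i) u" and nz: "2 \<le> (2::nat) ^ e \<or> 65 \<le> B"
  and SZ: "SZ = 8192 * k" and \<beta>: "2 ^ 20 * k \<le> \<beta>" "2 * 2 ^ lg \<le> \<beta>"
 shows "\<exists>X1 D1. 1 \<le> X1 & 1 \<le> D1 & ok \<beta> (ITER d) u X1 D1 Rd Wr
  (\<lambda>t. \<exists>g'. sel_inv s0 lg g' t & sel_work lg g' + X1 \<le> sel_work lg (B, e, i) & sel_depth lg g' + D1 \<le> sel_depth lg (B, e, i))"
proof -
 let ?P1 = "(Num 2 [<=] Var 7) [*] (Var 6 [<=] Num 32 [*] Var 5)"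
 let ?P2 = "MINIMA d ;; PIVOT ;; SCAN ;; FILTER"
 note I' = I[unfolded sel_inv_def prod.case]
 have su: "same {5..13} {0..6} {0} s0 u" and u6: "ireg u 6 = B" and u7: "ireg u 7 = 2 ^ e" and elg: "e \<le> lg"
  and inj: "inj_on (AI u 0) {..<B}" and Alt: "!!j. j < B ==> AI u 0 j < 2 ^ (lg - e)" and B64: "B \<le> 64 * k" and B1: "1 \<le> B"
  and pw: "16 ^ i * (B * 2 ^ e) \<le> 2 ^ lg * 15 ^ i"
  and K1: "1 \<le> ireg u 5" and Kk: "ireg u 5 \<le> k" and Kc: "ireg u 5 \<le> card (cov n (2 ^ e) (AI u 0 ` {..<B}))"
  and kth: "!!v. is_kth Dm (cov n (2 ^ e) (AI u 0 ` {..<B})) (ireg u 5) v ==> is_kth Dm {..<n} k v"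
  using I' by auto
 note Bb = sel_inv_B[OF I]
 have eu: "env u" by (rule env_same[OF e0 su]) auto
 have Qu: "ireg u 2 = Q" using eu by (simp add: env_def)
 define K where "K = ireg u 5"
 note uK = K_def[symmetric]
 show ?thesis
 proof (cases "2 \<le> (2::nat) ^ e & B \<le> 32 * K")
  case True
  then obtain c where ec: "e = Suc c" by (cases e) auto
  have lge: "(2::nat) ^ (lg - c) = 2 * 2 ^ (lg - e)" using elg ec by (metis Suc_diff_Suc Suc_le_eq power_Suc)
  have le2: "(2::nat) ^ (lg - c) \<le> 2 ^ lg" by (intro power_increasing) auto
  have X: "1 + B \<le> 1 + 2 ^ (lg - e)" using Bb by simp
  show ?thesis
  proof (intro exI conjI)
   show "1 \<le> 1 + (2::nat) ^ (lg - e)" "(1::nat) \<le> 1" by simp_all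
   show "ok \<beta> (ITER d) u (1 + 2 ^ (lg - e)) 1 Rd Wr (\<lambda>t. \<exists>g'. sel_inv s0 lg g' t & sel_work lg g' + (1 + 2 ^ (lg - e)) \<le> sel_work lg (B,
    e, i) & sel_depth lg g' + 1 \<le> sel_depth lg (B, e, i))"
    unfolding ITER_def
   proof (rule ok_if)
    assume "ival ?P1 u \<noteq> 0"
    show "ok \<beta> SPLIT u (1 + 2 ^ (lg - e)) 1 Rd Wr (\<lambda>t. \<exists>g'. sel_inv s0 lg g' t & sel_work lg g' + (1 + 2 ^ (lg - e)) \<le> sel_work lg (B,
     e, i) & sel_depth lg g' + 1 \<le> sel_depth lg (B, e, i))"
    proof (rule SPLIT_ok[where B = B and c = "2 ^ c"])
     show "env u" by fact
     show "ireg u 7 = 2 * 2 ^ c" using u7 ec by simp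
     have Bk: "B \<le> 32 * k" using True Kk unfolding K_def by linarith
     show "2 * B \<le> SZ" "2 * B \<le> \<beta>" using Bk SZ \<beta>(1) by simp_all
     show "2 ^ c \<le> \<beta>"
     proof -
      have "(2::nat) ^ c \<le> 2 ^ lg" using elg ec by (intro power_increasing) auto
      then show ?thesis using \<beta>(2) by linarith
     qed
     show "2 * AI u 0 j + 1 \<le> \<beta>" if "j < B" for j
      using Alt[OF that] lge le2 \<beta>(2) by linarith
     fix t assume t: "same {6, 7} {0} {} u t" "ireg t 6 = 2 * B" "ireg t 7 = 2 ^ c"
      "AI t 0 ` {..<2 * B} = (\<lambda>a. 2 * a) ` AI u 0 ` {..<B} \<union> (\<lambda>a. 2 * a + 1) ` AI u 0 ` {..<B}"
      "inj_on (AI t 0) {..<2 * B}"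
     have st: "same {5..13} {0..6} {0} s0 t" by (rule same_trans[OF su t(1)]) auto
     have t5: "ireg t 5 = ireg u 5" using same_reg[OF t(1)] by simp
     have cv: "cov n (2 ^ c) (AI t 0 ` {..<2 * B}) = cov n (2 ^ e) (AI u 0 ` {..<B})"
      unfolding t(4) ec power_Suc by (rule cov_split[symmetric]) simp
     have lt: "AI t 0 j < 2 ^ (lg - c)" if "j < 2 * B" for j
     proof -
      have "AI t 0 j \<in> AI t 0 ` {..<2 * B}" using that by (intro imageI) simp
      then obtain a where "a \<in> AI u 0 ` {..<B}" "AI t 0 j \<le> 2 * a + 1" unfolding t(4) by fastforce
      then obtain j' where "j' < B" "AI t 0 j \<le> 2 * AI u 0 j' + 1" by blast
      then show ?thesis using Alt[of j'] lge by linarith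
     qed
     have "sel_inv s0 lg (2 * B, c, i) t"
      unfolding sel_inv_def prod.case
     proof (intro conjI allI impI)
      show "16 ^ i * (2 * B * 2 ^ c) \<le> 2 ^ lg * 15 ^ i" using pw ec by (simp add: ac_simps)
      show "2 * B \<le> 64 * k" using Bk by simp
     qed (use st t(2,3,5) lt elg ec B1 K1 Kk Kc kth in \<open>simp_all add: t5 cv\<close>)
     moreover have "sel_work lg (2 * B, c, i) + (1 + 2 ^ (lg - e)) \<le> sel_work lg (B, e, i)"
      unfolding sel_work_def prod.case lge using le2 lge ec by (simp add: ac_simps)
     moreover have "sel_depth lg (2 * B, c, i) + 1 \<le> sel_depth lg (B, e, i)"
      unfolding sel_depth_def prod.case by (simp add: ec)
     ultimately show "\<exists>g'. sel_inv s0 lg g' t & sel_work lg g' + (1 + 2 ^ (lg - e)) \<le> sel_work lg (B, e, i) & sel_depth lg g' + 1 \<le>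
      sel_depth lg (B, e, i)"
      by blast
    qed (use u6 inj X in simp_all)
   next
    assume "ival ?P1 u = 0"
    then have False using True by (simp add: u6 u7 uK)
    then show "ok \<beta> (MSIZE ;; ?P2) u (1 + 2 ^ (lg - e)) 1 Rd Wr (\<lambda>t. \<exists>g'. sel_inv s0 lg g' t & sel_work lg g' + (1 + 2 ^ (lg - e)) \<le>
     sel_work lg (B, e, i) & sel_depth lg g' + 1 \<le> sel_depth lg (B, e, i))" ..
   qed simp_all
  qed
 next
  case False
  \<comment> \<open>A filtering happens either with many more blocks than the sought rank or with
    blocks of size one.\<close>
  have KR: "32 * K < B \<or> e = 0 & 65 \<le> B"
  proof (cases "e = 0")
   case True
   then show ?thesis using nz by simp
  next
   case e: False
   then have "(2::nat) ^ 1 \<le> 2 ^ e" by (intro power_increasing) auto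
   then show ?thesis using False by simp
  qed
  have K1': "1 \<le> K" using K1 by (simp add: K_def)
  have B8: "32 < B" using KR K1' by linarith
  define D0 where "D0 = (LEAST D0. B \<le> 2 ^ D0)"
  have D0: "B \<le> 2 ^ D0" unfolding D0_def by (rule LeastI[of _ B]) (rule less_imp_le[OF less_exp])
  have D0B: "D0 \<le> B" unfolding D0_def by (rule Least_le) (rule less_imp_le[OF less_exp])
  have D0l: "D0 \<le> lg"
  proof -
   have "(2::nat) ^ (lg - e) \<le> 2 ^ lg" by (intro power_increasing) auto
   then show ?thesis unfolding D0_def using Bb(1) by (intro Least_le) linarith
  qed
  let ?E = "B * 2 ^ e"
  have EB: "B \<le> ?E" by simp
  let ?X = "10000 * ?E" and ?D = "lg + 4"
  let ?PP = "\<lambda>t. \<exists>g'. sel_inv s0 lg g' t & sel_work lg g' + ?X \<le> sel_work lg (B, e, i) & sel_depth lg g' + ?D \<le> sel_depth lg (B, e, i)"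
  show ?thesis
  proof (intro exI conjI)
   show "1 \<le> ?X" "1 \<le> ?D" using B1 by simp_all
   show "ok \<beta> (ITER d) u ?X ?D Rd Wr ?PP"
    unfolding ITER_def
   proof (rule ok_if)
    assume "ival ?P1 u \<noteq> 0"
    then have False using False by (simp add: u6 u7 uK)
    then show "ok \<beta> SPLIT u ?X ?D Rd Wr ?PP" ..
   next
    have X1: "2 + D0 \<le> ?X" "2 + D0 \<le> ?D" using D0B D0l EB B8 by linarith+
    show "ok \<beta> (MSIZE ;; ?P2) u ?X ?D Rd Wr ?PP"
    proof (rule ok_seq, rule MSIZE_ok[OF eu u6 _ D0])
     show "8 < B" "512 * B \<le> \<beta>" using B8 B64 \<beta>(1) by simp_all
     show "2 + D0 \<le> ?X" "2 + D0 \<le> ?D" by fact+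
     fix t1 J assume t1: "same {8} {} {} u t1" "imem t1 = imem u" "rmem t1 = rmem u" "ireg t1 8 = 64 * 8 ^ J" "B \<le> 64 * 8 ^ J" "8 * 8 ^
      J < B" "J \<le> D0"
     define M where "M = (64 * 8 ^ J :: nat)"
     have MB: "M < 8 * B" using t1(6) by (simp add: M_def)
     have J1: "(1::nat) \<le> 8 ^ J" by simp
     have Mpow: "M = 2 ^ (6 + 3 * J)" by (simp add: M_def power_add power_mult)
     have L: "6 + 3 * J + 1 \<le> ?D"
     proof -
      have "(2::nat) ^ (3 + 3 * J) = 8 * 8 ^ J" by (simp add: power_add power_mult)
      also have "\<dots> < 2 ^ (lg - e)" using t1(6) Bb(1) by linarith
      finally have "3 + 3 * J < lg - e" by (simp only: power_strict_increasing_iff)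
      then show ?thesis by simp
     qed
     have e1: "env t1" by (rule env_same[OF eu t1(1)]) auto
     have r1: "ireg t1 6 = B" "ireg t1 7 = 2 ^ e" "ireg t1 5 = K" "ireg t1 2 = Q"
      using same_reg[OF t1(1)] by (simp_all add: u6 u7 uK Qu)
     have M1: "8 * M \<le> SZ" "512 * M \<le> \<beta>" using MB B64 SZ \<beta>(1) by simp_all
     show "ok \<beta> ?P2 t1 ?X ?D Rd Wr ?PP"
     proof (rule ok_seq, rule MINIMA_ok[OF e1 r1(1,2) t1(4)[folded M_def]])
      show "B \<le> M" using t1(5) by (simp add: M_def)
      show "M \<le> SZ" "M \<le> \<beta>" using M1 by simp_all
      show "B * 2 ^ e \<le> \<beta>" using Bb(2) \<beta>(2) by simp
      show "1 + M \<le> ?X" "1 + B * 2 ^ e \<le> ?X" using MB EB B8 by linarith+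
      fix t2 assume t2: "same {} {} {0} t1 t2" "!!j. j < M ==> AR t2 0 j = (if j < B then Min (insert BIG (Dm ` {j'. j' < n & j' div 2 ^
       e = AI t1 0 j})) else BIG)"
       "ireg t2 = ireg t1" "imem t2 = imem t1"
      define V where "V = AR t2 0"
      define A where "A = AI u 0"
      have A1: "AI t1 0 = A" by (simp add: A_def r1 Qu t1(2))
      have V1: "V j = Min (insert BIG (Dm ` {j'. j' < n & j' div 2 ^ e = A j}))" if "j < B" for j
       using t2(2)[of j] that t1(5) fun_cong[OF A1, of j] by (simp add: V_def M_def t2(3) r1)
      have V2: "V j = BIG" if "B \<le> j" "j < M" for j
       using t2(2)[of j] that by (simp add: V_def t2(3))
      interpret F: filter_step n "2 ^ e" B K Dm BIG A V
       by unfold_locales (use BIG inj V1 K1' Kc in \<open>simp_all add: A_def K_def\<close>)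
      have e2: "env t2" by (rule env_same[OF e1 t2(1)]) auto
      have XP: "2 + 1200 * (64 * 8 ^ J) \<le> ?X" using MB EB B8 unfolding M_def by linarith
      have DP: "J + 1 \<le> ?D" using t1(7) D0l by simp
      show "ok \<beta> (PIVOT ;; SCAN ;; FILTER) t2 ?X ?D Rd Wr ?PP"
      proof (rule ok_seq, rule PIVOT_ok[OF e2, where J = J])
       show "ireg t2 8 = 64 * 8 ^ J" using t1(4) t2(3) by simp
       show "512 * 8 ^ J \<le> SZ" "512 * (64 * 8 ^ J) \<le> \<beta>" using M1 by (simp_all add: M_def)
       show "2 + 1200 * (64 * 8 ^ J) \<le> ?X" "J + 1 \<le> ?D" by fact+
       fix t3 assume t3: "same {9, 10, 13} {2, 3, 4} {} t2 t3" "ireg t3 13 < 64 * 8 ^ J"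
        "4 * 8 ^ J \<le> card {j. j < 64 * 8 ^ J & vlt (AR t3 0) j (ireg t3 13)}"
        "card {j. j < 64 * 8 ^ J & vlt (AR t3 0) j (ireg t3 13)} < 5 * 8 ^ J"
       define \<pi> where "\<pi> = ireg t3 13"
       have Q3: "ireg t3 2 = Q" using same_Q[OF t3(1)] by (simp add: t2(3) r1)
       have V3: "AR t3 0 = V" using same_AR[OF t3(1), of 0] by (simp add: V_def Q3 t2(3) r1 fun_eq_iff)
       have pc: "4 * 8 ^ J \<le> card {j. j < M & vlt V j \<pi>}" "card {j. j < M & vlt V j \<pi>} < 5 * 8 ^ J"
        using t3(3,4) unfolding V3 \<pi>_def[symmetric] M_def by simp_all
       have \<pi>M: "\<pi> < M" using t3(2) by (simp add: \<pi>_def M_def)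
       \<comment> \<open>A pivot in the padding would have all \<open>B > 8 * 8 ^ J\<close> alive
         slots below it, too many for its rank.\<close>
       have \<pi>B: "\<pi> < B"
       proof (rule ccontr)
        assume n: "\<not> \<pi> < B"
        then have "V \<pi> = BIG" using V2[of \<pi>] \<pi>M by simp
        then have "{..<B} \<subseteq> {j. j < M & vlt V j \<pi>}" using F.V_big n \<pi>M by (fastforce simp: vlt_def)
        then have "B \<le> card {j. j < M & vlt V j \<pi>}" using card_mono[of "{j. j < M & vlt V j \<pi>}" "{..<B}"] by simp
        then show False using pc(2) t1(6) by linarith
       qed
       define P where "P j = (\<not> vlt V \<pi> j)" for j
       have hiP: "\<not> P j" if "B \<le> j" "j < M" for j
        using V2[OF that] F.V_big[OF \<pi>B] \<pi>B that by (simp add: P_def vlt_def)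
       have Pk: "{j. j < B & P j} = F.kept \<pi>"
        using vlt_total[of _ \<pi> V] vlt_asym[of V] by (auto simp: P_def F.kept_def)
       have rB: "cnt P 0 M = cnt P 0 B"
       proof -
        have BM: "B \<le> M" using t1(5) by (simp add: M_def)
        have "cnt P B M = 0" using hiP by (auto simp: cnt_def)
        then show ?thesis using cnt_add[of 0 B M P] BM by simp
       qed
       define r where "r = cnt P 0 B"
       have rk: "r = card (F.kept \<pi>)" unfolding r_def Pk[symmetric] by (simp add: cnt_def)
       have rc: "r = card {j. j < M & vlt V j \<pi>} + 1"
       proof -
        have "{j. j < M & P j} = insert \<pi> {j. j < M & vlt V j \<pi>}"
         using vlt_total[of _ \<pi> V] vlt_asym[of V] \<pi>M by (auto simp: P_def)
        then have "cnt P 0 M = card (insert \<pi> {j. j < M & vlt V j \<pi>})" by (simp add: cnt_def)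
        then show ?thesis using rB by (simp add: r_def)
       qed
       \<comment> \<open>More than \<open>4 * 8 ^ J\<close> slots are kept while
         \<open>B \<le> 64 * 8 ^ J\<close>, and at most \<open>5 * 8 ^ J\<close> are kept while
         \<open>B > 8 * 8 ^ J\<close>. Either side of the pivot therefore has fewer than 15/16 of
         the blocks.\<close>
       have rlo: "B < 16 * r" and rhi: "r \<le> 5 * 8 ^ J" using rc pc t1(5) by linarith+
       have e3: "env t3" by (rule env_same[OF e2 t3(1)]) auto
       have r3: "ireg t3 6 = B" "ireg t3 7 = 2 ^ e" "ireg t3 5 = K" "ireg t3 8 = M"
        using same_reg[OF t3(1)] by (simp_all add: t2(3) r1 t1(4) M_def)
       show "ok \<beta> (SCAN ;; FILTER) t3 ?X ?D Rd Wr ?PP"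
       proof (rule ok_seq, rule SCAN_ok[OF e3 r3(4)[unfolded Mpow] \<pi>_def[symmetric]])
        show "\<pi> < SZ" using \<pi>M M1 by simp
        show "4 * 2 ^ (6 + 3 * J) \<le> SZ" "4 * 2 ^ (6 + 3 * J) \<le> \<beta>" using M1 unfolding Mpow[symmetric] by simp_all
        show "8 + 8 * 2 ^ (6 + 3 * J) \<le> ?X" using MB EB B8 unfolding Mpow[symmetric] by linarith
        show "6 + 3 * J + 1 \<le> ?D" by fact
        fix t4 assume t4: "same {11, 12} {5, 6} {} t3 t4"
         "!!i. i < 2 ^ (6 + 3 * J) ==> AI t4 5 (2 ^ (6 + 3 * J) + i) = of_bool (\<not> vlt (AR t3 0) \<pi> i)"
         "!!i. i < 2 ^ (6 + 3 * J) ==> AI t4 6 (2 ^ (6 + 3 * J) + i) = cnt (\<lambda>i. \<not> vlt (AR t3 0) \<pi> i) 0 i"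
         "ireg t4 12 = cnt (\<lambda>i. \<not> vlt (AR t3 0) \<pi> i) 0 (2 ^ (6 + 3 * J))"
        have Peq: "(\<lambda>i. \<not> vlt (AR t3 0) \<pi> i) = P" unfolding V3 P_def ..
        have Q4: "ireg t4 2 = Q" using same_Q[OF t4(1)] Q3 by simp
        have A4: "AI t4 0 = A"
        proof
         fix j
         have "AI t4 0 j = AI t3 0 j" by (rule same_AI[OF t4(1)]) auto
         also have "\<dots> = AI t2 0 j" by (rule same_AI[OF t3(1)]) auto
         also have "\<dots> = A j" using fun_cong[OF A1, of j] by (simp add: t2(3,4))
         finally show "AI t4 0 j = A j" .
        qed
        have e4: "env t4" by (rule env_same[OF e3 t4(1)]) auto
        have r4: "ireg t4 6 = B" "ireg t4 7 = 2 ^ e" "ireg t4 5 = K" "ireg t4 8 = M" "ireg t4 12 = r"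
         using same_reg[OF t4(1)] t4(4)[unfolded Peq] rB by (simp_all add: r3 Mpow[symmetric] r_def)
        have BM: "B \<le> M" using t1(5) by (simp add: M_def)
        show "ok \<beta> FILTER t4 ?X ?D Rd Wr ?PP"
        proof (rule FILTER_ok[OF e4 r4(1,4,5,3), where P = P])
         show "AI t4 5 (M + j) = of_bool (P j)" "AI t4 6 (M + j) = cnt P 0 j" if "j < B" for j
          using t4(2)[of j] t4(3)[of j] that BM unfolding Mpow[symmetric] Peq by (auto simp: V3 P_def)
         show "r = cnt P 0 B" by (rule r_def)
         show "inj_on (AI t4 0) {..<B}" unfolding A4 by (rule F.inj)
         show "2 * M \<le> SZ" "B \<le> M" "B \<le> \<beta>" "K \<le> \<beta>" "1 + B \<le> ?X" "1 \<le> ?D"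
          using M1 BM B64 Kk \<beta>(1) EB B8 unfolding K_def by (simp_all, linarith?)
         fix w assume w: "same {5, 6} {0, 1} {} t4 w" and
          dis: "K \<le> r & ireg w 5 = K & ireg w 6 = r & AI w 0 ` {..<r} = AI t4 0 ` {i. i < B & P i} & inj_on (AI w 0) {..<r} \<or> r <
           K & ireg w 5 = K - r & ireg w 6 = B - r & AI w 0 ` {..<B - r} = AI t4 0 ` {i. i < B & \<not> P i} & inj_on (AI w 0) {..<B - r}"
         have s1: "same {5..13} {0..6} {0} s0 t1" by (rule same_trans[OF su t1(1)]) auto
         have s2: "same {5..13} {0..6} {0} s0 t2" by (rule same_trans[OF s1 t2(1)]) auto
         have s3: "same {5..13} {0..6} {0} s0 t3" by (rule same_trans[OF s2 t3(1)]) auto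
         have s4: "same {5..13} {0..6} {0} s0 t4" by (rule same_trans[OF s3 t4(1)]) auto
         have s5: "same {5..13} {0..6} {0} s0 w" by (rule same_trans[OF s4 w(1)]) auto
         have w7: "ireg w 7 = 2 ^ e" using same_reg[OF w(1), of 7] r4 by simp
         have fin: "?PP w" if B': "16 * B' \<le> 15 * B" "1 \<le> B'" and S': "AI w 0 ` {..<B'} \<subseteq> A ` {..<B}" and
           v: "ireg w 6 = B'" "inj_on (AI w 0) {..<B'}" "1 \<le> ireg w 5" "ireg w 5 \<le> k"
            "ireg w 5 \<le> card (cov n (2 ^ e) (AI w 0 ` {..<B'}))"
            "!!v. is_kth Dm (cov n (2 ^ e) (AI w 0 ` {..<B'})) (ireg w 5) v ==> is_kth Dm {..<n} k v" for B'
         proof (intro exI conjI)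
          show "sel_inv s0 lg (B', e, Suc i) w"
           unfolding sel_inv_def prod.case
          proof (intro conjI allI impI)
           show "B' \<le> 64 * k" using B' B64 by linarith
           show "AI w 0 j < 2 ^ (lg - e)" if "j < B'" for j
           proof -
            have "AI w 0 j \<in> A ` {..<B}" using S' that by blast
            then show ?thesis using Alt unfolding A_def by auto
           qed
           have "16 ^ Suc i * (B' * 2 ^ e) = 16 ^ i * ((16 * B') * 2 ^ e)" by simp
           also have "\<dots> \<le> 16 ^ i * ((15 * B) * 2 ^ e)" using B'(1) by (intro mult_le_mono2 mult_le_mono1)
           also have "\<dots> = 15 * (16 ^ i * (B * 2 ^ e))" by simp
           also have "\<dots> \<le> 15 * (2 ^ lg * 15 ^ i)" using pw by (rule mult_le_mono2)
           finally show "16 ^ Suc i * (B' * 2 ^ e) \<le> 2 ^ lg * 15 ^ Suc i" by simp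
          qed (use s5 w7 elg v B' in simp_all)
          have "(16 * B') * 2 ^ e \<le> (15 * B) * 2 ^ e" using B'(1) by (rule mult_le_mono1)
          then show "sel_work lg (B', e, Suc i) + ?X \<le> sel_work lg (B, e, i)"
           unfolding sel_work_def prod.case by (simp only: mult.assoc)
          have "11 * lg + 1 - i = Suc (11 * lg + 1 - Suc i)" using Bb(3) by simp
          then have "11 * lg + 1 - i + e = Suc (11 * lg + 1 - Suc i + e)" by simp
          then show "sel_depth lg (B', e, Suc i) + ?D \<le> sel_depth lg (B, e, i)"
           unfolding sel_depth_def prod.case by (simp only: mult_Suc_right)
         qed
         from dis show "?PP w"
         proof (elim disjE conjE)
          assume a: "K \<le> r" "ireg w 5 = K" "ireg w 6 = r" "AI w 0 ` {..<r} = AI t4 0 ` {i. i < B & P i}" "inj_on (AI w 0) {..<r}"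
          have S: "AI w 0 ` {..<r} = A ` F.kept \<pi>" unfolding a(4) A4 Pk ..
          note fl = F.filter_low[of \<pi>, folded rk, OF a(1)]
          show ?thesis
          proof (rule fin[of r])
           show "16 * r \<le> 15 * B" using rhi t1(6) by linarith
           show "AI w 0 ` {..<r} \<subseteq> A ` {..<B}" unfolding S by (auto simp: F.kept_def)
           show "is_kth Dm {..<n} k v" if "is_kth Dm (cov n (2 ^ e) (AI w 0 ` {..<r})) (ireg w 5) v" for v
            using fl(2)[of v] that kth[of v] unfolding S a(2) A_def K_def by blast
          qed (use a(3,5) fl(1) S rlo K1' Kk B1 in \<open>simp_all add: a(2) K_def, linarith?\<close>)
         next
          assume a: "r < K" "ireg w 5 = K - r" "ireg w 6 = B - r" "AI w 0 ` {..<B - r} = AI t4 0 ` {i. i < B & \<not> P i}" "inj_on (AI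
           w 0) {..<B - r}"
          \<comment> \<open>If \<open>32 * K < B\<close>, then \<open>r\<close>, being more than
            \<open>B / 16\<close>, would exceed \<open>K\<close>. The low side is thus removed only
            at block size one, as \<open>filter_high\<close> demands.\<close>
          have "e = 0" using KR rlo a(1) by linarith
          then have e0: "(2::nat) ^ e = 1" by simp
          have "{i. i < B & \<not> P i} = {..<B} - F.kept \<pi>" using Pk by auto
          then have S: "AI w 0 ` {..<B - r} = A ` ({..<B} - F.kept \<pi>)" unfolding a(4) A4 by simp
          note fh = F.filter_high[OF e0, of \<pi>, folded rk, OF a(1)]
          have ne: "1 \<le> B - r"
          proof (rule ccontr)
           assume "\<not> 1 \<le> B - r"
           then have "B - r = 0" by simp
           then have em: "A ` ({..<B} - F.kept \<pi>) = {}" unfolding S[symmetric] by simp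
           have "card (cov n (2 ^ e) (A ` ({..<B} - F.kept \<pi>))) = 0" unfolding em cov_def by simp
           then show False using fh(1) a(1) by simp
          qed
          show ?thesis
          proof (rule fin[of "B - r"])
           show "16 * (B - r) \<le> 15 * B" using rlo by simp
           show "AI w 0 ` {..<B - r} \<subseteq> A ` {..<B}" unfolding S by auto
           show "is_kth Dm {..<n} k v" if "is_kth Dm (cov n (2 ^ e) (AI w 0 ` {..<B - r})) (ireg w 5) v" for v
            using fh(2)[of v] that kth[of v] unfolding S a(2) A_def K_def by blast
           show "ireg w 5 \<le> card (cov n (2 ^ e) (AI w 0 ` {..<B - r}))" unfolding S a(2) by (rule fh(1))
           show "ireg w 5 \<le> k" "1 \<le> ireg w 5" using a(1) Kk unfolding a(2) K_def by simp_all
          qed (use a(3,5) ne in simp_all)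
         qed
        qed
       qed
      qed
     qed simp_all
    qed
   next
    show "1 \<le> ?X" using B1 by simp
    show "1 \<le> ?D" by linarith
   qed simp
  qed
 qed
qed

lemma SELECT_ok:
 assumes s: "env s" "ireg s 1 = k" "ireg s 3 = 2 ^ lg" "ireg s 15 = G" and GW: "RCell (adr G 0 p) \<in> Wr"
  and kn: "1 \<le> k" "k \<le> n" "n \<le> 2 ^ lg"
  and SZ: "SZ = 8192 * k" and \<beta>: "2 ^ 20 * k \<le> \<beta>" "2 * 2 ^ lg \<le> \<beta>"
  and X: "170000 * 2 ^ lg \<le> X" and D: "(lg + 4) * (12 * lg + 1) + 1 \<le> D"
  and post: "!!t. is_kth Dm {..<n} k (rmem t (adr G 0 p)) ==> PP t"
 shows "ok \<beta> (SELECT d) s X D Rd Wr PP"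
proof -
 let ?P1 = "Whl ((Num 2 [<=] Var 7) [+] (Num 65 [<=] Var 6)) (ITER d) ;; Asg 8 (Num 64) ;; MINIMA d ;; SORT ;; Pf 14 (Num 1) [] (RS (Adr
  (Var 15) 0 (Var 4)) (RA 0 (IA 2 (Var 5 [-] Num 1))))"
 let ?P2 = "RS (Adr (Var 15) 0 (Var 4)) (RA 0 (IA 2 (Var 5 [-] Num 1)))"
 let ?P3 = "Pf 14 (Num 1) [] (IS (Adr (Var 2) 0 (Num 0)) (Num 0)) ;; ?P1"
 have X1: "5000 \<le> X" "1 \<le> D"
 proof -
  have "(1::nat) \<le> 2 ^ lg" by simp
  then show "5000 \<le> X" using X by linarith
  show "1 \<le> D" using D by simp
 qed
 have \<beta>1: "2 ^ 20 \<le> \<beta>" "k \<le> \<beta>" using \<beta>(1) kn(1) by simp_all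
 have Qs: "ireg s 2 = Q" and s1: "ireg s (Suc 0) = k" using s by (simp_all add: env_def)
 have SZ1: "8192 \<le> SZ" using SZ kn by simp
 show ?thesis
  unfolding SELECT_def
 proof (rule ok_seq, rule asg_same)
  fix t1 assume t1: "same {5} {} {} s t1" "ireg t1 = (ireg s)(5 := ival (Var 1) s)" "imem t1 = imem s" "rmem t1 = rmem s"
  show "ok \<beta> (Asg 6 (Num 1) ;; Asg 7 (Var 3) ;; ?P3) t1 X D Rd Wr PP"
  proof (rule ok_seq, rule asg_same)
   fix t2 assume t2: "same {6} {} {} t1 t2" "ireg t2 = (ireg t1)(6 := ival (Num 1) t1)" "imem t2 = imem t1" "rmem t2 = rmem t1"
   show "ok \<beta> (Asg 7 (Var 3) ;; ?P3) t2 X D Rd Wr PP"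
   proof (rule ok_seq, rule asg_same)
    show "ival (Var 3) t2 \<le> \<beta>" using \<beta>(2) by (simp add: t2 t1 s)
    fix t3 assume t3: "same {7} {} {} t2 t3" "ireg t3 = (ireg t2)(7 := ival (Var 3) t2)" "imem t3 = imem t2" "rmem t3 = rmem t2"
    have a2: "same {5..13} {0..6} {0} s t2" by (rule same_trans[OF t1(1) t2(1)]) auto
    have a3: "same {5..13} {0..6} {0} s t3" by (rule same_trans[OF a2 t3(1)]) auto
    have r3: "ireg t3 5 = k" "ireg t3 6 = 1" "ireg t3 7 = 2 ^ lg" "ireg t3 2 = Q" by (simp_all add: t3 t2 t1 s s1 Qs)
    show "ok \<beta> ?P3 t3 X D Rd Wr PP"
    proof (rule ok_seq, rule pf_IA[where z = SZ and m = 1 and G = "\<lambda>i. True" and ad = "\<lambda>i. 0" and vl = "\<lambda>i. 0"])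
     fix t4 assume t4: "same {} {0} {} t3 t4" "!!i::nat. i < 1 ==> True ==> AI t4 0 0 = 0" "ireg t4 = ireg t3"
     have a4: "same {5..13} {0..6} {0} s t4" by (rule same_trans[OF a3 t4(1)]) auto
     have A0: "AI t4 0 0 = 0" using t4(2)[of 0] by simp
     have "AI t4 0 ` {..<1} = {AI t4 0 0}" by (auto simp: lessThan_Suc)
     then have im: "AI t4 0 ` {..<1} = {0}" unfolding A0 .
     have init: "sel_inv s lg (1, lg, 0) t4"
      unfolding sel_inv_def prod.case im cov_all[OF kn(3)]
      using a4 kn A0 by (simp add: t4(3) r3 inj_on_def)
     show "ok \<beta> ?P1 t4 X D Rd Wr PP"
     proof (rule ok_seq, rule ok_while[where I = "sel_inv s lg" and \<Phi> = "sel_work lg" and \<Delta> = "sel_depth lg" and g = "(1, lg, 0)"])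
      show "sel_inv s lg (1, lg, 0) t4" by fact
      have "lg < 2 ^ lg" by (rule less_exp)
      then show "sel_work lg (1, lg, 0) \<le> X" using X unfolding sel_work_def prod.case by (simp, use \<open>lg < 2 ^ lg\<close> in linarith)
      show "sel_depth lg (1, lg, 0) \<le> D" using D unfolding sel_depth_def prod.case by (simp add: add.commute)
     next
      fix g u assume I: "sel_inv s lg g u" and nz: "ival ((Num 2 [<=] Var 7) [+] (Num 65 [<=] Var 6)) u \<noteq> 0"
      obtain B e i where g: "g = (B, e, i)" by (cases g) auto
      have "ireg u 6 = B" "ireg u 7 = 2 ^ e" using I by (simp_all add: g sel_inv_def)
      then have "2 \<le> (2::nat) ^ e \<or> 65 \<le> B" using nz by auto
      from ITER_ok[OF s(1) I[unfolded g] this SZ \<beta>] show "\<exists>X1 D1. 1 \<le> X1 & 1 \<le> D1 & ok \<beta> (ITER d) u X1 D1 Rd Wr (\<lambda>t. \<exists>g'. sel_inv s lg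
       g' t & sel_work lg g' + X1 \<le> sel_work lg g & sel_depth lg g' + D1 \<le> sel_depth lg g)"
       unfolding g .
     next
      fix g u assume "sel_inv s lg g u"
      show "1 \<le> sel_work lg g & 1 \<le> sel_depth lg g" by (cases g) (simp add: sel_work_def sel_depth_def)
     next
      fix g u assume I: "sel_inv s lg g u" and z: "ival ((Num 2 [<=] Var 7) [+] (Num 65 [<=] Var 6)) u = 0"
      obtain B e i where g: "g = (B, e, i)" by (cases g) auto
      note I' = I[unfolded g sel_inv_def prod.case]
      have su: "same {5..13} {0..6} {0} s u" and u6: "ireg u 6 = B" and u7': "ireg u 7 = 2 ^ e"
       and inj: "inj_on (AI u 0) {..<B}" and K1: "1 \<le> ireg u 5" and Kk: "ireg u 5 \<le> k"
       and Kc': "ireg u 5 \<le> card (cov n (2 ^ e) (AI u 0 ` {..<B}))"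
       and kth': "!!v. is_kth Dm (cov n (2 ^ e) (AI u 0 ` {..<B})) (ireg u 5) v ==> is_kth Dm {..<n} k v"
       using I' by auto
      have z': "\<not> 2 \<le> (2::nat) ^ e" "B \<le> 64" using z by (auto simp: u6 u7')
      have e1: "(2::nat) ^ e = 1" using z'(1) by (cases e) auto
      note u7 = u7'[unfolded e1] and Kc = Kc'[unfolded e1] and kth = kth'[unfolded e1]
      define K where "K = ireg u 5"
      note uK = K_def[symmetric]
      have eu: "env u" by (rule env_same[OF s(1) su]) auto
      have Qu: "ireg u 2 = Q" using eu by (simp add: env_def)
      have KB: "K \<le> B"
      proof -
       have "cov n 1 (AI u 0 ` {..<B}) \<subseteq> AI u 0 ` {..<B}" by (auto simp: cov_def)
       then have "card (cov n 1 (AI u 0 ` {..<B})) \<le> card (AI u 0 ` {..<B})" by (intro card_mono) auto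
       also have "\<dots> \<le> B" using card_image_le[of "{..<B}" "AI u 0"] by simp
       finally show ?thesis using Kc by (simp add: K_def)
      qed
      show "ok \<beta> (Asg 8 (Num 64) ;; MINIMA d ;; SORT ;; Pf 14 (Num 1) [] ?P2) u X D Rd Wr PP"
      proof (rule ok_seq, rule asg_same)
       fix v assume v: "same {8} {} {} u v" "ireg v = (ireg u)(8 := ival (Num 64) u)" "imem v = imem u" "rmem v = rmem u"
       have ev: "env v" by (rule env_same[OF eu v(1)]) auto
       have rv: "ireg v 6 = B" "ireg v 7 = 1" "ireg v 8 = 64" "ireg v 2 = Q" "ireg v 5 = K" by (simp_all add: v u6 u7 Qu uK)
       show "ok \<beta> (MINIMA d ;; SORT ;; Pf 14 (Num 1) [] ?P2) v X D Rd Wr PP"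
       proof (rule ok_seq, rule MINIMA_ok[OF ev rv(1-3)])
        fix w assume w: "same {} {} {0} v w" "!!i. i < 64 ==> AR w 0 i = (if i < B then Min (insert BIG (Dm ` {j. j < n & j div 1 = AI
         v 0 i})) else BIG)"
         "ireg w = ireg v" "imem w = imem v"
        have ew: "env w" by (rule env_same[OF ev w(1)]) auto
        define V where "V = AR w 0"
        define A where "A = AI u 0"
        have A1: "AI v 0 = A" by (simp add: A_def rv Qu v(3))
        interpret F: filter_step n 1 B K Dm BIG A V
        proof unfold_locales
         show "V i = Min (insert BIG (Dm ` {j. j < n & j div 1 = A i}))" if "i < B" for i
          using w(2)[of i] that z'(2) fun_cong[OF A1, of i] by (simp add: V_def)
        qed (use BIG inj K1 Kc in \<open>simp_all add: A_def K_def\<close>)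
        show "ok \<beta> (SORT ;; Pf 14 (Num 1) [] ?P2) w X D Rd Wr PP"
        proof (rule ok_seq, rule SORT_ok[OF ew, where nb = 1])
         fix y assume y: "same {9, 10} {2, 3, 4} {} w y" "buffers (AR y 0) (AI y 2) 64 64 1 1 0"
         have Qy: "ireg y 2 = Q" using same_Q[OF y(1)] by (simp add: w(3) rv)
         have Vy: "AR y 0 = V" using same_AR[OF y(1), of 0] by (simp add: V_def Qy w(3) rv fun_eq_iff)
         have q: "K - 1 < 64" using KB z'(2) F.K by simp
         define x where "x = AI y 2 (K - 1)"
         note pr = pivot_rank[OF y(2) q, folded x_def, unfolded Vy]
         have "is_kth Dm (cov n 1 (A ` {..<B})) K (V x)"
         proof (rule F.final_select[where M = 64])
          show "V i = BIG" if "B \<le> i" "i < 64" for i using w(2)[of i] that by (simp add: V_def)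
         qed (use z' pr in simp_all)
         then have kv: "is_kth Dm {..<n} k (V x)" using kth[of "V x"] by (simp add: A_def K_def)
         have r: "ireg y 5 = K" "ireg y 4 = p" "ireg y 15 = G"
          using same_reg[OF y(1)] w(3) rv(5) ew same_reg[OF su, of 15] by (simp_all add: env_def v s)
         have xx: "rmem y (adr Q 0 x) = V x" using fun_cong[OF Vy, of x] by (simp add: Qy)
         show "ok \<beta> (Pf 14 (Num 1) [] ?P2) y X D Rd Wr PP"
         proof (rule ok_pf_RS[where m = 1 and G = "\<lambda>i. True" and ad = "\<lambda>i. adr G 0 p" and vl = "\<lambda>i. V x"])
          fix i :: nat
          show "rval (RA 0 (IA 2 (Var 5 [-] Num 1))) (setv y 14 i) = V x"
           using xx by (simp add: r Qy x_def)
          fix l assume "l \<in> grd [] ?P2 (setv y 14 i)"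
          then have "l = ICell (adr Q 2 (K - 1)) \<or> l = RCell (adr Q 0 x)" by (auto simp: r Qy x_def)
          moreover have "K - 1 < SZ" "x < SZ" using q pr(3) SZ1 by simp_all
          ultimately show "l \<in> Rd \<union> Wr" by auto
         next
          fix f assume f: "!!i::nat. i < 1 ==> True ==> f (adr G 0 p) = V x"
          have "f (adr G 0 p) = V x" using f[of 0] by simp
          then show "PP (y\<lparr>rmem := f\<rparr>)" using kv by (intro post) simp
         qed (use GW X1 \<beta>1 in \<open>simp_all add: r\<close>)
        qed (use w(3) rv SZ1 X1 \<beta>1 in simp_all)
       qed (use z' X1 \<beta>1 SZ1 in simp_all)
      qed (use X1 \<beta>1 in simp_all)
     qed simp
    qed (use X1 \<beta>1 SZ1 reg in \<open>auto simp: r3\<close>)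
   qed (use X1 in simp_all)
  qed (use X1 \<beta>1 in simp_all)
 qed (use X1 \<beta>1 in \<open>simp_all add: s s1\<close>)
qed

end

section \<open>Core distances and the cone graph\<close>

text \<open>A maximum is obtained as a priority minimum of negated distances. \<open>BIG\<close>
  merely has to exceed all distances, and the old content of the cell can only enlarge it.\<close>

definition MAXD :: "nat => hc" where
 "MAXD d = Pf 14 (Var 0 [*] Var 0) [] (RM (Adr (Var 2) 4 (Num 0))
    (RBin RSub (RNum 0) (dexp d (Var 14 [/] Var 0) (Var 14 [%] Var 0)))) ;;
   RAsg 0 (RBin RSub (RNum 1) (RA 4 (Num 0)))"

text \<open>Memory layout: variable 15 points behind the \<open>n * d\<close> input reals and the
  \<open>2 * n\<close> cells reserved for output; there the global arrays with
  \<open>n * K + 2\<close> entries begin. Variable 16 is the start of the workspaces and 17 the size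
  of one, \<open>16 * 8192 * minPts\<close>. Variable 3 becomes a power of two that is at least
  \<open>n\<close>.\<close>

definition PREP :: "nat => nat => hc" where
 "PREP d K = Asg 15 (Var 0 [*] Num (d + 2)) ;; Asg 2 (Var 15) ;;
   Asg 16 (Var 15 [+] Num 16 [*] (Var 0 [*] Num K [+] Num 2)) ;; Asg 17 (Num 131072 [*] Var 1) ;;
   Asg 3 (Num 1) ;; Whl (Var 3 [<] Var 0) (Asg 3 (Num 2 [*] Var 3)) ;;
   MAXD d"

definition CORE :: "nat => hc" where
 "CORE d = Par 4 (Var 0) (Asg 2 (Var 16 [+] Var 4 [*] Var 17) ;; SELECT d)"

locale run =
 fixes n k d K lg \<beta> X D :: nat and inp :: "nat => real"
 assumes k: "1 \<le> k" "k \<le> n" and d: "1 \<le> d" and K: "1 \<le> K"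
  and lg: "n \<le> 2 ^ lg" "2 ^ lg < 2 * n"
  and b: "2 ^ 20 * (n * n * (K + d + 1)) \<le> \<beta>"
  and X: "400000 * (n * n) \<le> X" "2 + 2 * (n * K) \<le> X"
  and D: "(lg + 4) * (12 * lg + 1) + 1 \<le> D"
begin

definition G where "G = n * (d + 2)"
definition m where "m = n * K"
definition Z where "Z = m + 2"
definition R0 where "R0 = G + 16 * Z"
definition SZ where "SZ = 8192 * k"
definition S where "S = R0 + 16 * SZ * n"
definition Rd :: "loc set" where "Rd = RCell ` {..<n * d}"
definition Wr :: "loc set" where "Wr = ICell ` {..<S} \<union> RCell ` {..<S}"
definition Dd where "Dd p q = sqrt (\<Sum>l<d. (inp (p * d + l) - inp (q * d + l))\<^sup>2)"

definition genv :: "real => state => bool" where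
 "genv BIG s \<longleftrightarrow> ireg s 0 = n & ireg s 1 = k & ireg s 2 = G & ireg s 3 = 2 ^ lg & ireg s 15 = G & ireg s 16 = R0 &
   ireg s 17 = 16 * SZ & rreg s 0 = BIG & (\<forall>a < n * d. rmem s a = inp a)"

lemma n0: "1 \<le> n" using k by simp

lemma bb: "S \<le> \<beta>" "2 ^ 20 * k \<le> \<beta>" "2 * 2 ^ lg \<le> \<beta>" "n * n \<le> \<beta>" "4 * n \<le> \<beta>" "4 * m + 4 \<le> \<beta>" "n * K \<le> \<beta>"
proof -
 have n2: "n \<le> n * n" "1 \<le> n * n" using n0 by simp_all
 have a: "n * n * (K + d + 1) = n * n * K + n * n * d + n * n" by (simp add: algebra_simps)
 have kn: "k * n \<le> n * n" using k by simp
 have nK: "n * K \<le> n * n * K" "n * d \<le> n * n * d" using n2 by simp_all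
 have kn1: "k \<le> k * n" using n0 by simp
 have n1: "1 \<le> n" by (rule n0)
 have L: "1048576 * (n * n * K) + 1048576 * (n * n * d) + 1048576 * (n * n) \<le> \<beta>"
  using b unfolding a by simp
 have Se: "S = n * d + 2 * n + 16 * (n * K) + 32 + 131072 * (k * n)"
  unfolding S_def R0_def G_def Z_def m_def SZ_def by (simp add: algebra_simps)
 show "S \<le> \<beta>" unfolding Se using L nK kn n2 by linarith
 have "1048576 * k \<le> \<beta>" using L kn kn1 by linarith
 then show "2 ^ 20 * k \<le> \<beta>" by simp
 show "2 * 2 ^ lg \<le> \<beta>" "n * n \<le> \<beta>" "4 * n \<le> \<beta>" "4 * m + 4 \<le> \<beta>" "n * K \<le> \<beta>"
  unfolding m_def using L nK n2 lg by linarith+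
qed

lemma Xs: "1 \<le> X" "1 + n * n \<le> X" "1 + n \<le> X" "1 + m \<le> X" "1 + 2 * m \<le> X" "1 + n * (170000 * 2 ^ lg) \<le> X" "1 \<le> D" "lg + 1 \<le> X" "lg + 1 \<le> D"
proof -
 have n2: "n \<le> n * n" "1 \<le> n * n" using n0 by simp_all
 have "n * (170000 * 2 ^ lg) \<le> n * (170000 * (2 * n))" using lg by (intro mult_le_mono2) simp
 also have "\<dots> = 340000 * (n * n)" by simp
 finally show "1 + n * (170000 * 2 ^ lg) \<le> X" using X(1) n2 by linarith
 show "1 \<le> X" "1 + n * n \<le> X" "1 + n \<le> X" "1 + m \<le> X" "1 + 2 * m \<le> X" "1 \<le> D"
  using X n2 D unfolding m_def by linarith+
 have "lg < 2 ^ lg" by (rule less_exp)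
 then show "lg + 1 \<le> X" using lg X n2 by linarith
 have "lg * 1 + 4 \<le> (lg + 4) * (12 * lg + 1)" by (simp add: algebra_simps)
 then show "lg + 1 \<le> D" using D by linarith
qed

lemma G_region: "region G Z \<subseteq> Wr"
 unfolding region_def Wr_def S_def R0_def by auto

lemma low: "n * d \<le> G" "2 * n \<le> G" "1 \<le> n" unfolding G_def using n0 by (auto simp: algebra_simps)

lemma inW [simp]: "c < 16 ==> i < Z ==> ICell (adr G c i) \<in> Wr" "c < 16 ==> i < Z ==> RCell (adr G c i) \<in> Wr"
 using G_region by auto

lemma val_dexp:
 assumes "\<forall>a < n * d. rmem s a = inp a" "ival a s = p" "ival b s = q" "p < n" "q < n"
 shows "rval (dexp d a b) s = Dd p q"
proof -
 have lt: "x * d + l < n * d" if "x < n" "l < d" for x l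
 proof -
  have "x * d + l < (x + 1) * d" using that by simp
  also have "\<dots> \<le> n * d" using that by (intro mult_le_mono1) simp
  finally show ?thesis .
 qed
 show ?thesis unfolding rval_dexp Dd_def assms(2,3)
  by (rule arg_cong[where f = sqrt], rule sum.cong) (use assms lt in auto)
qed

lemma rd_dexp:
 assumes "l \<in> rrd (dexp d a b) s" "ival a s < n" "ival b s < n" "ird a s = {}" "ird b s = {}"
 shows "l \<in> Rd" "l \<noteq> RCell (adr G c i)"
proof -
 obtain q where "q < n * d" "l = RCell q" using rrd_dexp[OF assms(1-3)] assms(4,5) by auto
 then show "l \<in> Rd" "l \<noteq> RCell (adr G c i)" using low(1) adr_ge[of G c i] by (auto simp: Rd_def)
qed

lemma dm: "i < n * n ==> i div n < n" "i mod n < n"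
 using n0 by (auto simp: less_mult_imp_div_less)

lemma PREP_ok:
 assumes s: "ireg s 0 = n" "ireg s 1 = k" "!!a. rmem s a = (if a < n * d then inp a else 0)"
  and post: "!!t BIG. genv BIG t ==> (!!p q. p < n ==> q < n ==> Dd p q < BIG) ==> PP t"
 shows "ok \<beta> (PREP d K) s X D Rd Wr PP"
proof -
 let ?P1 = "dexp d (Var 14 [/] Var 0) (Var 14 [%] Var 0)"
 let ?P2 = "RM (Adr (Var 2) 4 (Num 0)) (RBin RSub (RNum 0) ?P1)"
 have "16 * SZ * 1 \<le> 16 * SZ * n" using n0 by (intro mult_le_mono2) simp
 then have "G \<le> S" "R0 \<le> S" "16 * SZ \<le> S" unfolding S_def R0_def by linarith+
 then have B: "G \<le> \<beta>" "R0 \<le> \<beta>" "16 * SZ \<le> \<beta>" using bb(1) by linarith+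
 let ?s = "\<lambda>v. s\<lparr>ireg := (ireg s)(15 := G, 2 := G, 16 := R0, 17 := 16 * SZ, 3 := v)\<rparr>"
 have e1: "R0 = G + 16 * (n * K + 2)" "16 * SZ = 131072 * k" by (simp_all add: R0_def Z_def m_def SZ_def)
 have loop: "ok \<beta> (Whl (Var 3 [<] Var 0) (Asg 3 (Num 2 [*] Var 3))) u X D Rd Wr P"
  if u: "u = ?s 1" and P: "P (?s (2 ^ lg))" for u P
 proof (rule ok_while[where I = "\<lambda>i u. u = ?s (2 ^ i) & i \<le> lg" and g = 0 and \<Phi> = "\<lambda>i. lg + 1 - i" and \<Delta> = "\<lambda>i. lg + 1 - i"])
  fix i u assume i: "u = ?s (2 ^ i) & i \<le> lg" and "ival (Var 3 [<] Var 0) u \<noteq> 0"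
  then have "(2::nat) ^ i < n" by (simp add: s split: if_splits)
  then have "(2::nat) ^ i < 2 ^ lg" using lg by linarith
  then have il: "i < lg" by simp
  have p: "2 * 2 ^ i \<le> \<beta>" using \<open>2 ^ i < n\<close> bb(5) by linarith
  show "\<exists>X1 D1. 1 \<le> X1 & 1 \<le> D1 & ok \<beta> (Asg 3 (Num 2 [*] Var 3)) u X1 D1 Rd Wr (\<lambda>t. \<exists>g'. (t = ?s (2 ^ g') & g' \<le> lg) & lg + 1 - g' + X1 \<le>
   lg + 1 - i & lg + 1 - g' + D1 \<le> lg + 1 - i)"
   by (rule exI[of _ 1], rule exI[of _ 1], intro conjI, simp, simp, rule ok_asg)
    (use i il p in \<open>auto intro!: exI[of _ "Suc i"]\<close>)
 next
  fix i u assume i: "u = ?s (2 ^ i) & i \<le> lg" and "ival (Var 3 [<] Var 0) u = 0"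
  then have "n \<le> 2 ^ i" by (simp add: s not_less_eq_eq split: if_splits)
  then have "(2::nat) ^ lg < 2 * 2 ^ i" using lg by linarith
  then have "(2::nat) ^ lg < 2 ^ Suc i" by simp
  then have "lg < Suc i" by (rule power_less_imp_less_exp[rotated]) simp
  then have il: "i = lg" using i by simp
  show "P u" using P i unfolding il by simp
 qed (use Xs u in \<open>auto\<close>)
 let ?t = "?s (2 ^ lg)"
 have fin: "ok \<beta> (MAXD d) ?t X D Rd Wr PP"
  unfolding MAXD_def
 proof (rule ok_seq, rule pf_RMA[where z = Z and m = "n * n" and G = "\<lambda>i. True" and ad = "\<lambda>i. 0" and
   vl = "\<lambda>i. - Dd (i div n) (i mod n)"])
  fix i :: nat assume i: "i < n * n"
  note j = dm(1)[OF i] dm(2)[of i]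
  let ?S = "(setv ?t 14 i)"
  have "rval ?P1 ?S = Dd (i div n) (i mod n)"
   by (rule val_dexp) (use j low in \<open>auto simp: s\<close>)
  then show "rval (RBin RSub (RNum 0) ?P1) ?S = - Dd (i div n) (i mod n)"
   by simp
  fix l assume "l \<in> grd [] ?P2 ?S"
  then have l: "l \<in> rrd ?P1 ?S" by simp
  have "l \<in> Rd" by (rule rd_dexp[OF l]) (use j in \<open>auto simp: s\<close>)
  then show "l \<in> Rd \<union> Wr" by simp
 next
  fix i j :: nat assume i: "i < n * n"
  let ?S = "(setv ?t 14 i)"
  assume "RCell (adr (ireg ?t 2) 4 0) \<in> grd [] ?P2 ?S"
  then have l: "RCell (adr G 4 0) \<in> rrd ?P1 ?S" by simp
  have "RCell (adr G 4 0) \<noteq> RCell (adr G 4 0)"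
   by (rule rd_dexp(2)[OF l]) (use dm(1)[OF i] dm(2)[of i] in \<open>auto simp: s\<close>)
  then show "i = j" by simp
 next
  fix t assume t: "same {} {} {4} ?t t" "!!j. AR t 4 j = Min (insert (AR ?t 4 j) ((\<lambda>i. - Dd (i div n) (i mod n)) ` {i. i < n * n & True & 0 = j}))"
   "ireg t = ireg ?t"
  have e: "ireg t 0 = n" "ireg t 1 = k" "ireg t 2 = G" "ireg t 3 = 2 ^ lg" "ireg t 15 = G" "ireg t 16 = R0" "ireg t 17 = 16 * SZ"
   by (simp_all add: t(3)) (simp_all add: s(1) s(2)[unfolded One_nat_def])
  have lo: "\<forall>a<n * d. rmem t a = inp a" using same_low[OF t(1)] low(1) s(3) by auto
  define BIG where "BIG = 1 - AR t 4 0"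
  have "Dd p q < BIG" if "p < n" "q < n" for p q
  proof -
   have "p * n + q < (p + 1) * n" using that by simp
   also have "\<dots> \<le> n * n" using that by (intro mult_le_mono1) simp
   finally have "p * n + q < n * n" .
   moreover have "(p * n + q) div n = p" "(p * n + q) mod n = q" using that by auto
   ultimately have "- Dd p q \<in> (\<lambda>i. - Dd (i div n) (i mod n)) ` {i. i < n * n & True & 0 = (0::nat)}"
    by (intro image_eqI[of _ _ "p * n + q"]) auto
   then have "AR t 4 0 \<le> - Dd p q" unfolding t(2) by (intro Min_le) auto
   then show ?thesis by (simp add: BIG_def)
  qed
  then show "ok \<beta> (RAsg 0 (RBin RSub (RNum 1) (RA 4 (Num 0)))) t X D Rd Wr PP"
   using e lo Xs by (intro ok_rasg post[of BIG]) (auto simp: genv_def BIG_def Z_def)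
 qed (use Xs bb G_region in \<open>auto simp: s Z_def\<close>)
 show ?thesis
  unfolding PREP_def
  by (intro ok_seq ok_asg loop)
   (rule fin | use Xs B k bb in \<open>simp add: s s(2)[unfolded One_nat_def] G_def R0_def Z_def m_def SZ_def\<close>)+
qed

lemma CORE_ok:
 assumes e: "genv BIG s" and BIG: "!!p q. p < n ==> q < n ==> Dd p q < BIG"
  and post: "!!t. genv BIG t ==> (!!p. p < n ==> is_kth (Dd p) {..<n} k (AR t 0 p)) ==> PP t"
 shows "ok \<beta> (CORE d) s X D Rd Wr PP"
proof -
 define Wi where "Wi p = region (R0 + p * (16 * SZ)) SZ \<union> {RCell (adr G 0 p)}" for p
 have GR: "adr G 0 p < R0" if "p < n" for p
 proof -
  have "n * 1 \<le> n * K" using K by (intro mult_le_mono2) simp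
  then have "p < Z" using that unfolding Z_def m_def by linarith
  then show ?thesis unfolding R0_def adr_def by simp
 qed
 have e': "ireg s 0 = n" "ireg s (Suc 0) = k" "ireg s 2 = G" "ireg s 3 = 2 ^ lg" "ireg s 15 = G" "ireg s 16 = R0"
   "ireg s 17 = 16 * SZ" "rreg s 0 = BIG" "!!a. a < n * d ==> rmem s a = inp a" using e by (auto simp: genv_def)
 have nxt: "p * (16 * SZ) + 16 * SZ \<le> q * (16 * SZ)" if "p < q" for p q
 proof -
  have "(p + 1) * (16 * SZ) \<le> q * (16 * SZ)" using that by (intro mult_le_mono1) simp
  then show ?thesis by (simp add: algebra_simps)
 qed
 have GS: "G \<le> R0" by (simp add: R0_def)
 show ?thesis
  unfolding CORE_def
 proof (rule ok_par[where m = n and Wi = Wi and Qi = "\<lambda>p t. is_kth (Dd p) {..<n} k (rmem t (adr G 0 p))" and ?X1.0 = "170000 * 2 ^ lg"])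
  fix p assume p: "p < n"
  let ?S = "(setv s 4 p)"
  let ?Q = "R0 + p * (16 * SZ)"
  interpret c: core n k d \<beta> ?Q SZ p Rd "Wi p" "Dd p" inp BIG
   by unfold_locales (use p BIG low(1) GS in \<open>auto simp: Wi_def Rd_def Dd_def\<close>)
  have Qb: "?Q \<le> \<beta>" using nxt[OF p] bb(1) unfolding S_def by (simp add: mult.commute)
  show "ok \<beta> (Asg 2 (Var 16 [+] Var 4 [*] Var 17) ;; SELECT d) ?S (170000 * 2 ^ lg) D Rd (Wi p) (\<lambda>t. is_kth (Dd p) {..<n} k (rmem t (adr G 0 p)))"
  proof (rule ok_seq, rule ok_asg)
   show "ok \<beta> (SELECT d) (?S\<lparr>ireg := (ireg ?S)(2 := ival (Var 16 [+] Var 4 [*] Var 17) ?S)\<rparr>) (170000 * 2 ^ lg) D Rd (Wi p) (\<lambda>t. is_kth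
    (Dd p) {..<n} k (rmem t (adr G 0 p)))"
    (is "ok \<beta> _ ?T _ _ _ _ _")
   proof -
    have "c.env ?T" unfolding c.env_def by (simp add: e')
    from c.SELECT_ok[OF this, of lg G] show ?thesis
     using k lg bb D by (simp add: e' Wi_def SZ_def)
   qed
  qed (use Xs(7) Qb e' in \<open>simp_all\<close>)
 next
  fix f g
  assume T: "!!i. i < n ==> \<exists>t. is_kth (Dd i) {..<n} k (rmem t (adr G 0 i)) & (\<forall>a. ICell a \<in> Wi i \<longrightarrow> f a = imem t a) & (\<forall>a. RCell a \<in> Wi i \<longrightarrow> g
   a = rmem t a)"
   and U: "!!a. (!!i. i < n ==> RCell a \<notin> Wi i) ==> g a = rmem s a"
  show "PP (s\<lparr>imem := f, rmem := g\<rparr>)"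
  proof (rule post)
   have "g a = inp a" if a: "a < n * d" for a
   proof -
    have "RCell a \<notin> Wi i" for i using a low(1) GS adr_ge[of G 0 i] by (auto simp: Wi_def region_def)
    then show ?thesis using U[of a] e'(9)[OF a] by simp
   qed
   then show "genv BIG (s\<lparr>imem := f, rmem := g\<rparr>)" using e by (simp add: genv_def)
   fix p assume p: "p < n"
   from T[OF p] show "is_kth (Dd p) {..<n} k (AR (s\<lparr>imem := f, rmem := g\<rparr>) 0 p)"
    by (auto simp: e' Wi_def)
  qed
 next
  fix i j assume i: "i < n" "j < n" "i \<noteq> j"
  then have "i < j \<or> j < i" by auto
  then show "Wi i \<inter> Wi j = {}"
   using nxt[of i j] nxt[of j i] GR[OF i(1)] GR[OF i(2)] i(3) by (auto simp: Wi_def region_def)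
 next
  fix i assume i: "i < n"
  show "Wi i \<inter> Rd = {}" using low(1) GS adr_ge[of G 0 i] by (auto simp: Wi_def region_def Rd_def)
  show "Wi i \<subseteq> Wr" using nxt[OF i] GR[OF i] unfolding Wi_def region_def Wr_def S_def by (auto simp: mult.commute)
 qed (use Xs bb in \<open>simp_all add: e'\<close>)
qed

end

section \<open>The cone graph program\<close>

primrec digE :: "nat => nat => rexp => iexp" where
 "digE g 0 x = Num 0"
| "digE g (Suc j) x = digE g j x [+] RLeq (RNum (2 * of_nat j / of_nat g - 1)) x"

definition digX where "digX g x = digE g g x"

text \<open>A digit takes values from 0 to \<open>2 * d + 1\<close>, hence the base
  \<open>2 * d + 2\<close> and the number \<open>(2 * d + 2) ^ d\<close> of cones.\<close>

primrec clsE :: "nat => nat => iexp => iexp => iexp" where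
 "clsE d 0 a b = Num 0"
| "clsE d (Suc l) a b = clsE d l a b [*] Num (2 * d + 2) [+] digX (2 * d + 1)
   (RBin RDiv (RBin RSub (RLd (b [*] Num d [+] Num l)) (RLd (a [*] Num d [+] Num l))) (dexp d a b))"

lemma ival_digX [simp]: "ival (digX g x) s = dig g (rval x s)"
proof -
 have "ival (digE g j x) s = (\<Sum>i<j. of_bool (2 * real i / real g - 1 \<le> rval x s))" for j
  by (induction j) (simp_all add: of_rat_divide of_rat_mult of_rat_diff)
 then show ?thesis by (simp add: dig_def digX_def)
qed

lemma ird_digX: "l \<in> ird (digX g x) s ==> l \<in> rrd x s"
proof -
 have "ird (digE g j x) s \<subseteq> rrd x s" for j by (induction j) auto
 then show "l \<in> ird (digX g x) s ==> l \<in> rrd x s" by (auto simp: digX_def)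
qed

text \<open>Slot \<open>p * K + c\<close> belongs to point \<open>p\<close> and cone
  \<open>c\<close>. Two rounds of priority writes find the least distance and then the least index
  attaining it; the index \<open>n\<close> marks an empty slot. Real array 0 holds the core
  distances.\<close>

definition YAO :: "nat => nat => hc" where
 "YAO d K = (let p = Var 14 [/] Var 0; q = Var 14 [%] Var 0; c = p [*] Num K [+] clsE d d p q in
   Pf 14 (Var 0 [*] Num K) [] (RS (Adr (Var 2) 1 (Var 14)) (RVar 0)) ;;
   Pf 14 (Var 0 [*] Num K) [] (IS (Adr (Var 2) 0 (Var 14)) (Var 0)) ;;
   Pf 14 (Var 0 [*] Var 0) [inot (p [=] q), RLeq (RA 0 q) (RA 0 p)] (RM (Adr (Var 2) 1 c) (dexp d p q)) ;;
   Pf 14 (Var 0 [*] Var 0) [inot (p [=] q), RLeq (RA 0 q) (RA 0 p), RLeq (dexp d p q) (RA 1 c)] (IM (Adr (Var 2) 0 c) q))"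

context run begin

definition cl :: "nat => nat => nat" where
 "cl p q = cone_idx (2 * d + 1) (\<lambda>l. (inp (q * d + l) - inp (p * d + l)) / Dd p q) d"

lemma ndl: "p < n ==> l < d ==> p * d + l < n * d"
proof -
 assume "p < n" "l < d"
 then have "p * d + l < (p + 1) * d" by simp
 also have "\<dots> \<le> n * d" using \<open>p < n\<close> by (intro mult_le_mono1) simp
 finally show ?thesis .
qed

lemma ival_clsE:
 assumes s: "\<forall>a < n * d. rmem s a = inp a" "ival a s = p" "ival b s = q" "p < n" "q < n"
 shows "ival (clsE d d a b) s = cl p q"
proof -
 have "l \<le> d ==> ival (clsE d l a b) s = cone_idx (2 * d + 1) (\<lambda>l. (inp (q * d + l) - inp (p * d + l)) / Dd p q) l" for l
 proof (induction l)
  case (Suc l)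
  then have l: "l < d" by simp
  show ?case using Suc ndl[OF s(4) l] ndl[OF s(5) l] s(1)
   by (simp add: s(2,3) val_dexp[OF s])
 qed simp
 then show ?thesis by (simp add: cl_def)
qed

lemma ird_clsE:
 assumes l: "l \<in> ird (clsE d d a b) s" and s: "ival a s < n" "ival b s < n" "ird a s = {}" "ird b s = {}"
 shows "\<exists>x<n * d. l = RCell x"
proof -
 have "j \<le> d ==> l \<in> ird (clsE d j a b) s ==> ?thesis" for j
 proof (induction j)
  case (Suc j)
  then have j: "j < d" by simp
  have *: "l \<in> rrd (dexp d a b) s ==> ?thesis" using rrd_dexp[of l d a b s n] s by auto
  let ?x = "RBin RDiv (RBin RSub (RLd (b [*] Num d [+] Num j)) (RLd (a [*] Num d [+] Num j))) (dexp d a b)"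
  from Suc.prems(2) have "l \<in> ird (clsE d j a b) s \<or> l \<in> ird (digX (2 * d + 1) ?x) s" by simp
  then show ?case
  proof
   assume "l \<in> ird (digX (2 * d + 1) ?x) s"
   from ird_digX[OF this] have "l \<in> rrd (dexp d a b) s \<or> l = RCell (ival b s * d + j) \<or> l = RCell (ival a s * d + j)"
    using s(3,4) by auto
   then show ?thesis using * ndl[OF s(1) j] ndl[OF s(2) j] by auto
  qed (use Suc.IH j in simp)
 qed simp
 then show ?thesis using l by blast
qed

lemma genv_same: "genv B s ==> same R C C' s t ==> R \<inter> {0, 1, 2, 3, 15, 16, 17} = {} ==> genv B t"
 unfolding genv_def using low(1) by (simp add: same_def)

lemma YAO_ok:
 assumes e: "genv BIG s" and BIG: "!!p q. p < n ==> q < n ==> Dd p q < BIG" and KK: "K = (2 * d + 2) ^ d"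
  and H: "H = (\<lambda>p q. p < n & q < n & p \<noteq> q & AR s 0 q \<le> AR s 0 p)"
  and post: "!!t. same {} {0} {1} s t ==> (!!e. e < m ==> AI t 0 e \<le> n) ==>
   (!!e. e < m ==> AI t 0 e < n ==> H (e div K) (AI t 0 e) & cl (e div K) (AI t 0 e) = e mod K & AR t 1 e = Dd (e div K) (AI t 0 e)) ==>
   (!!p q. H p q ==> AI t 0 (p * K + cl p q) < n & AR t 1 (p * K + cl p q) \<le> Dd p q) ==> PP t"
 shows "ok \<beta> (YAO d K) s X D Rd Wr PP"
proof -
 let ?p = "Var 14 [/] Var 0" and ?q = "Var 14 [%] Var 0"
 let ?c = "?p [*] Num K [+] clsE d d ?p ?q"
 let ?P1 = "[inot (?p [=] ?q), RLeq (RA 0 ?q) (RA 0 ?p), RLeq (dexp d ?p ?q) (RA 1 ?c)]"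
 let ?P2 = "[inot (?p [=] ?q), RLeq (RA 0 ?q) (RA 0 ?p)]"
 let ?P3 = "RM (Adr (Var 2) 1 ?c) (dexp d ?p ?q)"
 let ?P4 = "Pf 14 (Var 0 [*] Var 0) ?P1 (IM (Adr (Var 2) 0 ?c) ?q)"
 let ?G = "\<lambda>i. H (i div n) (i mod n)"
 let ?ix = "\<lambda>i. i div n * K + cl (i div n) (i mod n)"
 let ?D = "\<lambda>i. Dd (i div n) (i mod n)"
 have cl: "cl p q < K" for p q
  unfolding cl_def KK using cone_less[of "2 * d + 1"] by simp
 have ixm: "p * K + cl p q < m" if "p < n" for p q
 proof -
  have "p * K + cl p q < (p + 1) * K" using cl by simp
  also have "\<dots> \<le> n * K" using that by (intro mult_le_mono1) simp
  finally show ?thesis by (simp add: m_def)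
 qed
 have ixm': "?ix i < m" if "i < n * n" for i using ixm dm(1)[OF that] by simp
 have nZ: "n < Z"
 proof -
  have "n * 1 \<le> n * K" using K by (intro mult_le_mono2) simp
  then show ?thesis unfolding Z_def m_def by linarith
 qed
 have g: "ireg s 0 = n" "ireg s 2 = G" "rreg s 0 = BIG" using e by (auto simp: genv_def)
 have thr: "gev ?P2 (setv u 14 i) = ?G i"
  "ival ?c (setv u 14 i) = ?ix i"
  "rval (dexp d ?p ?q) (setv u 14 i) = ?D i"
  "!!l. l \<in> ird ?c (setv u 14 i) ==> \<exists>x<n * d. l = RCell x"
  "!!l. l \<in> rrd (dexp d ?p ?q) (setv u 14 i) ==> \<exists>x<n * d. l = RCell x"
  if i: "i < n * n" and u: "same {} C {1} s u" for i u C
 proof -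
  let ?S = "(setv u 14 i)"
  note j = dm(1)[OF i] dm(2)[of i]
  have gu: "ireg u 0 = n" "ireg u 2 = G" "\<forall>a < n * d. rmem ?S a = inp a"
   using genv_same[OF e u] by (auto simp: genv_def)
  have a: "AR u 0 x = AR s 0 x" for x using same_AR[OF u, of 0] by simp
  show "gev ?P2 ?S = ?G i"
   using j a by (auto simp: gu H)
  have pq: "ival ?p ?S = i div n" "ival ?q ?S = i mod n" "ird ?p ?S = {}" "ird ?q ?S = {}" by (simp_all add: gu)
  have "ival (clsE d d ?p ?q) ?S = cl (i div n) (i mod n)"
   by (rule ival_clsE) (use j pq gu in auto)
  then show "ival ?c ?S = ?ix i" using pq by simp
  show "rval (dexp d ?p ?q) ?S = ?D i" by (rule val_dexp) (use j pq gu in auto)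
  show "\<exists>x<n * d. l = RCell x" if "l \<in> ird ?c ?S" for l
   by (rule ird_clsE) (use j pq that in auto)
  show "\<exists>x<n * d. l = RCell x" if "l \<in> rrd (dexp d ?p ?q) ?S" for l
   using rrd_dexp[OF that, of n] j pq by auto
 qed
 have far: "adr G c i \<noteq> x" if "x < n * d" for c i x using that low(1) adr_ge[of G c i] by linarith
 have RW: "x < n * d ==> RCell x \<in> Rd" for x by (simp add: Rd_def)
 show ?thesis
  unfolding YAO_def Let_def
 proof (rule ok_seq, rule pf_RA[where z = Z and m = m and G = "\<lambda>i. True" and ad = "\<lambda>i. i" and vl = "\<lambda>i. BIG"])
  fix t1 assume t1: "same {} {} {1} s t1" "!!i. i < m ==> True ==> AR t1 1 i = BIG" "ireg t1 = ireg s" "imem t1 = imem s"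
  have g1: "ireg t1 0 = n" "ireg t1 2 = G" using g by (simp_all add: t1(3))
  show "ok \<beta> (Pf 14 (Var 0 [*] Num K) [] (IS (Adr (Var 2) 0 (Var 14)) (Var 0)) ;; Pf 14 (Var 0 [*] Var 0) ?P2 ?P3 ;; ?P4) t1 X D Rd Wr PP"
  proof (rule ok_seq, rule pf_IA[where z = Z and m = m and G = "\<lambda>i. True" and ad = "\<lambda>i. i" and vl = "\<lambda>i. n"])
   fix t2 assume t2: "same {} {0} {} t1 t2" "!!i. i < m ==> True ==> AI t2 0 i = n" "ireg t2 = ireg t1"
   have g2: "ireg t2 0 = n" "ireg t2 2 = G" using g1 by (simp_all add: t2(3))
   have s2: "same {} {0} {1} s t2" by (rule same_trans[OF t1(1) t2(1)]) auto
   show "ok \<beta> (Pf 14 (Var 0 [*] Var 0) ?P2 ?P3 ;; ?P4) t2 X D Rd Wr PP"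
   proof (rule ok_seq, rule pf_RMA[where z = Z and m = "n * n" and G = ?G and ad = ?ix and vl = ?D])
    fix i assume i: "i < n * n"
    note th = thr[OF i s2]
    note j = dm(1)[OF i] dm(2)[of i]
    show "gev ?P2 (setv t2 14 i) = ?G i" by (rule th(1))
    show "ival ?c (setv t2 14 i) = ?ix i" by (rule th(2))
    show "rval (dexp d ?p ?q) (setv t2 14 i) = ?D i" by (rule th(3))
    have gl: "(\<exists>x<n * d. l = RCell x) \<or> l = RCell (adr G 0 (i mod n)) \<or> l = RCell (adr G 0 (i div n))"
     if "l \<in> grd ?P2 ?P3 (setv t2 14 i)" for l
     using that th(4,5)[of l] by (auto simp: g2 split: if_splits)
    show "l \<in> Rd \<union> Wr" if "l \<in> grd ?P2 ?P3 (setv t2 14 i)" for l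
     using gl[OF that] RW less_trans[OF j(1) nZ] less_trans[OF j(2) nZ] by auto
    show "i = j'" if "RCell (adr (ireg t2 2) 1 (?ix j')) \<in> grd ?P2 ?P3 (setv t2 14 i)" for j'
     using gl[OF that] far by (auto simp: g2)
    show "?ix i < Z" using ixm'[OF i] by (simp add: Z_def)
   next
    fix t3 assume t3: "same {} {} {1} t2 t3" "!!j. AR t3 1 j = Min (insert (AR t2 1 j) (?D ` {i. i < n * n & ?G i & ?ix i = j}))" "ireg
     t3 = ireg t2" "imem t3 = imem t2"
    have s3: "same {} {0} {1} s t3" by (rule same_trans[OF s2 t3(1)]) auto
    have g3: "ireg t3 0 = n" "ireg t3 2 = G" using g2 by (simp_all add: t3(3))
    have NI3: "AI t3 0 i = n" if "i < m" for i using t2(2)[OF that] by (simp add: t3(3,4))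
    have ND3: "AR t3 1 j = Min (insert BIG (?D ` {i. i < n * n & ?G i & ?ix i = j}))" if "j < m" for j
     unfolding t3(2) using t1(2)[OF that] same_AR[OF t2(1), of 1] by simp
    show "ok \<beta> ?P4 t3 X D Rd Wr PP"
    proof (rule pf_IMA[where z = Z and m = "n * n" and G = "\<lambda>i. ?G i & ?D i \<le> AR t3 1 (?ix i)" and ad = ?ix and vl = "\<lambda>i. i mod n"])
     fix i assume i: "i < n * n"
     note th = thr[OF i s3]
     note j = dm(1)[OF i] dm(2)[of i]
     let ?S = "(setv t3 14 i)"
     have ap: "gev (?P2 @ [x]) ?S \<longleftrightarrow> ?G i & ival x ?S \<noteq> 0" for x
      using th(1) unfolding append.simps gev.simps by blast
     show "gev ?P1 ?S = (?G i & ?D i \<le> AR t3 1 (?ix i))"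
      using ap[of "RLeq (dexp d ?p ?q) (RA 1 ?c)"] th(2,3) unfolding append.simps by (simp add: g3)
     show "ival ?c ?S = ?ix i" by (rule th(2))
     have gl: "(\<exists>x<n * d. l = RCell x) \<or> l = RCell (adr G 0 (i mod n)) \<or> l = RCell (adr G 0 (i div n)) \<or> l = RCell (adr G 1 (?ix i))"
      if "l \<in> grd ?P1 (IM (Adr (Var 2) 0 ?c) ?q) ?S" for l
      using that th(4,5)[of l] th(2) by (auto simp: g3 split: if_splits)
     show "l \<in> Rd \<union> Wr" if "l \<in> grd ?P1 (IM (Adr (Var 2) 0 ?c) ?q) ?S" for l
     proof -
      have "?ix i < Z" using ixm'[OF i] by (simp add: Z_def)
      then show ?thesis using gl[OF that] RW less_trans[OF j(1) nZ] less_trans[OF j(2) nZ] by auto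
     qed
     show "i = j'" if "ICell (adr (ireg t3 2) 0 (?ix j')) \<in> grd ?P1 (IM (Adr (Var 2) 0 ?c) ?q) ?S" for j'
      using gl[OF that] by auto
     show "?ix i < Z" using ixm'[OF i] by (simp add: Z_def)
    next
     fix t assume t: "same {} {0} {} t3 t" "!!j. AI t 0 j = Min (insert (AI t3 0 j) ((\<lambda>i. i mod n) ` {i. i < n * n & (?G i & ?D i \<le> AR
      t3 1 (?ix i)) & ?ix i = j}))"
      "rmem t = rmem t3"
     have NIt: "AI t 0 j = Min (insert n ((\<lambda>i. i mod n) ` {i. i < n * n & (?G i & ?D i \<le> AR t3 1 (?ix i)) & ?ix i = j}))" if "j < m" for j
      unfolding t(2) NI3[OF that] ..
     have NDt: "AR t 1 j = AR t3 1 j" for j using same_AR[OF t(1), of 1] by simp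
     have NDle: "AR t3 1 (?ix i) \<le> ?D i" if "i < n * n" "?G i" for i
      unfolding ND3[OF ixm'[OF that(1)]] using that by (intro Min_le) auto
     show "PP t"
     proof (rule post)
      show "same {} {0} {1} s t" by (rule same_trans[OF s3 t(1)]) auto
      fix e assume e: "e < m"
      show "AI t 0 e \<le> n" unfolding NIt[OF e] by (rule Min_le) auto
      assume lt: "AI t 0 e < n"
      have "AI t 0 e \<in> insert n ((\<lambda>i. i mod n) ` {i. i < n * n & (?G i & ?D i \<le> AR t3 1 (?ix i)) & ?ix i = e})"
       unfolding NIt[OF e] by (rule Min_in) auto
      then obtain i where i: "AI t 0 e = i mod n" "i < n * n" "?G i" "?D i \<le> AR t3 1 (?ix i)" "?ix i = e" using lt by auto
      have "e div K = i div n" "e mod K = cl (i div n) (i mod n)" unfolding i(5)[symmetric] using cl[of "i div n" "i mod n"] by auto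
      moreover have "AR t3 1 e = ?D i" using NDle[OF i(2,3)] i(4,5) by simp
      ultimately show "H (e div K) (AI t 0 e) & cl (e div K) (AI t 0 e) = e mod K & AR t 1 e = Dd (e div K) (AI t 0 e)"
       using i(3) by (simp add: i(1) NDt[unfolded One_nat_def])
     next
      fix p q assume pq: "H p q"
      then have lt: "p < n" "q < n" by (simp_all add: H)
      define i where "i = p * n + q"
      have "p * n + q < (p + 1) * n" using lt by simp
      also have "\<dots> \<le> n * n" using lt by (intro mult_le_mono1) simp
      finally have i: "i < n * n" "i div n = p" "i mod n = q" using lt by (auto simp: i_def)
      define e where "e = p * K + cl p q"
      have em: "e < m" using ixm[OF lt(1)] by (simp add: e_def)
      have le: "AR t3 1 e \<le> Dd p q" using NDle[of i] i pq by (simp add: e_def)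
      \<comment> \<open>The stored distance is at most \<open>Dd p q\<close>, hence below
        \<open>BIG\<close>, so some thread attains it and writes a genuine index in the second
        round.\<close>
      have "AR t3 1 e \<in> insert BIG (?D ` {i. i < n * n & ?G i & ?ix i = e})" unfolding ND3[OF em] by (rule Min_in) auto
      then obtain i' where i': "AR t3 1 e = ?D i'" "i' < n * n" "?G i'" "?ix i' = e" using le BIG[OF lt] by auto
      have "AI t 0 e \<le> i' mod n" unfolding NIt[OF em] using i' by (intro Min_le) auto
      then have "AI t 0 e < n" using dm(2)[of i'] by linarith
      then show "AI t 0 (p * K + cl p q) < n & AR t 1 (p * K + cl p q) \<le> Dd p q" using le by (simp add: NDt[unfolded One_nat_def] e_def)
     qed
    qed (use Xs bb G_region in \<open>simp_all add: g3\<close>)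
   qed (use Xs bb G_region in \<open>simp_all add: g2\<close>)
  qed (use Xs bb G_region in \<open>simp_all add: g1 m_def Z_def\<close>)
 qed (use Xs bb G_region in \<open>simp_all add: g m_def Z_def\<close>)
qed

end

section \<open>The Boruvka program\<close>

text \<open>Expressions offer no maximum of reals, so it is written as half of
  \<open>a + b + \<bar>a - b\<bar>\<close>, with a square root for the absolute value. The core
  distance of the far end is covered, being at most that of the near end.\<close>

definition ewE :: "nat => iexp => rexp" where
 "ewE K e = (let a = RA 0 (e [/] Num K); b = RA 1 e; x = RBin RSub a b in
   RBin RDiv (RBin RAdd (RBin RAdd a b) (RSq (RBin RMul x x))) (RNum 2))"

lemma rval_ewE [simp]: "rval (ewE K e) s = max (AR s 0 (ival e s div K)) (AR s 1 (ival e s))"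
proof -
 have "(a + b + sqrt ((a - b) * (a - b))) / 2 = max a b" for a b :: real
  using real_sqrt_abs2[of "a - b"] by (simp add: max_def)
 then show ?thesis by (simp add: ewE_def Let_def)
qed

lemma rrd_ewE [simp]: "rrd (ewE K e) s = {RCell (adr (ireg s 2) 0 (ival e s div K)), RCell (adr (ireg s 2) 1 (ival e s))} \<union> ird e s"
 by (auto simp: ewE_def Let_def)

text \<open>Thread \<open>2 * e + 1\<close> handles the first endpoint of edge \<open>e\<close>, thread \<open>2 * e\<close> the second one.\<close>

definition MINB :: "nat => hc" where
 "MINB K = (let e = Var 14 [/] Num 2; a = e [/] Num K; b = IA 0 e; r = Var 14 [%] Num 2;
    v = IA 1 (r [*] a [+] (Num 1 [-] r) [*] b); mm = Var 0 [*] Num K in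
   Pf 14 (Var 0) [] (RS (Adr (Var 2) 2 (Var 14)) (RVar 0)) ;;
   Pf 14 (Var 0) [] (IS (Adr (Var 2) 3 (Var 14)) mm) ;;
   Pf 14 (Num 2 [*] mm) [b [<] Var 0, inot (IA 1 a [=] IA 1 b)] (RM (Adr (Var 2) 2 v) (ewE K e)) ;;
   Pf 14 (Num 2 [*] mm) [b [<] Var 0, inot (IA 1 a [=] IA 1 b), RLeq (ewE K e) (RA 2 v)] (IM (Adr (Var 2) 3 v) e))"

text \<open>Integer array 1 holds the labels, 2 the slots, 3 the lightest edges, 4 \<open>PR\<close>
  and 5 \<open>PR2\<close>. The factor in \<open>f\<close> replaces the mark \<open>m\<close> of a
  missing edge by 0, so that addresses stay within the arrays.\<close>

definition LINK :: "nat => hc" where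
 "LINK K = (let c = Var 14; b = (IA 3 c [<] Var 0 [*] Num K); f = IA 3 c [*] b; t = (IA 4 (IA 4 c) [=] c) [*] (c [<] IA 4 c) in
   Pf 14 (Var 0) [] (IS (Adr (Var 2) 4 c) (b [*] (IA 1 (f [/] Num K) [+] IA 1 (IA 0 f) [-] c) [+] inot b [*] c)) ;;
   Pf 14 (Var 0) [] (IS (Adr (Var 2) 5 c) (t [*] c [+] inot t [*] IA 4 c)) ;;
   Pf 14 (Var 0) [inot (IA 5 c [=] c)] (IS (Adr (Var 2) 2 c) (IA 3 c)))"

text \<open>Array 5 holds the iterate of the pointer function whose exponent is in variable 8.
  Doubling stops at \<open>n * K + 2\<close>, the number of steps after which hooking chains have
  surely ended.\<close>

definition JUMP :: "nat => hc" where
 "JUMP K = Asg 8 (Num 1) ;; Whl (Var 8 [<] Var 0 [*] Num K [+] Num 2)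
   (Pf 14 (Var 0) [] (IS (Adr (Var 2) 6 (Var 14)) (IA 5 (IA 5 (Var 14)))) ;;
   Pf 14 (Var 0) [] (IS (Adr (Var 2) 5 (Var 14)) (IA 6 (Var 14))) ;; Asg 8 (Num 2 [*] Var 8))"

definition ROUND :: "nat => hc" where
 "ROUND K = MINB K ;; LINK K ;; JUMP K ;;
   Pf 14 (Var 0) [] (IS (Adr (Var 2) 1 (Var 14)) (IA 5 (IA 1 (Var 14)))) ;; Asg 9 (Num 2 [*] Var 9)"

text \<open>The components are never counted: variable 9 doubles in each round and stops the loop
  after enough rounds for halving to have left one component.\<close>

definition BOR :: "nat => hc" where
 "BOR K = Pf 14 (Var 0) [] (IS (Adr (Var 2) 1 (Var 14)) (Var 14)) ;; Asg 9 (Num 1) ;; Whl (Var 9 [<] Var 0) (ROUND K)"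

text \<open>Edge \<open>e\<close> joins \<open>e div K\<close> and \<open>NI e\<close>, and
  \<open>NI e < n\<close> marks it as valid. \<open>NI\<close>, \<open>cd\<close> and
  \<open>ND\<close> name contents of memory that stay fixed during all rounds.\<close>

locale bor = run +
 fixes BIG :: real and s0 :: state and NI :: "nat => nat" and cd ND :: "nat => real"
 assumes g0: "genv BIG s0" and NI: "!!e. AI s0 0 e = NI e" and cd: "!!p. AR s0 0 p = cd p" and ND: "!!e. AR s0 1 e = ND e"
  and NIn: "!!e. e < m ==> NI e \<le> n" and eB: "!!e. e < m ==> NI e < n ==> max (cd (e div K)) (ND e) < BIG"
  and con: "!!u v. u < n ==> v < n ==> conn (pairs {e. e < m & NI e < n} (\<lambda>e. e div K) NI) u v"
begin

lemma eK: "e < m ==> e div K < n" unfolding m_def by (rule less_mult_imp_div_less)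

sublocale B: boruvka n m "\<lambda>e. NI e < n" "\<lambda>e. e div K" NI "\<lambda>e. max (cd (e div K)) (ND e)"
 by unfold_locales (use eK con in auto)

abbreviation ew where "ew e \<equiv> max (cd (e div K)) (ND e)"

definition base :: "state => bool" where "base s \<longleftrightarrow> same {8, 9} {1..6} {2} s0 s"

lemma baseD:
 assumes "base s"
 shows "ireg s 0 = n" "ireg s 2 = G" "rreg s 0 = BIG" "imem s (adr G 0 e) = NI e" "rmem s (adr G 0 e) = cd e"
  "rmem s (adr G (Suc 0) e) = ND e"
proof -
 note b = assms[unfolded base_def]
 have gs: "genv BIG s" by (rule genv_same[OF g0 b]) auto
 then show e: "ireg s 0 = n" "ireg s 2 = G" "rreg s 0 = BIG" by (auto simp: genv_def)
 show "imem s (adr G 0 e) = NI e" using same_AI[OF b, of 0 e] NI[of e] same_Q[OF b] e by simp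
 show "rmem s (adr G 0 e) = cd e" using same_AR[OF b, of 0 e] cd[of e] same_Q[OF b] e by simp
 show "rmem s (adr G (Suc 0) e) = ND e" using same_AR[OF b, of 1 e] ND[of e] same_Q[OF b] e by simp
qed

lemma base_same: "base s ==> same R C C' s t ==> R \<subseteq> {8, 9} ==> C \<subseteq> {1..6} ==> C' \<subseteq> {2} ==> base t"
 unfolding base_def by (erule same_trans) auto

lemma nZ: "n < Z" "n \<le> m" "0 < m"
proof -
 have "n * 1 \<le> n * K" using K by (intro mult_le_mono2) simp
 then show "n < Z" "n \<le> m" "0 < m" unfolding Z_def m_def using n0 by linarith+
qed

lemma ltZ: "i \<le> n ==> i < Z" "i \<le> m ==> i < Z" using nZ by (auto simp: Z_def)

definition dv :: "nat => nat" where "dv i = i mod 2 * (i div 2 div K) + (1 - i mod 2) * NI (i div 2)"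

text \<open>An edge between different components has two threads, of which exactly one addresses the
  cell of a given incident component. Minima over threads thus become minima over outgoing
  edges.\<close>

lemma dart_outs: "(\<lambda>i. f (i div 2)) ` {i. i < 2 * m & (NI (i div 2) < n & L (i div 2 div K) \<noteq> L (NI (i div 2)) & P (i div 2) c) & L (dv i) = c} =
  f ` {e \<in> B.outs L c. P e c}"
proof (intro equalityI subsetI)
 fix x assume "x \<in> (\<lambda>i. f (i div 2)) ` {i. i < 2 * m & (NI (i div 2) < n & L (i div 2 div K) \<noteq> L (NI (i div 2)) & P (i div 2) c) & L (dv i) = c}"
 then obtain i where i: "x = f (i div 2)" "i < 2 * m" "NI (i div 2) < n" "L (i div 2 div K) \<noteq> L (NI (i div 2))" "P (i div 2) c" "L (dv i) =
  c" by auto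
 have "i mod 2 = 0 \<or> i mod 2 = 1" by linarith
 then have "dv i = i div 2 div K \<or> dv i = NI (i div 2)" by (auto simp: dv_def)
 then have "i div 2 \<in> B.outs L c" using i by (auto simp: B.outs_def)
 then show "x \<in> f ` {e \<in> B.outs L c. P e c}" using i by auto
next
 fix x assume "x \<in> f ` {e \<in> B.outs L c. P e c}"
 then obtain e where e: "x = f e" "e \<in> B.outs L c" "P e c" by auto
 define i where "i = (if L (e div K) = c then 2 * e + 1 else 2 * e)"
 have "i div 2 = e" "i < 2 * m" "L (dv i) = c" using e(2) by (auto simp: i_def B.outs_def dv_def)
 then show "x \<in> (\<lambda>i. f (i div 2)) ` {i. i < 2 * m & (NI (i div 2) < n & L (i div 2 div K) \<noteq> L (NI (i div 2)) & P (i div 2) c) & L (dv i) = c}"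
  using e by (intro image_eqI[of _ _ i]) (auto simp: B.outs_def)
qed

text \<open>Minimising first the weight and then the number among the lightest realises the minimum
  in the order \<open>elt\<close> by two rounds of priority writes.\<close>

lemma min_edge:
 assumes BW: "BW = Min (insert BIG (ew ` B.outs L c))" and BE: "BE = Min (insert m {e \<in> B.outs L c. ew e \<le> BW})"
 shows "B.outs L c = {} ==> BE = m"
  and "B.outs L c \<noteq> {} ==> BE \<in> B.outs L c & (\<forall>e\<in>B.outs L c. B.rk BE \<le> B.rk e)"
proof -
 show "B.outs L c = {} ==> BE = m" using BE by simp
 assume ne: "B.outs L c \<noteq> {}"
 have sub: "B.outs L c \<subseteq> {..<m}" by (auto simp: B.outs_def)
 then have fin: "finite (B.outs L c)" using finite_subset by blast
 have le: "BW \<le> ew e" if "e \<in> B.outs L c" for e unfolding BW using that fin by (intro Min_le) auto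
 have lt: "ew e < BIG" if "e \<in> B.outs L c" for e using that by (intro eB) (auto simp: B.outs_def)
 obtain e0 where e0: "e0 \<in> B.outs L c" using ne by blast
 have "BW \<in> insert BIG (ew ` B.outs L c)" unfolding BW using fin by (intro Min_in) auto
 then obtain f where f: "f \<in> B.outs L c" "BW = ew f" using le[OF e0] lt[OF e0] by fastforce
 have mn: "BE \<le> e" if "e \<in> B.outs L c" "ew e \<le> BW" for e
  unfolding BE using that fin by (intro Min_le) auto
 have "BE \<in> insert m {e \<in> B.outs L c. ew e \<le> BW}" unfolding BE using fin by (intro Min_in) auto
 moreover have "BE < m" using mn[OF f(1)] f sub by fastforce
 ultimately have b: "BE \<in> B.outs L c" "ew BE \<le> BW" by auto
 have "B.rk BE \<le> B.rk e" if e: "e \<in> B.outs L c" for e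
 proof (rule ccontr)
  assume "\<not> ?thesis"
  then have "B.rk e < B.rk BE" by simp
  moreover have "e < m" "BE < m" using e b sub by auto
  ultimately have "B.elt e BE" using B.rk_less_iff by blast
  then show False using le[OF e] b mn[OF e] unfolding B.elt_def by linarith
 qed
 with b show "BE \<in> B.outs L c & (\<forall>e\<in>B.outs L c. B.rk BE \<le> B.rk e)" by blast
qed

lemma MINB_ok:
 fixes Xa Da :: nat
 assumes b: "base s" and L: "!!v. imem s (adr G (Suc 0) v) = L v" and Ln: "!!v. v < n ==> L v < n"
  and X: "1 + 2 * m \<le> Xa" "1 \<le> Da"
  and post: "!!t. same {} {3} {2} s t ==> (!!c. c < n ==> B.outs L c = {} ==> AI t 3 c = m) ==>
   (!!c. c < n ==> B.outs L c \<noteq> {} ==> AI t 3 c \<in> B.outs L c & (\<forall>e\<in>B.outs L c. B.rk (AI t 3 c) \<le> B.rk e)) ==> PP t"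
 shows "ok \<beta> (MINB K) s Xa Da Rd Wr PP"
proof -
 let ?e = "Var 14 [/] Num 2" and ?r = "Var 14 [%] Num 2"
 let ?a = "?e [/] Num K" and ?b = "IA 0 ?e" and ?mm = "Var 0 [*] Num K"
 let ?v = "IA 1 (?r [*] ?a [+] (Num 1 [-] ?r) [*] ?b)"
 let ?gs = "[?b [<] Var 0, inot (IA 1 ?a [=] IA 1 ?b)]"
 let ?P1 = "[?b [<] Var 0, inot (IA 1 ?a [=] IA 1 ?b), RLeq (ewE K ?e) (RA 2 ?v)]"
 let ?P2 = "RM (Adr (Var 2) 2 ?v) (ewE K ?e)"
 let ?P3 = "Pf 14 (Num 2 [*] ?mm) ?P1 (IM (Adr (Var 2) 3 ?v) ?e)"
 let ?G = "\<lambda>i. NI (i div 2) < n & L (i div 2 div K) \<noteq> L (NI (i div 2)) & True"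
 have X': "1 + n \<le> Xa" using X nZ by linarith
 have dvn: "dv i < n" if "i < 2 * m" "?G i" for i
 proof -
  have "i mod 2 = 0 \<or> i mod 2 = 1" by linarith
  then show ?thesis using that eK[of "i div 2"] by (auto simp: dv_def)
 qed
 have thr: "gev ?gs (setv u 14 i) = ?G i"
  "ival ?v (setv u 14 i) = L (dv i)"
  "rval (ewE K ?e) (setv u 14 i) = ew (i div 2)"
  "!!l. l \<in> grd (?gs @ xs) ac (setv u 14 i) ==> l = ICell (adr G 0 (i div 2)) \<or> NI (i div 2) < n & (l = ICell (adr G 1 (i div 2 div K)) \<or> l =
   ICell (adr G 1 (NI (i div 2))) \<or> ?G i & l \<in> grd xs ac (setv u 14 i))"
  "ird ?v (setv u 14 i) = {ICell (adr G 0 (i div 2)), ICell (adr G 1 (dv i))}"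
  if i: "i < 2 * m" and u: "same {} {3} {2} s u" for i u xs ac
 proof -
  have bu: "base u" by (rule base_same[OF b u]) auto
  have Lu: "imem u (adr G (Suc 0) v) = L v" for v
   using same_AI[OF u, of 1 v] same_Q[OF u] baseD(2)[OF b] L[of v] by simp
  note D = baseD[OF bu]
  let ?S = "(setv u 14 i)"
  have g: "gev [?b [<] Var 0] ?S \<longleftrightarrow> NI (i div 2) < n" "gev [inot (IA 1 ?a [=] IA 1 ?b)] ?S \<longleftrightarrow> L (i div 2 div K) \<noteq> L (NI (i div 2))"
   by (auto simp: D Lu Suc_le_eq)
  then show g1: "gev ?gs ?S = ?G i" by simp
  show v: "ival ?v ?S = L (dv i)" by (simp add: D Lu dv_def)
  show "rval (ewE K ?e) ?S = ew (i div 2)" by (simp add: D)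
  show "ird ?v ?S = {ICell (adr G 0 (i div 2)), ICell (adr G 1 (dv i))}" by (auto simp: D dv_def)
  fix l assume l: "l \<in> grd (?gs @ xs) ac ?S"
  have i1: "ird (?b [<] Var 0) ?S = {ICell (adr G 0 (i div 2))}" by (simp add: D)
  have i2: "ird (inot (IA 1 ?a [=] IA 1 ?b)) ?S = {ICell (adr G 0 (i div 2)), ICell (adr G 1 (i div 2 div K)), ICell (adr G 1 (NI (i div 2)))}"
   by (auto simp: D)
  from l g show "l = ICell (adr G 0 (i div 2)) \<or> NI (i div 2) < n & (l = ICell (adr G 1 (i div 2 div K)) \<or> l = ICell (adr G 1 (NI (i div
   2))) \<or> ?G i & l \<in> grd xs ac ?S)"
   unfolding append.simps grd.simps gev.simps i1 i2 by (auto split: if_splits)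
 qed
 have D0: "ireg s 0 = n" "ireg s 2 = G" "rreg s 0 = BIG" using baseD[OF b] by auto
 have half: "i < 2 * m ==> i div 2 < m" for i by linarith
 have inZ: "i div 2 < Z" "i div 2 div K < Z" "NI (i div 2) < Z" if "i < 2 * m" for i
  using half[OF that] eK[OF half[OF that]] NIn[OF half[OF that]] by (auto intro: ltZ simp: less_imp_le)
 have dvZ: "dv i < Z" "L (dv i) < Z" if "i < 2 * m" "?G i" for i
  using dvn[OF that] Ln[OF dvn[OF that]] by (auto intro: ltZ simp: less_imp_le)
 show ?thesis
  unfolding MINB_def Let_def
 proof (rule ok_seq, rule pf_RA[where z = Z and m = n and G = "\<lambda>i. True" and ad = "\<lambda>i. i" and vl = "\<lambda>i. BIG"])
  fix t1 assume t1: "same {} {} {2} s t1" "!!i. i < n ==> True ==> AR t1 2 i = BIG" "ireg t1 = ireg s" "imem t1 = imem s"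
  have g1: "ireg t1 0 = n" "ireg t1 2 = G" using D0 by (simp_all add: t1(3))
  show "ok \<beta> (Pf 14 (Var 0) [] (IS (Adr (Var 2) 3 (Var 14)) ?mm) ;; Pf 14 (Num 2 [*] ?mm) ?gs ?P2 ;; ?P3) t1 Xa Da Rd Wr PP"
  proof (rule ok_seq, rule pf_IA[where z = Z and m = n and G = "\<lambda>i. True" and ad = "\<lambda>i. i" and vl = "\<lambda>i. m"])
   fix t2 assume t2: "same {} {3} {} t1 t2" "!!i. i < n ==> True ==> AI t2 3 i = m" "ireg t2 = ireg t1"
   have g2: "ireg t2 0 = n" "ireg t2 2 = G" using g1 by (simp_all add: t2(3))
   have s2: "same {} {3} {2} s t2" by (rule same_trans[OF t1(1) t2(1)]) auto
   show "ok \<beta> (Pf 14 (Num 2 [*] ?mm) ?gs ?P2 ;; ?P3) t2 Xa Da Rd Wr PP"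
   proof (rule ok_seq, rule pf_RMA[where z = Z and m = "2 * m" and G = ?G and ad = "\<lambda>i. L (dv i)" and vl = "\<lambda>i. ew (i div 2)"])
    fix i assume i: "i < 2 * m"
    note th = thr[OF i s2]
    show "gev ?gs (setv t2 14 i) = ?G i" by (rule th(1))
    show "ival ?v (setv t2 14 i) = L (dv i)" by (rule th(2))
    show "rval (ewE K ?e) (setv t2 14 i) = ew (i div 2)" by (rule th(3))
    have gl: "l \<in> ICell ` {adr G 0 (i div 2), adr G 1 (i div 2 div K), adr G 1 (NI (i div 2))} \<or> ?G i & l \<in> {ICell (adr G 1 (dv i)),
     RCell (adr G 0 (i div 2 div K)), RCell (adr G 1 (i div 2))}"
     if "l \<in> grd ?gs ?P2 (setv t2 14 i)" for l
    proof -
     have "ard ?P2 (setv t2 14 i) = ird ?v (setv t2 14 i) \<union> rrd (ewE K ?e) (setv t2 14 i)" by simp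
     also have "\<dots> = {ICell (adr G 0 (i div 2)), ICell (adr G 1 (dv i)), RCell (adr G 0 (i div 2 div K)), RCell (adr G 1 (i div 2))}"
      unfolding th(5) rrd_ewE by (auto simp: g2)
     finally show ?thesis using th(4)[of l "[]", unfolded append.simps, OF that] unfolding grd.simps by auto
    qed
    show "l \<in> Rd \<union> Wr" if "l \<in> grd ?gs ?P2 (setv t2 14 i)" for l
     using gl[OF that] inZ[OF i] dvZ[OF i] by auto
    show "i = j'" if "RCell (adr (ireg t2 2) 2 (L (dv j'))) \<in> grd ?gs ?P2 (setv t2 14 i)" for j'
     using gl[OF that] by (auto simp: g2)
    show "?G i ==> L (dv i) < Z" using dvZ[OF i] by simp
   next
    fix t3 assume t3: "same {} {} {2} t2 t3" "!!j. AR t3 2 j = Min (insert (AR t2 2 j) ((\<lambda>i. ew (i div 2)) ` {i. i < 2 * m & ?G i & L (dv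
     i) = j}))" "ireg t3 = ireg t2" "imem t3 = imem t2"
    have s3: "same {} {3} {2} s t3" by (rule same_trans[OF s2 t3(1)]) auto
    have g3: "ireg t3 0 = n" "ireg t3 2 = G" using g2 by (simp_all add: t3(3))
    have BW: "AR t3 2 c = Min (insert BIG (ew ` B.outs L c))" if "c < n" for c
     unfolding t3(2) dart_outs[of ew L "\<lambda>e c. True" c] using t1(2)[OF that] same_AR[OF t2(1), of 2] by simp
    have BE3: "AI t3 3 c = m" if "c < n" for c using t2(2)[OF that] by (simp add: t3(3,4))
    let ?H = "\<lambda>i. NI (i div 2) < n & L (i div 2 div K) \<noteq> L (NI (i div 2)) & ew (i div 2) \<le> AR t3 2 (L (dv i))"
    show "ok \<beta> ?P3 t3 Xa Da Rd Wr PP"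
    proof (rule pf_IMA[where z = Z and m = "2 * m" and G = ?H and ad = "\<lambda>i. L (dv i)" and vl = "\<lambda>i. i div 2"])
     fix i assume i: "i < 2 * m"
     note th = thr[OF i s3]
     let ?S = "(setv t3 14 i)"
     have gx: "gev [?b [<] Var 0, inot (IA 1 ?a [=] IA 1 ?b), x] ?S \<longleftrightarrow> ?G i & ival x ?S \<noteq> 0" for x
      using th(1) unfolding gev.simps by blast
     have rv: "rval (RA 2 ?v) ?S = AR t3 2 (ival ?v ?S)" by simp
     have "ival (RLeq (ewE K ?e) (RA 2 ?v)) ?S = of_bool (ew (i div 2) \<le> AR t3 2 (L (dv i)))"
      unfolding ival.simps(6) th(3) rv[unfolded th(2)] ..
     then show "gev ?P1 ?S = ?H i"
      unfolding gx by simp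
     show "ival ?v ?S = L (dv i)" by (rule th(2))
     have gl: "l \<in> ICell ` {adr G 0 (i div 2), adr G 1 (i div 2 div K), adr G 1 (NI (i div 2))} \<or> ?G i & l \<in> {ICell (adr G 1 (dv i)),
      RCell (adr G 0 (i div 2 div K)), RCell (adr G 1 (i div 2)), RCell (adr G 2 (L (dv i)))}"
      if "l \<in> grd ?P1 (IM (Adr (Var 2) 3 ?v) ?e) ?S" for l
     proof -
      have "ird (RLeq (ewE K ?e) (RA 2 ?v)) ?S = rrd (ewE K ?e) ?S \<union> insert (RCell (adr (ireg t3 2) 2 (ival ?v ?S))) (ird ?v ?S)"
       by simp
      also have "\<dots> = {ICell (adr G 0 (i div 2)), ICell (adr G 1 (dv i)), RCell (adr G 0 (i div 2 div K)), RCell (adr G 1 (i div 2)),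
       RCell (adr G 2 (L (dv i)))}"
       unfolding th(2,5) rrd_ewE by (auto simp: g3)
      finally have e1: "ird (RLeq (ewE K ?e) (RA 2 ?v)) ?S = \<dots>" .
      have "ard (IM (Adr (Var 2) 3 ?v) ?e) ?S = ird ?v ?S" by simp
      note e2 = this[unfolded th(5)]
      show ?thesis using th(4)[of l "[RLeq (ewE K ?e) (RA 2 ?v)]", unfolded append.simps, OF that]
       unfolding grd.simps e1 e2 by (auto split: if_splits)
     qed
     show "l \<in> Rd \<union> Wr" if "l \<in> grd ?P1 (IM (Adr (Var 2) 3 ?v) ?e) ?S" for l
      using gl[OF that] inZ[OF i] dvZ[OF i] by auto
     show "i = j'" if "ICell (adr (ireg t3 2) 3 (L (dv j'))) \<in> grd ?P1 (IM (Adr (Var 2) 3 ?v) ?e) ?S" for j'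
      using gl[OF that] by (auto simp: g3)
     show "?H i ==> L (dv i) < Z" using dvZ[OF i] by simp
    next
     fix t assume t: "same {} {3} {} t3 t" "!!j. AI t 3 j = Min (insert (AI t3 3 j) ((\<lambda>i. i div 2) ` {i. i < 2 * m & ?H i & L (dv i) = j}))"
     have st: "same {} {3} {2} s t" by (rule same_trans[OF s3 t(1)]) auto
     have BE: "AI t 3 c = Min (insert m {e \<in> B.outs L c. ew e \<le> AR t3 2 c})" if "c < n" for c
     proof -
      have "{i. i < 2 * m & ?H i & L (dv i) = c} = {i. i < 2 * m & (NI (i div 2) < n & L (i div 2 div K) \<noteq> L (NI (i div 2)) & ew (i
       div 2) \<le> AR t3 2 c) & L (dv i) = c}" by auto
      then show ?thesis unfolding t(2) using dart_outs[of "\<lambda>x. x" L "\<lambda>e c. ew e \<le> AR t3 2 c" c] BE3[OF that] by simp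
     qed
     show "PP t" by (rule post[OF st]) (use min_edge[OF BW BE] in blast)+
    qed (use X bb G_region in \<open>simp_all add: g3 m_def\<close>)
   qed (use X bb G_region in \<open>simp_all add: g2 m_def\<close>)
  qed (use X' X bb G_region ltZ in \<open>simp_all add: g1 m_def\<close>)
 qed (use X' X bb G_region ltZ in \<open>simp_all add: D0\<close>)
qed

end

section \<open>Hooking, pointer jumping and the rounds\<close>

context bor begin

lemma same_at: "same R C C' s t ==> ireg s 2 = G ==> c < 16 ==> c \<notin> C ==> imem t (adr G c i) = imem s (adr G c i)"
 by (auto simp: same_def)

lemma LINK_ok:
 fixes Xa Da :: nat
 assumes b: "base s" and L: "!!v. imem s (adr G (Suc 0) v) = L v" and Ln: "!!v. v < n ==> L v < n"
  and BE: "!!c. imem s (adr G 3 c) = BE c" and sl: "!!c. imem s (adr G 2 c) = sl c"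
  and BEo: "!!c. c < n ==> BE c = m \<or> BE c \<in> B.outs L c"
  and X: "1 + n \<le> Xa" "1 \<le> Da"
  and post: "!!t PR. same {} {2, 4, 5} {} s t ==>
   (!!c. c < n ==> PR c = (if BE c < m then L (BE c div K) + L (NI (BE c)) - c else c)) ==>
   (!!c. c < n ==> AI t 5 c = (if PR (PR c) = c & c < PR c then c else PR c)) ==> (!!c. c < n ==> AI t 5 c < n) ==>
   (!!c. c < n ==> AI t 2 c = (if AI t 5 c \<noteq> c then BE c else sl c)) ==> PP t"
 shows "ok \<beta> (LINK K) s Xa Da Rd Wr PP"
proof -
 note D0 = baseD[OF b]
 define PR where "PR c = (if BE c < m then L (BE c div K) + L (NI (BE c)) - c else c)" for c
 define P2 where "P2 c = (if PR (PR c) = c & c < PR c then c else PR c)" for c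
 \<comment> \<open>The edge number actually used for addressing, 0 if no edge leaves
   \<open>c\<close>; it is always a proper edge index.\<close>
 define F where "F c = BE c * of_bool (Suc (BE c) \<le> n * K)" for c
 have Fm: "F c < m" "F c div K < n" "NI (F c) \<le> n" for c
 proof -
  show "F c < m" using nZ by (simp add: F_def m_def)
  then show "F c div K < n" "NI (F c) \<le> n" using eK NIn by blast+
 qed
 have PRn: "PR c < n" if c: "c < n" for c
 proof (cases "BE c < m")
  case True
  then have "BE c \<in> B.outs L c" using BEo[OF c] by auto
  then have "NI (BE c) < n" "L (BE c div K) = c \<or> L (NI (BE c)) = c" by (auto simp: B.outs_def)
  then show ?thesis using True Ln[OF eK[OF True]] Ln[of "NI (BE c)"] by (auto simp: PR_def)
 qed (use c in \<open>simp add: PR_def\<close>)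
 have P2n: "P2 c < n" if "c < n" for c using PRn[OF that] that by (simp add: P2_def)
 let ?c = "Var 14" and ?b = "(IA 3 (Var 14) [<] Var 0 [*] Num K)"
 let ?f = "IA 3 ?c [*] ?b" and ?t = "(IA 4 (IA 4 ?c) [=] ?c) [*] (?c [<] IA 4 ?c)"
 let ?P1 = "?b [*] (IA 1 (?f [/] Num K) [+] IA 1 (IA 0 ?f) [-] ?c) [+] inot ?b [*] ?c"
 let ?P2 = "IS (Adr (Var 2) 5 ?c) (?t [*] ?c [+] inot ?t [*] IA 4 ?c)"
 let ?P3 = "Pf 14 (Var 0) [inot (IA 5 ?c [=] ?c)] (IS (Adr (Var 2) 2 ?c) (IA 3 ?c))"
 have Z1: "i < n ==> i < Z" for i using ltZ[of i] by simp
 show ?thesis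
  unfolding LINK_def Let_def
 proof (rule ok_seq, rule pf_IA[where z = Z and m = n and G = "\<lambda>i. True" and ad = "\<lambda>i. i" and vl = PR])
  fix i assume i: "i < n"
  let ?S = "(setv s 14 i)"
  have b: "ival ?b ?S = of_bool (BE i < m)" by (auto simp: D0 BE m_def Suc_le_eq)
  have "ival ?P1 ?S = ival ?b ?S * (L (BE i * ival ?b ?S div K) + L (NI (BE i * ival ?b ?S)) - i) + (1 - ival ?b ?S) * i"
   by (simp add: D0 BE L)
  then show "ival ?P1 ?S = PR i"
   unfolding b PR_def by simp
  have gl: "l \<in> ICell ` {adr G 3 i, adr G 1 (F i div K), adr G 1 (NI (F i)), adr G 0 (F i)}"
   if "l \<in> grd [] (IS (Adr (Var 2) 4 ?c) ?P1) ?S" for l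
   using that by (auto simp: D0 BE F_def)
  show "l \<in> Rd \<union> Wr" if "l \<in> grd [] (IS (Adr (Var 2) 4 ?c) ?P1) ?S" for l
   using gl[OF that] Z1[OF i] ltZ(1)[OF Fm(3)] Z1[OF Fm(2)] ltZ(2)[OF less_imp_le[OF Fm(1)]] by auto
  show "i = j" if "ICell (adr (ireg s 2) 4 j) \<in> grd [] (IS (Adr (Var 2) 4 ?c) ?P1) ?S" for j
   using gl[OF that] by (auto simp: D0)
  show "PR i \<le> \<beta>" using PRn[OF i] bb(5) by linarith
 next
  fix t1 assume t1: "same {} {4} {} s t1" "!!i. i < n ==> True ==> AI t1 4 i = PR i"
  note E1 = baseD[OF base_same[OF \<open>base s\<close> t1(1)], simplified]
  have A1: "!!i. i < n ==> imem t1 (adr G 4 i) = PR i" "imem t1 (adr G 3 i) = BE i" "imem t1 (adr G 2 i) = sl i" for i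
   using t1(2) same_at[OF t1(1) D0(2), of 3 i] same_at[OF t1(1) D0(2), of 2 i] BE sl by (simp_all add: E1)
  show "ok \<beta> (Pf 14 (Var 0) [] ?P2 ;; ?P3) t1 Xa Da Rd Wr PP"
  proof (rule ok_seq, rule pf_IA[where z = Z and m = n and G = "\<lambda>i. True" and ad = "\<lambda>i. i" and vl = P2])
   fix i assume i: "i < n"
   let ?S = "(setv t1 14 i)"
   have b: "ival ?t ?S = of_bool (PR (PR i) = i & i < PR i)" by (auto simp: E1 A1 i PRn Suc_le_eq)
   have "ival (?t [*] ?c [+] inot ?t [*] IA 4 ?c) ?S = ival ?t ?S * i + (1 - ival ?t ?S) * PR i" by (simp add: E1 A1 i)
   then show "ival (?t [*] ?c [+] inot ?t [*] IA 4 ?c) ?S = P2 i" unfolding b P2_def by simp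
   have gl: "l \<in> ICell ` {adr G 4 i, adr G 4 (PR i)}"
    if "l \<in> grd [] ?P2 ?S" for l
    using that by (auto simp: E1 A1 i)
   show "l \<in> Rd \<union> Wr" if "l \<in> grd [] ?P2 ?S" for l
    using gl[OF that] Z1[OF i] Z1[OF PRn[OF i]] by auto
   show "i = j" if "ICell (adr (ireg t1 2) 5 j) \<in> grd [] ?P2 ?S" for j
    using gl[OF that] by (auto simp: E1)
   show "P2 i \<le> \<beta>" using P2n[OF i] bb(5) by linarith
  next
   fix t2 assume t2: "same {} {5} {} t1 t2" "!!i. i < n ==> True ==> AI t2 5 i = P2 i"
   have s2: "same {} {2, 4, 5} {} s t2" by (rule same_trans[OF t1(1) t2(1)]) auto
   note E2 = baseD[OF base_same[OF \<open>base s\<close> s2], simplified]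
   have A2: "!!i. i < n ==> imem t2 (adr G 5 i) = P2 i" "imem t2 (adr G 3 i) = BE i" "imem t2 (adr G 2 i) = sl i" for i
    using t2(2) same_at[OF t2(1) E1(2), of 3 i] same_at[OF t2(1) E1(2), of 2 i] A1 by (simp_all add: E2)
   show "ok \<beta> ?P3 t2 Xa Da Rd Wr PP"
   proof (rule pf_IA[where z = Z and m = n and G = "\<lambda>i. P2 i \<noteq> i" and ad = "\<lambda>i. i" and vl = BE])
    fix t assume t: "same {} {2} {} t2 t" "!!i. i < n ==> P2 i \<noteq> i ==> AI t 2 i = BE i"
     "!!j. (!!i. i < n ==> P2 i \<noteq> i ==> i \<noteq> j) ==> AI t 2 j = AI t2 2 j"
    have st: "same {} {2, 4, 5} {} s t" by (rule same_trans[OF s2 t(1)]) auto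
    have Et: "ireg t 2 = G" using same_Q[OF st] D0 by simp
    have P: "AI t 5 c = P2 c" if "c < n" for c using same_at[OF t(1) E2(2), of 5 c] A2(1)[OF that] by (simp add: Et)
    show "PP t"
    proof (rule post[OF st, of PR])
     fix c assume c: "c < n"
     show "AI t 5 c < n" using P[OF c] P2n[OF c] by simp
     show "AI t 5 c = (if PR (PR c) = c & c < PR c then c else PR c)" using P[OF c] unfolding P2_def .
     show "AI t 2 c = (if AI t 5 c \<noteq> c then BE c else sl c)"
     proof (cases "P2 c = c")
      case True
      have "AI t 2 c = AI t2 2 c" by (rule t(3)) (use True in auto)
      then show ?thesis using True P[OF c] A2(3)[of c] by (simp add: E2)
     next
      case False
      then show ?thesis using t(2)[OF c] P[OF c] by simp
     qed
    qed (simp add: PR_def)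
   next
    show "bnd \<beta> t2 ==> BE i \<le> \<beta>" for i using A2(2)[of i] unfolding bnd_def by metis
   qed (use X bb G_region Z1 in \<open>auto simp: E2 A2 split: if_splits\<close>)
  qed (use X bb G_region Z1 in \<open>simp_all add: E1\<close>)
 qed (use X bb G_region Z1 in \<open>simp_all add: D0\<close>)
qed

definition lgm :: nat where "lgm = lg + K + 2"

lemma lgm: "m + 2 \<le> 2 ^ lgm"
proof -
 have "n * K \<le> 2 ^ lg * K" "2 \<le> 2 ^ lg * (2::nat)" using lg by auto
 then have "m + 2 \<le> 2 ^ lg * (K + 2)" unfolding m_def add_mult_distrib2 by linarith
 also have "\<dots> \<le> 2 ^ lg * 2 ^ (K + 2)" by (intro mult_le_mono2 less_imp_le less_exp)
 finally show ?thesis by (simp add: lgm_def power_add)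
qed

lemma JUMP_ok:
 fixes Xa Da :: nat
 assumes b: "base s" and f: "!!c. c < n ==> AI s 5 c = f c" "!!c. c < n ==> f c < n"
  and X: "(lgm + 2) * (1 + n) \<le> Xa" "lgm + 2 \<le> Da"
  and post: "!!t N. same {8} {5, 6} {} s t ==> m + 2 \<le> N ==> (!!c. c < n ==> AI t 5 c = (f ^^ N) c) ==> PP t"
 shows "ok \<beta> (JUMP K) s Xa Da Rd Wr PP"
proof -
 let ?P1 = "IS (Adr (Var 2) 6 (Var 14)) (IA 5 (IA 5 (Var 14)))"
 let ?P2 = "Pf 14 (Var 0) [] (IS (Adr (Var 2) 5 (Var 14)) (IA 6 (Var 14))) ;; Asg 8 (Num 2 [*] Var 8)"
 let ?P3 = "Var 8 [<] Var 0 [*] Num K [+] Num 2"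
 note D0 = baseD[OF b]
 define I where "I i u \<longleftrightarrow> same {8} {5, 6} {} s u & ireg u 8 = 2 ^ i & i \<le> lgm & (\<forall>c<n. AI u 5 c = (f ^^ (2 ^ i)) c)" for i u
 have fn: "c < n ==> (f ^^ j) c < n" for j c by (induction j) (use f(2) in auto)
 have Z1: "i < n ==> i < Z" for i using ltZ[of i] by simp
 have X1: "1 \<le> Xa" "1 \<le> Da" using X by simp_all
 show ?thesis
  unfolding JUMP_def
 proof (rule ok_seq, rule asg_same)
  fix t1 assume t1: "same {8} {} {} s t1" "ireg t1 = (ireg s)(8 := ival (Num 1) s)" "imem t1 = imem s"
  show "ok \<beta> (Whl ?P3 (Pf 14 (Var 0) [] ?P1 ;; ?P2)) t1 Xa Da Rd Wr PP"
  proof (rule ok_while[where I = I and g = 0 and \<Phi> = "\<lambda>i. (lgm - i) * (1 + n) + 1" and \<Delta> = "\<lambda>i. lgm - i + 1"])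
   have "same {8} {5, 6} {} s t1" by (rule same_mono[OF t1(1)]) auto
   then show "I 0 t1" using f(1) by (simp add: I_def t1)
  next
   fix i u assume "I i u" and "ival ?P3 u \<noteq> 0"
   then have su: "same {8} {5, 6} {} s u" and u8: "ireg u 8 = 2 ^ i" and il: "i \<le> lgm"
    and F: "!!c. c < n ==> AI u 5 c = (f ^^ (2 ^ i)) c" and nz: "ival ?P3 u \<noteq> 0"
    by (auto simp: I_def)
   have bu: "base u" by (rule base_same[OF b su]) auto
   note E = baseD[OF bu]
   have lt: "2 ^ i < m + 2" using nz by (simp add: u8 E m_def split: if_splits)
   then have "(2::nat) ^ i < 2 ^ lgm" using lgm by linarith
   then have il: "i < lgm" by simp
   have Fu: "imem u (adr G 5 c) = (f ^^ (2 ^ i)) c" if "c < n" for c using F[OF that] by (simp add: E)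
   show "\<exists>X1 D1. 1 \<le> X1 & 1 \<le> D1 & ok \<beta> (Pf 14 (Var 0) [] ?P1 ;; ?P2) u X1 D1 Rd Wr (\<lambda>t. \<exists>g'. I g' t & (lgm - g') * (1 + n) + 1 + X1 \<le>
    (lgm - i) * (1 + n) + 1 & lgm - g' + 1 + D1 \<le> lgm - i + 1)"
   proof (rule exI[of _ "1 + n"], rule exI[of _ 1], intro conjI, simp, simp, rule ok_seq,
     rule pf_IA[where z = Z and m = n and G = "\<lambda>i. True" and ad = "\<lambda>i. i" and vl = "\<lambda>c. (f ^^ (2 ^ Suc i)) c"])
    fix c assume c: "c < n"
    let ?S = "(setv u 14 c)"
    have "(f ^^ (2 ^ i)) ((f ^^ (2 ^ i)) c) = (f ^^ (2 ^ Suc i)) c"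
     using funpow_add[of "2 ^ i" "2 ^ i" f] by (simp add: mult_2)
    then show "ival (IA 5 (IA 5 (Var 14))) ?S = (f ^^ (2 ^ Suc i)) c" using c fn[OF c] by (simp add: E Fu)
    have gl: "l \<in> ICell ` {adr G 5 c, adr G 5 ((f ^^ (2 ^ i)) c)}"
     if "l \<in> grd [] ?P1 ?S" for l
     using that by (auto simp: E Fu[OF c])
    show "l \<in> Rd \<union> Wr" if "l \<in> grd [] ?P1 ?S" for l
     using gl[OF that] Z1[OF c] Z1[OF fn[OF c]] by auto
    show "c = j" if "ICell (adr (ireg u 2) 6 j) \<in> grd [] ?P1 ?S" for j
     using gl[OF that] by (auto simp: E)
    show "(f ^^ (2 ^ Suc i)) c \<le> \<beta>" using fn[OF c, of "2 ^ Suc i"] bb(5) by linarith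
   next
    fix t2 assume t2: "same {} {6} {} u t2" "!!c. c < n ==> True ==> AI t2 6 c = (f ^^ (2 ^ Suc i)) c"
    note E2 = baseD[OF base_same[OF bu t2(1)], simplified]
    have F2: "imem t2 (adr G 6 c) = (f ^^ (2 ^ Suc i)) c" if "c < n" for c using t2(2)[OF that] by (simp add: E2)
    show "ok \<beta> ?P2 t2 (1 + n) 1 Rd Wr (\<lambda>t. \<exists>g'. I g' t & (lgm - g') * (1 + n) + 1 + (1 + n) \<le> (lgm - i) * (1 + n) + 1 & lgm - g' + 1 + 1
     \<le> lgm - i + 1)"
    proof (rule ok_seq, rule pf_IA[where z = Z and m = n and G = "\<lambda>i. True" and ad = "\<lambda>i. i" and vl = "\<lambda>c. (f ^^ (2 ^ Suc i)) c"])
     fix t3 assume t3: "same {} {5} {} t2 t3" "!!c. c < n ==> True ==> AI t3 5 c = (f ^^ (2 ^ Suc i)) c" "ireg t3 = ireg t2"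
     have a2: "same {8} {5, 6} {} s t2" by (rule same_trans[OF su t2(1)]) auto
     have a3: "same {8} {5, 6} {} s t3" by (rule same_trans[OF a2 t3(1)]) auto
     have r8: "ireg t3 8 = 2 ^ i" using same_reg[OF t2(1), of 8] by (simp add: t3(3) u8)
     show "ok \<beta> (Asg 8 (Num 2 [*] Var 8)) t3 (1 + n) 1 Rd Wr (\<lambda>t. \<exists>g'. I g' t & (lgm - g') * (1 + n) + 1 + (1 + n) \<le> (lgm - i) * (1 +
      n) + 1 & lgm - g' + 1 + 1 \<le> lgm - i + 1)"
     proof (rule asg_same)
      fix t assume t: "same {8} {} {} t3 t" "ireg t = (ireg t3)(8 := ival (Num 2 [*] Var 8) t3)" "imem t = imem t3"
      have "same {8} {5, 6} {} s t" by (rule same_trans[OF a3 t(1)]) auto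
      moreover have "AI t 5 c = (f ^^ (2 ^ Suc i)) c" if "c < n" for c using t3(2)[OF that] by (simp add: t)
      ultimately have "I (Suc i) t" using il unfolding I_def by (simp add: t r8)
      moreover have "lgm - i = Suc (lgm - Suc i)" using il by simp
      ultimately show "\<exists>g'. I g' t & (lgm - g') * (1 + n) + 1 + (1 + n) \<le> (lgm - i) * (1 + n) + 1 & lgm - g' + 1 + 1 \<le> lgm - i + 1"
       by (intro exI[of _ "Suc i"]) simp
     next
      show "ival (Num 2 [*] Var 8) t3 \<le> \<beta>" using lt bb(6) by (simp add: r8)
     qed (simp_all add: r8)
    next
     show "(f ^^ (2 ^ Suc i)) c \<le> \<beta>" if "c < n" for c using fn[OF that, of "2 ^ Suc i"] bb(5) by linarith
    qed (use bb G_region Z1 in \<open>simp_all add: E2 F2\<close>)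
   qed (use bb G_region Z1 in \<open>simp_all add: E\<close>)
  next
   fix i u assume I: "I i u" and z: "ival ?P3 u = 0"
   then have su: "same {8} {5, 6} {} s u" and u8: "ireg u 8 = 2 ^ i" by (auto simp: I_def)
   have "ireg u 0 = n" using same_reg[OF su, of 0] D0 by simp
   then have "m + 2 \<le> 2 ^ i" using z by (simp add: u8 m_def split: if_splits)
   then show "PP u" using I by (intro post[of u "2 ^ i"]) (auto simp: I_def)
  next
   show "(lgm - 0) * (1 + n) + 1 \<le> Xa" "lgm - 0 + 1 \<le> Da" using X by simp_all
  qed auto
 qed (use X1 bb nZ in auto)
qed

definition Xr :: nat where "Xr = 2 + 2 * m + (lgm + 2) * (1 + n)"

lemma ROUND_ok:
 assumes b: "base s" and inv: "B.bor_inv (AI s 1) (AI s 2)" and s9: "ireg s 9 \<le> n"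
  and post: "!!t. base t ==> B.bor_inv (AI t 1) (AI t 2) ==>
   card (B.roots (AI t 1)) \<le> 1 \<or> 2 * card (B.roots (AI t 1)) \<le> card (B.roots (AI s 1)) ==> ireg t 9 = 2 * ireg s 9 ==> PP t"
 shows "ok \<beta> (ROUND K) s Xr (lgm + 2) Rd Wr PP"
proof -
 let ?P1 = "IS (Adr (Var 2) 1 (Var 14)) (IA 5 (IA 1 (Var 14)))"
 let ?P2 = "Pf 14 (Var 0) [] ?P1 ;; Asg 9 (Num 2 [*] Var 9)"
 note D0 = baseD[OF b]
 define L where "L = AI s 1"
 define sl where "sl = AI s 2"
 have Ls: "imem s (adr G (Suc 0) v) = L v" "imem s (adr G 2 v) = sl v" for v by (simp_all add: L_def sl_def D0)
 have Ln: "v < n ==> L v < n" for v using inv unfolding B.bor_inv_def L_def by blast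
 have Z1: "i < n ==> i < Z" for i using ltZ[of i] by simp
 have Xs: "1 + 2 * m \<le> Xr" "1 + n \<le> Xr" "(lgm + 2) * (1 + n) \<le> Xr" "1 \<le> Xr" unfolding Xr_def by simp_all
 show ?thesis
  unfolding ROUND_def
 proof (rule ok_seq, rule MINB_ok[OF b Ls(1) Ln])
  fix t1 assume t1: "same {} {3} {2} s t1" "!!c. c < n ==> B.outs L c = {} ==> AI t1 3 c = m"
   "!!c. c < n ==> B.outs L c \<noteq> {} ==> AI t1 3 c \<in> B.outs L c & (\<forall>e\<in>B.outs L c. B.rk (AI t1 3 c) \<le> B.rk e)"
  have b1: "base t1" by (rule base_same[OF b t1(1)]) auto
  note E1 = baseD[OF b1]
  define BE where "BE = AI t1 3"
  have A1: "imem t1 (adr G (Suc 0) v) = L v" "imem t1 (adr G 3 v) = BE v" "imem t1 (adr G 2 v) = sl v" for v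
   using same_at[OF t1(1) D0(2), of 1 v] same_at[OF t1(1) D0(2), of 2 v] Ls by (simp_all add: BE_def E1)
  have BEo: "BE c = m \<or> BE c \<in> B.outs L c" if "c < n" for c using t1(2,3)[OF that] unfolding BE_def by blast
  show "ok \<beta> (LINK K ;; JUMP K ;; ?P2) t1 Xr (lgm + 2) Rd Wr PP"
  proof (rule ok_seq, rule LINK_ok[OF b1 A1(1) Ln A1(2,3) BEo])
   fix t2 PR assume t2: "same {} {2, 4, 5} {} t1 t2" and PR: "!!c. c < n ==> PR c = (if BE c < m then L (BE c div K) + L (NI (BE c)) - c else c)"
    and P2: "!!c. c < n ==> AI t2 5 c = (if PR (PR c) = c & c < PR c then c else PR c)" "!!c. c < n ==> AI t2 5 c < n"
    and sl2: "!!c. c < n ==> AI t2 2 c = (if AI t2 5 c \<noteq> c then BE c else sl c)"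
   have b2: "base t2" by (rule base_same[OF b1 t2]) auto
   note E2 = baseD[OF b2]
   define Q where "Q = AI t2 5"
   define sl' where "sl' = AI t2 2"
   note Qr = Q_def[symmetric]
   show "ok \<beta> (JUMP K ;; ?P2) t2 Xr (lgm + 2) Rd Wr PP"
   proof (rule ok_seq, rule JUMP_ok[OF b2, of Q])
    show "AI t2 5 c = Q c" for c by (simp add: Q_def)
    show Qn: "c < n ==> Q c < n" for c using P2(2) by (simp add: Q_def)
    fix t3 N assume t3: "same {8} {5, 6} {} t2 t3" and N: "m + 2 \<le> N" and J: "!!c. c < n ==> AI t3 5 c = (Q ^^ N) c"
    have b3: "base t3" by (rule base_same[OF b2 t3]) auto
    note E3 = baseD[OF b3]
    define L' where "L' v = (Q ^^ N) (L v)" for v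
    have fn: "c < n ==> (Q ^^ j) c < n" for j c by (induction j) (use Qn in auto)
    have A3: "imem t3 (adr G (Suc 0) v) = L v" "imem t3 (adr G 2 v) = sl' v" for v
     using same_at[OF t3 E2(2), of 1 v] same_at[OF t2 E1(2), of 1 v] A1(1)[of v] same_at[OF t3 E2(2), of 2 v]
     by (simp_all add: sl'_def E2)
    have J3: "imem t3 (adr G 5 c) = (Q ^^ N) c" if "c < n" for c using J[OF that] by (simp add: E3)
    have f1: "B.bor_inv L sl" using inv unfolding L_def sl_def .
    have f2: "\<not> BE c < m" if "c < n" "B.outs L c = {}" for c using t1(2)[OF that] by (simp add: BE_def)
    have f3: "BE c \<in> B.outs L c & (\<forall>e\<in>B.outs L c. B.rk (BE c) \<le> B.rk e)" if "c < n" "B.outs L c \<noteq> {}" for c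
     using t1(3)[OF that] unfolding BE_def .
    have f4: "Q c = (if PR (PR c) = c & c < PR c then c else PR c)" if "c < n" for c using P2(1)[OF that] unfolding Q_def .
    have f5: "L' v = (Q ^^ N) (L v)" if "v < n" for v by (rule L'_def)
    have f6: "sl' c = (if Q c \<noteq> c then BE c else sl c)" if "c < n" for c using sl2[OF that] unfolding Q_def sl'_def .
    note stp = B.boruvka_step[OF f1 f2 f3 PR f4 N f5 f6]
    show "ok \<beta> ?P2 t3 Xr (lgm + 2) Rd Wr PP"
    proof (rule ok_seq, rule pf_IA[where z = Z and m = n and G = "\<lambda>i. True" and ad = "\<lambda>i. i" and vl = L'])
     fix v assume v: "v < n"
     let ?S = "(setv t3 14 v)"
     show "ival (IA 5 (IA 1 (Var 14))) ?S = L' v" using Ln[OF v] by (simp add: E3 A3 J3 L'_def)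
     have gl: "l \<in> ICell ` {adr G 1 v, adr G 5 (L v)}"
      if "l \<in> grd [] ?P1 ?S" for l
      using that by (auto simp: E3 A3)
     show "l \<in> Rd \<union> Wr" if "l \<in> grd [] ?P1 ?S" for l
      using gl[OF that] Z1[OF v] Z1[OF Ln[OF v]] by auto
     show "v = j" if "ICell (adr (ireg t3 2) 1 j) \<in> grd [] ?P1 ?S" for j
      using gl[OF that] by (auto simp: E3)
     show "L' v \<le> \<beta>" using fn[OF Ln[OF v], of N] bb(5) unfolding L'_def by linarith
    next
     fix t4 assume t4: "same {} {1} {} t3 t4" "!!v. v < n ==> True ==> AI t4 1 v = L' v"
     have b4: "base t4" by (rule base_same[OF b3 t4(1)]) auto
     note E4 = baseD[OF b4]
     have r9: "ireg t4 9 = ireg s 9"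
      using same_reg[OF t4(1), of 9] same_reg[OF t3, of 9] same_reg[OF t2, of 9] same_reg[OF t1(1), of 9] by simp
     show "ok \<beta> (Asg 9 (Num 2 [*] Var 9)) t4 Xr (lgm + 2) Rd Wr PP"
     proof (rule asg_same)
      fix t assume t: "same {9} {} {} t4 t" "ireg t = (ireg t4)(9 := ival (Num 2 [*] Var 9) t4)" "imem t = imem t4"
      have bt: "base t" by (rule base_same[OF b4 t(1)]) auto
      have l1: "AI t 1 v = L' v" if "v < n" for v using t4(2)[OF that] by (simp add: t)
      have l2: "AI t 2 v = sl' v" for v
       using same_at[OF t4(1) E3(2), of 2 v] A3(2)[of v] by (simp add: t E4)
      have n1: "L' v < n" if "v < n" for v using stp(1) that unfolding B.bor_inv_def by blast
      have ro: "B.roots (AI t 1) = B.roots L'" unfolding B.roots_def using l1 by auto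
      have "{c. c < n & AI t 1 c \<noteq> c} = {c. c < n & L' c \<noteq> c}" using l1 by auto
      then have "B.bor_inv (AI t 1) (AI t 2) = B.bor_inv L' sl'"
       unfolding B.bor_inv_def l2 by (simp only: l1 n1 cong: conj_cong) (use l1 n1 in \<open>auto simp: l2\<close>)
      then show "PP t" using stp ro by (intro post[OF bt]) (simp_all add: t r9 L_def)
     qed (use Xs s9 bb in \<open>simp_all add: r9\<close>)
    qed (use Xs bb G_region Z1 in \<open>simp_all add: E3\<close>)
   qed (use Xs in simp_all)
  qed (use Xs in simp_all)
 qed (use Xs in simp_all)
qed

lemma BOR_ok:
 assumes X: "lg * Xr + 1 + n \<le> X" "lg * (lgm + 2) + 1 \<le> D"
  and post: "!!t. base t ==> B.bor_inv (AI t 1) (AI t 2) ==> card (B.roots (AI t 1)) \<le> 1 ==> PP t"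
 shows "ok \<beta> (BOR K) s0 X D Rd Wr PP"
proof -
 have b0: "base s0" by (simp add: base_def)
 note D0 = baseD[OF b0]
 have X1: "1 \<le> X" "1 + n \<le> X" "1 \<le> D" using X by simp_all
 have Z1: "i < n ==> i < Z" for i using ltZ[of i] by simp
 \<comment> \<open>After \<open>r\<close> rounds there are at most \<open>n / 2 ^ r\<close>
   components unless only one is left; at \<open>2 ^ r \<ge> n\<close> both cases mean one.\<close>
 define I where "I r u \<longleftrightarrow> base u & B.bor_inv (AI u 1) (AI u 2) & ireg u 9 = 2 ^ r & (card (B.roots (AI u 1)) \<le> 1 \<or> 2 ^ r * card (B.roots (AI
  u 1)) \<le> n)" for r u
 show ?thesis
  unfolding BOR_def
 proof (rule ok_seq, rule pf_IA[where z = Z and m = n and G = "\<lambda>i. True" and ad = "\<lambda>i. i" and vl = "\<lambda>i. i"])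
  fix t1 assume t1: "same {} {1} {} s0 t1" "!!v. v < n ==> True ==> AI t1 1 v = v"
  have b1: "base t1" by (rule base_same[OF b0 t1(1)]) auto
  show "ok \<beta> (Asg 9 (Num 1) ;; Whl (Var 9 [<] Var 0) (ROUND K)) t1 X D Rd Wr PP"
  proof (rule ok_seq, rule asg_same)
   fix t2 assume t2: "same {9} {} {} t1 t2" "ireg t2 = (ireg t1)(9 := ival (Num 1) t1)" "imem t2 = imem t1"
   have b2: "base t2" by (rule base_same[OF b1 t2(1)]) auto
   have l2: "AI t2 1 v = v" if "v < n" for v using t1(2)[OF that] by (simp add: t2)
   have "B.roots (AI t2 1) \<subseteq> {..<n}" by (auto simp: B.roots_def)
   then have "card (B.roots (AI t2 1)) \<le> n" using card_mono[of "{..<n}"] by fastforce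
   moreover have "B.bor_inv (AI t2 1) (AI t2 2)" unfolding B.bor_inv_def using l2 by (simp add: conn_refl)
   ultimately have I0: "I 0 t2" using b2 by (simp add: I_def t2)
   show "ok \<beta> (Whl (Var 9 [<] Var 0) (ROUND K)) t2 X D Rd Wr PP"
   proof (rule ok_while[where I = I and g = 0 and \<Phi> = "\<lambda>r. (lg - r) * Xr + 1" and \<Delta> = "\<lambda>r. (lg - r) * (lgm + 2) + 1"])
    fix r u assume I: "I r u" and nz: "ival (Var 9 [<] Var 0) u \<noteq> 0"
    then have bu: "base u" and inv: "B.bor_inv (AI u 1) (AI u 2)" and u9: "ireg u 9 = 2 ^ r"
     and ca: "card (B.roots (AI u 1)) \<le> 1 \<or> 2 ^ r * card (B.roots (AI u 1)) \<le> n" by (simp_all add: I_def)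
    have lt: "2 ^ r < n" using nz baseD(1)[OF bu] by (simp add: u9 split: if_splits)
    then have "(2::nat) ^ r < 2 ^ lg" using lg by linarith
    then have rl: "r < lg" by simp
    have sub: "lg - r = Suc (lg - Suc r)" using rl by simp
    have "ok \<beta> (ROUND K) u Xr (lgm + 2) Rd Wr (\<lambda>t. I (Suc r) t)"
    proof (rule ROUND_ok[OF bu inv])
     show "ireg u 9 \<le> n" using lt u9 by simp
     fix t assume t: "base t" "B.bor_inv (AI t 1) (AI t 2)"
      "card (B.roots (AI t 1)) \<le> 1 \<or> 2 * card (B.roots (AI t 1)) \<le> card (B.roots (AI u 1))" "ireg t 9 = 2 * ireg u 9"
     have "2 ^ Suc r * card (B.roots (AI t 1)) \<le> n" if "\<not> card (B.roots (AI t 1)) \<le> 1"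
     proof -
      have le: "2 * card (B.roots (AI t 1)) \<le> card (B.roots (AI u 1))" using t(3) that by blast
      have "2 ^ Suc r * card (B.roots (AI t 1)) = 2 ^ r * (2 * card (B.roots (AI t 1)))" by simp
      also have "\<dots> \<le> 2 ^ r * card (B.roots (AI u 1))" using le by (rule mult_le_mono2)
      also have "\<dots> \<le> n" using ca le that by linarith
      finally show ?thesis .
     qed
     then show "I (Suc r) t" using t u9 unfolding I_def by auto
    qed
    then have "ok \<beta> (ROUND K) u Xr (lgm + 2) Rd Wr (\<lambda>t. \<exists>g'. I g' t & (lg - g') * Xr + 1 + Xr \<le> (lg - r) * Xr + 1 & (lg - g') * (lgm +
     2) + 1 + (lgm + 2) \<le> (lg - r) * (lgm + 2) + 1)"
     by (rule ok_weaken) (rule exI[of _ "Suc r"], simp add: sub)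
    moreover have "1 \<le> Xr" "1 \<le> lgm + 2" by (simp_all add: Xr_def)
    ultimately show "\<exists>X1 D1. 1 \<le> X1 & 1 \<le> D1 & ok \<beta> (ROUND K) u X1 D1 Rd Wr (\<lambda>t. \<exists>g'. I g' t & (lg - g') * Xr + 1 + X1 \<le> (lg - r) * Xr +
     1 & (lg - g') * (lgm + 2) + 1 + D1 \<le> (lg - r) * (lgm + 2) + 1)" by blast
   next
    fix r u assume I: "I r u" and z: "ival (Var 9 [<] Var 0) u = 0"
    then have bu: "base u" and u9: "ireg u 9 = 2 ^ r"
     and ca: "card (B.roots (AI u 1)) \<le> 1 \<or> 2 ^ r * card (B.roots (AI u 1)) \<le> n" by (simp_all add: I_def)
    have ge: "n \<le> 2 ^ r" using z baseD(1)[OF bu] by (simp add: u9 split: if_splits)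
    have "card (B.roots (AI u 1)) \<le> 1"
    proof (rule ccontr)
     assume "\<not> ?thesis"
     then have "2 ^ r * card (B.roots (AI u 1)) \<le> n" "2 ^ r * 2 \<le> 2 ^ r * card (B.roots (AI u 1))" using ca by auto
     then show False using ge n0 by linarith
    qed
    then show "PP u" using I by (intro post) (auto simp: I_def)
   next
    show "I 0 t2" by fact
    show "(lg - 0) * Xr + 1 \<le> X" "(lg - 0) * (lgm + 2) + 1 \<le> D" using X by simp_all
   qed auto
  qed (use X1 bb n0 in auto)
 qed (use X1 bb G_region Z1 in \<open>simp_all add: D0\<close>)
qed

end

section \<open>The whole algorithm\<close>

text \<open>The slots of all vertices except the last root must fill the output without a gap, so
  the place of the root takes the slot of vertex \<open>n - 1\<close>.\<close>

definition OUT :: "nat => hc" where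
 "OUT K = (let c = Var 14; e = IA 2 (c [+] (c [=] IA 1 (Num 0)) [*] (Var 0 [-] Num 1 [-] c)) in
   Pf 14 (Var 0 [-] Num 1) [] (IS (Num 2 [*] c) (e [/] Num K)) ;;
   Pf 14 (Var 0 [-] Num 1) [] (IS (Num 2 [*] c [+] Num 1) (IA 0 e)))"

context bor begin

lemma OUT_ok:
 assumes b: "base s" and L: "imem s (adr G (Suc 0) 0) = z" and sl: "!!c. imem s (adr G 2 c) = sl c"
  and z: "z < n" and slv: "!!c. c < n ==> c \<noteq> z ==> sl c < m & NI (sl c) < n"
  and post: "!!t. (!!c. c < n - 1 ==> imem t (2 * c) = sl (if c = z then n - 1 else c) div K &
    imem t (2 * c + 1) = NI (sl (if c = z then n - 1 else c))) ==> PP t"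
 shows "ok \<beta> (OUT K) s X D Rd Wr PP"
proof -
 note D0 = baseD[OF b]
 let ?c = "Var 14"
 let ?e = "IA 2 (?c [+] (?c [=] IA 1 (Num 0)) [*] (Var 0 [-] Num 1 [-] ?c))"
 let ?P1 = "IS (Num 2 [*] ?c [+] Num 1) (IA 0 ?e)"
 let ?P2 = "IS (Num 2 [*] ?c) (?e [/] Num K)"
 let ?ix = "\<lambda>c. if c = z then n - 1 else c"
 have ix: "?ix c < n" "?ix c \<noteq> z" "sl (?ix c) < m" "NI (sl (?ix c)) < n" if "c < n - 1" for c
 proof -
  show "?ix c < n" "?ix c \<noteq> z" using that by auto
  then show "sl (?ix c) < m" "NI (sl (?ix c)) < n" using slv by blast+
 qed
 have thr: "ival ?e (setv u 14 c) = sl (?ix c)"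
  "ird ?e (setv u 14 c) = {ICell (adr G 1 0), ICell (adr G 2 (?ix c))}"
  "NI e = imem u (adr G 0 e)"
  if c: "c < n - 1" and u: "ireg u = ireg s" "!!c i. imem u (adr G c i) = imem s (adr G c i)" for c u e
 proof -
  let ?S = "(setv u 14 c)"
  have "ival (?c [+] (?c [=] IA 1 (Num 0)) [*] (Var 0 [-] Num 1 [-] ?c)) ?S = ?ix c"
   using c by (auto simp: u D0 L)
  then show "ival ?e ?S = sl (?ix c)" "ird ?e ?S = {ICell (adr G 1 0), ICell (adr G 2 (?ix c))}"
   by (auto simp: u D0 sl)
  show "NI e = imem u (adr G 0 e)" by (simp add: u D0)
 qed
 have far: "2 * c < G" "2 * c + 1 < G" "ICell (2 * c) \<in> Wr" "ICell (2 * c + 1) \<in> Wr" if "c < n - 1" for c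
 proof -
  show *: "2 * c < G" "2 * c + 1 < G" using that low(2) by linarith+
  have "G \<le> S" by (simp add: S_def R0_def)
  then show "ICell (2 * c) \<in> Wr" "ICell (2 * c + 1) \<in> Wr" using * by (auto simp: Wr_def)
 qed
 have ne: "adr G a i \<noteq> 2 * c" "adr G a i \<noteq> 2 * c + 1" if "c < n - 1" for a i c
  using far[OF that] adr_ge[of G a i] by linarith+
 have Xn: "1 + (n - 1) \<le> X" "n - 1 \<le> \<beta>" using Xs(3) bb(5) n0 by linarith+
 have Z1: "i < n ==> i < Z" for i using ltZ[of i] by simp
 show ?thesis
  unfolding OUT_def Let_def
 proof (rule ok_seq, rule ok_pf_IS[where m = "n - 1" and G = "\<lambda>i. True" and ad = "\<lambda>c. 2 * c" and vl = "\<lambda>c. sl (?ix c) div K"])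
  fix c assume c: "c < n - 1"
  note th = thr[OF c refl refl]
  show "ival (?e [/] Num K) (setv s 14 c) = sl (?ix c) div K"
   unfolding ival.simps(3) th(1) by simp
  have gl: "l = ICell (adr G 1 0) \<or> l = ICell (adr G 2 (?ix c))"
   if "l \<in> grd [] ?P2 (setv s 14 c)" for l
  proof -
   have "grd [] ?P2 (setv s 14 c) = ird ?e (setv s 14 c)" by simp
   with that show ?thesis unfolding th(2) by blast
  qed
  show "l \<in> Rd \<union> Wr" if "l \<in> grd [] ?P2 (setv s 14 c)" for l
   using gl[OF that] Z1[OF ix(1)[OF c]] nZ(1) by auto
  show "c = j" if "j < n - 1" "ICell (2 * j) \<in> grd [] ?P2 (setv s 14 c)" for j
   using gl[OF that(2)] ne[OF that(1), of 1 0] ne[OF that(1), of 2 "?ix c"] by auto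
  show "ICell (2 * c) \<in> Wr" by (rule far(3)[OF c])
  show "sl (?ix c) div K \<le> \<beta>" using eK[OF ix(3)[OF c]] bb(5) by linarith
 next
  fix f assume f: "!!c. c < n - 1 ==> True ==> f (2 * c) = sl (?ix c) div K"
   "!!a. (!!c. c < n - 1 ==> True ==> 2 * c \<noteq> a) ==> f a = imem s a"
  let ?u = "s\<lparr>imem := f\<rparr>"
  have fa: "imem ?u (adr G a i) = imem s (adr G a i)" for a i using f(2)[of "adr G a i"] ne by (simp add: eq_commute)
  have ru: "ireg ?u = ireg s" by simp
  show "ok \<beta> (Pf 14 (Var 0 [-] Num 1) [] ?P1) ?u X D Rd Wr PP"
  proof (rule ok_pf_IS[where m = "n - 1" and G = "\<lambda>i. True" and ad = "\<lambda>c. 2 * c + 1" and vl = "\<lambda>c. NI (sl (?ix c))"])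
   fix c assume c: "c < n - 1"
   note th = thr[OF c ru fa]
   have G': "ireg ?u 2 = G" using D0 by simp
   have "ival (IA 0 ?e) (setv ?u 14 c) = imem ?u (adr (ireg ?u 2) 0 (ival ?e (setv ?u 14 c)))" by simp
   then show "ival (IA 0 ?e) (setv ?u 14 c) = NI (sl (?ix c))"
    unfolding th(1) th(3) G' .
   have gl: "l = ICell (adr G 1 0) \<or> l = ICell (adr G 2 (?ix c)) \<or> l = ICell (adr G 0 (sl (?ix c)))"
    if "l \<in> grd [] ?P1 (setv ?u 14 c)" for l
   proof -
    have "grd [] ?P1 (setv ?u 14 c) = insert (ICell (adr (ireg ?u 2) 0 (ival ?e (setv ?u 14 c)))) (ird ?e (setv ?u 14 c))" by simp
    with that show ?thesis unfolding th(1,2) G' by blast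
   qed
   show "l \<in> Rd \<union> Wr" if "l \<in> grd [] ?P1 (setv ?u 14 c)" for l
    using gl[OF that] Z1[OF ix(1)[OF c]] ltZ(2)[OF less_imp_le[OF ix(3)[OF c]]] nZ(1) by auto
   show "c = j" if "j < n - 1" "ICell (2 * j + 1) \<in> grd [] ?P1 (setv ?u 14 c)" for j
    using gl[OF that(2)] ne(2)[OF that(1), of 1 0] ne(2)[OF that(1), of 2 "?ix c"] ne(2)[OF that(1), of 0 "sl (?ix c)"] by auto
   show "ICell (2 * c + 1) \<in> Wr" by (rule far(4)[OF c])
   show "NI (sl (?ix c)) \<le> \<beta>" using ix(4)[OF c] bb(5) by linarith
  next
   fix g assume g: "!!c. c < n - 1 ==> True ==> g (2 * c + 1) = NI (sl (?ix c))"
    "!!a. (!!c. c < n - 1 ==> True ==> 2 * c + 1 \<noteq> a) ==> g a = imem ?u a"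
   have "g (2 * c) = f (2 * c)" for c
   proof -
    have "2 * c' + 1 \<noteq> 2 * c" for c' by presburger
    then show ?thesis using g(2)[of "2 * c"] by simp
   qed
   then show "PP (?u\<lparr>imem := g\<rparr>)" using f(1) g(1) by (intro post) simp
  qed (use Xn Xs in \<open>simp_all add: D0\<close>)
 qed (use Xn Xs in \<open>simp_all add: D0\<close>)
qed

end

text \<open>Keeps core distances, and with them all edge weights, below the sentinel
  \<open>BIG\<close>.\<close>

lemma is_kth_bound:
 assumes "is_kth f {..<n} k v" "!!i. i < n ==> f i < B"
 shows "v < B"
proof (rule ccontr)
 assume "\<not> v < B"
 then have "f i < v" if "i < n" for i using assms(2)[OF that] by linarith
 then have e: "{i\<in>{..<n}. f i < v} = {..<n}" by auto
 have "card {i\<in>{..<n}. f i \<le> v} \<le> card {..<n}" by (intro card_mono) auto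
 then show False using assms(1) unfolding is_kth_def e by simp
qed

lemma is_kth_cong:
 assumes "!!i. i \<in> S ==> f i = g i"
 shows "is_kth f S k v = is_kth g S k v"
proof -
 have "{i\<in>S. f i < v} = {i\<in>S. g i < v}" "{i\<in>S. f i \<le> v} = {i\<in>S. g i \<le> v}" using assms by auto
 then show ?thesis by (simp only: is_kth_def)
qed

lemma cone_cong: "(!!i. i < d ==> f i = g i) ==> cone_idx G f d = cone_idx G g d"
 by (induction d) auto

lemma conn_image:
 assumes "conn T x y"
 shows "conn ((`) f ` T) (f x) (f y)"
 using assms
proof (induction rule: conn_induct)
 case (step y z)
 have "{f y, f z} \<in> (`) f ` T" using step.hyps(2) by (intro image_eqI[of _ _ "{y, z}"]) auto
 with step.IH show ?case by (rule conn_step)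
qed simp

section \<open>Composition of the programs and correctness of the output\<close>

definition MAIN :: "nat => nat => hc" where
 "MAIN d K = PREP d K ;; CORE d ;; YAO d K ;; BOR K ;; OUT K"

context run begin

lemma Dd_sym: "Dd p q = Dd q p"
 unfolding Dd_def by (simp add: power2_commute)

lemma MAIN_ok:
 fixes pt :: "nat => real ^ 'd::finite" and coord :: "nat => 'd"
 assumes s: "ireg s 0 = n" "ireg s 1 = k" "!!a. rmem s a = (if a < n * d then inp a else 0)"
  and dd: "d = CARD('d)" and KK: "K = (2 * d + 2) ^ d" and inp: "!!a. a < n * d ==> inp a = pt (a div d) $ coord (a mod d)"
  and bij: "bij_betw pt {..<n} P" and coord: "bij_betw coord {..<CARD('d)} UNIV"
  and XB: "lg * (2 + 2 * (n * K) + (lg + K + 4) * (1 + n)) + 1 + n \<le> X" "lg * (lg + K + 4) + 1 \<le> D"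
 shows "ok \<beta> (MAIN d K) s X D Rd Wr (\<lambda>t. valid_output n t & mutual_reach_mst P k (output_edges pt n t))"
proof -
 have inj: "inj_on pt {..<n}" and img: "pt ` {..<n} = P" using bij by (auto simp: bij_betw_def)
 have fin: "finite P" unfolding img[symmetric] by simp
 have cP: "card P = n" using bij_betw_same_card[OF bij] by simp
 have inp': "inp (p * d + l) = pt p $ coord l" if "p < n" "l < d" for p l using inp[OF ndl[OF that]] that by simp
 have Dd: "Dd p q = dist (pt p) (pt q)" if "p < n" "q < n" for p q
 proof -
  have "(\<Sum>l<d. (inp (p * d + l) - inp (q * d + l))\<^sup>2) = (\<Sum>l<d. (dist (pt p $ coord l) (pt q $ coord l))\<^sup>2)"
   by (rule sum.cong) (use inp' that in \<open>auto simp: dist_real_def\<close>)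
  also have "\<dots> = (\<Sum>i\<in>UNIV. (dist (pt p $ i) (pt q $ i))\<^sup>2)"
   using sum.reindex_bij_betw[OF coord, of "\<lambda>i. (dist (pt p $ i) (pt q $ i))\<^sup>2"] dd by simp
  finally show ?thesis by (simp add: Dd_def dist_vec_def L2_set_def)
 qed
 have cle: "cl p q < K" for p q unfolding cl_def KK using cone_less[of "2 * d + 1"] by simp
 have closer: "Dd r q < Dd p q"
  if "p < n" "q < n" "r < n" "p \<noteq> q" "p \<noteq> r" "cl p q = cl p r" "Dd p r \<le> Dd p q" for p q r
 proof -
  have ne: "pt q \<noteq> pt p" "pt r \<noteq> pt p" using that inj by (auto simp: inj_on_def)
  have cl': "cl p x = cone_idx (2 * CARD('d) + 1) (\<lambda>i. (pt x $ coord i - pt p $ coord i) / dist (pt p) (pt x)) CARD('d)" if x: "x < n" for x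
   unfolding cl_def dd[symmetric] by (rule cone_cong) (use inp' x \<open>p < n\<close> Dd in auto)
  have "dist (pt p) (pt r) \<le> dist (pt p) (pt q)" using that by (simp add: Dd)
  from same_direction_closer[OF coord refl ne this that(6)[unfolded cl'[OF that(2)] cl'[OF that(3)]]]
  show ?thesis using that by (simp add: Dd)
 qed
 show ?thesis
  unfolding MAIN_def
 proof (rule ok_seq, rule PREP_ok[OF s])
  fix t1 BIG assume t1: "genv BIG t1" "!!p q. p < n ==> q < n ==> Dd p q < BIG"
  show "ok \<beta> (CORE d ;; YAO d K ;; BOR K ;; OUT K) t1 X D Rd Wr (\<lambda>t. valid_output n t & mutual_reach_mst P k (output_edges pt n t))"
  proof (rule ok_seq, rule CORE_ok[OF t1])
   fix t2 assume t2: "genv BIG t2" "!!p. p < n ==> is_kth (Dd p) {..<n} k (AR t2 0 p)"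
   define cd where "cd = AR t2 0"
   have kth: "is_kth (Dd p) {..<n} k (cd p)" if "p < n" for p using t2(2)[OF that] by (simp add: cd_def)
   have core: "core_dist P k (pt p) = cd p" if "p < n" for p
    using kth[OF that] is_kth_cong[of "{..<n}" "Dd p" "\<lambda>j. dist (pt p) (pt j)" k "cd p"] Dd that
    by (intro core_dist_eqI[OF bij k]) auto
   have cdB: "cd p < BIG" if "p < n" for p by (rule is_kth_bound[OF kth[OF that]]) (use t1(2) that in auto)
   define w where "w p q = max (cd p) (max (cd q) (Dd p q))" for p q
   have mw: "mutual_reach_weight P k {pt p, pt q} = w p q" if "p < n" "q < n" for p q
    using that by (simp add: mutual_reach_dist_def core Dd w_def)
   define H where "H p q \<longleftrightarrow> p < n & q < n & p \<noteq> q & AR t2 0 q \<le> AR t2 0 p" for p q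
   show "ok \<beta> (YAO d K ;; BOR K ;; OUT K) t2 X D Rd Wr (\<lambda>t. valid_output n t & mutual_reach_mst P k (output_edges pt n t))"
   proof (rule ok_seq, rule YAO_ok[OF t2(1) t1(2) KK, of H])
    show "H = (\<lambda>p q. p < n & q < n & p \<noteq> q & AR t2 0 q \<le> AR t2 0 p)" by (simp add: H_def fun_eq_iff)
    fix t3 assume t3: "same {} {0} {1} t2 t3" "!!e. e < m ==> AI t3 0 e \<le> n"
     "!!e. e < m ==> AI t3 0 e < n ==> H (e div K) (AI t3 0 e) & cl (e div K) (AI t3 0 e) = e mod K & AR t3 1 e = Dd (e div K) (AI t3 0 e)"
     "!!p q. H p q ==> AI t3 0 (p * K + cl p q) < n & AR t3 1 (p * K + cl p q) \<le> Dd p q"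
    define NI where "NI = AI t3 0"
    define ND where "ND = AR t3 1"
    have g3: "genv BIG t3" by (rule genv_same[OF t2(1) t3(1)]) auto
    have cd3: "AR t3 0 p = cd p" for p using same_AR[OF t3(1), of 0] by (simp add: cd_def)
    have v: "e div K < n" "e div K \<noteq> NI e" "cd (NI e) \<le> cd (e div K)" "ND e = Dd (e div K) (NI e)" "cl (e div K) (NI e) = e mod K"
     if "e < m" "NI e < n" for e
     using t3(3)[OF that(1)] that(2) unfolding NI_def ND_def H_def cd_def by auto
    have ewv: "max (cd (e div K)) (ND e) = w (e div K) (NI e)" if "e < m" "NI e < n" for e
     using v(3,4)[OF that] by (simp add: w_def)
    let ?E = "{e. e < m & NI e < n}"
    have span: "conn (pairs {h\<in>?E. w (h div K) (NI h) \<le> w p q} (\<lambda>e. e div K) NI) p q" if "p < n" "q < n" for p q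
    proof (rule sparse_spanner[where D = Dd and C = cl and cd = cd and n = n])
     fix p q assume pq: "p < n" "q < n" "p \<noteq> q" "cd q \<le> cd p"
     define h where "h = p * K + cl p q"
     have "H p q" using pq by (simp add: H_def cd_def)
     from t3(4)[OF this] have hn: "NI h < n" "ND h \<le> Dd p q" by (simp_all add: NI_def ND_def h_def)
     have hK: "h div K = p" "h mod K = cl p q" using cle[of p q] by (auto simp: h_def)
     have "h < (p + 1) * K" using cle[of p q] by (simp add: h_def)
     also have "\<dots> \<le> n * K" using pq by (intro mult_le_mono1) simp
     finally have hm: "h < m" by (simp add: m_def)
     show "\<exists>h\<in>?E. h div K = p & NI h < n & NI h \<noteq> p & cd (NI h) \<le> cd p & cl p q = cl p (NI h) & Dd p (NI h) \<le> Dd p q"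
      by (rule bexI[of _ h]) (use hn hm v[OF hm hn(1)] hK in auto)
    qed (use Dd_sym closer that in \<open>auto simp: w_def\<close>)
    interpret bor n k d K lg \<beta> X D inp BIG t3 NI cd ND
    proof unfold_locales
     show "max (cd (e div K)) (ND e) < BIG" if "e < m" "NI e < n" for e
      using v[OF that] that cdB t1(2) by simp
     show "conn (pairs ?E (\<lambda>e. e div K) NI) p q" if "p < n" "q < n" for p q
      by (rule conn_mono[OF span[OF that]]) (rule pairs_mono, auto)
    qed (use g3 cd3 t3(2) in \<open>auto simp: NI_def ND_def\<close>)
    show "ok \<beta> (BOR K ;; OUT K) t3 X D Rd Wr (\<lambda>t. valid_output n t & mutual_reach_mst P k (output_edges pt n t))"
    proof (rule ok_seq, rule BOR_ok)
     have e1: "lgm + 2 = lg + K + 4" by (simp add: lgm_def)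
     have e2: "Xr = 2 + 2 * (n * K) + (lg + K + 4) * (1 + n)" unfolding Xr_def m_def e1 ..
     show "lg * Xr + 1 + n \<le> X" "lg * (lgm + 2) + 1 \<le> D" using XB unfolding e1 e2 by blast+
     fix t4 assume t4: "base t4" and inv: "B.bor_inv (AI t4 1) (AI t4 2)" and one: "card (B.roots (AI t4 1)) \<le> 1"
     define L where "L = AI t4 1"
     define sl where "sl = AI t4 2"
     define z where "z = L 0"
     have n1: "0 < n" using n0 by simp
     note BF = B.boruvka_final[OF inv[folded L_def sl_def] one[folded L_def] n1, folded z_def]
     define ix where "ix c = (if c = z then n - 1 else c)" for c
     show "ok \<beta> (OUT K) t4 X D Rd Wr (\<lambda>t. valid_output n t & mutual_reach_mst P k (output_edges pt n t))"
     proof (rule OUT_ok[OF t4, of z sl, folded ix_def])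
      show "imem t4 (adr G (Suc 0) 0) = z" "imem t4 (adr G 2 c) = sl c" for c by (simp_all add: z_def L_def sl_def baseD[OF t4])
      show "z < n" by (rule BF(2))
      show "c < n ==> c \<noteq> z ==> sl c < m & NI (sl c) < n" for c by (rule BF(4))
      fix t :: state assume t: "!!c. c < n - 1 ==> imem t (2 * c) = sl (ix c) div K & imem t (2 * c + 1) = NI (sl (ix c))"
      define Sl where "Sl = sl ` ({..<n} - {z})"
      have Sv: "h < m" "NI h < n" if "h \<in> Sl" for h using that BF(4) by (auto simp: Sl_def)
      have ixi: "ix ` {..<n - 1} = {..<n} - {z}"
      proof (intro equalityI subsetI)
       fix c assume c: "c \<in> {..<n} - {z}"
       show "c \<in> ix ` {..<n - 1}"
       proof (cases "c < n - 1")
        case False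
        then have "c = n - 1" using c by auto
        then have "ix z = c" "z < n - 1" using c BF(2) by (auto simp: ix_def)
        then show ?thesis by (intro image_eqI[of _ _ z]) auto
       qed (use c in \<open>auto simp: ix_def intro!: image_eqI[of _ _ c]\<close>)
      qed (use BF(2) in \<open>auto simp: ix_def split: if_splits\<close>)
      have ixS: "sl (ix c) \<in> Sl" if "c < n - 1" for c
      proof -
       have "ix c \<in> {..<n} - {z}" using ixi that by blast
       then show ?thesis by (simp add: Sl_def)
      qed
      have T: "output_edges pt n t = (\<lambda>h. {pt (h div K), pt (NI h)}) ` Sl"
      proof -
       have "output_edges pt n t = (\<lambda>c. {pt (sl (ix c) div K), pt (NI (sl (ix c)))}) ` {..<n - 1}"
        unfolding output_edges_def by (rule image_cong) (use t in auto)
       also have "\<dots> = (\<lambda>h. {pt (h div K), pt (NI h)}) ` sl ` ix ` {..<n - 1}" by (simp add: image_image)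
       finally show ?thesis unfolding ixi Sl_def .
      qed
      have ip: "(`) pt ` pairs S (\<lambda>e. e div K) NI = (\<lambda>h. {pt (h div K), pt (NI h)}) ` S" for S
       by (auto simp: pairs_def image_image)
      have val: "valid_output n t"
       unfolding valid_output_def
      proof (intro allI impI)
       fix j assume j: "j < 2 * (n - 1)"
       define c where "c = j div 2"
       have c: "c < n - 1" using j by (simp add: c_def)
       have "j = 2 * c \<or> j = 2 * c + 1" unfolding c_def by linarith
       then show "imem t j < n" using t[OF c] eK[OF Sv(1)[OF ixS[OF c]]] Sv(2)[OF ixS[OF c]] by auto
      qed
      have "mutual_reach_mst P k (output_edges pt n t)"
      proof (rule mst_criterion)
       show "finite P" by (rule fin)
       show "output_edges pt n t \<subseteq> complete_edges P"
       proof
        fix x assume "x \<in> output_edges pt n t"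
        then obtain h where h: "h \<in> Sl" "x = {pt (h div K), pt (NI h)}" unfolding T by blast
        note hv = Sv[OF h(1)]
        have "pt (h div K) \<noteq> pt (NI h)" using v(1,2)[OF hv] hv(2) inj by (auto simp: inj_on_def)
        moreover have "pt (h div K) \<in> P" "pt (NI h) \<in> P" using v(1)[OF hv] hv(2) img by auto
        ultimately show "x \<in> complete_edges P" unfolding complete_edges_def h(2) by blast
       qed
       have "card (output_edges pt n t) \<le> card {..<n - 1}" unfolding output_edges_def by (rule card_image_le) simp
       then show "card (output_edges pt n t) < card P" using cP n1 by simp
       have con: "conn (output_edges pt n t) (pt u) (pt v)" if "u < n" "v < n" for u v
        using conn_image[OF BF(3)[OF that], of pt] unfolding Sl_def[symmetric] ip T .
       show "connects P (output_edges pt n t)"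
        unfolding connects_iff img[symmetric] using con by blast
       fix p q assume pq: "p \<in> P" "q \<in> P" "p \<noteq> q"
       then obtain a b where ab: "a < n" "b < n" "p = pt a" "q = pt b" unfolding img[symmetric] by blast
       let ?S = "{h \<in> Sl. max (cd (h div K)) (ND h) \<le> w a b}"
       have "conn (pairs ?S (\<lambda>e. e div K) NI) a b"
       \<comment> \<open>A spanner path below the threshold is rerouted edge by edge through tree
         edges no heavier than the edge replaced.\<close>
       proof (rule conn_subst[OF span[OF ab(1,2)]])
        fix x y assume "{x, y} \<in> pairs {h\<in>?E. w (h div K) (NI h) \<le> w a b} (\<lambda>e. e div K) NI"
        then obtain h where h: "h < m" "NI h < n" "w (h div K) (NI h) \<le> w a b" "{x, y} = {h div K, NI h}"
         by (auto simp: pairs_def)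
        have c: "conn (pairs ?S (\<lambda>e. e div K) NI) (h div K) (NI h)"
         by (rule conn_mono[OF BF(5)[OF h(1,2)]], rule pairs_mono)
          (use h(3) ewv[OF h(1,2)] in \<open>auto simp: Sl_def\<close>)
        from h(4) have "x = h div K & y = NI h \<or> x = NI h & y = h div K" by (simp add: doubleton_eq_iff)
        then show "conn (pairs ?S (\<lambda>e. e div K) NI) x y" using c conn_sym[OF c] by (elim disjE conjE) simp_all
       qed
       from conn_image[OF this, of pt] have "conn ((\<lambda>h. {pt (h div K), pt (NI h)}) ` ?S) p q" unfolding ip ab .
       then show "conn {e \<in> output_edges pt n t. mutual_reach_weight P k e \<le> mutual_reach_weight P k {p, q}} p q"
       proof (rule conn_mono)
        show "(\<lambda>h. {pt (h div K), pt (NI h)}) ` ?S \<subseteq> {e \<in> output_edges pt n t. mutual_reach_weight P k e \<le> mutual_reach_weight P k {p, q}}"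
        proof
         fix x assume "x \<in> (\<lambda>h. {pt (h div K), pt (NI h)}) ` ?S"
         then obtain h where h: "h \<in> Sl" "max (cd (h div K)) (ND h) \<le> w a b" "x = {pt (h div K), pt (NI h)}" by blast
         note hv = Sv[OF h(1)]
         have "mutual_reach_weight P k x \<le> mutual_reach_weight P k {p, q}"
          unfolding h(3) ab(3,4) mw[OF v(1)[OF hv] hv(2)] mw[OF ab(1,2)] using h(2) ewv[OF hv] by simp
         then show "x \<in> {e \<in> output_edges pt n t. mutual_reach_weight P k e \<le> mutual_reach_weight P k {p, q}}"
          using h unfolding T by blast
        qed
       qed
      qed
      with val show "valid_output n t & mutual_reach_mst P k (output_edges pt n t)" by blast
     qed
    qed
   qed
  qed
 qed
qed

end

section \<open>Arithmetic of the final bounds\<close>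

lemma ex_pow2:
 assumes "1 \<le> (n::nat)"
 shows "\<exists>l. n \<le> 2 ^ l & 2 ^ l < 2 * n"
 using assms
proof (induction n rule: less_induct)
 case (less n)
 show ?case
 proof (cases "n = 1")
  case False
  define h where "h = (n + 1) div 2"
  have h: "h < n" "1 \<le> h" "n \<le> 2 * h" "2 * h \<le> n + 1" using False less.prems unfolding h_def by linarith+
  from less.IH[OF h(1,2)] obtain l where l: "h \<le> 2 ^ l" "2 ^ l < 2 * h" by blast
  have "(2::nat) ^ l < n + 1" using l h by linarith
  moreover have "(2::nat) ^ l < n" if "2 * h = n + 1"
  proof (rule ccontr)
   assume "\<not> ?thesis"
   then have e: "(2::nat) ^ l = n" using \<open>2 ^ l < n + 1\<close> by linarith
   then have "odd ((2::nat) ^ l)" using that by presburger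
   then have "l = 0" by (cases l) auto
   then show False using e False by simp
  qed
  ultimately have "2 * 2 ^ l < 2 * n \<or> 2 ^ l = n" by linarith
  then show ?thesis
  proof
   assume "2 * 2 ^ l < 2 * n"
   then show ?thesis using l h by (intro exI[of _ "Suc l"]) simp
  next
   assume "2 ^ l = n"
   then show ?thesis using less.prems by (intro exI[of _ l]) simp
  qed
 qed (auto intro: exI[of _ 0])
qed

text \<open>Bounds the square of \<open>lg\<close> by a multiple of \<open>n\<close>, so that the
  logarithmic factors of the rounds fit into quadratic work.\<close>

lemma sq_le_pow2: "(l + 1) * (l + 1) \<le> 4 * (2::nat) ^ l"
proof (induction l)
 case (Suc l)
 show ?case
 proof (cases "l \<le> 1")
  case False
  then have "2 * 2 \<le> l * l" by (intro mult_le_mono) auto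
  then have "(Suc l + 1) * (Suc l + 1) \<le> 2 * ((l + 1) * (l + 1))" by (simp add: algebra_simps)
  then show ?thesis using Suc by simp
 next
  case True
  then have "l = 0 \<or> l = 1" by linarith
  then show ?thesis by auto
 qed
qed simp

lemma work_arith:
 fixes n K lg :: nat
 assumes n: "1 \<le> n" and lg: "2 ^ lg < 2 * n" and K: "1 \<le> K"
 shows "400000 * (n * n) + 2 + 2 * (n * K) + (lg * (2 + 2 * (n * K) + (lg + K + 4) * (1 + n)) + 1 + n)
  \<le> (400100 + 10 * K) * (n * n)"
proof -
 have nn: "n \<le> n * n" "1 \<le> n * n" using n by simp_all
 have l: "lg \<le> 2 * n" using less_exp[of lg] lg by linarith
 have a: "lg * 2 \<le> 4 * (n * n)" using l nn by linarith
 have "lg * (2 * (n * K)) \<le> (2 * n) * (2 * (n * K))" using l by (rule mult_le_mono1)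
 then have b: "lg * (2 * (n * K)) \<le> 4 * (n * n * K)" by (simp add: algebra_simps)
 have "lg * lg \<le> (lg + 1) * (lg + 1)" by simp
 then have "lg * lg \<le> 8 * n" using sq_le_pow2[of lg] lg by linarith
 moreover have "lg * (K + 4) \<le> 2 * n * (K + 4)" using l by (rule mult_le_mono1)
 ultimately have c1: "lg * (lg + K + 4) \<le> 16 * n + 2 * (n * K)" by (simp add: algebra_simps)
 have "lg * (lg + K + 4) * (1 + n) \<le> (16 * n + 2 * (n * K)) * (2 * n)" using c1 n by (intro mult_le_mono) simp_all
 then have c: "lg * ((lg + K + 4) * (1 + n)) \<le> 32 * (n * n) + 4 * (n * n * K)" by (simp add: algebra_simps)
 have "n * K \<le> n * n * K" using nn by simp
 moreover have "lg * (2 + 2 * (n * K) + (lg + K + 4) * (1 + n)) = lg * 2 + lg * (2 * (n * K)) + lg * ((lg + K + 4) * (1 + n))"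
  by (simp only: add_mult_distrib2)
 moreover have "(400100 + 10 * K) * (n * n) = 400100 * (n * n) + 10 * (n * n * K)" by (simp add: algebra_simps)
 ultimately show ?thesis using a b c nn by linarith
qed

lemma depth_arith:
 fixes L :: real and K lg :: nat
 assumes L: "1 \<le> L" and lg: "real lg \<le> 2 * L"
 shows "real ((lg + 4) * (12 * lg + 1) + 1 + (lg * (lg + K + 4) + 1)) \<le> (170 + 2 * real K) * L\<^sup>2"
proof -
 have L2: "L \<le> L\<^sup>2" "1 \<le> L\<^sup>2" using L by (auto simp: power2_eq_square intro: mult_ge1_I)
 have "real lg * real lg \<le> (2 * L) * (2 * L)" using lg L by (intro mult_mono) auto
 then have a: "real lg * real lg \<le> 4 * L\<^sup>2" by (simp add: power2_eq_square)
 have "real lg * real K \<le> 2 * L * real K" using lg by (intro mult_right_mono) auto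
 also have "\<dots> \<le> 2 * L\<^sup>2 * real K" using L2 by (intro mult_right_mono) auto
 finally have b: "real lg * real K \<le> 2 * (real K * L\<^sup>2)" by (simp add: algebra_simps)
 have "real ((lg + 4) * (12 * lg + 1) + 1 + (lg * (lg + K + 4) + 1)) = 13 * (real lg * real lg) + 53 * real lg + real lg * real K + 6" by
  (simp add: algebra_simps)
 also have "\<dots> \<le> 170 * L\<^sup>2 + 2 * (real K * L\<^sup>2)" using a b lg L2 by linarith
 finally show ?thesis by (simp add: algebra_simps)
qed

theorem theorem3p3:
  shows "\<exists>(prog :: com) (e :: nat) (C :: real).
    \<forall>(P :: (real ^ 'd::finite) set) (n :: nat) (minPts :: nat)
      (pt :: nat \<Rightarrow> real ^ 'd) (coord :: nat \<Rightarrow> 'd).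
      finite P \<and> card P = n \<and> 1 \<le> minPts \<and> minPts \<le> n \<and>
      bij_betw pt {..<n} P \<and> bij_betw coord {..<CARD('d)} UNIV \<longrightarrow>
      (\<exists>(t :: state) (u :: usage).
        exec ((n + 2) ^ e) prog (init_state coord pt n minPts) t u \<and>
        valid_output n t \<and>
        mutual_reach_mst P minPts (output_edges pt n t) \<and>
        real (work u) \<le> C * real n ^ 2 \<and>
        (2 \<le> n \<longrightarrow> real (depth u) \<le> C * log 2 (real n) ^ 2) \<and>
        real (shared_space u) \<le> C * (real n * real minPts))"
proof -
 define d where "d = CARD('d)"
 define K where "K = (2 * d + 2) ^ d"
 define h where "h = hsz (MAIN d K)"
 \<comment> \<open>Source variable 1 lives in machine register 2, whereas \<open>minPts\<close>
   arrives in register 1; the two leading instructions copy it.\<close>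
 define prog where "prog = Seq (Seq (Do (IConst 3 0)) (Do (IOp IAdd 2 1 3))) (hcom (MAIN d K))"
 \<comment> \<open>\<open>\<beta> + 2 \<le> (n + 2) ^ (24 + K + d)\<close>, and programs of size
   \<open>h\<close> need the \<open>h\<close>-th power of \<open>\<beta> + 2\<close>. The additional
   1 gives \<open>n + 2 \<le> (n + 2) ^ e\<close>, which admits the two leading
   instructions.\<close>
 define e where "e = (24 + K + d) * h + 1"
 define C :: nat where "C = 131200 + d + 16 * K + h * (400100 + 10 * K)"
 have d1: "1 \<le> d" unfolding d_def by (simp add: Suc_leI)
 have K1: "1 \<le> K" by (simp add: K_def)
 have main: "\<exists>t u. exec ((n + 2) ^ e) prog (init_state coord pt n k) t u & valid_output n t &
   mutual_reach_mst P k (output_edges pt n t) & real (work u) \<le> real C * real n ^ 2 &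
   (2 \<le> n \<longrightarrow> real (depth u) \<le> real C * log 2 (real n) ^ 2) & real (shared_space u) \<le> real C * (real n * real k)"
  if k: "1 \<le> k" "k \<le> n" and bij: "bij_betw pt {..<n} P" "bij_betw coord {..<CARD('d)} UNIV"
  for P :: "(real ^ 'd) set" and n k and pt :: "nat => real ^ 'd" and coord :: "nat => 'd"
 proof -
  have n1: "1 \<le> n" using k by simp
  obtain lg where lg: "n \<le> 2 ^ lg" "2 ^ lg < 2 * n" using ex_pow2[OF n1] by blast
  define \<beta> where "\<beta> = 2 ^ 20 * (n * n * (K + d + 1))"
  define X where "X = 400000 * (n * n) + 2 + 2 * (n * K) + (lg * (2 + 2 * (n * K) + (lg + K + 4) * (1 + n)) + 1 + n)"
  define D where "D = (lg + 4) * (12 * lg + 1) + 1 + (lg * (lg + K + 4) + 1)"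
  define inp where "inp a = pt (a div d) $ coord (a mod d)" for a
  interpret run n k d K lg \<beta> X D inp
   by unfold_locales (use k d1 K1 lg in \<open>auto simp: \<beta>_def X_def D_def\<close>)
  define s where "s = \<lparr>ireg = (\<lambda>_. 0)(0 := n, 1 := k), rreg = (\<lambda>_. 0), imem = (\<lambda>_. 0),
   rmem = (\<lambda>a. if a < n * d then inp a else 0)\<rparr>"
  let ?s0 = "init_state coord pt n k"
  let ?s1 = "instr_next (IConst 3 0) ?s0"
  let ?s2 = "instr_next (IOp IAdd 2 1 3) ?s1"
  let ?W = "(n + 2) ^ e"
  have rel: "rel ?s2 s"
   by (auto simp: rel_def s_def init_state_def inp_def d_def set_ireg_def fun_eq_iff)
  have bnd: "bnd \<beta> s" using bb(5) k by (auto simp: bnd_def s_def)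
  have \<beta>W: "(\<beta> + 2) ^ h \<le> (n + 2) ^ ((24 + K + d) * h)"
  proof -
   have p2: "2 ^ i \<le> (n + 2) ^ i" for i by (intro power_mono) auto
   have "K + d + 1 \<le> 2 ^ (K + d + 1)" using less_exp[of "K + d + 1"] by simp
   then have "n * n * (K + d + 1) \<le> (n + 2) ^ 2 * (n + 2) ^ (K + d + 1)"
    using p2[of "K + d + 1"] by (intro mult_le_mono) (auto simp: power2_eq_square intro: le_trans)
   from mult_le_mono[OF p2[of 20] this] have "\<beta> \<le> (n + 2) ^ 20 * ((n + 2) ^ 2 * (n + 2) ^ (K + d + 1))"
    unfolding \<beta>_def .
   also have "\<dots> = (n + 2) ^ (23 + K + d)" by (simp only: power_add[symmetric]) simp
   finally have "\<beta> \<le> (n + 2) ^ (23 + K + d)" .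
   moreover have "2 \<le> (n + 2) ^ (23 + K + d)"
    using p2[of 1] power_increasing[of 1 "23 + K + d" "n + 2"] by simp
   moreover have "2 * (n + 2) ^ (23 + K + d) \<le> (n + 2) * (n + 2) ^ (23 + K + d)" by (intro mult_le_mono1) simp
   moreover have "(n + 2) * (n + 2) ^ (23 + K + d) = (n + 2) ^ (24 + K + d)" by (simp flip: power_Suc)
   ultimately have "\<beta> + 2 \<le> (n + 2) ^ (24 + K + d)" by linarith
   then show ?thesis unfolding power_mult by (intro power_mono) auto
  qed
  have eW: "(n + 2) ^ ((24 + K + d) * h) \<le> ?W" "(n + 2) ^ 1 \<le> ?W"
   unfolding e_def by (intro power_increasing; simp)+
  have ok: "ok \<beta> (MAIN d K) s X D Rd Wr (\<lambda>t. valid_output n t & mutual_reach_mst P k (output_edges pt n t))"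
   by (rule MAIN_ok[OF _ _ _ d_def K_def _ bij]) (auto simp: s_def inp_def X_def D_def)
  obtain t u t' where ex: "exec ?W (hcom (MAIN d K)) ?s2 t u" "rel t t'" "work u \<le> h * X" "depth u \<le> h * D"
   "reads u \<subseteq> Rd \<union> Wr" "stores u \<union> pwrites u \<subseteq> Wr" "valid_output n t'" "mutual_reach_mst P k (output_edges pt n t')"
   using ok[unfolded ok_def, rule_format, OF _ rel bnd, of ?W] \<beta>W eW(1) unfolding h_def by (meson le_trans)
  have im: "imem t = imem t'" using ex(2) by (simp add: rel_def)
  have out: "valid_output n t" "mutual_reach_mst P k (output_edges pt n t)"
   using ex(7,8) unfolding valid_output_def output_edges_def im by blast+
  have pre: "exec ?W (Seq (Do (IConst 3 0)) (Do (IOp IAdd 2 1 3))) ?s0 ?s2 (seq_usage tick tick)"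
  proof -
   have "instr_ok ?W (IConst 3 0) ?s0" "instr_ok ?W (IOp IAdd 2 1 3) ?s1"
    using eW(2) k by (auto simp: init_state_def set_ireg_def)
   then show ?thesis using exec.Seq[OF exec.Do exec.Do, of ?W "IConst 3 0" ?s0 "IOp IAdd 2 1 3"] by simp
  qed
  define v where "v = seq_usage (seq_usage tick tick) u"
  have vE: "work v = 2 + work u" "depth v = 2 + depth u" "reads v = reads u" "stores v = stores u" "pwrites v = pwrites u"
   by (simp_all add: v_def seq_usage_def tick_def)
  have X: "X \<le> (400100 + 10 * K) * (n * n)" unfolding X_def by (rule work_arith[OF n1 lg(2) K1])
  have "work v \<le> C * (n * n)"
  proof -
   have "h * X \<le> h * ((400100 + 10 * K) * (n * n))" using X by (rule mult_le_mono2)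
   moreover have "1 \<le> n * n" using n1 by simp
   ultimately have "work v \<le> 2 * (n * n) + h * ((400100 + 10 * K) * (n * n))"
    using ex(3) unfolding vE by linarith
   also have "\<dots> = (2 + h * (400100 + 10 * K)) * (n * n)" by (simp only: add_mult_distrib mult.assoc)
   also have "\<dots> \<le> C * (n * n)" unfolding C_def by (intro mult_le_mono1) simp
   finally show ?thesis .
  qed
  then have "real (work v) \<le> real (C * (n * n))" by (simp only: of_nat_le_iff)
  then have w: "real (work v) \<le> real C * real n ^ 2" by (simp add: power2_eq_square)
  have dp: "real (depth v) \<le> real C * log 2 (real n) ^ 2" if n2: "2 \<le> n"
  proof -
   define L where "L = log 2 (real n)"
   have L1: "1 \<le> L" using n2 by (simp add: L_def le_log_iff)
   have "real (2 ^ lg) < real (2 * n)" using lg(2) by (simp only: of_nat_less_iff)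
   then have "2 powr real lg < 2 * real n" by (simp add: powr_realpow)
   then have "real lg < log 2 (2 * real n)" using n1 by (simp add: less_log_iff)
   also have "\<dots> = 1 + L" using n1 by (simp add: L_def log_mult)
   finally have "real lg \<le> 2 * L" using L1 by linarith
   note DL = depth_arith[OF L1 this, of K, folded D_def]
   have L2: "1 \<le> L\<^sup>2" using L1 by (simp add: one_le_power)
   have "real (depth v) \<le> 2 + real h * real D" using ex(4) unfolding vE by (simp flip: of_nat_mult)
   also have "\<dots> \<le> 2 * L\<^sup>2 + real h * ((170 + 2 * real K) * L\<^sup>2)"
    using DL L2 by (intro add_mono mult_left_mono) auto
   also have "\<dots> = (2 + real h * (170 + 2 * real K)) * L\<^sup>2" by (simp add: algebra_simps)
   also have "\<dots> \<le> real C * L\<^sup>2"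
   proof (rule mult_right_mono)
    have "real h * (170 + 2 * real K) \<le> real h * (400100 + 10 * real K)" by (intro mult_left_mono) auto
    then show "2 + real h * (170 + 2 * real K) \<le> real C" unfolding C_def by simp
   qed simp
   finally show ?thesis unfolding L_def .
  qed
  have "n * d \<le> S" using low(1) unfolding S_def R0_def by simp
  then have "Rd \<union> Wr \<subseteq> ICell ` {..<S} \<union> RCell ` {..<S}" unfolding Rd_def Wr_def by auto
  then have "shared_space v \<le> S" unfolding shared_space_def vE using ex(5,6) by (intro Least_le) blast
  moreover have "S \<le> C * (n * k)"
  proof -
   have nk: "n \<le> n * k" "1 \<le> n * k" using k n1 by simp_all
   have "n * d \<le> n * k * d" "n * K \<le> n * k * K" using nk by simp_all
   moreover have "S = n * d + 2 * n + 16 * (n * K) + 32 + 131072 * (n * k)"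
    unfolding S_def R0_def G_def Z_def m_def SZ_def by (simp add: algebra_simps)
   moreover have "(131106 + d + 16 * K) * (n * k) = 131106 * (n * k) + n * k * d + 16 * (n * k * K)" by (simp add: algebra_simps)
   ultimately have "S \<le> (131106 + d + 16 * K) * (n * k)" using nk by linarith
   also have "\<dots> \<le> C * (n * k)" unfolding C_def by (intro mult_le_mono1) simp
   finally show ?thesis .
  qed
  ultimately have "real (shared_space v) \<le> real (C * (n * k))" by (simp only: of_nat_le_iff)
  then have sp: "real (shared_space v) \<le> real C * (real n * real k)" by simp
  have "exec ?W prog ?s0 t v" unfolding prog_def v_def by (rule exec.Seq[OF pre ex(1)])
  with out w dp sp show ?thesis by blast
 qed
 show ?thesis
  by (rule exI[of _ prog], rule exI[of _ e], rule exI[of _ "real C"], intro allI impI, elim conjE) (rule main)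
qed

end
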